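(* Fix $n$ and $h$ with $n\ge h\ge 3$. Any two combinatorial 4-PPTs with $n$ vertices, $h$ of which lie on the outer face, can be transformed into each other by a finite sequence of flips (the unlabeled flip graph is connected), and there is an absolute constant $C$ such that $Cn^2$ flips always suffice (diameter $O(n^2)$). The same holds for labeled combinatorial 4-PPTs: for any two labeled combinatorial 4-PPTs on the same $n$ labeled vertices with the same outer face (the same $h$ labeled vertices in the same cyclic order along the outer face), there is a sequence of $O(n^2)$ flips transforming one into the other.
   Context: An angle of a plane embedded graph is an incidence between a vertex and a face (the wedge between two consecutive edges around the vertex). A combinatorial pseudo-triangulation is a combinatorial embedding in the plane (rotation system together with a designated outer face) of a connected planar simple graph, together with an assignment of a tag "reflex" or "convex" to each angle, such that (1) every interior face has exactly three angles tagged convex, (2) all angles of the outer face are tagged reflex, (3) no vertex is incident to more than one angle tagged reflex. It is pointed if every vertex is incident to exactly one reflex angle. A combinatorial 4-PPT is a combinatorial pointed pseudo-triangulation in which every interior face has size (number of edges on its boundary) 3 or 4; the outer face may have any size $h\ge 3$. Flip: let $\triangle$ be an interior triangular face of a combinatorial 4-PPT $T$, let $e$ be an edge of $\triangle$ that is not an edge of the outer face, and let $F$ be the other face incident to $e$ ($F$ has size 3 or 4). Deleting $e$ merges $\triangle$ and $F$ into a region $R$. A flip of $e$ replaces $e$ by another edge $e'\neq e$ drawn inside $R$ such that $e'$ splits $R$ into a triangular face and a face of the same size as $F$, and such that the result (tags outside $R$ unchanged, suitable tags inside $R$) is again a combinatorial 4-PPT; in particular the new graph must be simple, so $e'$ may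 not join two vertices already adjacent in $T$. In the unlabeled setting combinatorial 4-PPTs are considered up to isomorphism preserving the embedding, the outer face and the tags; in the labeled setting vertices carry distinct labels, flips preserve labels, and the outer face (its labeled vertices and their cyclic order) is fixed. *)

theory Defs
  imports Complex_Main
begin

section \<open>Combinatorial plane maps (rotation systems) with angle tags\<close>

text \<open>
A map is given by a finite vertex set, a set of edges (2-element sets of vertices),
a rotation system (rot v u = neighbour of v following u in the cyclic order around v),
a designated outer face (given as its set of darts), and the reflex tags of angles.
Darts are ordered pairs (u,v) with {u,v} an edge.  The face permutation sends the dart
(u,v) to (v, rot v u); faces are its orbits.  The angle represented by the dart (u,v)
is the corner at vertex v between the edges vu and v(rot v u); it belongs to the face
containing (u,v).  So angles of a face f are exactly the darts of f, and the vertex of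
an angle d is snd d.  Representation is normalised: rot v u = u if u is not a
neighbour of v, and reflex d = False if d is not a dart.
\<close>

record 'v cmap =
  verts :: "'v set"
  edges :: "'v set set"
  rot :: "'v \<Rightarrow> 'v \<Rightarrow> 'v"
  outer :: "('v \<times> 'v) set"
  reflex :: "'v \<times> 'v \<Rightarrow> bool"

definition darts :: "'v cmap \<Rightarrow> ('v \<times> 'v) set" where
  "darts M = {(u, v). {u, v} \<in> edges M}"

definition nbrs :: "'v cmap \<Rightarrow> 'v \<Rightarrow> 'v set" where
  "nbrs M v = {u. {u, v} \<in> edges M}"

definition fstep :: "'v cmap \<Rightarrow> 'v \<times> 'v \<Rightarrow> 'v \<times> 'v" where
  "fstep M d = (snd d, rot M (snd d) (fst d))"

definition face :: "'v cmap \<Rightarrow> 'v \<times> 'v \<Rightarrow> ('v \<times> 'v) set" where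
  "face M d = {(fstep M ^^ k) d | k. True}"

definition faces :: "'v cmap \<Rightarrow> ('v \<times> 'v) set set" where
  "faces M = face M ` darts M"

definition simple_graph :: "'v cmap \<Rightarrow> bool" where
  "simple_graph M \<longleftrightarrow> finite (verts M) \<and>
     (\<forall>e\<in>edges M. \<exists>u v. e = {u, v} \<and> u \<noteq> v \<and> u \<in> verts M \<and> v \<in> verts M)"

definition connected_graph :: "'v cmap \<Rightarrow> bool" where
  "connected_graph M \<longleftrightarrow>
     (\<forall>u\<in>verts M. \<forall>w\<in>verts M. (u, w) \<in> (darts M)\<^sup>*)"

text \<open>rot v restricted to the neighbours of v is a single cyclic permutation.\<close>
definition rotation_system :: "'v cmap \<Rightarrow> bool" where
  "rotation_system M \<longleftrightarrow> (\<forall>v.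
      (\<forall>u\<in>nbrs M v. rot M v u \<in> nbrs M v) \<and>
      inj_on (rot M v) (nbrs M v) \<and>
      (\<forall>u\<in>nbrs M v. \<forall>w\<in>nbrs M v. \<exists>k. (rot M v ^^ k) u = w) \<and>
      (\<forall>u. u \<notin> nbrs M v \<longrightarrow> rot M v u = u))"

text \<open>Combinatorial embedding in the plane of a connected simple graph:
  rotation system of genus 0 (Euler's formula V - E + F = 2), with a designated outer face.\<close>
definition plane_map :: "'v cmap \<Rightarrow> bool" where
  "plane_map M \<longleftrightarrow> simple_graph M \<and> connected_graph M \<and> rotation_system M \<and>
     int (card (verts M)) - int (card (edges M)) + int (card (faces M)) = 2 \<and>
     outer M \<in> faces M \<and>
     (\<forall>d. reflex M d \<longrightarrow> d \<in> darts M)"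

definition convex_count :: "'v cmap \<Rightarrow> ('v \<times> 'v) set \<Rightarrow> nat" where
  "convex_count M f = card {d \<in> f. \<not> reflex M d}"

definition reflex_at :: "'v cmap \<Rightarrow> 'v \<Rightarrow> ('v \<times> 'v) set" where
  "reflex_at M v = {d \<in> darts M. snd d = v \<and> reflex M d}"

definition comb_pt :: "'v cmap \<Rightarrow> bool" where
  "comb_pt M \<longleftrightarrow> plane_map M \<and>
     (\<forall>f\<in>faces M. f \<noteq> outer M \<longrightarrow> convex_count M f = 3) \<and>
     (\<forall>d\<in>outer M. reflex M d) \<and>
     (\<forall>v\<in>verts M. card (reflex_at M v) \<le> 1)"

definition pointed :: "'v cmap \<Rightarrow> bool" where
  "pointed M \<longleftrightarrow> (\<forall>v\<in>verts M. card (reflex_at M v) = 1)"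

text \<open>Combinatorial 4-PPT (outer face of size at least 3).\<close>
definition is_4ppt :: "'v cmap \<Rightarrow> bool" where
  "is_4ppt M \<longleftrightarrow> comb_pt M \<and> pointed M \<and>
     (\<forall>f\<in>faces M. f \<noteq> outer M \<longrightarrow> card f = 3 \<or> card f = 4) \<and>
     card (outer M) \<ge> 3"

text \<open>Number of vertices on the outer face.\<close>
definition outer_verts :: "'v cmap \<Rightarrow> 'v set" where
  "outer_verts M = snd ` outer M"

section \<open>Edge deletion (on the rotation system) and flips\<close>

definition rot_remove :: "('v \<Rightarrow> 'v \<Rightarrow> 'v) \<Rightarrow> 'v \<Rightarrow> 'v \<Rightarrow> ('v \<Rightarrow> 'v \<Rightarrow> 'v)" where
  "rot_remove r a b = (\<lambda>v u. if v = a then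
       (if u = b then u else if r a u = b then r a b else r a u) else r v u)"

definition del_rot :: "'v cmap \<Rightarrow> 'v \<Rightarrow> 'v \<Rightarrow> ('v \<Rightarrow> 'v \<Rightarrow> 'v)" where
  "del_rot M a b = rot_remove (rot_remove (rot M) a b) b a"

text \<open>Labeled flip: the edge e = {a,b} of the interior triangle face(a,b) (not on the
outer face; F = face(b,a)) is replaced by e' = {c,d}, drawn inside the region R
obtained by deleting e: after deleting e from the old map and e' from the new map one
gets the same map, and all faces not incident to e' in the new map are exactly the
faces not incident to e in the old one.  The new faces are a triangle and a face of
the size of F; tags outside R are unchanged; the result is a combinatorial 4-PPT.\<close>
definition flip :: "'v cmap \<Rightarrow> 'v cmap \<Rightarrow> bool" where
  "flip M M' \<longleftrightarrow> is_4ppt M \<and> is_4ppt M' \<and> verts M' = verts M \<and> outer M' = outer M \<and>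
    (\<exists>a b c d.
       (a, b) \<in> darts M \<and> face M (a, b) \<noteq> outer M \<and> card (face M (a, b)) = 3 \<and>
       (a, b) \<notin> outer M \<and> (b, a) \<notin> outer M \<and>
       c \<noteq> d \<and> {c, d} \<notin> edges M \<and>
       edges M' = insert {c, d} (edges M - {{a, b}}) \<and>
       del_rot M' c d = del_rot M a b \<and>
       {f \<in> faces M'. (c, d) \<notin> f \<and> (d, c) \<notin> f} = {f \<in> faces M. (a, b) \<notin> f \<and> (b, a) \<notin> f} \<and>
       {card (face M' (c, d)), card (face M' (d, c))} = {3, card (face M (b, a))} \<and>
       (\<forall>x \<in> darts M - (face M (a, b) \<union> face M (b, a)). reflex M' x = reflex M x))"

text \<open>Isomorphism preserving embedding, outer face and tags.\<close>
definition cmap_iso :: "'v cmap \<Rightarrow> 'v cmap \<Rightarrow> bool" where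
  "cmap_iso M N \<longleftrightarrow> (\<exists>\<sigma>. bij_betw \<sigma> (verts M) (verts N) \<and>
     edges N = (\<lambda>e. \<sigma> ` e) ` edges M \<and>
     (\<forall>(u, v)\<in>darts M. rot N (\<sigma> v) (\<sigma> u) = \<sigma> (rot M v u)) \<and>
     outer N = map_prod \<sigma> \<sigma> ` outer M \<and>
     (\<forall>d\<in>darts M. reflex N (map_prod \<sigma> \<sigma> d) = reflex M d))"

text \<open>Adjacency in the unlabeled flip graph (on isomorphism classes): some
representatives are related by a flip.\<close>
definition uflip :: "'v cmap \<Rightarrow> 'v cmap \<Rightarrow> bool" where
  "uflip M N \<longleftrightarrow> (\<exists>Y Z. cmap_iso M Y \<and> flip Y Z \<and> cmap_iso Z N)"

end

theory Submission
  imports Defs "HOL-Library.Multiset"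
begin

text \<open>Every combinatorial 4-PPT is brought into a normal form that depends only on the labelled outer
  face and the vertex set, by \<open>O(n\<^sup>2)\<close> flips; flips are reversible, and the unlabelled case follows by
  relabelling. In the normal form the outer face is triangulated by a fan from one vertex, and
  all interior vertices sit in one triangle of the fan, as a ladder: they are all adjacent to the same
  two corners and appear in increasing order.

  A map is replaced by the multiset of its tagged faces, on which flips act as local rewriting
  rules. A counting argument shows that the inside of any three-cycle contains exactly one triangle
  and no reflex angle at the three corners. This decides every adjacency that could
  block a flip. A triangle can therefore be moved along a dual path of quadrilaterals to a given
  boundary edge \<open>ca\<close>. There it starts a ladder with apex \<open>c\<close>, which is advanced around \<open>c\<close> from one
  neighbour to the next until it reaches the other boundary neighbour \<open>b\<close> and the ear \<open>abc\<close> is cut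
  off; three-cycles met on the way are treated recursively. Ladders can be turned inside their
  triangle and slid through a common edge of two triangles, which collects all interior vertices in
  the last ladder. The vertices of this ladder are sorted by insertion.\<close>

section \<open>Cyclic permutations and faces\<close>

text \<open>Two things can block a flip: the new edge is already present, or the reflex vertex of
  the region would become the tip of the new triangle. A present edge closes a three-cycle. With
  \<open>F\<close> faces, \<open>V\<close> vertices and \<open>E\<close> edges inside it,
  \<open>F + V = E + 1\<close>, and counting darts and reflex angles leaves triangles + 2 * (reflex
  corners) = 1. So the present edge is either contradictory or bounds a smaller instance of the same
  problem.

  The quadratic bound rests on how costs are charged. Moving a ladder on by one neighbour costs a
  number of flips linear in its length and lowers a potential that is at most four per face, so an
  ear costs about \<open>n\<close> times the length of its final ladder. The ladders of different
  ears have disjoint vertex sets, so these lengths add up to at most \<open>n\<close>. Each boundary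
  vertex contributes a further linear term, and sorting is quadratic by itself. The constants are 60
  for the fan and 12 for sorting, doubled to 144 because two maps are brought to the normal
  form.\<close>

definition cyclic_on :: "('a \<Rightarrow> 'a) \<Rightarrow> 'a set \<Rightarrow> bool" where
  "cyclic_on r N \<longleftrightarrow> (\<forall>u\<in>N. r u \<in> N) \<and> inj_on r N \<and>
     (\<forall>S\<subseteq>N. S \<noteq> {} \<longrightarrow> (\<forall>u\<in>S. r u \<in> S) \<longrightarrow> S = N)"

text \<open>Minimality among nonempty closed sets replaces reachability by iterates: deleting or
  inserting an element then needs one enlarged or shrunken closed set and no bookkeeping of
  exponents.\<close>

lemma cyclic_on_iff_funpow:
  "cyclic_on r N \<longleftrightarrow> (\<forall>u\<in>N. r u \<in> N) \<and> inj_on r N \<and> (\<forall>u\<in>N. \<forall>w\<in>N. \<exists>k. (r ^^ k) u = w)"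
proof -
  have "(\<forall>S\<subseteq>N. S \<noteq> {} \<longrightarrow> (\<forall>u\<in>S. r u \<in> S) \<longrightarrow> S = N) \<longleftrightarrow> (\<forall>u\<in>N. \<forall>w\<in>N. \<exists>k. (r ^^ k) u = w)"
    if cl: "\<forall>u\<in>N. r u \<in> N"
  proof
    assume H: "\<forall>S\<subseteq>N. S \<noteq> {} \<longrightarrow> (\<forall>u\<in>S. r u \<in> S) \<longrightarrow> S = N"
    show "\<forall>u\<in>N. \<forall>w\<in>N. \<exists>k. (r ^^ k) u = w"
    proof (intro ballI)
      fix u w assume u: "u \<in> N" and w: "w \<in> N"
      let ?S = "{(r ^^ k) u | k. True}"
      have "(r ^^ k) u \<in> N" for k using cl u by (induction k) auto
      then have "?S \<subseteq> N" by auto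
      moreover have "?S \<noteq> {}" by auto
      moreover have "\<forall>x\<in>?S. r x \<in> ?S"
      proof
        fix x assume "x \<in> ?S"
        then obtain k where "x = (r ^^ k) u" by auto
        then have "r x = (r ^^ Suc k) u" by simp
        then show "r x \<in> ?S" by blast
      qed
      ultimately have "?S = N" using H by blast
      with w show "\<exists>k. (r ^^ k) u = w" by auto
    qed
  next
    assume H: "\<forall>u\<in>N. \<forall>w\<in>N. \<exists>k. (r ^^ k) u = w"
    show "\<forall>S\<subseteq>N. S \<noteq> {} \<longrightarrow> (\<forall>u\<in>S. r u \<in> S) \<longrightarrow> S = N"
    proof (intro allI impI)
      fix S assume S: "S \<subseteq> N" "S \<noteq> {}" "\<forall>u\<in>S. r u \<in> S"
      then obtain u where u: "u \<in> S" by auto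
      have "(r ^^ k) u \<in> S" for k using S u by (induction k) auto
      then show "S = N" using H S u by (metis subsetD subsetI subset_antisym)
    qed
  qed
  then show ?thesis unfolding cyclic_on_def by (intro conj_cong refl) blast
qed

lemma cyclic_on_remove:
  assumes "cyclic_on r N"
  shows "cyclic_on (\<lambda>u. if u = b then u else if r u = b then r b else r u) (N - {b})"
proof (cases "b \<in> N")
  case False
  have "cyclic_on (\<lambda>u. if u = b then u else if r u = b then r b else r u) N \<longleftrightarrow> cyclic_on r N"
  proof -
    have e: "\<And>u. u \<in> N \<Longrightarrow> (if u = b then u else if r u = b then r b else r u) = r u"
      using False assms unfolding cyclic_on_def by auto
    then show ?thesis unfolding cyclic_on_def inj_on_def by (simp add: e subset_iff cong: ball_cong)
  qed
  with False assms show ?thesis by simp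
next
  case True
  let ?r = "\<lambda>u. if u = b then u else if r u = b then r b else r u"
  have cl: "\<And>u. u \<in> N \<Longrightarrow> r u \<in> N" and inj: "inj_on r N"
    and tr: "\<And>S. S \<subseteq> N \<Longrightarrow> S \<noteq> {} \<Longrightarrow> \<forall>u\<in>S. r u \<in> S \<Longrightarrow> S = N"
    using assms unfolding cyclic_on_def by auto
  have 1: "\<forall>u\<in>N - {b}. ?r u \<in> N - {b}"
    using cl inj True by (auto dest: inj_onD)
  have 2: "inj_on ?r (N - {b})"
    using inj True unfolding inj_on_def by (auto split: if_splits)
  have 3: "S = N - {b}" if S: "S \<subseteq> N - {b}" "S \<noteq> {}" "\<forall>u\<in>S. ?r u \<in> S" for S
  proof -
    \<comment> \<open>The set becomes closed under the old \<open>r\<close> once \<open>b\<close> is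
      put back exactly when its predecessor is present.\<close>
    let ?S = "if \<exists>u\<in>S. r u = b then insert b S else S"
    have "?S = N"
    proof (rule tr)
      show "?S \<subseteq> N" using S True by auto
      show "?S \<noteq> {}" using S by auto
      show "\<forall>u\<in>?S. r u \<in> ?S"
      proof
        fix u assume u: "u \<in> ?S"
        show "r u \<in> ?S"
        proof (cases "u \<in> S")
          case uS: True
          then have ub: "u \<noteq> b" using S by auto
          show ?thesis
          proof (cases "r u = b")
            case True then show ?thesis using uS by auto
          next
            case False then show ?thesis using S(3) uS ub by auto
          qed
        next
          case False
          then have "u = b" and ex: "\<exists>w\<in>S. r w = b" using u by (auto split: if_splits)
          then obtain w where w: "w \<in> S" "r w = b" by auto
          then have "w \<noteq> b" using S by auto
          then have "r b \<in> S" using S(3) w by auto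
          then show ?thesis using \<open>u = b\<close> ex by auto
        qed
      qed
    qed
    then show ?thesis using S(1) by (auto split: if_splits)
  qed
  show ?thesis unfolding cyclic_on_def using 1 2 3 by blast
qed

lemma cyclic_on_insert:
  assumes "cyclic_on r N" "x \<in> N" "y \<notin> N"
  shows "cyclic_on (\<lambda>u. if u = x then y else if u = y then r x else r u) (insert y N)"
proof -
  let ?r = "\<lambda>u. if u = x then y else if u = y then r x else r u"
  have xy: "x \<noteq> y" using assms by auto
  have cl: "\<And>u. u \<in> N \<Longrightarrow> r u \<in> N" and inj: "inj_on r N"
    and tr: "\<And>S. S \<subseteq> N \<Longrightarrow> S \<noteq> {} \<Longrightarrow> \<forall>u\<in>S. r u \<in> S \<Longrightarrow> S = N"
    using assms unfolding cyclic_on_def by auto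
  have 1: "\<forall>u\<in>insert y N. ?r u \<in> insert y N"
    by (auto intro: cl assms(2))
  have rx: "r u \<noteq> y" if "u \<in> N" for u using cl[OF that] assms(3) by auto
  have 2: "inj_on ?r (insert y N)"
  proof (rule inj_onI)
    fix u w assume u: "u \<in> insert y N" and w: "w \<in> insert y N" and e: "?r u = ?r w"
    have n: "r u = r w \<longleftrightarrow> u = w" if "u \<in> N" "w \<in> N" for u w
      using that inj by (auto dest: inj_onD)
    show "u = w"
      using u w e rx[of u] rx[of w] rx[OF assms(2)] n[of u w] n[of u x] n[of x w] assms(2) xy
      by (cases "u = x"; cases "u = y"; cases "w = x"; cases "w = y") simp_all
  qed
  have 3: "S = insert y N" if S: "S \<subseteq> insert y N" "S \<noteq> {}" "\<forall>u\<in>S. ?r u \<in> S" for S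
  proof -
    have yx: "y \<in> S \<Longrightarrow> r x \<in> S" using S(3) xy by auto
    have rxN: "r x \<in> N" using cl assms by auto
    \<comment> \<open>Without \<open>y\<close> the set is closed under the old \<open>r\<close>,
      because the detour through \<open>y\<close> leads from \<open>x\<close> to
      \<open>r x\<close>.\<close>
    have "S - {y} = N"
    proof (rule tr)
      show "S - {y} \<subseteq> N" using S by auto
      show "S - {y} \<noteq> {}"
      proof
        assume "S - {y} = {}"
        then have "y \<in> S" using S(2) by auto
        then show False using yx rxN assms(3) \<open>S - {y} = {}\<close> by auto
      qed
      show "\<forall>u\<in>S - {y}. r u \<in> S - {y}"
      proof
        fix u assume u: "u \<in> S - {y}"
        then have "u \<in> N" using S by auto
        then have "r u \<noteq> y" using cl assms(3) by auto
        moreover have "r u \<in> S" using S(3) u yx by (cases "u = x") auto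
        ultimately show "r u \<in> S - {y}" by auto
      qed
    qed
    moreover then have "x \<in> S" using assms by auto
    then have "y \<in> S" using S(3) by auto
    ultimately show ?thesis by auto
  qed
  show ?thesis unfolding cyclic_on_def using 1 2 3 by blast
qed

section \<open>Darts, the face permutation and its orbits\<close>

lemma rotation_system_iff:
  "rotation_system M \<longleftrightarrow> (\<forall>v. cyclic_on (rot M v) (nbrs M v) \<and> (\<forall>u. u \<notin> nbrs M v \<longrightarrow> rot M v u = u))"
  unfolding rotation_system_def cyclic_on_iff_funpow by blast

lemma mem_darts: "(u, v) \<in> darts M \<longleftrightarrow> {u, v} \<in> edges M"
  by (simp add: darts_def)

lemma mem_nbrs: "u \<in> nbrs M v \<longleftrightarrow> (u, v) \<in> darts M"
  by (simp add: darts_def nbrs_def)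

lemma darts_sym: "(u, v) \<in> darts M \<Longrightarrow> (v, u) \<in> darts M"
  by (simp add: mem_darts insert_commute)

lemma darts_finite: "simple_graph M \<Longrightarrow> finite (darts M)"
proof -
  assume s: "simple_graph M"
  have "darts M \<subseteq> verts M \<times> verts M"
    using s unfolding simple_graph_def darts_def by (fastforce simp: doubleton_eq_iff)
  moreover have "finite (verts M)" using s by (simp add: simple_graph_def)
  ultimately show ?thesis by (meson finite_SigmaI finite_subset)
qed

lemma darts_verts: "simple_graph M \<Longrightarrow> (u, v) \<in> darts M \<Longrightarrow> u \<noteq> v \<and> u \<in> verts M \<and> v \<in> verts M"
  unfolding simple_graph_def darts_def by (fastforce simp: doubleton_eq_iff)

text \<open>Off the neighbours the rotation is the identity, so injectivity extends to the whole
  type. This makes \<open>fstep\<close> injective everywhere and its powers cancellable.\<close>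

lemma rot_inj: "rotation_system M \<Longrightarrow> inj (rot M v)"
proof (rule injI)
  fix x y assume r: "rotation_system M" and e: "rot M v x = rot M v y"
  have c: "cyclic_on (rot M v) (nbrs M v)" "\<And>u. u \<notin> nbrs M v \<Longrightarrow> rot M v u = u"
    using r unfolding rotation_system_iff by auto
  show "x = y" using c e unfolding cyclic_on_def inj_on_def by metis
qed

lemma fstep_inj: "rotation_system M \<Longrightarrow> inj (fstep M)"
proof (rule injI)
  fix x y assume r: "rotation_system M" and "fstep M x = fstep M y"
  then have e: "snd x = snd y" "rot M (snd x) (fst x) = rot M (snd x) (fst y)" by (auto simp: fstep_def)
  then have "fst x = fst y" using rot_inj[OF r] by (meson injD)
  then show "x = y" using e by (simp add: prod_eq_iff)
qed

lemma fstep_simp [simp]: "fstep M (u, v) = (v, rot M v u)"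
  by (simp add: fstep_def)

lemma fstep_darts: "rotation_system M \<Longrightarrow> d \<in> darts M \<Longrightarrow> fstep M d \<in> darts M"
  unfolding rotation_system_iff cyclic_on_def
  by (cases d) (metis darts_sym fstep_simp mem_nbrs)

lemma self_in_face: "d \<in> face M d"
  unfolding face_def by (metis (mono_tags, lifting) funpow_0 mem_Collect_eq)

lemma face_step: "e \<in> face M d \<Longrightarrow> fstep M e \<in> face M d"
  unfolding face_def by clarsimp (metis funpow.simps(2) comp_apply)

lemma face_subset_closed:
  assumes "d \<in> S" "\<And>e. e \<in> S \<Longrightarrow> fstep M e \<in> S" shows "face M d \<subseteq> S"
proof -
  have "(fstep M ^^ k) d \<in> S" for k using assms by (induction k) auto
  then show ?thesis unfolding face_def by auto
qed

lemma face_subset_darts: "rotation_system M \<Longrightarrow> d \<in> darts M \<Longrightarrow> face M d \<subseteq> darts M"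
  by (rule face_subset_closed) (auto intro: fstep_darts)

lemma face_cycle:
  assumes "simple_graph M" "rotation_system M" "d \<in> darts M"
  shows "\<exists>n>0. (fstep M ^^ n) d = d"
proof -
  have "{y. \<exists>n. y = (fstep M ^^ n) d} = face M d" unfolding face_def by auto
  then have fin: "finite {y. \<exists>n. y = (fstep M ^^ n) d}"
    using assms face_subset_darts darts_finite finite_subset by metis
  have "inj (fstep M)" using assms fstep_inj by auto
  from funpow_inj_finite[OF this fin] show ?thesis by metis
qed

lemma face_eq:
  assumes "simple_graph M" "rotation_system M" "d \<in> darts M" "e \<in> face M d"
  shows "face M e = face M d"
proof
  show "face M e \<subseteq> face M d" by (rule face_subset_closed) (auto intro: assms face_step)
  obtain k where k: "e = (fstep M ^^ k) d" using assms unfolding face_def by auto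
  obtain n where n: "n > 0" "(fstep M ^^ n) d = d" using face_cycle assms by metis
  have m: "(fstep M ^^ (n * j)) d = d" for j
    by (induction j) (auto simp: funpow_add n)
  have "k \<le> n * k" using n by simp
  then have "(fstep M ^^ (n * k - k)) e = d"
  proof -
    have "(fstep M ^^ (n * k - k)) e = (fstep M ^^ (n * k - k + k)) d" by (simp only: k funpow_add comp_apply)
    then show ?thesis using \<open>k \<le> n * k\<close> m[of k] by simp
  qed
  then have "d \<in> face M e" unfolding face_def by auto
  then show "face M d \<subseteq> face M e" by (intro face_subset_closed) (auto intro: face_step)
qed

lemma faces_partition:
  assumes "simple_graph M" "rotation_system M" "f \<in> faces M" "d \<in> f"
  shows "f = face M d" "d \<in> darts M"
proof -
  obtain e where e: "e \<in> darts M" "f = face M e" using assms unfolding faces_def by auto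
  then show "f = face M d" using assms face_eq by metis
  show "d \<in> darts M" using e assms face_subset_darts by blast
qed

lemma faces_disjoint:
  assumes "simple_graph M" "rotation_system M" "f \<in> faces M" "g \<in> faces M" "d \<in> f" "d \<in> g"
  shows "f = g"
  using assms faces_partition by metis

lemma faces_step:
  assumes "f \<in> faces M" "d \<in> f" shows "fstep M d \<in> f"
  using assms face_step unfolding faces_def by blast

lemma face_in_faces: "d \<in> darts M \<Longrightarrow> face M d \<in> faces M"
  by (simp add: faces_def)

lemma faces_Union:
  assumes "simple_graph M" "rotation_system M" shows "\<Union>(faces M) = darts M"
  using faces_partition(2)[OF assms] self_in_face[of _ M] face_in_faces[of _ M] by blast

lemma finite_faces: "simple_graph M \<Longrightarrow> finite (faces M)"
  unfolding faces_def using darts_finite by auto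

lemma face_finite:
  assumes "simple_graph M" "rotation_system M" "f \<in> faces M" shows "finite f"
  using assms faces_Union darts_finite by (metis Union_upper finite_subset)

lemma face3:
  assumes "fstep M d1 = d2" "fstep M d2 = d3" "fstep M d3 = d1"
  shows "face M d1 = {d1, d2, d3}"
proof
  show "face M d1 \<subseteq> {d1, d2, d3}" by (rule face_subset_closed) (use assms in auto)
  have 1: "d1 \<in> face M d1" by (rule self_in_face)
  show "{d1, d2, d3} \<subseteq> face M d1"
    using 1 face_step[OF 1] face_step[OF face_step[OF 1]] assms by simp
qed

lemma face4:
  assumes "fstep M d1 = d2" "fstep M d2 = d3" "fstep M d3 = d4" "fstep M d4 = d1"
  shows "face M d1 = {d1, d2, d3, d4}"
proof
  show "face M d1 \<subseteq> {d1, d2, d3, d4}" by (rule face_subset_closed) (use assms in auto)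
  have 1: "d1 \<in> face M d1" by (rule self_in_face)
  show "{d1, d2, d3, d4} \<subseteq> face M d1"
    using 1 face_step[OF 1] face_step[OF face_step[OF 1]] face_step[OF face_step[OF face_step[OF 1]]] assms by simp
qed

text \<open>A face other than \<open>A\<close> and \<open>B\<close> avoids both along its whole
  orbit, so the two face permutations agree on all of it. What a flip does to the set of faces is
  read off from this.\<close>

lemma faces_exchange:
  assumes sg: "simple_graph M" "rotation_system M" "simple_graph M'" "rotation_system M'"
    and A: "A \<in> faces M" and B: "B \<in> faces M"
    and A': "A' \<in> faces M'" and B': "B' \<in> faces M'"
    and dj: "A' \<union> B' \<union> (darts M - (A \<union> B)) = darts M'"
    and dj2: "(A' \<union> B') \<inter> (darts M - (A \<union> B)) = {}"
    and agree: "\<And>d. d \<in> darts M - (A \<union> B) \<Longrightarrow> fstep M' d = fstep M d"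
  shows "faces M' = faces M - {A, B} \<union> {A', B'}"
proof -
  have f_eq: "face M' d = face M d \<and> face M d \<inter> (A \<union> B) = {}" if d: "d \<in> darts M - (A \<union> B)" for d
  proof -
    have disj: "face M d \<inter> (A \<union> B) = {}"
    proof (rule ccontr)
      assume "face M d \<inter> (A \<union> B) \<noteq> {}"
      then obtain e where e: "e \<in> face M d" "e \<in> A \<or> e \<in> B" by auto
      have "face M d \<in> faces M" using d unfolding faces_def by auto
      then have "face M d = A \<or> face M d = B" using e A B faces_disjoint[OF sg(1,2)] by metis
      then show False using d self_in_face[of d M] by auto
    qed
    have "(fstep M' ^^ k) d = (fstep M ^^ k) d" for k
    proof (induction k)
      case (Suc k)
      have "(fstep M ^^ k) d \<in> face M d" unfolding face_def by auto
      then have "(fstep M ^^ k) d \<in> darts M - (A \<union> B)"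
        using disj d face_subset_darts[OF sg(2)] by blast
      then show ?case using Suc agree by simp
    qed simp
    then have "face M' d = face M d" unfolding face_def by simp
    then show ?thesis using disj by simp
  qed
  show ?thesis
  proof (intro equalityI subsetI)
    fix f assume f: "f \<in> faces M'"
    then obtain d where d: "d \<in> darts M'" "f = face M' d" unfolding faces_def by auto
    show "f \<in> faces M - {A, B} \<union> {A', B'}"
    proof (cases "d \<in> A' \<union> B'")
      case True
      have "d \<in> f" using d self_in_face by metis
      then have "f = A' \<or> f = B'" using True f A' B' faces_disjoint[OF sg(3,4)] by (metis UnE)
      then show ?thesis by auto
    next
      case False
      then have d2: "d \<in> darts M - (A \<union> B)" using d dj by auto
      then have "f = face M d" "face M d \<inter> (A \<union> B) = {}" using f_eq d by auto
      then have "f \<in> faces M" "f \<noteq> A" "f \<noteq> B" using d2 self_in_face[of d M] unfolding faces_def by auto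
      then show ?thesis by auto
    qed
  next
    fix f assume f: "f \<in> faces M - {A, B} \<union> {A', B'}"
    show "f \<in> faces M'"
    proof (cases "f \<in> {A', B'}")
      case True then show ?thesis using A' B' by auto
    next
      case False
      then have f: "f \<in> faces M" "f \<noteq> A" "f \<noteq> B" using f by auto
      then obtain d where d: "d \<in> darts M" "f = face M d" unfolding faces_def by auto
      have "d \<notin> A" "d \<notin> B" using f d A B faces_disjoint[OF sg(1,2)] self_in_face by metis+
      then have d2: "d \<in> darts M - (A \<union> B)" using d by auto
      then have "f = face M' d" using f_eq d by auto
      moreover have "d \<in> darts M'" using d2 dj by auto
      ultimately show ?thesis unfolding faces_def by auto
    qed
  qed
qed

section \<open>Tagged faces\<close>

type_synonym 'v tface = "('v \<times> 'v) set \<times> 'v set"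

text \<open>A tagged face is recorded as its set of darts together with the set of its reflex vertices. The
  flag \<open>s\<close> says whether the listed vertices follow the darts or run against them, and \<open>w\<close> is the
  reflex vertex of a quadrilateral.\<close>
definition Tri :: "bool \<Rightarrow> 'v \<Rightarrow> 'v \<Rightarrow> 'v \<Rightarrow> 'v tface" where
  "Tri s x y z = (if s then {(x, y), (y, z), (z, x)} else {(y, x), (z, y), (x, z)}, {})"

definition Qd :: "bool \<Rightarrow> 'v \<Rightarrow> 'v \<Rightarrow> 'v \<Rightarrow> 'v \<Rightarrow> 'v \<Rightarrow> 'v tface" where
  "Qd s x y z t w = (if s then {(x, y), (y, z), (z, t), (t, x)} else {(y, x), (z, y), (t, z), (x, t)}, {w})"

definition tagged :: "'v cmap \<Rightarrow> ('v \<times> 'v) set \<Rightarrow> 'v tface" where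
  "tagged M f = (f, snd ` {d \<in> f. reflex M d})"

definition fm :: "'v cmap \<Rightarrow> 'v tface multiset" where
  "fm M = image_mset (tagged M) (mset_set (faces M))"

lemma Tri_rot: "Tri s x y z = Tri s y z x" by (simp add: Tri_def insert_commute)
lemma Tri_flip: "Tri (\<not> s) x y z = Tri s z y x" by (simp add: Tri_def insert_commute)
lemma Qd_rot: "Qd s x y z t w = Qd s y z t x w" by (simp add: Qd_def insert_commute)
lemma Qd_flip: "Qd (\<not> s) x y z t w = Qd s t z y x w" by (simp add: Qd_def insert_commute)

lemma is_4pptD:
  assumes "is_4ppt M"
  shows "simple_graph M" "rotation_system M" "connected_graph M"
    "int (card (verts M)) - int (card (edges M)) + int (card (faces M)) = 2"
    "outer M \<in> faces M" "\<And>d. reflex M d \<Longrightarrow> d \<in> darts M"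
    "\<And>f. f \<in> faces M \<Longrightarrow> f \<noteq> outer M \<Longrightarrow> convex_count M f = 3"
    "\<And>d. d \<in> outer M \<Longrightarrow> reflex M d"
    "\<And>v. v \<in> verts M \<Longrightarrow> card (reflex_at M v) = 1"
    "\<And>f. f \<in> faces M \<Longrightarrow> f \<noteq> outer M \<Longrightarrow> card f = 3 \<or> card f = 4"
    "card (outer M) \<ge> 3"
  using assms unfolding is_4ppt_def comb_pt_def plane_map_def pointed_def by (simp_all del: split_paired_All)

lemma fm_finite: "is_4ppt M \<Longrightarrow> finite (faces M)"
  using is_4pptD(1) finite_faces by blast

lemma in_fm: "is_4ppt M \<Longrightarrow> x \<in># fm M \<longleftrightarrow> (\<exists>f\<in>faces M. x = tagged M f)"
  unfolding fm_def using fm_finite[of M] by (auto simp: image_iff)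

lemma in_fm_faces: "is_4ppt M \<Longrightarrow> x \<in># fm M \<Longrightarrow> fst x \<in> faces M \<and> x = tagged M (fst x)"
proof -
  assume "is_4ppt M" "x \<in># fm M"
  then obtain f where "f \<in> faces M" "x = tagged M f" using in_fm by blast
  then show ?thesis by (simp add: tagged_def)
qed

lemma reflex_unique:
  assumes "is_4ppt M" "reflex M d" "reflex M e" "snd d = snd e" shows "d = e"
proof -
  have "d \<in> darts M" "e \<in> darts M" using is_4pptD(6)[OF assms(1)] assms by auto
  then have v: "snd d \<in> verts M" using darts_verts is_4pptD(1)[OF assms(1)] by (metis prod.collapse)
  have "d \<in> reflex_at M (snd d)" "e \<in> reflex_at M (snd d)"
    using assms \<open>d \<in> darts M\<close> \<open>e \<in> darts M\<close> by (auto simp: reflex_at_def)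
  moreover have "card (reflex_at M (snd d)) = 1" using is_4pptD(9)[OF assms(1) v] .
  ultimately show ?thesis by (metis card_1_singletonE singletonD)
qed

text \<open>The least period of \<open>d\<close> equals the number of darts of its face, since the
  iterates below it are distinct. This turns face sizes 3 and 4 into explicit closed walks.\<close>

lemma face_orbit:
  assumes "simple_graph M" "rotation_system M" "d \<in> darts M"
  shows "(fstep M ^^ card (face M d)) d = d"
    and "face M d = (\<lambda>i. (fstep M ^^ i) d) ` {..<card (face M d)}"
proof -
  let ?P = "\<lambda>n. n > 0 \<and> (fstep M ^^ n) d = d"
  define n where "n = (LEAST n. ?P n)"
  obtain m where "?P m" using face_cycle[OF assms] by blast
  then have n: "n > 0" "(fstep M ^^ n) d = d" unfolding n_def using LeastI[of ?P m] by auto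
  have least: "\<not> ?P k" if "k < n" for k using not_less_Least that unfolding n_def by blast
  have inj: "inj_on (\<lambda>i. (fstep M ^^ i) d) {..<n}"
  proof (rule linorder_inj_onI)
    fix i j assume ij: "i < j" "i \<in> {..<n}" "j \<in> {..<n}"
    show "(fstep M ^^ i) d \<noteq> (fstep M ^^ j) d"
    proof
      assume e: "(fstep M ^^ i) d = (fstep M ^^ j) d"
      have "j = i + (j - i)" using ij by simp
      then have "(fstep M ^^ j) d = (fstep M ^^ i) ((fstep M ^^ (j - i)) d)"
        by (metis comp_apply funpow_add)
      moreover have "inj (fstep M ^^ i)" using fstep_inj[OF assms(2)] inj_fn by blast
      ultimately have "(fstep M ^^ (j - i)) d = d" using e by (simp add: inj_eq)
      moreover have "0 < j - i" "j - i < n" using ij by auto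
      ultimately show False using least by blast
    qed
  qed auto
  have img: "face M d = (\<lambda>i. (fstep M ^^ i) d) ` {..<n}"
  proof
    show "face M d \<subseteq> (\<lambda>i. (fstep M ^^ i) d) ` {..<n}"
    proof
      fix e assume "e \<in> face M d"
      then obtain k where "e = (fstep M ^^ k) d" unfolding face_def by auto
      then have "e = (fstep M ^^ (k mod n)) d" using funpow_mod_eq[OF n(2)] by metis
      then show "e \<in> (\<lambda>i. (fstep M ^^ i) d) ` {..<n}" using n by auto
    qed
    show "(\<lambda>i. (fstep M ^^ i) d) ` {..<n} \<subseteq> face M d" unfolding face_def by auto
  qed
  have c: "card (face M d) = n" unfolding img using card_image[OF inj] by simp
  show "(fstep M ^^ card (face M d)) d = d" using n c by simp
  show "face M d = (\<lambda>i. (fstep M ^^ i) d) ` {..<card (face M d)}" using img c by simp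
qed

lemma face_card3:
  assumes "simple_graph M" "rotation_system M" "(x, y) \<in> darts M" "card (face M (x, y)) = 3"
  shows "\<exists>z. face M (x, y) = {(x, y), (y, z), (z, x)} \<and> rot M y x = z \<and> rot M z y = x \<and> rot M x z = y \<and> distinct [x, y, z]"
proof -
  let ?z = "rot M y x"
  have c: "(fstep M ^^ 3) (x, y) = (x, y)" using face_orbit(1)[OF assms(1-3)] assms(4) by simp
  have r: "rot M ?z y = x" "rot M x ?z = y" using c by (auto simp: numeral_3_eq_3)
  have f: "face M (x, y) = {(x, y), (y, ?z), (?z, x)}" by (rule face3) (use r in auto)
  have "(y, ?z) \<in> darts M" "(?z, x) \<in> darts M" using f face_subset_darts[OF assms(2,3)] by auto
  then have "distinct [x, y, ?z]" using darts_verts[OF assms(1)] assms(3) by fastforce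
  then show ?thesis using f r by blast
qed

lemma nbrs_closed:
  assumes "rotation_system M" "S \<subseteq> nbrs M v" "S \<noteq> {}" "\<And>u. u \<in> S \<Longrightarrow> rot M v u \<in> S"
  shows "S = nbrs M v"
  using assms unfolding rotation_system_iff cyclic_on_def by meson

lemma verts_closed:
  assumes "simple_graph M" "connected_graph M" "S \<subseteq> verts M" "S \<noteq> {}" "\<And>u v. u \<in> S \<Longrightarrow> (u, v) \<in> darts M \<Longrightarrow> v \<in> S"
  shows "S = verts M"
proof
  show "S \<subseteq> verts M" by fact
  show "verts M \<subseteq> S"
  proof
    fix w assume w: "w \<in> verts M"
    obtain u where u: "u \<in> S" using assms by auto
    then have "(u, w) \<in> (darts M)\<^sup>*" using assms w unfolding connected_graph_def by auto
    then show "w \<in> S" by (induction rule: rtrancl_induct) (use u assms in auto)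
  qed
qed

text \<open>A closed walk of length four that revisits a vertex bounds a path, and then the whole map is
  that path and has only one face.\<close>
lemma face_card4_aux:
  assumes M: "is_4ppt M" and d: "(x, y) \<in> darts M" and r: "rot M y x = z" "rot M z y = y" "rot M y z = x" "rot M x y = y"
    and out: "face M (x, y) \<noteq> outer M"
  shows False
proof -
  note D = is_4pptD[OF M]
  have f: "face M (x, y) = {(x, y), (y, z), (z, y), (y, x)}" by (rule face4) (use r in auto)
  have dz: "(y, z) \<in> darts M" using f face_subset_darts[OF D(2) d] by auto
  have y: "{x, z} = nbrs M y"
    by (rule nbrs_closed[OF D(2)]) (use r d dz darts_sym in \<open>auto simp: mem_nbrs\<close>)
  have x: "{y} = nbrs M x" by (rule nbrs_closed[OF D(2)]) (use r d darts_sym in \<open>auto simp: mem_nbrs\<close>)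
  have z: "{y} = nbrs M z" by (rule nbrs_closed[OF D(2)]) (use r dz darts_sym in \<open>auto simp: mem_nbrs\<close>)
  have n: "v \<in> nbrs M u" if "(u, v) \<in> darts M" for u v using that darts_sym mem_nbrs by metis
  have "{x, y, z} = verts M"
  proof (rule verts_closed[OF D(1,3)])
    show "{x, y, z} \<subseteq> verts M" using darts_verts[OF D(1)] d dz by auto
    fix u v assume "u \<in> {x, y, z}" "(u, v) \<in> darts M"
    then show "v \<in> {x, y, z}" using n[of u v] x y z by auto
  qed auto
  then have vs: "verts M = {x, y, z}" by simp
  have sub: "darts M \<subseteq> face M (x, y)"
  proof
    fix d assume dM: "d \<in> darts M"
    obtain u v where uv: "d = (u, v)" by (cases d)
    then have "u \<in> {x, y, z}" using vs darts_verts[OF D(1)] dM by metis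
    moreover have "v \<in> nbrs M u" using n uv dM by simp
    ultimately show "d \<in> face M (x, y)" using x y z unfolding f uv by auto
  qed
  obtain e where e: "e \<in> outer M" using D(11) by (metis card.empty equals0I not_numeral_le_zero)
  then have "e \<in> face M (x, y)" using sub faces_partition(2)[OF D(1,2,5) e] by auto
  then show False using out faces_disjoint[OF D(1,2,5) face_in_faces[OF d] e] by auto
qed

lemma face_card4:
  assumes M: "is_4ppt M" and d: "(x, y) \<in> darts M" and c: "card (face M (x, y)) = 4"
    and out: "face M (x, y) \<noteq> outer M"
  shows "\<exists>z t. face M (x, y) = {(x, y), (y, z), (z, t), (t, x)} \<and> rot M y x = z \<and> rot M z y = t \<and> rot M t z = x \<and> rot M x t = y
     \<and> distinct [x, y, z, t]"
proof -
  note D = is_4pptD[OF M]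
  let ?z = "rot M y x" let ?t = "rot M ?z y"
  have c: "(fstep M ^^ 4) (x, y) = (x, y)" using face_orbit(1)[OF D(1,2) d] c by simp
  have r: "rot M ?t ?z = x" "rot M x ?t = y" using c by (auto simp: numeral_eq_Suc)
  have f: "face M (x, y) = {(x, y), (y, ?z), (?z, ?t), (?t, x)}" by (rule face4) (use r in auto)
  have dd: "(y, ?z) \<in> darts M" "(?z, ?t) \<in> darts M" "(?t, x) \<in> darts M" using f face_subset_darts[OF D(2) d] by auto
  have 1: "y \<noteq> ?t"
  proof
    assume e: "y = ?t"
    show False by (rule face_card4_aux[OF M d refl _ _ _ out]) (use r e in auto)
  qed
  \<comment> \<open>The case \<open>x = ?z\<close> is the same degeneration with the walk started
    one dart later.\<close>
  have 2: "x \<noteq> ?z"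
  proof
    assume e: "x = ?z"
    have o2: "face M (y, ?z) \<noteq> outer M" using out face_eq[OF D(1,2) d, of "(y, ?z)"] f by auto
    show False by (rule face_card4_aux[OF M dd(1) refl _ _ _ o2]) (use r e in auto)
  qed
  have "distinct [x, y, ?z, ?t]" using 1 2 darts_verts[OF D(1)] d dd by fastforce
  then show ?thesis using f r by blast
qed

text \<open>All outer angles are reflex and no vertex has two reflex angles, so the outer face has
  at least three reflex vertices. The tag alone separates it from triangles (none) and
  quadrilaterals (one).\<close>

lemma outer_tag:
  assumes "is_4ppt M" shows "tagged M (outer M) = (outer M, snd ` outer M)" "card (snd ` outer M) \<ge> 3"
proof -
  note D = is_4pptD[OF assms]
  show "tagged M (outer M) = (outer M, snd ` outer M)"
    unfolding tagged_def using D(8) by (auto intro!: arg_cong[where f = "(`) snd"])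
  have "inj_on snd (outer M)" using reflex_unique[OF assms] D(8) by (meson inj_onI)
  then show "card (snd ` outer M) \<ge> 3" using D(11) by (simp add: card_image)
qed

lemma TriD:
  assumes M: "is_4ppt M" and t: "Tri True x y z \<in># fm M"
  shows "distinct [x, y, z]" "rot M y x = z" "rot M z y = x" "rot M x z = y"
    "{(x, y), (y, z), (z, x)} \<in> faces M" "{(x, y), (y, z), (z, x)} \<noteq> outer M"
    "\<not> reflex M (x, y)" "\<not> reflex M (y, z)" "\<not> reflex M (z, x)" "face M (x, y) = {(x, y), (y, z), (z, x)}"
    "{(x, y), (y, z), (z, x)} \<subseteq> darts M"
proof -
  note D = is_4pptD[OF M]
  let ?f = "{(x, y), (y, z), (z, x)}"
  have f: "?f \<in> faces M" and tg: "Tri True x y z = tagged M ?f"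
    using in_fm_faces[OF M t] by (auto simp: Tri_def)
  then show "?f \<in> faces M" by simp
  have nr: "\<And>d. d \<in> ?f \<Longrightarrow> \<not> reflex M d" using tg by (auto simp: Tri_def tagged_def)
  then show "\<not> reflex M (x, y)" "\<not> reflex M (y, z)" "\<not> reflex M (z, x)" by auto
  show o: "?f \<noteq> outer M" using nr D(8) by blast
  show sub: "?f \<subseteq> darts M" using f faces_Union[OF D(1,2)] by auto
  then have d: "(x, y) \<in> darts M" by auto
  have ff: "face M (x, y) = ?f" using faces_partition(1)[OF D(1,2) f] by blast
  then show "face M (x, y) = ?f" .
  have dist: "x \<noteq> y" "y \<noteq> z" "z \<noteq> x" using sub darts_verts[OF D(1)] by auto
  then show "distinct [x, y, z]" by auto
  have "card ?f = 3" using dist by (auto simp: card_insert_if)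
  then obtain z' where z': "?f = {(x, y), (y, z'), (z', x)}" "rot M y x = z'" "rot M z' y = x" "rot M x z' = y" "distinct [x, y, z']"
    using face_card3[OF D(1,2) d] ff by auto
  then have "(y, z') \<in> ?f" by auto
  then have "z' = z" using z'(5) dist by auto
  then show "rot M y x = z" "rot M z y = x" "rot M x z = y" using z' by auto
qed

lemma QdD:
  assumes M: "is_4ppt M" and t: "Qd True x y z t w \<in># fm M"
  shows "distinct [x, y, z, t]" "rot M y x = z" "rot M z y = t" "rot M t z = x" "rot M x t = y"
    "{(x, y), (y, z), (z, t), (t, x)} \<in> faces M" "{(x, y), (y, z), (z, t), (t, x)} \<noteq> outer M"
    "w \<in> {x, y, z, t}" "\<And>d. d \<in> {(x, y), (y, z), (z, t), (t, x)} \<Longrightarrow> reflex M d \<longleftrightarrow> snd d = w"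
    "face M (x, y) = {(x, y), (y, z), (z, t), (t, x)}" "{(x, y), (y, z), (z, t), (t, x)} \<subseteq> darts M"
proof -
  note D = is_4pptD[OF M]
  let ?f = "{(x, y), (y, z), (z, t), (t, x)}"
  have f: "?f \<in> faces M" and tg: "Qd True x y z t w = tagged M ?f"
    using in_fm_faces[OF M t] by (auto simp: Qd_def)
  then show "?f \<in> faces M" by simp
  show o: "?f \<noteq> outer M"
  proof
    assume "?f = outer M"
    then have "Qd True x y z t w = (outer M, snd ` outer M)" using tg outer_tag[OF M] by simp
    then have "snd ` outer M = {w}" by (simp add: Qd_def)
    then show False using outer_tag(2)[OF M] by simp
  qed
  show sub: "?f \<subseteq> darts M" using f faces_Union[OF D(1,2)] by auto
  then have d: "(x, y) \<in> darts M" by auto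
  have ff: "face M (x, y) = ?f" using faces_partition(1)[OF D(1,2) f] by blast
  then show "face M (x, y) = ?f" .
  have dist: "x \<noteq> y" "y \<noteq> z" "z \<noteq> t" "t \<noteq> x" using sub darts_verts[OF D(1)] by auto
  have w: "snd ` {d \<in> ?f. reflex M d} = {w}" using tg by (auto simp: Qd_def tagged_def)
  have "w \<in> snd ` {d \<in> ?f. reflex M d}" unfolding w by simp
  then obtain e where "e \<in> {d \<in> ?f. reflex M d}" "w = snd e" by (rule imageE)
  then have e: "e \<in> ?f" "reflex M e" "snd e = w" by (simp_all only: mem_Collect_eq)
  show w2: "w \<in> {x, y, z, t}" using e by auto
  \<comment> \<open>The reflex angle comes on top of three convex ones, so the four listed darts
    cannot coincide.\<close>
  have c4: "card ?f = 4"
  proof -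
    have "card ?f = 3 \<or> card ?f = 4" using D(10)[OF f o] .
    moreover have "card ?f \<noteq> 3"
    proof
      assume c: "card ?f = 3"
      have "card {d \<in> ?f. \<not> reflex M d} < card ?f" using e by (intro psubset_card_mono) auto
      moreover have "card {d \<in> ?f. \<not> reflex M d} = 3" using D(7)[OF f o] by (simp only: convex_count_def)
      ultimately show False using c by simp
    qed
    ultimately show ?thesis by blast
  qed
  obtain z' t' where z': "?f = {(x, y), (y, z'), (z', t'), (t', x)}" "rot M y x = z'" "rot M z' y = t'" "rot M t' z' = x" "rot M x t' = y"
      "distinct [x, y, z', t']"
    using face_card4[OF M d] c4 o unfolding ff by blast
  have "(y, z) \<in> {(x, y), (y, z'), (z', t'), (t', x)}" unfolding z'(1)[symmetric] by simp
  then have zz: "z = z'" using z'(6) by auto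
  have "(z, t) \<in> {(x, y), (y, z'), (z', t'), (t', x)}" unfolding z'(1)[symmetric] by simp
  then have "t = t'" using z'(6) zz by auto
  then show "distinct [x, y, z, t]" "rot M y x = z" "rot M z y = t" "rot M t z = x" "rot M x t = y" using z' zz by auto
  show "reflex M d \<longleftrightarrow> snd d = w" if "d \<in> ?f" for d
  proof
    assume "reflex M d"
    then have "snd d \<in> snd ` {d \<in> ?f. reflex M d}" using that by (intro imageI CollectI conjI)
    then show "snd d = w" unfolding w by simp
  next
    assume a: "snd d = w"
    have "inj_on snd ?f" using z'(6) zz \<open>t = t'\<close> by auto
    then have "d = e" using e that a by (metis inj_onD)
    then show "reflex M d" using e by simp
  qed
qed

text \<open>An interior face has three convex angles, so size 3 leaves no reflex angle and size 4
  exactly one.\<close>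

lemma tri_or_quad:
  assumes M: "is_4ppt M" and f: "f \<in> faces M" "f \<noteq> outer M" and d: "(x, y) \<in> f"
  shows "(\<exists>z. tagged M f = Tri True x y z) \<or> (\<exists>z t w. tagged M f = Qd True x y z t w)"
proof -
  note D = is_4pptD[OF M]
  have dd: "(x, y) \<in> darts M" and ff: "f = face M (x, y)" using faces_partition[OF D(1,2) f(1) d] by auto
  have c3: "card {d \<in> f. \<not> reflex M d} = 3" using D(7)[OF f] by (simp only: convex_count_def)
  have fin: "finite f" using face_finite[OF D(1,2) f(1)] .
  from D(10)[OF f] show ?thesis
  proof
    assume c: "card f = 3"
    then obtain z where z: "f = {(x, y), (y, z), (z, x)}" using face_card3[OF D(1,2) dd] ff by auto
    have "{d \<in> f. \<not> reflex M d} = f" using c c3 fin by (intro card_subset_eq) auto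
    then have "{d \<in> f. reflex M d} = {}" by blast
    then have "tagged M f = Tri True x y z" by (simp only: tagged_def Tri_def z if_True image_empty)
    then show ?thesis by blast
  next
    assume c: "card f = 4"
    then obtain z t where z: "f = {(x, y), (y, z), (z, t), (t, x)}" using face_card4[OF M dd] ff f(2) by metis
    have "card (f - {d \<in> f. \<not> reflex M d}) = 1" using c c3 fin by (subst card_Diff_subset) auto
    then obtain e where "f - {d \<in> f. \<not> reflex M d} = {e}" by (metis card_1_singletonE)
    then have "{d \<in> f. reflex M d} = {e}" by blast
    then have "tagged M f = Qd True x y z t (snd e)" using z by (simp add: tagged_def Qd_def)
    then show ?thesis by blast
  qed
qed

section \<open>Exchanging one edge\<close>

definition rot_ins :: "('v \<Rightarrow> 'v \<Rightarrow> 'v) \<Rightarrow> 'v \<Rightarrow> 'v \<Rightarrow> 'v \<Rightarrow> ('v \<Rightarrow> 'v \<Rightarrow> 'v)" where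
  "rot_ins r a x y = (\<lambda>v u. if v = a then (if u = x then y else if u = y then r a x else r a u) else r v u)"

text \<open>\<open>xc\<close> and \<open>xd\<close> are the neighbours after which the new edge
  \<open>cd\<close> enters the rotations at \<open>c\<close> and \<open>d\<close>, which fixes how
  it is drawn; \<open>S\<close> is the set of reflex angles in the two new faces.\<close>

definition swap_map :: "'v cmap \<Rightarrow> 'v \<Rightarrow> 'v \<Rightarrow> 'v \<Rightarrow> 'v \<Rightarrow> 'v \<Rightarrow> 'v \<Rightarrow> ('v \<times> 'v) set \<Rightarrow> 'v cmap" where
  "swap_map M a b c xc d xd S = M\<lparr>edges := insert {c, d} (edges M - {{a, b}}),
     rot := rot_ins (rot_ins (del_rot M a b) c xc d) d xd c,
     reflex := \<lambda>e. (reflex M e \<and> e \<notin> face M (a, b) \<union> face M (b, a)) \<or> e \<in> S\<rparr>"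

definition rots_on :: "('v \<Rightarrow> 'v \<Rightarrow> 'v) \<Rightarrow> ('v \<Rightarrow> 'v set) \<Rightarrow> bool" where
  "rots_on r N \<longleftrightarrow> (\<forall>v. cyclic_on (r v) (N v) \<and> (\<forall>u. u \<notin> N v \<longrightarrow> r v u = u))"

lemma rots_on_remove:
  assumes "rots_on r N" shows "rots_on (rot_remove r a b) (\<lambda>v. if v = a then N a - {b} else N v)"
proof -
  have r: "rot_remove r a b a = (\<lambda>u. if u = b then u else if r a u = b then r a b else r a u)"
    by (simp add: rot_remove_def)
  have o: "rot_remove r a b v = r v" if "v \<noteq> a" for v using that by (simp add: rot_remove_def)
  have "cyclic_on (rot_remove r a b a) (N a - {b})"
    unfolding r by (rule cyclic_on_remove) (use assms in \<open>auto simp: rots_on_def\<close>)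
  moreover have "rot_remove r a b a u = u" if "u \<notin> N a - {b}" for u
    using that assms unfolding r rots_on_def by auto
  ultimately show ?thesis using assms o unfolding rots_on_def by simp
qed

lemma rots_on_ins:
  assumes "rots_on r N" "x \<in> N a" "y \<notin> N a"
  shows "rots_on (rot_ins r a x y) (\<lambda>v. if v = a then insert y (N a) else N v)"
proof -
  have r: "rot_ins r a x y a = (\<lambda>u. if u = x then y else if u = y then r a x else r a u)"
    by (simp add: rot_ins_def)
  have o: "rot_ins r a x y v = r v" if "v \<noteq> a" for v using that by (simp add: rot_ins_def)
  have "cyclic_on (rot_ins r a x y a) (insert y (N a))"
    unfolding r by (rule cyclic_on_insert) (use assms in \<open>auto simp: rots_on_def\<close>)
  moreover have "rot_ins r a x y a u = u" if "u \<notin> insert y (N a)" for u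
    using that assms unfolding r rots_on_def by auto
  ultimately show ?thesis using assms o unfolding rots_on_def by simp
qed

lemma faces_step_back:
  assumes "simple_graph M" "rotation_system M" "f \<in> faces M" "d \<in> darts M" "fstep M d \<in> f"
  shows "d \<in> f"
proof -
  have "fstep M d \<in> face M d" using face_step self_in_face by metis
  then have "f = face M d" using faces_disjoint[OF assms(1-3) face_in_faces[OF assms(4)] assms(5)] by simp
  then show ?thesis using self_in_face by metis
qed

lemma finite_edges: "simple_graph M \<Longrightarrow> finite (edges M)"
proof -
  assume s: "simple_graph M"
  have "edges M \<subseteq> Pow (verts M)"
  proof
    fix e assume "e \<in> edges M"
    then obtain u v where "e = {u, v}" "u \<in> verts M" "v \<in> verts M" using s unfolding simple_graph_def by metis
    then show "e \<in> Pow (verts M)" by simp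
  qed
  then show ?thesis using s unfolding simple_graph_def by (meson finite_Pow_iff finite_subset)
qed

text \<open>One exchange serves all kinds of flips: \<open>A\<close> is the triangle,
  \<open>B\<close> the face behind \<open>ab\<close>, and \<open>cd\<close> cuts the merged region
  into \<open>A'\<close> and \<open>B'\<close>. The numbers of edges and faces do not change, so the
  genus stays 0; \<open>pt\<close> preserves the number of reflex angles at every vertex.\<close>

locale edge_swap =
  fixes M :: "'v cmap" and a b c xc d xd x S A B A' B' M'
  assumes M: "is_4ppt M" and A: "A = face M (a, b)" "A = {(a, b), (b, x), (x, a)}" "A \<noteq> outer M"
    and B: "B = face M (b, a)" "B \<noteq> outer M" "A \<noteq> B"
    and ab: "(a, b) \<in> darts M" and cd: "c \<noteq> d" "{c, d} \<notin> edges M"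
    and xc: "(xc, c) \<in> (A \<union> B) - {(a, b), (b, a)}" and xd: "(xd, d) \<in> (A \<union> B) - {(a, b), (b, a)}"
    and M': "M' = swap_map M a b c xc d xd S"
    and A': "A' = face M' (c, d)" and B': "B' = face M' (d, c)"
    and U: "A' \<union> B' = (A \<union> B) - {(a, b), (b, a)} \<union> {(c, d), (d, c)}" and disj: "A' \<inter> B' = {}"
    and sizes: "{card A', card B'} = {3, card B}"
    and S: "S \<subseteq> A' \<union> B'" "card {e \<in> A'. e \<notin> S} = 3" "card {e \<in> B'. e \<notin> S} = 3"
    and pt: "\<And>v. card {e \<in> S. snd e = v} = card {e \<in> A \<union> B. snd e = v \<and> reflex M e}"
begin

lemmas D = is_4pptD[OF M]

lemma ab_ne: "a \<noteq> b" using ab darts_verts[OF D(1)] by auto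

lemma AB_faces: "A \<in> faces M" "B \<in> faces M"
  using A(1) B(1) ab darts_sym face_in_faces by metis+

lemma AB_darts: "A \<union> B \<subseteq> darts M" using AB_faces faces_Union[OF D(1,2)] by auto

lemma in_AB: "(a, b) \<in> A" "(b, a) \<in> B" using A(1) B(1) self_in_face by metis+

lemma cd_notin: "(c, d) \<notin> darts M" "(d, c) \<notin> darts M" using cd by (auto simp: mem_darts insert_commute)

lemma M'_sel: "edges M' = insert {c, d} (edges M - {{a, b}})"
  "rot M' = rot_ins (rot_ins (del_rot M a b) c xc d) d xd c" "verts M' = verts M" "outer M' = outer M"
  "reflex M' e \<longleftrightarrow> (reflex M e \<and> e \<notin> A \<union> B) \<or> e \<in> S"
  unfolding M' swap_map_def A(1) B(1) by simp_all

lemma darts': "darts M' = (darts M - {(a, b), (b, a)}) \<union> {(c, d), (d, c)}"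
  unfolding darts_def M'_sel by (auto simp: doubleton_eq_iff)

lemma cd_verts: "c \<in> verts M" "d \<in> verts M"
  using xc xd AB_darts darts_verts[OF D(1)] by blast+

lemma simple': "simple_graph M'"
  using D(1) cd(1) cd_verts unfolding simple_graph_def M'_sel by auto

definition NK where "NK = (\<lambda>v. nbrs M v - (if v = a then {b} else if v = b then {a} else {}))"

lemma rotsK: "rots_on (del_rot M a b) NK"
proof -
  have "rots_on (rot M) (nbrs M)" using D(2) unfolding rotation_system_iff rots_on_def .
  from rots_on_remove[OF rots_on_remove[OF this, of a b], of b a]
  have "rots_on (del_rot M a b) (\<lambda>v. if v = b then (if b = a then nbrs M a - {b} else nbrs M b) - {a} else if v = a then nbrs M a - {b} else nbrs M v)"
    unfolding del_rot_def .
  moreover have "(\<lambda>v. if v = b then (if b = a then nbrs M a - {b} else nbrs M b) - {a} else if v = a then nbrs M a - {b} else nbrs M v) = NK"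
    unfolding NK_def using ab_ne by (intro ext) auto
  ultimately show ?thesis by simp
qed

lemma NK_facts: "xc \<in> NK c" "d \<notin> NK c" "xd \<in> NK d" "c \<notin> NK d"
  using xc xd AB_darts cd_notin unfolding NK_def by (auto simp: mem_nbrs)

lemma rots': "rots_on (rot M') (nbrs M')"
proof -
  let ?N = "\<lambda>v. if v = c then insert d (NK c) else NK v"
  have 1: "rots_on (rot_ins (del_rot M a b) c xc d) ?N"
    using rots_on_ins[OF rotsK] NK_facts by simp
  have "rots_on (rot M') (\<lambda>v. if v = d then insert c (?N d) else ?N v)"
    unfolding M'_sel by (rule rots_on_ins[OF 1]) (use NK_facts cd in auto)
  moreover have "(\<lambda>v. if v = d then insert c (?N d) else ?N v) = nbrs M'"
  proof
    fix v
    have "u \<in> nbrs M' v \<longleftrightarrow> (u, v) \<in> darts M \<and> (u, v) \<noteq> (a, b) \<and> (u, v) \<noteq> (b, a) \<or> u = c \<and> v = d \<or> u = d \<and> v = c" for u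
      unfolding mem_nbrs darts' by blast
    moreover have "u \<in> NK v \<longleftrightarrow> (u, v) \<in> darts M \<and> (u, v) \<noteq> (a, b) \<and> (u, v) \<noteq> (b, a)" for u
      using ab_ne unfolding NK_def by (simp add: mem_nbrs)
    ultimately show "(if v = d then insert c (?N d) else ?N v) = nbrs M' v"
      using cd(1) by (auto simp: set_eq_iff)
  qed
  ultimately show ?thesis by simp
qed

lemma rot': "rotation_system M'"
  using rots' unfolding rotation_system_iff rots_on_def .

lemma rotK_inj: "del_rot M a b v u = del_rot M a b v w \<Longrightarrow> u = w"
  using rotsK unfolding rots_on_def cyclic_on_def inj_on_def by metis

lemma rotK_fix: "del_rot M a b c d = d" "del_rot M a b d c = c"
  using rotsK NK_facts unfolding rots_on_def by auto

lemma del': "del_rot M' c d = del_rot M a b"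
proof (intro ext)
  fix v u
  have n: "xc \<noteq> d" "xd \<noteq> c" using NK_facts by auto
  have k: "del_rot M a b c u = d \<longleftrightarrow> u = d" "del_rot M a b d u = c \<longleftrightarrow> u = c"
    using rotK_fix rotK_inj by metis+
  show "del_rot M' c d v u = del_rot M a b v u"
    using cd(1) n k rotK_fix unfolding del_rot_def[of M'] rot_remove_def M'_sel rot_ins_def by auto
qed

text \<open>Outside the merged region no dart steps onto the deleted edge, and none arrives at the
  place where \<open>cd\<close> is inserted.\<close>

lemma agree: "e \<in> darts M - (A \<union> B) \<Longrightarrow> fstep M' e = fstep M e"
proof -
  assume e: "e \<in> darts M - (A \<union> B)"
  obtain u v where uv: "e = (u, v)" by (cases e)
  have 1: "e \<noteq> (xc, c)" "e \<noteq> (xd, d)" "e \<noteq> (d, c)" "e \<noteq> (c, d)" "e \<noteq> (a, b)" "e \<noteq> (b, a)"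
    using e xc xd cd_notin in_AB by auto
  have 2: "fstep M e \<noteq> (a, b)" "fstep M e \<noteq> (b, a)"
    using faces_step_back[OF D(1,2)] AB_faces in_AB e by fastforce+
  have "rot M' v u = del_rot M a b v u" using 1 unfolding uv M'_sel rot_ins_def by auto
  moreover have "del_rot M a b v u = rot M v u"
    using 1 2 ab_ne unfolding uv del_rot_def rot_remove_def by auto
  ultimately show ?thesis using uv by simp
qed

lemma A'B'_faces: "A' \<in> faces M'" "B' \<in> faces M'"
  unfolding A' B' by (rule face_in_faces, simp add: darts')+

lemma in_A'B': "(c, d) \<in> A'" "(d, c) \<in> B'" unfolding A' B' by (rule self_in_face)+

lemma faces': "faces M' = faces M - {A, B} \<union> {A', B'}"
proof (rule faces_exchange[OF D(1,2) simple' rot' AB_faces A'B'_faces])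
  show "A' \<union> B' \<union> (darts M - (A \<union> B)) = darts M'"
    unfolding U darts' using AB_darts in_AB by auto
  show "(A' \<union> B') \<inter> (darts M - (A \<union> B)) = {}" unfolding U using cd_notin by auto
qed (rule agree)

lemma other_face: "f \<in> faces M - {A, B} \<Longrightarrow> e \<in> f \<Longrightarrow> e \<notin> A \<union> B \<and> e \<notin> A' \<union> B' \<and> e \<in> darts M"
proof -
  assume f: "f \<in> faces M - {A, B}" and e: "e \<in> f"
  have 1: "e \<in> darts M" using faces_partition(2)[OF D(1,2)] f e by blast
  have "e \<notin> A" "e \<notin> B" using faces_disjoint[OF D(1,2) _ AB_faces(1) e] faces_disjoint[OF D(1,2) _ AB_faces(2) e] f by auto
  then show ?thesis using U cd_notin 1 by auto
qed

lemma new_not: "A' \<notin> faces M" "B' \<notin> faces M" "A' \<noteq> B'"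
  using in_A'B' cd_notin faces_partition(2)[OF D(1,2)] disj by blast+

lemma card_faces': "card (faces M') = card (faces M)"
proof -
  have fin: "finite (faces M)" using finite_faces D(1) by auto
  have "card (faces M') = card (faces M - {A, B}) + card {A', B'}"
    unfolding faces' by (rule card_Un_disjoint) (use fin new_not in auto)
  also have "card {A', B'} = card {A, B}" using new_not B(3) by simp
  also have "card (faces M - {A, B}) + card {A, B} = card (faces M)"
    using fin AB_faces by (metis card_Diff_subset card_mono empty_subsetI finite.emptyI finite.insertI insert_subset le_add_diff_inverse2)
  finally show ?thesis .
qed

lemma card_edges': "card (edges M') = card (edges M)"
proof -
  have fin: "finite (edges M)" using finite_edges D(1) by auto
  have "{a, b} \<in> edges M" using ab by (simp add: mem_darts)
  then have "Suc (card (edges M - {{a, b}})) = card (edges M)" by (rule card_Suc_Diff1[OF fin])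
  then show ?thesis unfolding M'_sel using fin cd by simp
qed

lemma conn': "connected_graph M'"
proof -
  have bx: "(b, x) \<in> darts M" "(x, a) \<in> darts M" using A AB_darts by auto
  \<comment> \<open>The deleted edge is bypassed through the third vertex \<open>x\<close> of the
    triangle.\<close>
  have "(a, x) \<in> darts M'" "(x, b) \<in> darts M'" "(b, x) \<in> darts M'" "(x, a) \<in> darts M'"
    using bx[THEN darts_sym] bx darts_verts[OF D(1) bx(1)] darts_verts[OF D(1) bx(2)] ab_ne unfolding darts' by auto
  then have "(a, b) \<in> (darts M')\<^sup>*" "(b, a) \<in> (darts M')\<^sup>*" by (meson converse_rtrancl_into_rtrancl r_into_rtrancl)+
  then have "darts M \<subseteq> (darts M')\<^sup>*" unfolding darts' by auto
  then have "(darts M)\<^sup>* \<subseteq> (darts M')\<^sup>*" by (metis rtrancl_subset_rtrancl)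
  then show ?thesis using D(3) unfolding connected_graph_def M'_sel by auto
qed

lemma refl_new: "e \<in> A' \<union> B' \<Longrightarrow> reflex M' e \<longleftrightarrow> e \<in> S"
  unfolding M'_sel U using cd_notin D(6) by auto

lemma refl_old: "f \<in> faces M - {A, B} \<Longrightarrow> e \<in> f \<Longrightarrow> reflex M' e \<longleftrightarrow> reflex M e"
  unfolding M'_sel using other_face S(1) by blast

lemma is_4ppt': "is_4ppt M'"
proof -
  have out: "outer M \<in> faces M - {A, B}" using D(5) A(3) B(2) by auto
  have cc: "convex_count M' f = 3" if f: "f \<in> faces M'" "f \<noteq> outer M" for f
  proof (cases "f \<in> {A', B'}")
    case True
    then have "{e \<in> f. \<not> reflex M' e} = {e \<in> f. e \<notin> S}" using refl_new by auto
    then show ?thesis using True S unfolding convex_count_def by auto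
  next
    case False
    then have f2: "f \<in> faces M - {A, B}" using f faces' by auto
    then have "{e \<in> f. \<not> reflex M' e} = {e \<in> f. \<not> reflex M e}" using refl_old by auto
    then show ?thesis using D(7) f2 f unfolding convex_count_def by auto
  qed
  have sz: "card f = 3 \<or> card f = 4" if f: "f \<in> faces M'" "f \<noteq> outer M" for f
  proof (cases "f \<in> {A', B'}")
    case True
    then have "card f = 3 \<or> card f = card B" using sizes by (auto simp: doubleton_eq_iff)
    then show ?thesis using D(10)[OF AB_faces(2) B(2)] by presburger
  next
    case False then show ?thesis using f faces' D(10) by auto
  qed
  have ra: "card (reflex_at M' v) = 1" if v: "v \<in> verts M" for v
  proof -
    let ?O = "{e. reflex M e \<and> e \<notin> A \<union> B \<and> snd e = v}"
    have fO: "finite ?O" using D(6) darts_finite[OF D(1)] by (metis (mono_tags, lifting) finite_subset mem_Collect_eq subsetI)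
    have fAB: "finite (A \<union> B)" using AB_darts darts_finite[OF D(1)] finite_subset by auto
    have fS: "finite S" by (rule finite_subset[OF S(1)]) (use fAB in \<open>simp add: U\<close>)
    have e1: "reflex_at M' v = ?O \<union> {e \<in> S. snd e = v}"
    proof -
      have "S \<subseteq> darts M'" using S(1) A'B'_faces faces_Union[OF simple' rot'] by blast
      moreover have "?O \<subseteq> darts M'" using D(6) in_AB unfolding darts' by auto
      ultimately show ?thesis unfolding reflex_at_def using M'_sel(5) by auto
    qed
    have e2: "reflex_at M v = ?O \<union> {e \<in> A \<union> B. snd e = v \<and> reflex M e}"
      unfolding reflex_at_def using D(6) by blast
    have d1: "?O \<inter> {e \<in> S. snd e = v} = {}"
    proof -
      have "e \<in> A \<union> B" if "e \<in> S" "reflex M e" for e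
        using that S(1) U cd_notin D(6) by auto
      then show ?thesis by auto
    qed
    have "card (reflex_at M' v) = card ?O + card {e \<in> S. snd e = v}"
      unfolding e1 by (rule card_Un_disjoint[OF fO _ d1]) (use fS in auto)
    also have "\<dots> = card ?O + card {e \<in> A \<union> B. snd e = v \<and> reflex M e}" using pt by simp
    also have "\<dots> = card (reflex_at M v)"
      unfolding e2 by (rule card_Un_disjoint[symmetric, OF fO]) (use fAB in auto)
    finally show ?thesis using D(9) v by simp
  qed
  have rd: "e \<in> darts M'" if "reflex M' e" for e
  proof -
    have "S \<subseteq> darts M'" using S(1) A'B'_faces faces_Union[OF simple' rot'] by blast
    then show ?thesis using that M'_sel(5)[of e] D(6)[of e] in_AB unfolding darts' by auto
  qed
  have or: "reflex M' e" if "e \<in> outer M" for e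
    using refl_old[OF out that] D(8)[OF that] by simp
  show ?thesis
    unfolding is_4ppt_def comb_pt_def plane_map_def pointed_def M'_sel(3,4) card_faces' card_edges'
  proof (intro conjI ballI allI impI)
    show "outer M \<in> faces M'" using out faces' by simp
    show "card (reflex_at M' v) \<le> 1" if "v \<in> verts M" for v using ra[OF that] by simp
  qed (use simple' conn' rot' D(4,11) rd cc or ra sz in blast)+
qed

lemma flip_M': "flip M M'"
  unfolding flip_def
proof (intro conjI exI)
  show "is_4ppt M" by (rule M)
  show "is_4ppt M'" by (rule is_4ppt')
  show "verts M' = verts M" "outer M' = outer M" by (simp_all add: M'_sel)
  show "(a, b) \<in> darts M" "c \<noteq> d" "{c, d} \<notin> edges M" by (fact ab cd)+
  show "face M (a, b) \<noteq> outer M" using A by simp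
  have "(b, x) \<in> darts M" "(x, a) \<in> darts M" using A AB_darts by auto
  then have "distinct [a, b, x]" using darts_verts[OF D(1)] ab_ne by fastforce
  then have "card {(a, b), (b, x), (x, a)} = 3" by auto
  then show "card (face M (a, b)) = 3" using A(1,2) by simp
  show "(a, b) \<notin> outer M" using faces_disjoint[OF D(1,2,5) AB_faces(1) _ in_AB(1)] A(3) by auto
  show "(b, a) \<notin> outer M" using faces_disjoint[OF D(1,2,5) AB_faces(2) _ in_AB(2)] B(2) by auto
  show "edges M' = insert {c, d} (edges M - {{a, b}})" by (simp add: M'_sel)
  show "del_rot M' c d = del_rot M a b" by (rule del')
  show "{f \<in> faces M'. (c, d) \<notin> f \<and> (d, c) \<notin> f} = {f \<in> faces M. (a, b) \<notin> f \<and> (b, a) \<notin> f}"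
  proof (intro equalityI subsetI)
    fix f assume f: "f \<in> {f \<in> faces M'. (c, d) \<notin> f \<and> (d, c) \<notin> f}"
    then have "f \<noteq> A'" "f \<noteq> B'" using in_A'B' by auto
    then have "f \<in> faces M - {A, B}" using f faces' by auto
    then show "f \<in> {f \<in> faces M. (a, b) \<notin> f \<and> (b, a) \<notin> f}" using other_face in_AB by blast
  next
    fix f assume f: "f \<in> {f \<in> faces M. (a, b) \<notin> f \<and> (b, a) \<notin> f}"
    then have "f \<in> faces M - {A, B}" using in_AB by auto
    then show "f \<in> {f \<in> faces M'. (c, d) \<notin> f \<and> (d, c) \<notin> f}" using other_face in_A'B' faces' by blast
  qed
  show "{card (face M' (c, d)), card (face M' (d, c))} = {3, card (face M (b, a))}"
    using sizes A' B' B by simp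
  show "\<forall>x\<in>darts M - (face M (a, b) \<union> face M (b, a)). reflex M' x = reflex M x"
  proof
    fix e assume e: "e \<in> darts M - (face M (a, b) \<union> face M (b, a))"
    then have "face M e \<in> faces M" "e \<in> face M e" using face_in_faces[of e M] self_in_face[of e M] by auto
    moreover have "face M e \<noteq> A" "face M e \<noteq> B" using e A(1) B(1) self_in_face[of e M] by auto
    ultimately show "reflex M' e = reflex M e" using refl_old by blast
  qed
qed

lemma fm_M':
  assumes "fm M = R + {#tagged M A, tagged M B#}"
  shows "fm M' = R + {#(A', snd ` (A' \<inter> S)), (B', snd ` (B' \<inter> S))#}"
proof -
  have fin: "finite (faces M)" using finite_faces D(1) by auto
  have "faces M = insert A (insert B (faces M - {A, B}))" using AB_faces by auto
  then have "mset_set (faces M) = mset_set (insert A (insert B (faces M - {A, B})))" by simp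
  also have "\<dots> = {#A, B#} + mset_set (faces M - {A, B})" using fin B(3) by simp
  finally have 1: "fm M = {#tagged M A, tagged M B#} + image_mset (tagged M) (mset_set (faces M - {A, B}))"
    unfolding fm_def by simp
  have "faces M' = insert A' (insert B' (faces M - {A, B}))" using faces' by auto
  then have "mset_set (faces M') = {#A', B'#} + mset_set (faces M - {A, B})" using fin new_not by simp
  then have 2: "fm M' = {#tagged M' A', tagged M' B'#} + image_mset (tagged M') (mset_set (faces M - {A, B}))"
    unfolding fm_def by simp
  have 3: "image_mset (tagged M') (mset_set (faces M - {A, B})) = image_mset (tagged M) (mset_set (faces M - {A, B}))"
  proof (rule image_mset_cong)
    fix f assume "f \<in># mset_set (faces M - {A, B})"
    then have f: "f \<in> faces M - {A, B}" using fin by simp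
    then have "{d \<in> f. reflex M' d} = {d \<in> f. reflex M d}" using refl_old by blast
    then show "tagged M' f = tagged M f" by (simp add: tagged_def)
  qed
  have "{d \<in> A'. reflex M' d} = A' \<inter> S" "{d \<in> B'. reflex M' d} = B' \<inter> S" using refl_new by auto
  then have 4: "tagged M' A' = (A', snd ` (A' \<inter> S))" "tagged M' B' = (B', snd ` (B' \<inter> S))"
    by (simp_all add: tagged_def)
  have "R = image_mset (tagged M) (mset_set (faces M - {A, B}))" using assms 1 by (simp add: union_commute)
  then show ?thesis unfolding 2 3 4 by (simp add: union_commute)
qed

end

section \<open>Flips as rewriting of multisets of tagged faces\<close>

definition DS :: "'v tface multiset \<Rightarrow> ('v \<times> 'v) set" where
  "DS X = \<Union>(fst ` set_mset X)"

lemma DS_simps [simp]: "DS {#} = {}" "DS (add_mset f X) = fst f \<union> DS X" "DS (X + Y) = DS X \<union> DS Y"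
  by (auto simp: DS_def)

text \<open>This lets the rewriting rules test adjacency on the multiset alone.\<close>

lemma DS_fm: assumes "is_4ppt M" shows "DS (fm M) = darts M"
proof -
  have "fst ` set_mset (fm M) = faces M"
    unfolding fm_def using fm_finite[OF assms] by (auto simp: tagged_def image_iff)
  then show ?thesis unfolding DS_def using faces_Union is_4pptD(1,2)[OF assms] by metis
qed

lemma quad_corner:
  assumes "distinct [a, b, c, d]" "w \<in> {a, b, c, d}"
  shows "\<exists>y. {x \<in> {(a, b), (b, c), (c, d), (d, a)}. snd x = w} = {(y, w)}"
proof -
  have "w = a \<or> w = b \<or> w = c \<or> w = d" using assms(2) by auto
  then show ?thesis
  proof (elim disjE)
    assume "w = a" then show ?thesis by (intro exI[of _ d]) (use assms(1) in auto)
  next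
    assume "w = b" then show ?thesis by (intro exI[of _ a]) (use assms(1) in auto)
  next
    assume "w = c" then show ?thesis by (intro exI[of _ b]) (use assms(1) in auto)
  next
    assume "w = d" then show ?thesis by (intro exI[of _ c]) (use assms(1) in auto)
  qed
qed

text \<open>Without the edge \<open>p0 p2\<close> the two faces form a pentagon, possibly with
  \<open>p1\<close> equal to \<open>p3\<close> or \<open>p4\<close>. The \<open>q\<close> are its
  labels rotated so that the new edge \<open>q1 q3\<close> cuts off \<open>q2\<close>; the fifth
  rotation would only restore \<open>p0 p2\<close>. As \<open>q2\<close> becomes the tip of a
  triangle, it must not be the reflex vertex.\<close>

lemma pent_swap:
  assumes M: "is_4ppt M" and X: "fm M = R + {#Tri True p0 p1 p2, Qd True p0 p2 p3 p4 w#}"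
    and q: "(q0, q1, q2, q3, q4) \<in> {(p0, p1, p2, p3, p4), (p1, p2, p3, p4, p0), (p2, p3, p4, p0, p1), (p3, p4, p0, p1, p2)}"
    and ne: "q0 \<noteq> q3" "q1 \<noteq> q4" "q1 \<noteq> q3" "w \<noteq> q2" and na: "(q1, q3) \<notin> darts M"
  shows "\<exists>M'. flip M M' \<and> fm M' = R + {#Tri True q1 q2 q3, Qd True q1 q3 q4 q0 w#}"
proof -
  have tin: "Tri True p0 p1 p2 \<in># fm M" and qin: "Qd True p0 p2 p3 p4 w \<in># fm M" using X by auto
  note T = TriD[OF M tin] and Q = QdD[OF M qin]
  let ?A = "{(p0, p1), (p1, p2), (p2, p0)}" and ?B = "{(p0, p2), (p2, p3), (p3, p4), (p4, p0)}"
  let ?K = "del_rot M p2 p0"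
  have d: "p0 \<noteq> p1" "p1 \<noteq> p2" "p0 \<noteq> p2" "p0 \<noteq> p3" "p0 \<noteq> p4" "p2 \<noteq> p3" "p2 \<noteq> p4" "p3 \<noteq> p4"
    using T(1) Q(1) by auto
  have K0: "?K p1 p0 = p2" "?K p2 p1 = p3" "?K p3 p2 = p4" "?K p4 p3 = p0" "?K p0 p4 = p1"
    using T(2-4) Q(2-5) d unfolding del_rot_def rot_remove_def by auto
  have K: "?K q1 q0 = q2" "?K q2 q1 = q3" "?K q3 q2 = q4" "?K q4 q3 = q0" "?K q0 q4 = q1"
    using q K0 by auto
  have reg: "?A \<union> ?B - {(p2, p0), (p0, p2)} = {(q0, q1), (q1, q2), (q2, q3), (q3, q4), (q4, q0)}"
  proof -
    have "?A \<union> ?B - {(p2, p0), (p0, p2)} = {(p0, p1), (p1, p2), (p2, p3), (p3, p4), (p4, p0)}" using d by auto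
    then show ?thesis using q by (elim insertE) (simp_all add: insert_commute)
  qed
  have e: "q0 \<noteq> q1" "q1 \<noteq> q2" "q2 \<noteq> q3" "q3 \<noteq> q4" "q4 \<noteq> q0" using q d by auto
  have wq: "w \<in> {q0, q1, q3, q4}" using Q(8) ne(4) q by auto
  let ?A' = "{(q1, q3), (q3, q4), (q4, q0), (q0, q1)}" and ?B' = "{(q3, q1), (q1, q2), (q2, q3)}"
  \<comment> \<open>The single reflex angle of the region stays at \<open>w\<close>, now inside the
    new quadrilateral.\<close>
  let ?S = "{x \<in> ?A'. snd x = w}"
  define M' where "M' = swap_map M p2 p0 q1 q0 q3 q2 ?S"
  have r': "rot M' = rot_ins (rot_ins ?K q1 q0 q3) q3 q2 q1" unfolding M'_def swap_map_def by simp
  have fA': "face M' (q1, q3) = ?A'"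
    by (rule face4; simp add: r' rot_ins_def) (use K ne e in auto)
  have fB': "face M' (q3, q1) = ?B'"
    by (rule face3; simp add: r' rot_ins_def) (use K ne e in auto)
  have S1: "\<exists>x. ?S = {(x, w)}" by (rule quad_corner) (use wq ne e in auto)
  interpret edge_swap M p2 p0 q1 q0 q3 q2 p1 ?S ?A ?B ?A' ?B' M'
  proof
    show "is_4ppt M" by fact
    show "?A = face M (p2, p0)" using faces_partition(1)[OF is_4pptD(1,2)[OF M] T(5), of "(p2, p0)"] by simp
    show "?A = {(p2, p0), (p0, p1), (p1, p2)}" by auto
    show "?A \<noteq> outer M" "?B \<noteq> outer M" using T(6) Q(7) by auto
    show "?B = face M (p0, p2)" using Q(10) by simp
    have "(p2, p0) \<notin> ?B" using d by auto
    moreover have "(p2, p0) \<in> ?A" by simp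
    ultimately show "?A \<noteq> ?B" by metis
    show "(p2, p0) \<in> darts M" using T(11) by auto
    show "q1 \<noteq> q3" by fact
    show "{q1, q3} \<notin> edges M" using na by (simp add: mem_darts)
    show "(q0, q1) \<in> ?A \<union> ?B - {(p2, p0), (p0, p2)}" "(q2, q3) \<in> ?A \<union> ?B - {(p2, p0), (p0, p2)}"
      unfolding reg by auto
    show "M' = swap_map M p2 p0 q1 q0 q3 q2 ?S" by (rule M'_def)
    show "?A' = face M' (q1, q3)" "?B' = face M' (q3, q1)" using fA' fB' by auto
    show "?A' \<union> ?B' = ?A \<union> ?B - {(p2, p0), (p0, p2)} \<union> {(q1, q3), (q3, q1)}" unfolding reg by auto
    show "?A' \<inter> ?B' = {}" using ne e by auto
    have "card ?B = 4" using d by auto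
    moreover have "card ?A' = 4" "card ?B' = 3" using ne e by auto
    ultimately show "{card ?A', card ?B'} = {3, card ?B}" by auto
    show "?S \<subseteq> ?A' \<union> ?B'" by auto
    obtain y where y: "?S = {(y, w)}" using S1 by auto
    have "{x \<in> ?A'. x \<notin> ?S} = ?A' - {(y, w)}" using y by auto
    moreover have "(y, w) \<in> ?A'" using y by blast
    ultimately show "card {x \<in> ?A'. x \<notin> ?S} = 3" using \<open>card ?A' = 4\<close> by (simp add: card_Diff_singleton)
    have "{x \<in> ?B'. x \<notin> ?S} = ?B'" using \<open>?A' \<inter> ?B' = {}\<close> by auto
    then show "card {x \<in> ?B'. x \<notin> ?S} = 3" using \<open>card ?B' = 3\<close> by simp
    show "card {x \<in> ?S. snd x = v} = card {x \<in> ?A \<union> ?B. snd x = v \<and> reflex M x}" for v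
    proof -
      have "{x \<in> ?A \<union> ?B. snd x = v \<and> reflex M x} = {x \<in> ?B. snd x = w \<and> v = w}"
        using T(7-9) Q(9) by blast
      also have "\<dots> = (if v = w then {x \<in> ?B. snd x = w} else {})" by simp
      finally have 1: "{x \<in> ?A \<union> ?B. snd x = v \<and> reflex M x} = (if v = w then {x \<in> ?B. snd x = w} else {})" .
      have 2: "{x \<in> ?S. snd x = v} = (if v = w then ?S else {})" by auto
      obtain z where z: "{x \<in> ?B. snd x = w} = {(z, w)}" using quad_corner[OF Q(1,8)] by blast
      show ?thesis unfolding 1 2 unfolding y z by simp
    qed
  qed
  have "fst (Tri True p0 p1 p2) = ?A" "fst (Qd True p0 p2 p3 p4 w) = ?B" by (simp_all add: Tri_def Qd_def)
  then have tg: "tagged M ?A = Tri True p0 p1 p2" "tagged M ?B = Qd True p0 p2 p3 p4 w"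
    using in_fm_faces[OF M tin] in_fm_faces[OF M qin] by auto
  obtain y where y: "?S = {(y, w)}" using S1 by auto
  have "(y, w) \<in> ?A'" using y by blast
  then have "?A' \<inter> ?S = {(y, w)}" "?B' \<inter> ?S = {}" using y disj by auto
  then have "(?A', snd ` (?A' \<inter> ?S)) = Qd True q1 q3 q4 q0 w" "(?B', snd ` (?B' \<inter> ?S)) = Tri True q1 q2 q3"
    by (simp_all add: Tri_def Qd_def insert_commute)
  then have "fm M' = R + {#Tri True q1 q2 q3, Qd True q1 q3 q4 q0 w#}"
    using fm_M'[of R] X tg by (simp add: add_mset_commute)
  then show ?thesis using flip_M' by blast
qed

lemma quad_swap:
  assumes M: "is_4ppt M" and X: "fm M = R + {#Tri True p0 p1 p2, Tri True p0 p2 p3#}"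
    and ne: "p1 \<noteq> p3" and na: "(p1, p3) \<notin> darts M"
  shows "\<exists>M'. flip M M' \<and> fm M' = R + {#Tri True p1 p2 p3, Tri True p1 p3 p0#}"
proof -
  have tin: "Tri True p0 p1 p2 \<in># fm M" and qin: "Tri True p0 p2 p3 \<in># fm M" using X by auto
  note T = TriD[OF M tin] and Q = TriD[OF M qin]
  let ?A = "{(p0, p1), (p1, p2), (p2, p0)}" and ?B = "{(p0, p2), (p2, p3), (p3, p0)}"
  let ?K = "del_rot M p2 p0"
  have d: "p0 \<noteq> p1" "p1 \<noteq> p2" "p0 \<noteq> p2" "p0 \<noteq> p3" "p2 \<noteq> p3"
    using T(1) Q(1) by auto
  have K: "?K p1 p0 = p2" "?K p2 p1 = p3" "?K p3 p2 = p0" "?K p0 p3 = p1"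
    using T(2-4) Q(2-4) d unfolding del_rot_def rot_remove_def by auto
  let ?A' = "{(p1, p3), (p3, p0), (p0, p1)}" and ?B' = "{(p3, p1), (p1, p2), (p2, p3)}"
  define M' where "M' = swap_map M p2 p0 p1 p0 p3 p2 {}"
  have r': "rot M' = rot_ins (rot_ins ?K p1 p0 p3) p3 p2 p1" unfolding M'_def swap_map_def by simp
  have fA': "face M' (p1, p3) = ?A'"
    by (rule face3; simp add: r' rot_ins_def) (use K ne d in auto)
  have fB': "face M' (p3, p1) = ?B'"
    by (rule face3; simp add: r' rot_ins_def) (use K ne d in auto)
  interpret edge_swap M p2 p0 p1 p0 p3 p2 p1 "{}" ?A ?B ?A' ?B' M'
  proof
    show "is_4ppt M" by fact
    show "?A = face M (p2, p0)" using faces_partition(1)[OF is_4pptD(1,2)[OF M] T(5), of "(p2, p0)"] by simp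
    show "?A = {(p2, p0), (p0, p1), (p1, p2)}" by auto
    show "?A \<noteq> outer M" "?B \<noteq> outer M" using T(6) Q(6) by auto
    show "?B = face M (p0, p2)" using Q(10) by simp
    have "(p2, p0) \<notin> ?B" using d by auto
    moreover have "(p2, p0) \<in> ?A" by simp
    ultimately show "?A \<noteq> ?B" by metis
    show "(p2, p0) \<in> darts M" using T(11) by auto
    show "p1 \<noteq> p3" by fact
    show "{p1, p3} \<notin> edges M" using na by (simp add: mem_darts)
    show "(p0, p1) \<in> ?A \<union> ?B - {(p2, p0), (p0, p2)}" "(p2, p3) \<in> ?A \<union> ?B - {(p2, p0), (p0, p2)}"
      using d by auto
    show "M' = swap_map M p2 p0 p1 p0 p3 p2 {}" by (rule M'_def)
    show "?A' = face M' (p1, p3)" "?B' = face M' (p3, p1)" using fA' fB' by auto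
    show "?A' \<union> ?B' = ?A \<union> ?B - {(p2, p0), (p0, p2)} \<union> {(p1, p3), (p3, p1)}" using d by auto
    show "?A' \<inter> ?B' = {}" using ne d by auto
    have "card ?B = 3" using d by auto
    moreover have "card ?A' = 3" "card ?B' = 3" using ne d by auto
    ultimately show "{card ?A', card ?B'} = {3, card ?B}" by auto
    show "{} \<subseteq> ?A' \<union> ?B'" by auto
    have "{x \<in> ?A'. x \<notin> {}} = ?A'" "{x \<in> ?B'. x \<notin> {}} = ?B'" by blast+
    then show "card {x \<in> ?A'. x \<notin> {}} = 3" "card {x \<in> ?B'. x \<notin> {}} = 3"
      using \<open>card ?A' = 3\<close> \<open>card ?B' = 3\<close> by simp_all
    show "card {x \<in> {}. snd x = v} = card {x \<in> ?A \<union> ?B. snd x = v \<and> reflex M x}" for v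
    proof -
      have "{x \<in> ?A \<union> ?B. snd x = v \<and> reflex M x} = {}" using T(7-9) Q(7-9) by blast
      then show ?thesis by simp
    qed
  qed
  have "fst (Tri True p0 p1 p2) = ?A" "fst (Tri True p0 p2 p3) = ?B" by (simp_all add: Tri_def)
  then have tg: "tagged M ?A = Tri True p0 p1 p2" "tagged M ?B = Tri True p0 p2 p3"
    using in_fm_faces[OF M tin] in_fm_faces[OF M qin] by auto
  have "(?A', snd ` (?A' \<inter> {})) = Tri True p1 p3 p0" "(?B', snd ` (?B' \<inter> {})) = Tri True p1 p2 p3"
    by (simp_all add: Tri_def insert_commute)
  then have "fm M' = R + {#Tri True p1 p2 p3, Tri True p1 p3 p0#}"
    using fm_M'[of R] X tg by (simp add: add_mset_commute)
  then show ?thesis using flip_M' by blast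
qed

text \<open>Flips in the pentagon \<open>p0 p1 p2 p3 p4\<close>, up to reflection, and in a quadrilateral of two triangles.
  \<open>far\<close> with \<open>p1 = p3\<close> swings a vertex of degree two from one side of the pentagon to another.\<close>
inductive fl :: "'v tface multiset \<Rightarrow> 'v tface multiset \<Rightarrow> bool" where
  near: "w \<noteq> p2 \<Longrightarrow> p1 \<noteq> p3 \<Longrightarrow> p1 \<noteq> p4 \<Longrightarrow> (p1, p3) \<notin> DS X \<Longrightarrow> X = R + {#Tri s p0 p1 p2, Qd s p0 p2 p3 p4 w#} \<Longrightarrow>
     fl X (R + {#Tri s p1 p2 p3, Qd s p1 p3 p4 p0 w#})"
| far: "w \<noteq> p3 \<Longrightarrow> p1 \<noteq> p4 \<Longrightarrow> (p2, p4) \<notin> DS X \<Longrightarrow> X = R + {#Tri s p0 p1 p2, Qd s p0 p2 p3 p4 w#} \<Longrightarrow>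
     fl X (R + {#Tri s p2 p3 p4, Qd s p2 p4 p0 p1 w#})"
| quad: "p1 \<noteq> p3 \<Longrightarrow> (p1, p3) \<notin> DS X \<Longrightarrow> X = R + {#Tri s p0 p1 p2, Tri s p0 p2 p3#} \<Longrightarrow>
     fl X (R + {#Tri s p1 p2 p3, Tri s p1 p3 p0#})"

lemma flip_preserves: "flip M M' \<Longrightarrow> is_4ppt M' \<and> verts M' = verts M \<and> outer M' = outer M"
  by (simp add: flip_def)

text \<open>For \<open>s\<close> false both faces are listed against their darts; reading the region
  backwards reduces each rule to \<open>pent_swap\<close> or \<open>quad_swap\<close>.\<close>

lemma fl_realize:
  assumes M: "is_4ppt M" and f: "fl (fm M) Y" shows "\<exists>M'. flip M M' \<and> fm M' = Y"
  using f
proof cases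
  case (near w p2 p1 p3 p4 R s p0)
  show ?thesis
  proof (cases s)
    case True
    then have sT: "s = True" by simp
    have d: "distinct [p0, p2, p3, p4]" by (rule QdD(1)[OF M, of _ _ _ _ w]) (use near(6) sT in simp)
    show ?thesis unfolding near(1) sT
      by (rule pent_swap[OF M, where ?q0.0 = p0 and ?q1.0 = p1 and ?q2.0 = p2 and ?q3.0 = p3 and ?q4.0 = p4 and ?p0.0 = p0 and ?p1.0 = p1 and ?p2.0 = p2 and ?p3.0 = p3 and ?p4.0 = p4])
        (use near sT d DS_fm[OF M] in auto)
  next
    case False
    then have sF: "s = (\<not> True)" by simp
    have e: "Tri s p0 p1 p2 = Tri True p2 p1 p0" "Qd s p0 p2 p3 p4 w = Qd True p2 p0 p4 p3 w"
      "Tri s p1 p2 p3 = Tri True p3 p2 p1" "Qd s p1 p3 p4 p0 w = Qd True p3 p1 p0 p4 w"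
      unfolding sF Tri_flip Qd_flip by (metis Qd_rot)+
    have d: "distinct [p2, p0, p4, p3]" by (rule QdD(1)[OF M, of _ _ _ _ w]) (use near(6) e in simp)
    have na: "(p3, p1) \<notin> darts M" using near(5) DS_fm[OF M] darts_sym by metis
    show ?thesis unfolding near(1) e
      by (rule pent_swap[OF M, where ?q0.0 = p4 and ?q1.0 = p3 and ?q2.0 = p2 and ?q3.0 = p1 and ?q4.0 = p0 and ?p0.0 = p2 and ?p1.0 = p1 and ?p2.0 = p0 and ?p3.0 = p4 and ?p4.0 = p3])
        (use near e d na in auto)
  qed
next
  case (far w p3 p1 p4 p2 R s p0)
  show ?thesis
  proof (cases s)
    case True
    then have sT: "s = True" by simp
    have d: "distinct [p0, p2, p3, p4]" by (rule QdD(1)[OF M, of _ _ _ _ w]) (use far(5) sT in simp)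
    show ?thesis unfolding far(1) sT
      by (rule pent_swap[OF M, where ?q0.0 = p1 and ?q1.0 = p2 and ?q2.0 = p3 and ?q3.0 = p4 and ?q4.0 = p0 and ?p0.0 = p0 and ?p1.0 = p1 and ?p2.0 = p2 and ?p3.0 = p3 and ?p4.0 = p4])
        (use far sT d DS_fm[OF M] in auto)
  next
    case False
    then have sF: "s = (\<not> True)" by simp
    have e: "Tri s p0 p1 p2 = Tri True p2 p1 p0" "Qd s p0 p2 p3 p4 w = Qd True p2 p0 p4 p3 w"
      "Tri s p2 p3 p4 = Tri True p4 p3 p2" "Qd s p2 p4 p0 p1 w = Qd True p4 p2 p1 p0 w"
      unfolding sF Tri_flip Qd_flip by (metis Qd_rot)+
    have d: "distinct [p2, p0, p4, p3]" by (rule QdD(1)[OF M, of _ _ _ _ w]) (use far(5) e in simp)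
    have na: "(p4, p2) \<notin> darts M" using far(4) DS_fm[OF M] darts_sym by metis
    show ?thesis unfolding far(1) e
      by (rule pent_swap[OF M, where ?q0.0 = p0 and ?q1.0 = p4 and ?q2.0 = p3 and ?q3.0 = p2 and ?q4.0 = p1 and ?p0.0 = p2 and ?p1.0 = p1 and ?p2.0 = p0 and ?p3.0 = p4 and ?p4.0 = p3])
        (use far e d na in auto)
  qed
next
  case (quad p1 p3 R s p0 p2)
  show ?thesis
  proof (cases s)
    case True
    then have sT: "s = True" by simp
    show ?thesis unfolding quad(1) sT
      by (rule quad_swap[OF M]) (use quad sT DS_fm[OF M] in auto)
  next
    case False
    then have sF: "s = (\<not> True)" by simp
    have e: "Tri s p0 p1 p2 = Tri True p2 p1 p0" "Tri s p0 p2 p3 = Tri True p2 p0 p3"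
      "Tri s p1 p2 p3 = Tri True p1 p3 p2" "Tri s p1 p3 p0 = Tri True p1 p0 p3"
      unfolding sF Tri_flip by (metis Tri_rot)+
    have na: "(p1, p3) \<notin> darts M" using quad(3) DS_fm[OF M] by metis
    show ?thesis
      using quad_swap[OF M, of R p2 p0 p3 p1] quad_swap[OF M, of R p2 p1 p0 p3] quad e na darts_sym[of p3 p1 M]
      by (auto simp: add_mset_commute)
  qed
qed

definition rc :: "nat \<Rightarrow> 'v tface multiset \<Rightarrow> 'v tface multiset \<Rightarrow> bool" where
  "rc n X Y \<longleftrightarrow> (\<exists>k\<le>n. (fl ^^ k) X Y)"

lemma rc_refl [simp]: "rc n X X" unfolding rc_def by (intro exI[of _ 0]) auto

lemma rc_step: "fl X Y \<Longrightarrow> rc (Suc 0) X Y" unfolding rc_def by (intro exI[of _ 1]) auto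

lemma rc_trans: "rc m X Y \<Longrightarrow> rc n Y Z \<Longrightarrow> rc (m + n) X Z"
proof -
  assume "rc m X Y" "rc n Y Z"
  then obtain k l where "k \<le> m" "l \<le> n" "(fl ^^ k) X Y" "(fl ^^ l) Y Z" unfolding rc_def by auto
  then have "(fl ^^ (k + l)) X Z" "k + l \<le> m + n" by (auto simp: relpowp_add)
  then show ?thesis unfolding rc_def by blast
qed

lemma rc_mono: "rc m X Y \<Longrightarrow> m \<le> n \<Longrightarrow> rc n X Y" unfolding rc_def by (meson le_trans)

definition frel :: "nat \<Rightarrow> 'v cmap \<Rightarrow> 'v cmap \<Rightarrow> bool" where
  "frel n M N \<longleftrightarrow> (\<exists>k\<le>n. (flip ^^ k) M N)"

lemma relpow_realize:
  assumes "is_4ppt M" "(fl ^^ k) (fm M) Y"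
  shows "\<exists>M'. (flip ^^ k) M M' \<and> fm M' = Y \<and> is_4ppt M' \<and> verts M' = verts M \<and> outer M' = outer M"
  using assms(2)
proof (induction k arbitrary: Y)
  case 0 then show ?case using assms by auto
next
  case (Suc k)
  then obtain Z where Z: "(fl ^^ k) (fm M) Z" "fl Z Y" by auto
  from Suc.IH[OF Z(1)] obtain M1 where M1: "(flip ^^ k) M M1" "fm M1 = Z" "is_4ppt M1" "verts M1 = verts M" "outer M1 = outer M" by auto
  from fl_realize[OF M1(3)] Z(2) M1(2) obtain M2 where "flip M1 M2" "fm M2 = Y" by auto
  then show ?case using M1 flip_preserves[of M1 M2] by auto
qed

lemma rc_realize:
  assumes "is_4ppt M" "rc n (fm M) Y"
  shows "\<exists>M'. frel n M M' \<and> fm M' = Y \<and> is_4ppt M' \<and> verts M' = verts M \<and> outer M' = outer M"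
  using assms relpow_realize unfolding rc_def frel_def by meson

section \<open>Three-cycles separate\<close>

text \<open>For a set \<open>X\<close> of edges (walls), two darts are linked if they follow each other on a face or are
  the two sides of an edge that is not a wall. One more wall creates at most one more
  component, and none if one end of the wall is not met by the walls built before.\<close>

definition G :: "'v cmap \<Rightarrow> 'v set set \<Rightarrow> (('v \<times> 'v) \<times> ('v \<times> 'v)) set" where
  "G M X = {(d, e). d \<in> darts M \<and> e \<in> darts M \<and>
     (e = fstep M d \<or> d = fstep M e \<or> (e = prod.swap d \<and> {fst d, snd d} \<notin> X))}"

definition comp :: "'v cmap \<Rightarrow> 'v set set \<Rightarrow> ('v \<times> 'v) \<Rightarrow> ('v \<times> 'v) set" where
  "comp M X d = (G M X)\<^sup>* `` {d}"

definition comps :: "'v cmap \<Rightarrow> 'v set set \<Rightarrow> ('v \<times> 'v) set set" where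
  "comps M X = comp M X ` darts M"

lemma G_sym: "sym (G M X)" unfolding G_def sym_def by (auto simp: insert_commute)

lemma comp_refl: "d \<in> comp M X d" by (simp add: comp_def)

lemma comp_eq: "e \<in> comp M X d \<Longrightarrow> comp M X e = comp M X d"
proof -
  assume "e \<in> comp M X d"
  then have 1: "(d, e) \<in> (G M X)\<^sup>*" by (simp add: comp_def)
  then have 2: "(e, d) \<in> (G M X)\<^sup>*" using sym_rtrancl[OF G_sym] by (meson symD)
  show ?thesis unfolding comp_def using 1 2 by (auto intro: rtrancl_trans)
qed

lemma comp_sub:
  assumes "d \<in> S" "\<And>x y. x \<in> S \<Longrightarrow> (x, y) \<in> G M X \<Longrightarrow> y \<in> S" shows "comp M X d \<subseteq> S"
proof
  fix e assume "e \<in> comp M X d"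
  then have "(d, e) \<in> (G M X)\<^sup>*" by (simp add: comp_def)
  then show "e \<in> S" by (induction rule: rtrancl_induct) (use assms in auto)
qed

lemma comp_darts: "d \<in> darts M \<Longrightarrow> comp M X d \<subseteq> darts M"
  by (rule comp_sub) (auto simp: G_def)

lemma comp_step: "e \<in> comp M X d \<Longrightarrow> (e, e') \<in> G M X \<Longrightarrow> e' \<in> comp M X d"
  unfolding comp_def by (auto intro: rtrancl_into_rtrancl)

lemma comps_cong:
  assumes "G M X \<subseteq> (G M Y)\<^sup>*" "Y \<subseteq> X \<or> X \<subseteq> Y" "X \<subseteq> Y"
  shows "comps M X = comps M Y"
proof -
  have "G M Y \<subseteq> G M X" using assms(3) unfolding G_def by auto
  then have "(G M X)\<^sup>* = (G M Y)\<^sup>*" using assms(1) by (metis rtrancl_mono rtrancl_subset_rtrancl subset_antisym)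
  then show ?thesis unfolding comps_def comp_def by simp
qed

locale pmap =
  fixes M :: "'v cmap"
  assumes sg: "simple_graph M" and rs: "rotation_system M" and cg: "connected_graph M"
    and euler: "int (card (verts M)) - int (card (edges M)) + int (card (faces M)) = 2"
begin

lemma fin: "finite (verts M)" "finite (edges M)" "finite (darts M)"
  using sg finite_edges darts_finite by (auto simp: simple_graph_def)

lemma fin_comps: "finite (comps M X)" unfolding comps_def using fin by simp

lemma rot_surj: "u \<in> nbrs M v \<Longrightarrow> \<exists>w\<in>nbrs M v. rot M v w = u"
proof -
  assume u: "u \<in> nbrs M v"
  have "finite (nbrs M v)"
    by (rule finite_subset[OF _ finite_imageI[OF fin(3), of fst]]) (force simp: mem_nbrs)
  moreover have "rot M v ` nbrs M v \<subseteq> nbrs M v" "inj_on (rot M v) (nbrs M v)"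
    using rs unfolding rotation_system_iff cyclic_on_def by auto
  ultimately have "rot M v ` nbrs M v = nbrs M v" by (rule endo_inj_surj)
  then show ?thesis using u by (metis imageE)
qed

text \<open>Removing one link of a graph splits at most one component. A path that used the link
  leaves each of its ends connected to one side of the wall, so apart from the component of
  \<open>(p, q)\<close> distinct new components come from distinct old ones.\<close>

lemma add_wall:
  assumes "e \<in> edges M" shows "card (comps M (insert e X)) \<le> card (comps M X) + 1"
proof -
  let ?Y = "insert e X"
  obtain p q where e: "e = {p, q}" using sg assms unfolding simple_graph_def by metis
  have ab: "(p, q) \<in> darts M" using e assms by (simp add: mem_darts)
  let ?near = "\<lambda>d. (p, q) \<in> comp M ?Y d \<or> (q, p) \<in> comp M ?Y d"
  have path: "d2 \<in> comp M ?Y d1 \<or> (?near d1 \<and> ?near d2)" if "(d1, d2) \<in> (G M X)\<^sup>*" for d1 d2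
    using that
  proof (induction rule: rtrancl_induct)
    case base show ?case by (simp add: comp_refl)
  next
    case (step y z)
    show ?case
    proof (cases "(y, z) \<in> G M ?Y")
      case True
      then have "z \<in> comp M ?Y y" using comp_step[OF comp_refl] by metis
      then have "comp M ?Y z = comp M ?Y y" by (rule comp_eq)
      then show ?thesis using step.IH comp_step True by metis
    next
      case False
      then have yz: "(y = (p, q) \<and> z = (q, p)) \<or> (y = (q, p) \<and> z = (p, q))"
        using step(2) e unfolding G_def by (cases y) (auto simp: doubleton_eq_iff)
      then have n: "?near z" "?near y" using comp_refl by metis+
      have "?near d1" using step.IH yz by metis
      then show ?thesis using n by blast
    qed
  qed
  let ?C = "comp M ?Y (p, q)"
  let ?\<phi> = "\<lambda>D. comp M X (SOME d. d \<in> darts M \<and> D = comp M ?Y d)"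
  have rep: "(SOME d. d \<in> darts M \<and> D = comp M ?Y d) \<in> darts M \<and> D = comp M ?Y (SOME d. d \<in> darts M \<and> D = comp M ?Y d)"
    if "D \<in> comps M ?Y" for D
    using someI_ex[of "\<lambda>d. d \<in> darts M \<and> D = comp M ?Y d"] that unfolding comps_def by blast
  have inj: "inj_on ?\<phi> (comps M ?Y - {?C})"
  proof (rule inj_onI)
    fix D1 D2 assume D: "D1 \<in> comps M ?Y - {?C}" "D2 \<in> comps M ?Y - {?C}" "?\<phi> D1 = ?\<phi> D2"
    define d1 where "d1 = (SOME d. d \<in> darts M \<and> D1 = comp M ?Y d)"
    define d2 where "d2 = (SOME d. d \<in> darts M \<and> D2 = comp M ?Y d)"
    have d1: "D1 = comp M ?Y d1" and d2: "D2 = comp M ?Y d2" using rep D unfolding d1_def d2_def by blast+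
    have "comp M X d1 = comp M X d2" using D(3) unfolding d1_def d2_def .
    then have "(d1, d2) \<in> (G M X)\<^sup>*" using comp_refl[of d2 M X] unfolding comp_def by blast
    from path[OF this] show "D1 = D2"
    proof
      assume "d2 \<in> comp M ?Y d1" then show ?thesis using d1 d2 comp_eq by metis
    next
      assume "?near d1 \<and> ?near d2"
      moreover have "(p, q) \<notin> comp M ?Y d1" "(p, q) \<notin> comp M ?Y d2" using D d1 d2 comp_eq by blast+
      ultimately have "(q, p) \<in> comp M ?Y d1" "(q, p) \<in> comp M ?Y d2" by auto
      then show ?thesis using d1 d2 comp_eq by metis
    qed
  qed
  have "?\<phi> ` (comps M ?Y - {?C}) \<subseteq> comps M X"
  proof
    fix Z assume "Z \<in> ?\<phi> ` (comps M ?Y - {?C})"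
    then obtain D where D: "D \<in> comps M ?Y" "Z = ?\<phi> D" by auto
    from rep[OF D(1)] show "Z \<in> comps M X" unfolding D(2) comps_def by (intro imageI) (rule conjunct1)
  qed
  then have "card (comps M ?Y - {?C}) \<le> card (comps M X)" by (rule card_inj_on_le[OF inj _ fin_comps])
  moreover have "card (comps M ?Y) \<le> card (comps M ?Y - {?C}) + 1"
    using fin_comps[of ?Y] by (cases "?C \<in> comps M ?Y") (simp_all add: card_Suc_Diff1 del: card_Diff_singleton)
  ultimately show ?thesis by linarith
qed

text \<open>One walks around \<open>v\<close> by stepping along a face and crossing the next edge.
  Only the edge to \<open>u\<close> may be a wall, and all others can be crossed.\<close>

lemma around:
  assumes uv: "(u, v) \<in> darts M" and X: "\<And>w. {w, v} \<in> X \<Longrightarrow> w = u"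
  shows "(v, u) \<in> comp M X (u, v)" "(w, v) \<in> darts M \<Longrightarrow> (w, v) \<in> comp M X (u, v)"
proof -
  let ?S = "{w \<in> nbrs M v. (w, v) \<in> comp M X (u, v)}"
  have st: "(v, rot M v w) \<in> comp M X (u, v) \<and> (v, rot M v w) \<in> darts M" if "w \<in> ?S" for w
  proof -
    have w: "(w, v) \<in> darts M" "(w, v) \<in> comp M X (u, v)" using that by (auto simp: mem_nbrs)
    then have d: "(v, rot M v w) \<in> darts M" using fstep_darts[OF rs w(1)] by simp
    then have "((w, v), (v, rot M v w)) \<in> G M X" using w unfolding G_def by auto
    then show ?thesis using w comp_step d by metis
  qed
  have "?S = nbrs M v"
  proof (rule nbrs_closed[OF rs])
    show "?S \<noteq> {}" using uv comp_refl[of "(u, v)"] by (auto simp: mem_nbrs)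
    fix w assume w: "w \<in> ?S"
    let ?w = "rot M v w"
    have wn: "?w \<in> nbrs M v" using st[OF w] darts_sym mem_nbrs by metis
    show "?w \<in> ?S"
    proof (cases "?w = u")
      case True then show ?thesis using wn comp_refl by auto
    next
      case False
      then have "{?w, v} \<notin> X" using X by blast
      then have "((v, ?w), (?w, v)) \<in> G M X" using st[OF w] darts_sym unfolding G_def by (auto simp: insert_commute)
      then show ?thesis using st[OF w] wn comp_step by blast
    qed
  qed auto
  then show "(w, v) \<in> darts M \<Longrightarrow> (w, v) \<in> comp M X (u, v)" for w by (auto simp: mem_nbrs set_eq_iff)
  obtain w where "w \<in> nbrs M v" "rot M v w = u" using rot_surj uv mem_nbrs by metis
  then show "(v, u) \<in> comp M X (u, v)" using st \<open>?S = nbrs M v\<close> by blast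
qed

text \<open>The free end \<open>v\<close> can be walked around, so the two sides of the new wall
  stay linked.\<close>

lemma leaf_wall:
  assumes uv: "{u, v} \<in> edges M" and v: "\<And>e. e \<in> X \<Longrightarrow> v \<notin> e"
  shows "comps M (insert {u, v} X) = comps M X"
proof (rule comps_cong[symmetric])
  let ?Y = "insert {u, v} X"
  have d: "(u, v) \<in> darts M" using uv by (simp add: mem_darts)
  have "(v, u) \<in> comp M ?Y (u, v)"
    by (rule around(1)[OF d]) (use v in \<open>auto simp: doubleton_eq_iff\<close>)
  then have 1: "((u, v), (v, u)) \<in> (G M ?Y)\<^sup>*" by (simp add: comp_def)
  then have 2: "((v, u), (u, v)) \<in> (G M ?Y)\<^sup>*" using sym_rtrancl[OF G_sym] by (meson symD)
  show "G M X \<subseteq> (G M ?Y)\<^sup>*"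
  proof clarify
    fix a b a' b' assume g: "((a, b), (a', b')) \<in> G M X"
    show "((a, b), (a', b')) \<in> (G M ?Y)\<^sup>*"
    proof (cases "((a, b), (a', b')) \<in> G M ?Y")
      case False
      then have "(a = u \<and> b = v \<and> a' = v \<and> b' = u) \<or> (a = v \<and> b = u \<and> a' = u \<and> b' = v)"
        using g unfolding G_def by (auto simp: doubleton_eq_iff)
      then show ?thesis using 1 2 by auto
    qed auto
  qed
qed auto

lemma comps_empty: "d0 \<in> darts M \<Longrightarrow> comps M {} = {darts M}"
proof -
  assume d0: "d0 \<in> darts M"
  let ?C = "comp M {} d0"
  have sw: "(v, u) \<in> ?C" if "(u, v) \<in> ?C" for u v
  proof -
    have d: "(u, v) \<in> darts M" using that comp_darts[OF d0] by auto
    then have "((u, v), (v, u)) \<in> G M {}" using darts_sym unfolding G_def by auto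
    then show ?thesis using that comp_step by metis
  qed
  have all: "(w, v) \<in> ?C" if "(u, v) \<in> ?C" "(w, v) \<in> darts M" for u v w
  proof -
    have d: "(u, v) \<in> darts M" using that comp_darts[OF d0] by auto
    have "(w, v) \<in> comp M {} (u, v)" by (rule around(2)[OF d _ that(2)]) auto
    then show ?thesis using comp_eq[OF that(1)] by simp
  qed
  let ?S = "{v \<in> verts M. \<exists>u. (u, v) \<in> ?C}"
  have S: "?S = verts M"
  proof (rule verts_closed[OF sg cg])
    have "d0 \<in> ?C" by (rule comp_refl)
    then show "?S \<noteq> {}" using darts_verts[OF sg] d0 by (cases d0) auto
    fix u v assume u: "u \<in> ?S" and uv: "(u, v) \<in> darts M"
    then obtain t where "(t, u) \<in> ?C" by auto
    then have "(v, u) \<in> ?C" using all darts_sym[OF uv] by metis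
    then show "v \<in> ?S" using sw darts_verts[OF sg uv] by auto
  qed auto
  have "?C = darts M"
  proof
    show "?C \<subseteq> darts M" using comp_darts[OF d0] .
    show "darts M \<subseteq> ?C"
    proof
      fix d assume d: "d \<in> darts M"
      obtain u v where uv: "d = (u, v)" by (cases d)
      have "v \<in> ?S" using S darts_verts[OF sg] d uv by auto
      then show "d \<in> ?C" using all d uv by auto
    qed
  qed
  then have "comp M {} d = darts M" if "d \<in> darts M" for d using that comp_eq by metis
  then show ?thesis unfolding comps_def using d0 by auto
qed

lemma comps_faces: "comps M (edges M) = faces M"
proof -
  have "comp M (edges M) d = face M d" if d: "d \<in> darts M" for d
  proof
    show "comp M (edges M) d \<subseteq> face M d"
    proof (rule comp_sub[OF self_in_face])
      fix x y assume x: "x \<in> face M d" and xy: "(x, y) \<in> G M (edges M)"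
      have "y = fstep M x \<or> x = fstep M y" "y \<in> darts M"
        using xy unfolding G_def by (cases x, auto simp: mem_darts)+
      then show "y \<in> face M d" using x face_step faces_step_back[OF sg rs face_in_faces[OF d]] by metis
    qed
    show "face M d \<subseteq> comp M (edges M) d"
    proof (rule face_subset_closed[OF comp_refl])
      fix e assume e: "e \<in> comp M (edges M) d"
      then have "e \<in> darts M" using comp_darts[OF d] by auto
      then have "(e, fstep M e) \<in> G M (edges M)" using fstep_darts[OF rs] unfolding G_def by auto
      then show "fstep M e \<in> comp M (edges M) d" using e comp_step by metis
    qed
  qed
  then show ?thesis unfolding comps_def faces_def by auto
qed

lemma add_walls:
  assumes "finite Z" "Z \<subseteq> edges M" shows "card (comps M (X \<union> Z)) \<le> card (comps M X) + card Z"
  using assms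
proof (induction Z)
  case (insert e Z)
  have "card (comps M (insert e (X \<union> Z))) \<le> card (comps M (X \<union> Z)) + 1"
    by (rule add_wall) (use insert in auto)
  then show ?case using insert by auto
qed simp

lemma grow_walls:
  assumes "finite N" "X \<subseteq> Y" "Y \<subseteq> edges M" "\<And>e. e \<in> X \<Longrightarrow> e \<subseteq> W" "\<And>e. e \<in> Y \<Longrightarrow> e \<subseteq> W \<union> N" "W \<inter> N = {}"
    "\<And>v. v \<in> N \<Longrightarrow> \<exists>w\<in>W. (w, v) \<in> {(a, b). {a, b} \<in> Y}\<^sup>*"
  shows "card (comps M Y) + card N \<le> card (comps M X) + card (Y - X)"
  using assms
proof (induction "card N" arbitrary: N X W)
  case 0
  then have "N = {}" by auto
  moreover have "card (comps M (X \<union> (Y - X))) \<le> card (comps M X) + card (Y - X)"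
    by (rule add_walls) (use 0 fin in \<open>auto intro: finite_subset\<close>)
  ultimately show ?case using 0 by (simp add: Un_absorb1)
next
  case (Suc n)
  then obtain v0 where v0: "v0 \<in> N" by fastforce
  then obtain w0 where w0: "w0 \<in> W" "(w0, v0) \<in> {(a, b). {a, b} \<in> Y}\<^sup>*" using Suc.prems(7) by blast
  have "\<exists>u v. u \<in> W \<and> v \<notin> W \<and> {u, v} \<in> Y"
  proof (rule ccontr)
    assume n: "\<not> ?thesis"
    have "v0 \<in> W" using w0(2) by (induction rule: rtrancl_induct) (use w0 n in auto)
    then show False using v0 Suc.prems(6) by auto
  qed
  then obtain u v where uv: "u \<in> W" "v \<notin> W" "{u, v} \<in> Y" by auto
  then have vN: "v \<in> N" using Suc.prems(5)[OF uv(3)] by auto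
  have nX: "{u, v} \<notin> X" using Suc.prems(4) uv by auto
  have finY: "finite (Y - X)" using Suc.prems(3) fin finite_subset by blast
  have c: "card (Y - X) = Suc (card (Y - insert {u, v} X))"
  proof -
    have "Y - insert {u, v} X = (Y - X) - {{u, v}}" by auto
    then show ?thesis using uv nX finY card_Suc_Diff1[OF finY, of "{u, v}"] by auto
  qed
  have lw: "comps M (insert {u, v} X) = comps M X"
    by (rule leaf_wall) (use uv Suc.prems in auto)
  have "card (comps M Y) + card (N - {v}) \<le> card (comps M (insert {u, v} X)) + card (Y - insert {u, v} X)"
  proof (rule Suc.hyps(1)[where W = "insert v W"])
    show "n = card (N - {v})" using Suc.hyps(2) vN Suc.prems(1) by (simp add: card_Diff_singleton)
    show "\<And>e. e \<in> Y \<Longrightarrow> e \<subseteq> insert v W \<union> (N - {v})" using Suc.prems(5) by blast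
    show "\<And>e. e \<in> insert {u, v} X \<Longrightarrow> e \<subseteq> insert v W" using Suc.prems(4) uv by auto
    show "\<And>w. w \<in> N - {v} \<Longrightarrow> \<exists>z\<in>insert v W. (z, w) \<in> {(a, b). {a, b} \<in> Y}\<^sup>*" using Suc.prems(7) by blast
  qed (use Suc.prems uv in auto)
  moreover have "card N = Suc (card (N - {v}))" using vN Suc.prems(1) by (metis card_Suc_Diff1)
  ultimately show ?case using c lw by simp
qed

end

section \<open>The Jordan theorem for three-cycles and the count of the inside\<close>

definition cyc3 :: "'v \<Rightarrow> 'v \<Rightarrow> 'v \<Rightarrow> 'v set set" where
  "cyc3 p q r = {{p, q}, {q, r}, {r, p}}"

text \<open>The darts of the faces on one side of a three-cycle.\<close>
definition side :: "'v cmap \<Rightarrow> 'v \<Rightarrow> 'v \<Rightarrow> 'v \<Rightarrow> ('v \<times> 'v) set \<Rightarrow> bool" where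
  "side M p q r J \<longleftrightarrow> J \<subseteq> darts M \<and> (\<forall>d\<in>darts M. d \<in> J \<longleftrightarrow> fstep M d \<in> J) \<and>
     (\<forall>u v. (u, v) \<in> darts M \<longrightarrow> ((u, v) \<in> J \<longleftrightarrow> ((v, u) \<in> J \<longleftrightarrow> {u, v} \<notin> cyc3 p q r)))"

lemma sideD:
  assumes "side M p q r J"
  shows "J \<subseteq> darts M" "d \<in> darts M \<Longrightarrow> d \<in> J \<longleftrightarrow> fstep M d \<in> J"
    "(u, v) \<in> darts M \<Longrightarrow> (u, v) \<in> J \<longleftrightarrow> ((v, u) \<in> J \<longleftrightarrow> {u, v} \<notin> cyc3 p q r)"
  using assms unfolding side_def by blast+

lemma cyc3_rot: "cyc3 p q r = cyc3 q r p" "cyc3 p q r = cyc3 q p r"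
  unfolding cyc3_def by (auto simp: insert_commute)

lemma side_rot: "side M p q r J \<longleftrightarrow> side M q r p J" "side M p q r J \<longleftrightarrow> side M q p r J"
  unfolding side_def cyc3_rot(1)[of p q r] by simp (simp add: cyc3_rot(2)[of q p r] cyc3_rot(1)[of p q r, symmetric])

lemma card_darts_of:
  assumes "finite E" "\<And>e. e \<in> E \<Longrightarrow> \<exists>u v. u \<noteq> v \<and> e = {u, v}"
  shows "finite {(u, v). {u, v} \<in> E} \<and> card {(u, v). {u, v} \<in> E} = 2 * card E"
  using assms
proof (induction E)
  case (insert e E)
  obtain u v where uv: "u \<noteq> v" "e = {u, v}" using insert.prems by blast
  have "{(a, b). {a, b} \<in> insert e E} = {(u, v), (v, u)} \<union> {(a, b). {a, b} \<in> E}"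
    using uv by (auto simp: doubleton_eq_iff)
  moreover have "{(u, v), (v, u)} \<inter> {(a, b). {a, b} \<in> E} = {}"
    using insert.hyps uv by (auto simp: insert_commute)
  moreover have "card {(u, v), (v, u)} = 2" using uv by simp
  moreover have "finite {(u, v). {u, v} \<in> E} \<and> card {(u, v). {u, v} \<in> E} = 2 * card E"
    using insert by blast
  ultimately show ?case
    using insert.hyps card_Un_disjoint[of "{(u, v), (v, u)}" "{(a, b). {a, b} \<in> E}"] by auto
qed simp

context pmap begin

lemma comps_path:
  assumes "{p, q} \<in> edges M" "{q, r} \<in> edges M" "distinct [p, q, r]"
  shows "card (comps M {{p, q}, {q, r}}) = 1"
proof -
  have "comps M {{q, r}, {p, q}} = comps M {{p, q}}"
    by (rule leaf_wall) (use assms in auto)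
  also have "\<dots> = comps M {}" by (rule leaf_wall) (use assms in auto)
  also have "\<dots> = {darts M}" using comps_empty[of "(p, q)"] assms by (simp add: mem_darts)
  finally show ?thesis by (simp add: insert_commute)
qed

lemma reach_all: "u \<in> verts M \<Longrightarrow> v \<in> verts M \<Longrightarrow> (u, v) \<in> {(a, b). {a, b} \<in> edges M}\<^sup>*"
  using cg unfolding connected_graph_def darts_def by simp

lemma edge_verts: "e \<in> edges M \<Longrightarrow> e \<subseteq> verts M"
  using sg unfolding simple_graph_def by fastforce

lemma side_vertex:
  assumes J: "side M p q r J" and y: "y \<notin> {p, q, r}" and a: "(a, y) \<in> J \<or> (y, a) \<in> J" and u: "(u, y) \<in> darts M"
  shows "(u, y) \<in> J" "(y, u) \<in> J"
proof -
  have c: "{w, y} \<notin> cyc3 p q r" for w using y unfolding cyc3_def by (auto simp: doubleton_eq_iff)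
  have sym: "(w, y) \<in> J \<longleftrightarrow> (y, w) \<in> J" if "(w, y) \<in> darts M" for w
    using J that c unfolding side_def by auto
  let ?S = "{w \<in> nbrs M y. (w, y) \<in> J}"
  have "?S = nbrs M y"
  proof (rule nbrs_closed[OF rs])
    have "(a, y) \<in> darts M" using a sideD(1)[OF J] darts_sym[of y a M] by auto
    then show "?S \<noteq> {}" using a sym by (auto simp: mem_nbrs)
    fix w assume w: "w \<in> ?S"
    then have d: "(w, y) \<in> darts M" by (simp add: mem_nbrs)
    then have "fstep M (w, y) \<in> J" "fstep M (w, y) \<in> darts M" using w sideD(2)[OF J d] fstep_darts[OF rs d] by auto
    then show "rot M y w \<in> ?S" using sym[of "rot M y w"] darts_sym[of y "rot M y w" M] by (auto simp: mem_nbrs)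
  qed auto
  moreover have "u \<in> nbrs M y" using u by (simp add: mem_nbrs)
  ultimately have "u \<in> ?S" by metis
  then show "(u, y) \<in> J" by simp
  then show "(y, u) \<in> J" using sym u by simp
qed

text \<open>Growing the walls from the cycle to all edges and comparing with Euler's formula gives
  at least two components. Two of the cycle edges form a path, which leaves one component, and the
  closing edge adds at most one. So there are exactly two, and \<open>J\<close> is the one without
  \<open>d0\<close>; the last clause records that the other one is connected.\<close>

theorem jordan:
  assumes e: "{p, q} \<in> edges M" "{q, r} \<in> edges M" "{r, p} \<in> edges M" and d: "distinct [p, q, r]"
    and d0: "d0 \<in> darts M"
  obtains J where "side M p q r J" "d0 \<notin> J"
    "\<And>S. S \<subseteq> darts M - J \<Longrightarrow> S \<noteq> {} \<Longrightarrow> (\<And>d. d \<in> S \<Longrightarrow> fstep M d \<in> S) \<Longrightarrow>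
       (\<And>u v. (u, v) \<in> S \<Longrightarrow> {u, v} \<notin> cyc3 p q r \<Longrightarrow> (v, u) \<in> S) \<Longrightarrow> S = darts M - J"
proof -
  let ?C = "cyc3 p q r"
  have paths: "card (comps M {{p, q}, {q, r}}) = 1" "card (comps M {{q, r}, {r, p}}) = 1" "card (comps M {{r, p}, {p, q}}) = 1"
    using comps_path[OF e(1,2)] comps_path[OF e(2,3)] comps_path[OF e(3,1)] d by auto
  have C: "?C = insert {r, p} {{p, q}, {q, r}}" "?C = insert {p, q} {{q, r}, {r, p}}" "?C = insert {q, r} {{r, p}, {p, q}}"
    unfolding cyc3_def by auto
  have up: "card (comps M ?C) \<le> 2" using add_wall[OF e(3), of "{{p, q}, {q, r}}"] paths(1) unfolding C(1) by simp
  have vs: "{p, q, r} \<subseteq> verts M" using edge_verts[OF e(1)] edge_verts[OF e(2)] by auto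
  have c3: "card ?C = 3" using d unfolding cyc3_def by (auto simp: card_insert_if doubleton_eq_iff)
  have Ce: "?C \<subseteq> edges M" using e unfolding cyc3_def by auto
  have "card (comps M (edges M)) + card (verts M - {p, q, r}) \<le> card (comps M ?C) + card (edges M - ?C)"
  proof (rule grow_walls[where W = "{p, q, r}"])
    show "finite (verts M - {p, q, r})" using fin by simp
    show "\<And>e. e \<in> ?C \<Longrightarrow> e \<subseteq> {p, q, r}" unfolding cyc3_def by auto
    show "\<And>e. e \<in> edges M \<Longrightarrow> e \<subseteq> {p, q, r} \<union> (verts M - {p, q, r})" using edge_verts by blast
    show "\<And>v. v \<in> verts M - {p, q, r} \<Longrightarrow> \<exists>w\<in>{p, q, r}. (w, v) \<in> {(a, b). {a, b} \<in> edges M}\<^sup>*"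
      using reach_all vs by blast
  qed (use Ce in auto)
  moreover have "card (verts M - {p, q, r}) = card (verts M) - 3" "3 \<le> card (verts M)"
    using vs fin(1) d card_mono[OF fin(1) vs] by (simp_all add: card_Diff_subset)
  moreover have "card (edges M - ?C) = card (edges M) - 3" "3 \<le> card (edges M)"
    using card_Diff_subset[OF _ Ce] card_mono[OF fin(2) Ce] c3 fin(2) Ce finite_subset by metis+
  ultimately have "card (comps M ?C) \<ge> 2" using comps_faces euler by simp
  with up have two: "card (comps M ?C) = 2" by simp
  let ?D = "comp M ?C d0"
  have in_comps: "comp M ?C d \<in> comps M ?C" if "d \<in> darts M" for d using that by (simp add: comps_def)
  obtain J where J: "comps M ?C = {?D, J}" "J \<noteq> ?D"
  proof -
    obtain A B where AB: "comps M ?C = {A, B}" "A \<noteq> B" using two by (meson card_2_iff)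
    have "?D = A \<or> ?D = B" using in_comps[OF d0] AB by auto
    then show ?thesis using AB that[of A] that[of B] by (auto simp: insert_commute)
  qed
  have Jc: "J = darts M - ?D"
  proof -
    have "J \<in> comps M ?C" using J by auto
    then obtain j where j: "j \<in> darts M" "J = comp M ?C j" unfolding comps_def by auto
    have "x \<notin> ?D" if "x \<in> J" for x using that j J(2) comp_eq by metis
    moreover have "x \<in> J" if "x \<in> darts M" "x \<notin> ?D" for x
      using in_comps[OF that(1)] J(1) comp_refl[of x M ?C] that(2) by auto
    ultimately show ?thesis using comp_darts[OF j(1)] j by blast
  qed
  have Jf: "x \<in> ?D \<longleftrightarrow> y \<in> ?D" if "(x, y) \<in> G M ?C" for x y
    using that comp_step[of x M ?C d0 y] comp_step[of y M ?C d0 x] G_sym[of M ?C] by (meson symD)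
  \<comment> \<open>If both sides of a cycle edge lay in one component, removing that wall would
    change nothing, but the remaining path has a single component.\<close>
  have sepe: "(u, v) \<in> ?D \<longleftrightarrow> (v, u) \<notin> ?D" if uv: "(u, v) \<in> darts M" "{u, v} \<in> ?C" for u v
  proof (rule ccontr)
    assume n: "\<not> ?thesis"
    have dd: "(v, u) \<in> darts M" using darts_sym uv by metis
    have same: "comp M ?C (u, v) = comp M ?C (v, u)"
    proof (cases "(u, v) \<in> ?D")
      case True then show ?thesis using n comp_eq by metis
    next
      case False
      then have "comp M ?C (u, v) \<noteq> ?D" "comp M ?C (v, u) \<noteq> ?D" using n comp_refl by metis+
      then show ?thesis using in_comps[OF uv(1)] in_comps[OF dd] J(1) by auto
    qed
    have "\<exists>X. ?C = insert {u, v} X \<and> card (comps M X) = 1"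
      using uv(2) C paths by (metis (no_types, lifting) cyc3_def insertE singletonD)
    then obtain X where X: "?C = insert {u, v} X" "card (comps M X) = 1" by auto
    have "comps M X = comps M ?C"
    proof (rule comps_cong)
      have 1: "((u, v), (v, u)) \<in> (G M ?C)\<^sup>*" "((v, u), (u, v)) \<in> (G M ?C)\<^sup>*"
        using same comp_refl[of _ M ?C] unfolding comp_def by blast+
      show "G M X \<subseteq> (G M ?C)\<^sup>*"
      proof clarify
        fix a b a' b' assume g: "((a, b), (a', b')) \<in> G M X"
        show "((a, b), (a', b')) \<in> (G M ?C)\<^sup>*"
        proof (cases "((a, b), (a', b')) \<in> G M ?C")
          case False
          then have "(a = u \<and> b = v \<and> a' = v \<and> b' = u) \<or> (a = v \<and> b = u \<and> a' = u \<and> b' = v)"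
            using g X unfolding G_def by (auto simp: doubleton_eq_iff)
          then show ?thesis using 1 by auto
        qed auto
      qed
    qed (use X in auto)
    then show False using X two by simp
  qed
  have "side M p q r J"
    unfolding side_def
  proof (intro conjI ballI allI impI)
    show "J \<subseteq> darts M" using Jc by auto
    fix d assume d: "d \<in> darts M"
    then have "(d, fstep M d) \<in> G M ?C" using fstep_darts[OF rs d] unfolding G_def by auto
    then show "d \<in> J \<longleftrightarrow> fstep M d \<in> J" using Jf Jc d fstep_darts[OF rs d] by auto
  next
    fix u v assume uv: "(u, v) \<in> darts M"
    then have vu: "(v, u) \<in> darts M" using darts_sym by metis
    show "(u, v) \<in> J \<longleftrightarrow> ((v, u) \<in> J \<longleftrightarrow> {u, v} \<notin> ?C)"
    proof (cases "{u, v} \<in> ?C")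
      case True then show ?thesis using sepe[OF uv] Jc uv vu by auto
    next
      case False
      then have "((u, v), (v, u)) \<in> G M ?C" using uv vu unfolding G_def by auto
      then show ?thesis using Jf Jc uv vu False by auto
    qed
  qed
  moreover have "d0 \<notin> J" using Jc comp_refl[of d0 M ?C] by auto
  moreover have "S = darts M - J" if S: "S \<subseteq> darts M - J" "S \<noteq> {}" "\<And>d. d \<in> S \<Longrightarrow> fstep M d \<in> S"
       "\<And>u v. (u, v) \<in> S \<Longrightarrow> {u, v} \<notin> ?C \<Longrightarrow> (v, u) \<in> S" for S
  proof -
    obtain s where s: "s \<in> S" using S by auto
    have sD: "s \<in> ?D" "s \<in> darts M" using s S Jc by auto
    have "comp M ?C s \<subseteq> S"
    proof (rule comp_sub[OF s])
      fix x y assume x: "x \<in> S" and xy: "(x, y) \<in> G M ?C"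
      then consider "y = fstep M x" | "x = fstep M y" | "y = prod.swap x" "{fst x, snd x} \<notin> ?C"
        unfolding G_def by auto
      then show "y \<in> S"
      proof cases
        case 2
        have yd: "y \<in> darts M" "x \<in> darts M" using xy unfolding G_def by auto
        have "face M x \<subseteq> S" by (rule face_subset_closed[OF x]) (rule S(3))
        moreover have "y \<in> face M x"
          by (rule faces_step_back[OF sg rs face_in_faces[OF yd(2)] yd(1)]) (use 2 self_in_face in metis)
        ultimately show ?thesis by auto
      qed (use x S(3,4) in \<open>auto simp: prod.swap_def\<close>)
    qed
    then show ?thesis using comp_eq[OF sD(1)] S(1) Jc comp_darts[OF d0] by auto
  qed
  ultimately show ?thesis using that by blast
qed

text \<open>The rotation at \<open>q\<close> sends the darts of \<open>J\<close> into
  \<open>q\<close> injectively to darts of \<open>J\<close> out of \<open>q\<close>. If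
  \<open>J\<close> contained \<open>(p, q)\<close> but not \<open>(q, r)\<close>, the outgoing darts
  would be missing at both \<open>p\<close> and \<open>r\<close> and be too few.\<close>

lemma side_balance:
  assumes J: "side M p q r J" and e: "{p, q} \<in> edges M" "{q, r} \<in> edges M" and d: "distinct [p, q, r]"
    and pq: "(p, q) \<in> J"
  shows "(q, r) \<in> J"
proof (rule ccontr)
  assume n: "(q, r) \<notin> J"
  let ?I = "{u. (u, q) \<in> J}" and ?O = "{u. (q, u) \<in> J}"
  have sd: "\<And>u. (u, q) \<in> darts M \<Longrightarrow> (u, q) \<in> J \<longleftrightarrow> ((q, u) \<in> J \<longleftrightarrow> {u, q} \<notin> cyc3 p q r)"
    and JD: "J \<subseteq> darts M" using J unfolding side_def by auto
  have dd: "(r, q) \<in> darts M" "(p, q) \<in> darts M" using e by (auto simp: mem_darts insert_commute)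
  have c: "{p, q} \<in> cyc3 p q r" "{r, q} \<in> cyc3 p q r" by (auto simp: cyc3_def)
  have rq: "(r, q) \<in> J" "(q, p) \<notin> J" using sd[OF dd(1)] sd[OF dd(2)] c n pq by auto
  have fI: "finite ?I" using JD fin(3) by (intro finite_subset[OF _ finite_imageI[OF fin(3), of fst]]) force
  have inj: "inj_on (rot M q) ?I" by (rule inj_on_subset[OF rot_inj[OF rs]]) simp
  have "rot M q ` ?I \<subseteq> ?O"
  proof
    fix x assume "x \<in> rot M q ` ?I"
    then obtain u where u: "(u, q) \<in> J" "x = rot M q u" by auto
    then have "fstep M (u, q) \<in> J" using sideD(2)[OF J, of "(u, q)"] subsetD[OF JD u(1)] by simp
    then show "x \<in> ?O" using u by simp
  qed
  moreover have OI: "?O \<subseteq> ?I - {p, r}"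
  proof
    fix u assume "u \<in> ?O"
    then have u: "(q, u) \<in> J" by simp
    then have ud: "(u, q) \<in> darts M" using subsetD[OF JD u] darts_sym by metis
    have "u \<noteq> p" "u \<noteq> r" using u rq n by auto
    then have "{u, q} \<notin> cyc3 p q r" using d by (auto simp: cyc3_def doubleton_eq_iff)
    then show "u \<in> ?I - {p, r}" using sd[OF ud] u \<open>u \<noteq> p\<close> \<open>u \<noteq> r\<close> by simp
  qed
  ultimately have "card ?I \<le> card (?I - {p, r})"
    using card_inj_on_le[OF inj] fI by (meson finite_Diff subset_trans)
  moreover have "card (?I - {p, r}) < card ?I" using pq fI by (intro psubset_card_mono) auto
  ultimately show False by simp
qed

lemma side_orient:
  assumes J: "side M p q r J" and e: "{p, q} \<in> edges M" "{q, r} \<in> edges M" "{r, p} \<in> edges M" and d: "distinct [p, q, r]"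
  shows "{(u, v) \<in> J. {u, v} \<in> cyc3 p q r} = {(p, q), (q, r), (r, p)} \<or>
    {(u, v) \<in> J. {u, v} \<in> cyc3 p q r} = {(q, p), (r, q), (p, r)}"
proof -
  have c: "{p, q} \<in> cyc3 p q r" "{q, r} \<in> cyc3 p q r" "{r, p} \<in> cyc3 p q r" by (simp_all add: cyc3_def)
  have x: "(p, q) \<in> J \<longleftrightarrow> (q, p) \<notin> J" "(q, r) \<in> J \<longleftrightarrow> (r, q) \<notin> J" "(r, p) \<in> J \<longleftrightarrow> (p, r) \<notin> J"
    using sideD(3)[OF J, of p q] sideD(3)[OF J, of q r] sideD(3)[OF J, of r p] c e by (auto simp: mem_darts)
  have J2: "side M q r p J" "side M r p q J" using J side_rot by metis+
  have b: "(p, q) \<in> J \<Longrightarrow> (q, r) \<in> J" "(q, r) \<in> J \<Longrightarrow> (r, p) \<in> J" "(r, p) \<in> J \<Longrightarrow> (p, q) \<in> J"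
    using side_balance[OF J e(1,2)] side_balance[OF J2(1) e(2,3)] side_balance[OF J2(2) e(3,1)] d by auto
  have s: "{(u, v) \<in> J. {u, v} \<in> cyc3 p q r} = J \<inter> {(p, q), (q, p), (q, r), (r, q), (r, p), (p, r)}"
    unfolding cyc3_def by (auto simp: doubleton_eq_iff)
  show ?thesis unfolding s using x b by (cases "(p, q) \<in> J") auto
qed

lemma side_face: "side M p q r J \<Longrightarrow> f \<in> faces M \<Longrightarrow> d \<in> f \<Longrightarrow> d \<in> J \<Longrightarrow> f \<subseteq> J"
proof -
  assume J: "side M p q r J" and f: "f \<in> faces M" and d: "d \<in> f" "d \<in> J"
  have "face M d \<subseteq> J"
    by (rule face_subset_closed[OF d(2)]) (use sideD(1)[OF J] sideD(2)[OF J] in blast)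
  then show ?thesis using faces_partition(1)[OF sg rs f d(1)] by simp
qed

end

lemma pmap_4ppt: "is_4ppt M \<Longrightarrow> pmap M"
  by unfold_locales (use is_4pptD in blast)+

text \<open>Let \<open>F\<close>, \<open>V\<close>, \<open>E\<close> count faces, vertices and edges
  inside, \<open>r\<close> the reflex angles inside and \<open>c\<close> those among them at corners
  of the cycle. Walls give \<open>F + V = E + 1\<close>, counting darts gives
  \<open>3 F + r = 2 E + 3\<close>, and pointedness gives \<open>r = V + c\<close>. The triangles
  number \<open>F - r\<close>, and these equations yield \<open>F - r + 2 c = 1\<close>, which
  forces \<open>c = 0\<close>.\<close>

theorem side_count:
  assumes M: "is_4ppt M" and J: "side M p q r J" and out: "outer M \<inter> J = {}"
    and e: "{p, q} \<in> edges M" "{q, r} \<in> edges M" "{r, p} \<in> edges M" and d: "distinct [p, q, r]"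
    and conn: "\<And>S. S \<subseteq> darts M - J \<Longrightarrow> S \<noteq> {} \<Longrightarrow> (\<And>d. d \<in> S \<Longrightarrow> fstep M d \<in> S) \<Longrightarrow>
       (\<And>u v. (u, v) \<in> S \<Longrightarrow> {u, v} \<notin> cyc3 p q r \<Longrightarrow> (v, u) \<in> S) \<Longrightarrow> S = darts M - J"
  shows "\<And>d. d \<in> J \<Longrightarrow> snd d \<in> {p, q, r} \<Longrightarrow> \<not> reflex M d" "card {f \<in> faces M. f \<subseteq> J \<and> card f = 3} = 1"
proof -
  interpret pmap M by (rule pmap_4ppt[OF M])
  note D = is_4pptD[OF M]
  note JD = sideD(1)[OF J] and Jf = sideD(2)[OF J] and Js = sideD(3)[OF J]
  let ?C = "cyc3 p q r"
  define EJ where "EJ = {e \<in> edges M - ?C. \<exists>u v. e = {u, v} \<and> (u, v) \<in> J}"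
  define VJ where "VJ = {v \<in> verts M - {p, q, r}. \<exists>u. (u, v) \<in> J}"
  define FJ where "FJ = {f \<in> faces M. f \<subseteq> J}"
  let ?X = "?C \<union> EJ"
  have vs: "{p, q, r} \<subseteq> verts M" using edge_verts[OF e(1)] edge_verts[OF e(2)] by auto
  have c3: "card ?C = 3" "finite ?C" using d unfolding cyc3_def by (auto simp: card_insert_if doubleton_eq_iff)
  have Ce: "?C \<subseteq> edges M" using e unfolding cyc3_def by auto
  have fF: "finite FJ" "finite VJ" "finite EJ" "finite J"
    unfolding FJ_def VJ_def EJ_def using finite_faces[OF sg] fin finite_subset[OF JD] by auto
  have disjEC: "EJ \<inter> ?C = {}" and EJe: "EJ \<subseteq> edges M" unfolding EJ_def by auto
  have cross: "(u, v) \<in> J \<longleftrightarrow> (v, u) \<in> J" if "(u, v) \<in> darts M" "{u, v} \<notin> ?C" for u v using Js that by auto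
  have inEJ: "{u, v} \<in> EJ \<longleftrightarrow> (u, v) \<in> J \<and> {u, v} \<notin> ?C" for u v
  proof
    assume a: "{u, v} \<in> EJ"
    then obtain u' v' where "{u, v} = {u', v'}" "(u', v') \<in> J" unfolding EJ_def by auto
    moreover then have "(u', v') \<in> darts M" using JD by auto
    moreover have "{u', v'} \<notin> ?C" using a calculation(1) unfolding EJ_def by simp
    ultimately show "(u, v) \<in> J \<and> {u, v} \<notin> ?C" using a cross[of u' v'] unfolding EJ_def by (auto simp: doubleton_eq_iff)
  next
    assume "(u, v) \<in> J \<and> {u, v} \<notin> ?C"
    then show "{u, v} \<in> EJ" using JD unfolding EJ_def by (auto simp: mem_darts[symmetric])
  qed
  obtain o1 where o1: "o1 \<in> outer M" using D(11) by (metis card.empty equals0I not_numeral_le_zero)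
  then have o1d: "o1 \<in> darts M" "o1 \<notin> J" using faces_partition(2)[OF D(1,2,5)] out by auto
  have cJ: "comp M ?X x = face M x" if x: "x \<in> J" for x
  proof
    have xd: "x \<in> darts M" using x JD by auto
    have fx: "face M x \<subseteq> J" by (rule side_face[OF J face_in_faces[OF xd] self_in_face x])
    show "comp M ?X x \<subseteq> face M x"
    proof (rule comp_sub[OF self_in_face])
      fix y z assume y: "y \<in> face M x" and yz: "(y, z) \<in> G M ?X"
      then have "\<not> (z = prod.swap y \<and> {fst y, snd y} \<notin> ?X)" using fx inEJ by (cases y) auto
      then have "z = fstep M y \<or> y = fstep M z" "z \<in> darts M" using yz unfolding G_def by auto
      then show "z \<in> face M x" using y face_step faces_step_back[OF sg rs face_in_faces[OF xd]] by metis
    qed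
    show "face M x \<subseteq> comp M ?X x"
    proof (rule face_subset_closed[OF comp_refl])
      fix y assume y: "y \<in> comp M ?X x"
      then have "y \<in> darts M" using comp_darts[OF xd] by auto
      then have "(y, fstep M y) \<in> G M ?X" using fstep_darts[OF rs] unfolding G_def by auto
      then show "fstep M y \<in> comp M ?X x" using y comp_step by metis
    qed
  qed
  have cJ': "comp M ?X x = darts M - J" if x: "x \<in> darts M - J" for x
  proof (rule conn)
    show sub: "comp M ?X x \<subseteq> darts M - J"
    proof (rule comp_sub[OF x])
      fix y z assume y: "y \<in> darts M - J" and yz: "(y, z) \<in> G M ?X"
      then have "z \<in> darts M" unfolding G_def by auto
      moreover have "z \<notin> J" using y yz Jf[of y] Jf[of z] cross[of "fst y" "snd y"] unfolding G_def by (cases y) auto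
      ultimately show "z \<in> darts M - J" by simp
    qed
    show "comp M ?X x \<noteq> {}" using comp_refl[of x M ?X] by auto
    fix y assume y: "y \<in> comp M ?X x"
    then have "y \<in> darts M" using sub by blast
    then have "(y, fstep M y) \<in> G M ?X" using fstep_darts[OF rs] unfolding G_def by blast
    then show "fstep M y \<in> comp M ?X x" using y comp_step by metis
  next
    fix u v assume uv: "(u, v) \<in> comp M ?X x" "{u, v} \<notin> ?C"
    have "comp M ?X x \<subseteq> darts M - J"
    proof (rule comp_sub[OF x])
      fix y z assume y: "y \<in> darts M - J" and yz: "(y, z) \<in> G M ?X"
      then have "z \<in> darts M" unfolding G_def by auto
      moreover have "z \<notin> J" using y yz Jf[of y] Jf[of z] cross[of "fst y" "snd y"] unfolding G_def by (cases y) auto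
      ultimately show "z \<in> darts M - J" by simp
    qed
    then have "(u, v) \<in> darts M" "(u, v) \<notin> J" using uv by auto
    then have "((u, v), (v, u)) \<in> G M ?X" using uv(2) inEJ darts_sym unfolding G_def by auto
    then show "(v, u) \<in> comp M ?X x" using uv comp_step by metis
  qed
  have "comps M ?X = insert (darts M - J) FJ"
  proof (intro equalityI subsetI)
    fix Z assume "Z \<in> comps M ?X"
    then obtain x where x: "x \<in> darts M" "Z = comp M ?X x" unfolding comps_def by auto
    show "Z \<in> insert (darts M - J) FJ"
    proof (cases "x \<in> J")
      case True
      then have "face M x \<subseteq> J" using side_face[OF J face_in_faces[OF x(1)] self_in_face] by simp
      then show ?thesis using cJ[OF True] x(2) face_in_faces[OF x(1)] unfolding FJ_def by simp
    next
      case False then show ?thesis using cJ' x by auto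
    qed
  next
    fix Z assume "Z \<in> insert (darts M - J) FJ"
    then consider "Z = darts M - J" | "Z \<in> FJ" by auto
    then show "Z \<in> comps M ?X"
    proof cases
      case 1 then show ?thesis using cJ'[of o1] o1d unfolding comps_def by auto
    next
      case 2
      then obtain x where x: "x \<in> darts M" "Z = face M x" unfolding FJ_def faces_def by auto
      then have "x \<in> J" using 2 self_in_face[of x M] unfolding FJ_def by auto
      then have "comp M ?X x = Z" using cJ[of x] x(2) by simp
      then show ?thesis using x(1) unfolding comps_def by blast
    qed
  qed
  moreover have "darts M - J \<notin> FJ" unfolding FJ_def using o1d by auto
  ultimately have k: "card (comps M ?X) = card FJ + 1" using fF by simp
  have kC: "card (comps M ?C) \<le> 2"
  proof -
    have "?C = insert {r, p} {{p, q}, {q, r}}" unfolding cyc3_def by auto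
    then show ?thesis using add_wall[OF e(3), of "{{p, q}, {q, r}}"] comps_path[OF e(1,2) d] by simp
  qed
  have XE: "?X - ?C = EJ" "?X \<subseteq> edges M" using disjEC Ce EJe by auto
  have XV: "f \<subseteq> {p, q, r} \<union> VJ" if "f \<in> ?X" for f
  proof (cases "f \<in> ?C")
    case True then show ?thesis unfolding cyc3_def by auto
  next
    case False
    then have "f \<in> EJ" using that by auto
    then obtain u v where uv: "f = {u, v}" "(u, v) \<in> J" "{u, v} \<notin> ?C" unfolding EJ_def by auto
    then have "(u, v) \<in> darts M" using JD by auto
    then have "(v, u) \<in> J" "u \<in> verts M" "v \<in> verts M" using cross uv darts_verts[OF sg] by blast+
    then show ?thesis using uv unfolding VJ_def by auto
  qed
  \<comment> \<open>Upper bound for \<open>F + V\<close>: the walls grow from the cycle to the inner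
    edges.\<close>
  have i: "card (comps M ?X) + card VJ \<le> card (comps M ?C) + card (?X - ?C)"
  proof (rule grow_walls[where W = "{p, q, r}"])
    show "\<And>e. e \<in> ?C \<Longrightarrow> e \<subseteq> {p, q, r}" unfolding cyc3_def by auto
    fix v assume v: "v \<in> VJ"
    let ?R = "{(a, b). {a, b} \<in> ?X}\<^sup>*"
    define S where "S = {v \<in> VJ. \<not> (\<exists>w\<in>{p, q, r}. (w, v) \<in> ?R)}"
    show "\<exists>w\<in>{p, q, r}. (w, v) \<in> ?R"
    proof (rule ccontr)
      assume "\<not> ?thesis"
      then have vS: "v \<in> S" using v unfolding S_def by auto
      have "S = verts M"
      proof (rule verts_closed[OF sg cg])
        show "S \<subseteq> verts M" unfolding S_def VJ_def by auto
        show "S \<noteq> {}" using vS by auto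
        fix u w assume u: "u \<in> S" and uw: "(u, w) \<in> darts M"
        have uV: "u \<in> verts M - {p, q, r}" "\<exists>t. (t, u) \<in> J" using u unfolding S_def VJ_def by auto
        then obtain t where t: "(t, u) \<in> J" by auto
        have uwJ: "(u, w) \<in> J" "(w, u) \<in> J" using side_vertex[OF J, of u t w] t uV darts_sym[OF uw] by auto
        have nC: "{u, w} \<notin> ?C" using uV unfolding cyc3_def by (auto simp: doubleton_eq_iff)
        then have X: "{u, w} \<in> ?X" using inEJ uwJ by auto
        then have wu: "(w, u) \<in> {(a, b). {a, b} \<in> ?X}" by (simp add: insert_commute)
        have "w \<notin> {p, q, r}"
        proof
          assume "w \<in> {p, q, r}"
          then have "\<exists>w\<in>{p, q, r}. (w, u) \<in> ?R" using wu by blast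
          then show False using u unfolding S_def by auto
        qed
        then have "w \<in> VJ" using uwJ darts_verts[OF sg uw] unfolding VJ_def by auto
        moreover have "\<not> (\<exists>z\<in>{p, q, r}. (z, w) \<in> ?R)"
        proof
          assume "\<exists>z\<in>{p, q, r}. (z, w) \<in> ?R"
          then obtain z where z: "z \<in> {p, q, r}" "(z, w) \<in> ?R" by auto
          then have "(z, u) \<in> ?R" using wu by (meson rtrancl_into_rtrancl)
          then show False using u z(1) unfolding S_def by auto
        qed
        ultimately show "w \<in> S" unfolding S_def by auto
      qed
      then show False using vs unfolding S_def VJ_def by auto
    qed
  next
    show "{p, q, r} \<inter> VJ = {}" unfolding VJ_def by auto
  qed (use fF XE XV in auto)
  \<comment> \<open>Lower bound: the walls grow on from there to all edges, where Euler's formula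
    applies.\<close>
  have ii: "card (comps M (edges M)) + card (verts M - ({p, q, r} \<union> VJ)) \<le> card (comps M ?X) + card (edges M - ?X)"
  proof (rule grow_walls[where W = "{p, q, r} \<union> VJ"])
    show "\<And>e. e \<in> edges M \<Longrightarrow> e \<subseteq> {p, q, r} \<union> VJ \<union> (verts M - ({p, q, r} \<union> VJ))" using edge_verts by blast
    show "\<And>v. v \<in> verts M - ({p, q, r} \<union> VJ) \<Longrightarrow> \<exists>w\<in>{p, q, r} \<union> VJ. (w, v) \<in> {(a, b). {a, b} \<in> edges M}\<^sup>*"
      using reach_all vs by blast
  qed (use fin XE XV in auto)
  have cV: "card ({p, q, r} \<union> VJ) = 3 + card VJ"
    using d fF by (subst card_Un_disjoint) (auto simp: VJ_def)
  have subV: "{p, q, r} \<union> VJ \<subseteq> verts M" using vs unfolding VJ_def by auto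
  have "card (verts M - ({p, q, r} \<union> VJ)) = card (verts M) - (3 + card VJ)" "3 + card VJ \<le> card (verts M)"
    using card_Diff_subset[OF _ subV] card_mono[OF fin(1) subV] cV fF by simp_all
  moreover have "card ?X = 3 + card EJ" using c3 fF disjEC by (subst card_Un_disjoint) auto
  then have "card (edges M - ?X) = card (edges M) - (3 + card EJ)" "3 + card EJ \<le> card (edges M)"
    using card_Diff_subset[OF _ XE(2)] card_mono[OF fin(2) XE(2)] c3 fF by simp_all
  ultimately have E1: "int (card FJ) + int (card VJ) = 1 + int (card EJ)"
    using i ii k kC XE(1) comps_faces euler by simp
  define \<rho> where "\<rho> = (\<lambda>f. card {d \<in> f. reflex M d})"
  have fne: "f \<noteq> outer M" "finite f" "f \<in> faces M" if "f \<in> FJ" for f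
    using that out o1 face_finite[OF sg rs] unfolding FJ_def by auto
  have cf: "card f = 3 + \<rho> f" if f: "f \<in> FJ" for f
  proof -
    have "f = {d \<in> f. \<not> reflex M d} \<union> {d \<in> f. reflex M d}" by auto
    then have "card f = card {d \<in> f. \<not> reflex M d} + card {d \<in> f. reflex M d}"
      using fne[OF f] card_Un_disjoint[of "{d \<in> f. \<not> reflex M d}" "{d \<in> f. reflex M d}"] by auto
    then show ?thesis using D(7)[OF fne(3)[OF f] fne(1)[OF f]] unfolding convex_count_def \<rho>_def by simp
  qed
  have dj: "\<And>f g. f \<in> FJ \<Longrightarrow> g \<in> FJ \<Longrightarrow> f \<noteq> g \<Longrightarrow> f \<inter> g = {}"
    using faces_disjoint[OF sg rs] fne(3) by blast
  have JU: "J = (\<Union>f\<in>FJ. f)"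
  proof
    show "J \<subseteq> (\<Union>f\<in>FJ. f)"
    proof
      fix x assume x: "x \<in> J"
      then have "x \<in> darts M" using JD by auto
      then have "face M x \<in> FJ" using side_face[OF J face_in_faces self_in_face x] face_in_faces[of x M] unfolding FJ_def by simp
      then show "x \<in> (\<Union>f\<in>FJ. f)" using self_in_face[of x M] by auto
    qed
  qed (auto simp: FJ_def)
  have "card J = (\<Sum>f\<in>FJ. card f)" unfolding JU by (rule card_UN_disjoint) (use fF fne dj in auto)
  also have "\<dots> = 3 * card FJ + (\<Sum>f\<in>FJ. \<rho> f)" using cf by (simp add: sum.distrib mult.commute)
  finally have cJ1: "card J = 3 * card FJ + (\<Sum>f\<in>FJ. \<rho> f)" .
  let ?RJ = "{d \<in> J. reflex M d}"
  have "card ?RJ = card (\<Union>f\<in>FJ. {d \<in> f. reflex M d})" using JU by (intro arg_cong[where f = card]) auto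
  also have "\<dots> = (\<Sum>f\<in>FJ. \<rho> f)" unfolding \<rho>_def
  proof (rule card_UN_disjoint)
    show "\<forall>f\<in>FJ. \<forall>g\<in>FJ. f \<noteq> g \<longrightarrow> {d \<in> f. reflex M d} \<inter> {d \<in> g. reflex M d} = {}"
      using dj by blast
  qed (use fF fne in simp_all)
  finally have cR: "card ?RJ = (\<Sum>f\<in>FJ. \<rho> f)" .
  define RC where "RC = {v \<in> {p, q, r}. \<exists>d\<in>?RJ. snd d = v}"
  have "inj_on snd ?RJ" by (rule inj_onI, rule reflex_unique[OF M]) simp_all
  then have "card ?RJ = card (snd ` ?RJ)" by (simp add: card_image)
  also have "snd ` ?RJ = VJ \<union> RC"
  proof (intro equalityI subsetI)
    fix v assume "v \<in> snd ` ?RJ"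
    then obtain u where u: "(u, v) \<in> J" "reflex M (u, v)" by auto
    then have "v \<in> verts M" using JD darts_verts[OF sg] by blast
    then show "v \<in> VJ \<union> RC" using u unfolding VJ_def RC_def by force
  next
    fix v assume "v \<in> VJ \<union> RC"
    then show "v \<in> snd ` ?RJ"
    proof
      assume v: "v \<in> VJ"
      then obtain t where t: "(t, v) \<in> J" "v \<in> verts M" "v \<notin> {p, q, r}" unfolding VJ_def by auto
      then obtain d where "reflex_at M v = {d}" using D(9) by (metis card_1_singletonE)
      then have dd: "d \<in> darts M" "snd d = v" "reflex M d" unfolding reflex_at_def by auto
      then have "d \<in> J" using side_vertex(1)[OF J t(3)] t(1) by (cases d) auto
      then show ?thesis using dd by auto
    next
      assume "v \<in> RC"
      then obtain d where "d \<in> ?RJ" "snd d = v" unfolding RC_def by blast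
      then show ?thesis by (metis imageI)
    qed
  qed
  finally have cR2: "card ?RJ = card VJ + card RC"
    using fF by (subst (asm) card_Un_disjoint) (auto simp: VJ_def RC_def)
  have cJ2: "card J = 2 * card EJ + 3"
  proof -
    let ?P = "{(u, v). {u, v} \<in> EJ}" and ?Q = "{(u, v) \<in> J. {u, v} \<in> ?C}"
    have 1: "J = ?P \<union> ?Q" using inEJ by auto
    have 2: "?P \<inter> ?Q = {}" using inEJ by auto
    have 3: "finite ?P \<and> card ?P = 2 * card EJ"
      by (rule card_darts_of[OF fF(3)]) (use EJe sg in \<open>unfold simple_graph_def, blast\<close>)
    have 4: "card ?Q = 3" "finite ?Q" using side_orient[OF J e d] d by auto
    have "card J = card (?P \<union> ?Q)" using 1 by (rule arg_cong)
    also have "\<dots> = card ?P + card ?Q" using 2 3 4 card_Un_disjoint by blast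
    finally show ?thesis using 3 4 by simp
  qed
  have "finite RC" unfolding RC_def by auto
  have r01: "\<rho> f = 0 \<or> \<rho> f = 1" if f: "f \<in> FJ" for f using cf[OF f] D(10)[OF fne(3)[OF f] fne(1)[OF f]] by auto
  let ?T = "{f \<in> FJ. \<rho> f = 0}"
  have r1: "\<rho> f = 1" if "f \<in> FJ - ?T" for f using r01[of f] that by auto
  have "(\<Sum>f\<in>FJ. \<rho> f) = (\<Sum>f\<in>FJ - ?T. 1)"
    by (rule sum.mono_neutral_cong_right[OF fF(1)]) (blast, blast, rule r1)
  then have "(\<Sum>f\<in>FJ. \<rho> f) = card FJ - card ?T" using fF by (simp add: card_Diff_subset)
  moreover have "card ?T \<le> card FJ" using fF by (intro card_mono) auto
  ultimately have t: "card ?T + (\<Sum>f\<in>FJ. \<rho> f) = card FJ" by simp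
  have "card ?T + 2 * card RC = 1" using E1 cJ1 cJ2 cR cR2 t by linarith
  then have fin1: "card ?T = 1" "card RC = 0" by presburger+
  have "?T = {f \<in> faces M. f \<subseteq> J \<and> card f = 3}" using cf unfolding FJ_def by auto
  then show "card {f \<in> faces M. f \<subseteq> J \<and> card f = 3} = 1" using fin1 by simp
  fix x assume x: "x \<in> J" "snd x \<in> {p, q, r}"
  have "RC = {}" using fin1 \<open>finite RC\<close> by simp
  show "\<not> reflex M x"
  proof
    assume "reflex M x"
    then have "x \<in> ?RJ" using x(1) by blast
    then have "snd x \<in> RC" using x(2) unfolding RC_def by blast
    then show False using \<open>RC = {}\<close> by blast
  qed
qed

section \<open>Regions\<close>

text \<open>Realisability: arguments about multisets of faces borrow planarity from some map behind
  them, and the map itself need not be carried along.\<close>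

definition rl :: "('v \<times> 'v) set \<Rightarrow> 'v tface multiset \<Rightarrow> bool" where
  "rl Ou X \<longleftrightarrow> (\<exists>M. is_4ppt M \<and> fm M = X \<and> outer M = Ou)"

abbreviation outf :: "('v \<times> 'v) set \<Rightarrow> 'v tface" where
  "outf Ou \<equiv> (Ou, snd ` Ou)"

lemma rc_rl: "rl Ou X \<Longrightarrow> rc n X Y \<Longrightarrow> rl Ou Y"
  unfolding rl_def using rc_realize by metis

lemma mem_DS: "d \<in> DS X \<longleftrightarrow> (\<exists>f\<in>#X. d \<in> fst f)" by (auto simp: DS_def)

lemma tagged_inj: "inj_on (tagged M) A" by (rule inj_onI) (simp add: tagged_def)

lemma fm_part:
  assumes M: "is_4ppt M" and X: "fm M = A + B"
  shows "DS A \<inter> DS B = {}" "d \<in> darts M \<Longrightarrow> d \<in> DS A \<longleftrightarrow> fstep M d \<in> DS A"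
proof -
  note D = is_4pptD[OF M]
  have fa: "fst f \<in> faces M" if "f \<in># A + B" for f using in_fm_faces[OF M] X that by auto
  have cnt: "count (A + B) f \<le> 1" for f
  proof -
    have "fm M = mset_set (tagged M ` faces M)"
      unfolding fm_def using image_mset_mset_set[OF tagged_inj] by metis
    then show ?thesis using X by (metis count_mset_set(1,3) count_mset_set(2) le_numeral_extra(4) le_numeral_extra(2) zero_le_one)
  qed
  show dis: "DS A \<inter> DS B = {}"
  proof (rule ccontr)
    assume "\<not> ?thesis"
    then obtain d where "d \<in> DS A" "d \<in> DS B" by blast
    then obtain f g where d: "f \<in># A" "g \<in># B" "d \<in> fst f" "d \<in> fst g" unfolding mem_DS by blast
    have fg: "f \<in># A + B" "g \<in># A + B" using d by simp_all
    have "fst f = fst g" by (rule faces_disjoint[OF D(1,2) fa[OF fg(1)] fa[OF fg(2)] d(3,4)])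
    then have "f = g" using in_fm_faces[OF M, of f] in_fm_faces[OF M, of g] X fg by simp
    then have "0 < count A f" "0 < count B f" using d(1,2) by (simp_all only: count_greater_zero_iff)
    then have "count (A + B) f \<ge> 2" unfolding count_union by linarith
    then show False using cnt[of f] by simp
  qed
  assume d: "d \<in> darts M"
  show "d \<in> DS A \<longleftrightarrow> fstep M d \<in> DS A"
  proof
    assume "d \<in> DS A"
    then obtain f where "f \<in># A" "d \<in> fst f" by (auto simp: mem_DS)
    then show "fstep M d \<in> DS A" using faces_step fa by (metis mem_DS union_iff)
  next
    assume "fstep M d \<in> DS A"
    then obtain f where f: "f \<in># A" "fstep M d \<in> fst f" by (auto simp: mem_DS)
    then have "d \<in> fst f" using faces_step_back[OF D(1,2) fa _ f(2)] d by auto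
    then show "d \<in> DS A" using f by (auto simp: mem_DS)
  qed
qed

lemma rl_disjoint: "rl Ou (A + B) \<Longrightarrow> DS A \<inter> DS B = {}"
  unfolding rl_def using fm_part(1) by metis

lemma rl_sym: "rl Ou X \<Longrightarrow> (u, v) \<in> DS X \<Longrightarrow> (v, u) \<in> DS X"
  unfolding rl_def using DS_fm darts_sym by metis

lemma rl_neq: "rl Ou X \<Longrightarrow> (u, v) \<in> DS X \<Longrightarrow> u \<noteq> v"
  unfolding rl_def using DS_fm darts_verts is_4pptD(1) by metis

text \<open>The dart from \<open>x\<close> to \<open>y\<close> seen in orientation \<open>s\<close>;
  with it one argument covers a picture and its mirror image.\<close>

definition dd :: "bool \<Rightarrow> 'v \<Rightarrow> 'v \<Rightarrow> 'v \<times> 'v" where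
  "dd s x y = (if s then (x, y) else (y, x))"

lemma fst_Tri: "fst (Tri s x y z) = {dd s x y, dd s y z, dd s z x}"
  by (simp add: Tri_def dd_def insert_commute)

lemma fst_Qd: "fst (Qd s x y z t w) = {dd s x y, dd s y z, dd s z t, dd s t x}"
  by (simp add: Qd_def dd_def insert_commute)

lemma snd_face [simp]: "snd (Tri s x y z) = {}" "snd (Qd s x y z t w) = {w}"
  by (simp_all add: Tri_def Qd_def)

lemma dd_eq [simp]: "dd s x y = dd s u v \<longleftrightarrow> x = u \<and> y = v" by (auto simp: dd_def)
lemma dd_swap: "dd (\<not> s) x y = dd s y x" by (simp add: dd_def)

lemma rl_dd_sym: "rl Ou X \<Longrightarrow> dd s u v \<in> DS X \<Longrightarrow> dd s v u \<in> DS X"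
  by (auto simp: dd_def intro: rl_sym)

lemma rl_face:
  assumes "rl Ou X" "f \<in># X" "f \<noteq> outf Ou" "dd s x y \<in> fst f"
  shows "(\<exists>z. f = Tri s x y z) \<or> (\<exists>z t w. f = Qd s x y z t w)"
proof -
  obtain M where M: "is_4ppt M" "fm M = X" "outer M = Ou" using assms(1) unfolding rl_def by auto
  have f: "fst f \<in> faces M" "f = tagged M (fst f)" using in_fm_faces[OF M(1)] M(2) assms(2) by auto
  have o: "fst f \<noteq> outer M" using f(2) outer_tag(1)[OF M(1)] assms(3) M(3) by metis
  show ?thesis
  proof (cases s)
    case True
    then show ?thesis using tri_or_quad[OF M(1) f(1) o, of x y] f(2) assms(4) by (simp add: dd_def)
  next
    case False
    then have s: "s = (\<not> True)" by simp
    have "(\<exists>z. f = Tri True y x z) \<or> (\<exists>z t w. f = Qd True y x z t w)"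
      using tri_or_quad[OF M(1) f(1) o, of y x] f(2) assms(4) False by (simp add: dd_def)
    then show ?thesis
    proof (elim disjE exE)
      fix z assume "f = Tri True y x z"
      then have "f = Tri s x y z" unfolding s Tri_flip using Tri_rot by metis
      then show ?thesis by blast
    next
      fix z t w assume "f = Qd True y x z t w"
      then have "f = Qd s x y t z w" unfolding s Qd_flip using Qd_rot by metis
      then show ?thesis by blast
    qed
  qed
qed

lemma rl_Qd:
  assumes "rl Ou X" "Qd s x y z t w \<in># X"
  shows "distinct [x, y, z, t]" "w \<in> {x, y, z, t}"
proof -
  obtain M where M: "is_4ppt M" "fm M = X" using assms(1) unfolding rl_def by auto
  have "distinct [x, y, z, t] \<and> w \<in> {x, y, z, t}"
  proof (cases s)
    case True
    then have sT: "s = True" by simp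
    show ?thesis using QdD(1,8)[OF M(1), of x y z t w] M(2) assms(2) sT by simp
  next
    case False
    then have s: "s = (\<not> True)" by simp
    have "Qd True t z y x w \<in># fm M" using assms(2) M(2) unfolding s Qd_flip by simp
    from QdD(1,8)[OF M(1) this] show ?thesis by auto
  qed
  then show "distinct [x, y, z, t]" "w \<in> {x, y, z, t}" by simp_all
qed

lemma rl_Tri:
  assumes "rl Ou X" "Tri s x y z \<in># X" shows "distinct [x, y, z]"
proof -
  have "dd s x y \<in> DS X" "dd s y z \<in> DS X" "dd s z x \<in> DS X"
    using assms(2) by (force simp: mem_DS fst_Tri)+
  then show ?thesis using rl_neq[OF assms(1)] by (auto simp: dd_def split: if_splits)
qed

lemma rl_outf:
  assumes "rl Ou X"
  shows "outf Ou \<in># X" "\<And>s x y z. outf Ou \<noteq> Tri s x y z" "\<And>s x y z t w. outf Ou \<noteq> Qd s x y z t w"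
proof -
  obtain M where M: "is_4ppt M" "fm M = X" "outer M = Ou" using assms(1) unfolding rl_def by auto
  note o = outer_tag[OF M(1)]
  show "outf Ou \<in># X" using o(1) in_fm[OF M(1)] is_4pptD(5)[OF M(1)] M by metis
  show "outf Ou \<noteq> Tri s x y z" for s x y z
  proof
    assume "outf Ou = Tri s x y z"
    then have "snd ` Ou = {}" using snd_face(1) by (metis snd_conv)
    then show False using o(2) M by simp
  qed
  show "outf Ou \<noteq> Qd s x y z t w" for s x y z t w
  proof
    assume "outf Ou = Qd s x y z t w"
    then have "snd ` Ou = {w}" using snd_face(2) by (metis snd_conv)
    then show False using o(2) M by simp
  qed
qed

text \<open>Symmetry at \<open>y\<close> means that the faces of \<open>A\<close> close up around
  \<open>y\<close>: stepping along a face of \<open>A\<close> and crossing the next edge stays in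
  \<open>A\<close>, and the rotation reaches every neighbour.\<close>

lemma rl_rotate:
  assumes rl: "rl Ou (A + B)" and y: "\<And>q. (q, y) \<in> DS A \<longleftrightarrow> (y, q) \<in> DS A" and a: "(a, y) \<in> DS A" and u: "(u, y) \<in> DS (A + B)"
  shows "(u, y) \<in> DS A"
proof -
  obtain M where M: "is_4ppt M" "fm M = A + B" using rl unfolding rl_def by auto
  note D = is_4pptD[OF M(1)]
  have dM: "DS (A + B) = darts M" using DS_fm[OF M(1)] M(2) by simp
  let ?S = "{w \<in> nbrs M y. (w, y) \<in> DS A}"
  have "?S = nbrs M y"
  proof (rule nbrs_closed[OF D(2)])
    show "?S \<noteq> {}" using a dM by (auto simp: mem_nbrs)
    fix w assume w: "w \<in> ?S"
    then have wd: "(w, y) \<in> darts M" by (simp add: mem_nbrs)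
    then have "(y, rot M y w) \<in> DS A" using fm_part(2)[OF M wd] w by simp
    then have "(rot M y w, y) \<in> DS A" using y by simp
    moreover have "(rot M y w, y) \<in> darts M" by (rule darts_sym) (use fstep_darts[OF D(2) wd] in simp)
    then have "rot M y w \<in> nbrs M y" by (simp add: mem_nbrs)
    ultimately show "rot M y w \<in> ?S" by simp
  qed auto
  moreover have "u \<in> nbrs M y" using u[unfolded dM] by (simp add: mem_nbrs)
  ultimately have "u \<in> ?S" by metis
  then show ?thesis by simp
qed

lemma rl_reflex_unique:
  assumes "rl Ou (A + B)" "f \<in># A" "g \<in># B" "y \<in> snd f" "y \<in> snd g" shows False
proof -
  obtain M where M: "is_4ppt M" "fm M = A + B" using assms(1) unfolding rl_def by auto
  have f: "f = tagged M (fst f)" "g = tagged M (fst g)" using in_fm_faces[OF M(1)] M(2) assms by auto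
  obtain d where d: "d \<in> fst f" "reflex M d" "snd d = y" using assms(4) f(1) unfolding tagged_def
    by (metis (no_types, lifting) imageE mem_Collect_eq snd_conv)
  obtain e where e: "e \<in> fst g" "reflex M e" "snd e = y" using assms(5) f(2) unfolding tagged_def
    by (metis (no_types, lifting) imageE mem_Collect_eq snd_conv)
  have "d = e" using reflex_unique[OF M(1) d(2) e(2)] d e by simp
  then show False using fm_part(1)[OF M] d e assms(2,3) by (auto simp: DS_def)
qed

lemma rl_reflex:
  assumes "rl Ou X" "(u, y) \<in> DS X"
  shows "\<exists>f q. f \<in># X \<and> y \<in> snd f \<and> (q, y) \<in> fst f"
proof -
  obtain M where M: "is_4ppt M" "fm M = X" using assms(1) unfolding rl_def by auto
  note D = is_4pptD[OF M(1)]
  have "(u, y) \<in> darts M" using assms(2) DS_fm[OF M(1)] M(2) by simp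
  then have "y \<in> verts M" using darts_verts[OF D(1)] by blast
  then obtain d where "reflex_at M y = {d}" using D(9) by (metis card_1_singletonE)
  then have d: "d \<in> darts M" "snd d = y" "reflex M d" unfolding reflex_at_def by auto
  have "tagged M (face M d) \<in># X" using in_fm[OF M(1)] M(2) face_in_faces[OF d(1)] by metis
  moreover have "y \<in> snd (tagged M (face M d))" "d \<in> fst (tagged M (face M d))"
    using d self_in_face[of d M] by (auto simp: tagged_def)
  ultimately show ?thesis using d(2) by (metis prod.collapse)
qed

lemma rl_nonempty_face: "rl Ou X \<Longrightarrow> f \<in># X \<Longrightarrow> \<exists>d. d \<in> fst f"
proof -
  assume "rl Ou X" "f \<in># X"
  then obtain M where M: "is_4ppt M" "f \<in># fm M" unfolding rl_def by auto
  then have "fst f \<in> faces M" using in_fm_faces by blast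
  then obtain d where "fst f = face M d" unfolding faces_def by auto
  then show ?thesis using self_in_face by metis
qed

lemma rl_DS_empty:
  assumes "rl Ou (A + B)" "DS B = {}" shows "B = {#}"
proof (rule ccontr)
  assume "B \<noteq> {#}"
  then obtain f where f: "f \<in># B" by (meson multiset_nonemptyE)
  then have "f \<in># A + B" by simp
  from rl_nonempty_face[OF assms(1) this] obtain d where "d \<in> fst f" by blast
  then have "d \<in> DS B" unfolding mem_DS using f by blast
  then show False using assms(2) by blast
qed

text \<open>A subfamily without boundary edges is closed under stepping along faces and crossing
  edges, and without walls there is only one component.\<close>

lemma rl_connected:
  assumes rl: "rl Ou (A + B)" and c: "\<And>u v. (u, v) \<in> DS A \<Longrightarrow> (v, u) \<in> DS A" and ne: "A \<noteq> {#}"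
  shows "B = {#}"
proof -
  obtain M where M: "is_4ppt M" "fm M = A + B" using rl unfolding rl_def by auto
  interpret pmap M by (rule pmap_4ppt[OF M(1)])
  have dM: "DS A \<union> DS B = darts M" using DS_fm[OF M(1)] M(2) by simp
  obtain f where f: "f \<in># A" using ne by blast
  have "f \<in># A + B" using f by simp
  from rl_nonempty_face[OF rl this] obtain d where d: "d \<in> fst f" by blast
  have dA: "d \<in> DS A" unfolding mem_DS using f d by blast
  then have dA: "d \<in> DS A" "d \<in> darts M" using dM by auto
  have "comp M {} d \<subseteq> DS A"
  proof (rule comp_sub[OF dA(1)])
    fix x y assume x: "x \<in> DS A" and xy: "(x, y) \<in> G M {}"
    have "y = fstep M x \<and> x \<in> darts M \<or> x = fstep M y \<and> y \<in> darts M \<or> y = prod.swap x"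
      using xy unfolding G_def by blast
    then consider "y = fstep M x" "x \<in> darts M" | "x = fstep M y" "y \<in> darts M" | "y = prod.swap x" by blast
    then show "y \<in> DS A"
    proof cases
      case 1 then show ?thesis using fm_part(2)[OF M] x by metis
    next
      case 2 then show ?thesis using fm_part(2)[OF M] x by metis
    next
      case 3 then show ?thesis using c x by (cases x) auto
    qed
  qed
  moreover have "comp M {} d = darts M" using comps_empty[OF dA(2)] dA(2) unfolding comps_def by blast
  ultimately have "DS B = {}" using dM fm_part(1)[OF M] by auto
  then show ?thesis by (rule rl_DS_empty[OF rl])
qed

text \<open>Dual connectivity to the face \<open>g\<close>, phrased without paths: a part that
  contains \<open>g\<close> and cannot be left by crossing an edge interior to \<open>K\<close> is
  all of \<open>K\<close>.\<close>

definition conn_to :: "'v tface \<Rightarrow> 'v tface multiset \<Rightarrow> bool" where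
  "conn_to g K \<longleftrightarrow> g \<in># K \<and> (\<forall>A B. K = A + B \<longrightarrow> g \<in># A \<longrightarrow>
     (\<forall>u v. (u, v) \<in> DS A \<longrightarrow> (v, u) \<in> DS K \<longrightarrow> (v, u) \<in> DS A) \<longrightarrow> B = {#})"

text \<open>\<open>J\<close> collects the faces inside the three-cycle and \<open>K\<close> those on
  the side of the outer face, together with the results of the count.\<close>

definition tri_side :: "('v \<times> 'v) set \<Rightarrow> 'v tface multiset \<Rightarrow> 'v \<Rightarrow> 'v \<Rightarrow> 'v \<Rightarrow> 'v tface multiset \<Rightarrow> 'v tface multiset \<Rightarrow> bool" where
  "tri_side Ou X x y z J K \<longleftrightarrow> X = J + K \<and> conn_to (outf Ou) K \<and>
     (\<forall>u v. (u, v) \<in> DS X \<longrightarrow> ((u, v) \<in> DS J \<longleftrightarrow> ((v, u) \<in> DS J \<longleftrightarrow> {u, v} \<notin> cyc3 x y z))) \<and>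
     ({(u, v) \<in> DS J. {u, v} \<in> cyc3 x y z} = {(x, y), (y, z), (z, x)} \<or>
      {(u, v) \<in> DS J. {u, v} \<in> cyc3 x y z} = {(y, x), (z, y), (x, z)}) \<and>
     (\<forall>f\<in>#J. snd f \<inter> {x, y, z} = {}) \<and> size {#f \<in># J. snd f = {}#} = 1"

theorem tri_side_exists:
  assumes rl: "rl Ou X" and d: "distinct [x, y, z]" and e: "(x, y) \<in> DS X" "(y, z) \<in> DS X" "(z, x) \<in> DS X"
  shows "\<exists>J K. tri_side Ou X x y z J K"
proof -
  obtain M where M: "is_4ppt M" "fm M = X" "outer M = Ou" using rl unfolding rl_def by auto
  interpret pmap M by (rule pmap_4ppt[OF M(1)])
  note D = is_4pptD[OF M(1)]
  have dM: "DS X = darts M" using DS_fm[OF M(1)] M(2) by simp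
  have ed: "{x, y} \<in> edges M" "{y, z} \<in> edges M" "{z, x} \<in> edges M" using e dM by (simp_all add: mem_darts)
  \<comment> \<open>The reference dart is taken on the outer face, so the side avoiding it is the
    inner one.\<close>
  obtain o1 where o1: "o1 \<in> outer M" using D(11) by (metis card.empty equals0I not_numeral_le_zero)
  then have o1d: "o1 \<in> darts M" using faces_partition(2)[OF D(1,2,5)] by auto
  obtain S where S: "side M x y z S" "o1 \<notin> S" and
    conn: "\<And>T. T \<subseteq> darts M - S \<Longrightarrow> T \<noteq> {} \<Longrightarrow> (\<And>d. d \<in> T \<Longrightarrow> fstep M d \<in> T) \<Longrightarrow>
       (\<And>u v. (u, v) \<in> T \<Longrightarrow> {u, v} \<notin> cyc3 x y z \<Longrightarrow> (v, u) \<in> T) \<Longrightarrow> T = darts M - S"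
    using jordan[OF ed d o1d] by blast
  have out: "outer M \<inter> S = {}" using side_face[OF S(1) D(5)] o1 S(2) by blast
  have cnt2: "card {f \<in> faces M. f \<subseteq> S \<and> card f = 3} = 1"
  proof (rule side_count(2)[OF M(1) S(1) out ed d])
    fix T assume a: "T \<subseteq> darts M - S" "T \<noteq> {}" "\<And>d. d \<in> T \<Longrightarrow> fstep M d \<in> T"
       "\<And>u v. (u, v) \<in> T \<Longrightarrow> {u, v} \<notin> cyc3 x y z \<Longrightarrow> (v, u) \<in> T"
    show "T = darts M - S" by (rule conn) (use a in blast)+
  qed
  have cnt1: "\<not> reflex M b" if b: "b \<in> S" "snd b \<in> {x, y, z}" for b
  proof (rule side_count(1)[OF M(1) S(1) out ed d])
    fix T assume a: "T \<subseteq> darts M - S" "T \<noteq> {}" "\<And>d. d \<in> T \<Longrightarrow> fstep M d \<in> T"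
       "\<And>u v. (u, v) \<in> T \<Longrightarrow> {u, v} \<notin> cyc3 x y z \<Longrightarrow> (v, u) \<in> T"
    show "T = darts M - S" by (rule conn) (use a in blast)+
  qed (use b in blast)+
  let ?FJ = "{f \<in> faces M. f \<subseteq> S}" and ?FK = "{f \<in> faces M. \<not> f \<subseteq> S}"
  define J where "J = image_mset (tagged M) (mset_set ?FJ)"
  define K where "K = image_mset (tagged M) (mset_set ?FK)"
  have ff: "finite (faces M)" using finite_faces[OF D(1)] .
  have "faces M = ?FJ \<union> ?FK" by auto
  then have "mset_set (faces M) = mset_set ?FJ + mset_set ?FK" using mset_set_Union[of ?FJ ?FK] ff by auto
  then have XJK: "X = J + K" using M(2) unfolding fm_def J_def K_def by simp
  have sJ: "set_mset J = tagged M ` ?FJ" "set_mset K = tagged M ` ?FK" unfolding J_def K_def using ff by simp_all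
  have DJ: "DS J = S"
  proof (intro equalityI subsetI)
    fix a assume "a \<in> DS J" then show "a \<in> S" unfolding DS_def sJ by (auto simp: tagged_def)
  next
    fix a assume a: "a \<in> S"
    then have ad: "a \<in> darts M" using sideD(1)[OF S(1)] by auto
    then have "face M a \<in> ?FJ" using side_face[OF S(1) face_in_faces[OF ad] self_in_face a] face_in_faces[OF ad] by simp
    then show "a \<in> DS J" unfolding DS_def sJ using self_in_face[of a M] by (auto simp: tagged_def)
  qed
  have dis: "DS J \<inter> DS K = {}" using fm_part(1)[OF M(1)] M(2) XJK by simp
  have DK: "DS K = darts M - S" using dis DJ dM XJK by auto
  have oK: "outf Ou \<in># K"
  proof -
    have "outer M \<in> ?FK" using D(5) out o1 by auto
    then have "tagged M (outer M) \<in> tagged M ` ?FK" by (rule imageI)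
    then show ?thesis using sJ(2) outer_tag(1)[OF M(1)] M(3) by simp
  qed
  have "conn_to (outf Ou) K"
    unfolding conn_to_def
  proof (intro conjI allI impI oK)
    fix A B assume K2: "K = A + B" and oA: "outf Ou \<in># A" and cl: "\<forall>u v. (u, v) \<in> DS A \<longrightarrow> (v, u) \<in> DS K \<longrightarrow> (v, u) \<in> DS A"
    have X2: "fm M = A + (B + J)" using M(2) XJK K2 by (simp add: ac_simps)
    have "DS A = darts M - S"
    proof (rule conn)
      show "DS A \<subseteq> darts M - S" using DK K2 by auto
      show "DS A \<noteq> {}" using oA o1 M(3) by (force simp: mem_DS)
      show "fstep M a \<in> DS A" if "a \<in> DS A" for a
        using fm_part(2)[OF M(1) X2, of a] that \<open>DS A \<subseteq> darts M - S\<close> by blast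
      fix u v assume uv: "(u, v) \<in> DS A" "{u, v} \<notin> cyc3 x y z"
      then have "(u, v) \<in> darts M" "(u, v) \<notin> S" using \<open>DS A \<subseteq> darts M - S\<close> by auto
      then have "(v, u) \<in> darts M - S" using sideD(3)[OF S(1), of u v] uv darts_sym by (metis DiffI)
      then show "(v, u) \<in> DS A" using cl uv DK by blast
    qed
    then have "DS B = {}" using DK K2 fm_part(1)[OF M(1) X2] by auto
    moreover have "rl Ou ((J + A) + B)" using rl XJK K2 by (simp add: ac_simps)
    ultimately show "B = {#}" using rl_DS_empty by blast
  qed
  moreover have "snd f \<inter> {x, y, z} = {}" if "f \<in># J" for f
  proof -
    have "f \<in> tagged M ` ?FJ" using that unfolding sJ(1)[symmetric] by simp
    then obtain g where g: "g \<in> ?FJ" "f = tagged M g" by blast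
    have "d \<notin> g \<or> \<not> reflex M d" if "snd d \<in> {x, y, z}" for d using cnt1[of d] g that by blast
    then show ?thesis using g by (auto simp: tagged_def)
  qed
  moreover have "size {#f \<in># J. snd f = {}#} = 1"
  proof -
    have "filter_mset (\<lambda>f. snd f = {}) J = image_mset (tagged M) (filter_mset (\<lambda>f. snd (tagged M f) = {}) (mset_set ?FJ))"
      unfolding J_def by (simp add: filter_mset_image_mset)
    also have "size \<dots> = card {f \<in> ?FJ. snd (tagged M f) = {}}" using ff by (simp add: filter_mset_mset_set)
    also have "{f \<in> ?FJ. snd (tagged M f) = {}} = {f \<in> faces M. f \<subseteq> S \<and> card f = 3}"
    proof -
      have "snd (tagged M f) = {} \<longleftrightarrow> card f = 3" if f: "f \<in> faces M" "f \<subseteq> S" for f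
      proof -
        have fo: "f \<noteq> outer M" using f out o1 by auto
        have fin_f: "finite f" using face_finite[OF D(1,2) f(1)] .
        have c3: "card {d \<in> f. \<not> reflex M d} = 3" using D(7)[OF f(1) fo] by (simp add: convex_count_def)
        have "f = {d \<in> f. \<not> reflex M d} \<union> {d \<in> f. reflex M d}" by auto
        then have "card f = 3 + card {d \<in> f. reflex M d}"
          using card_Un_disjoint[of "{d \<in> f. \<not> reflex M d}" "{d \<in> f. reflex M d}"] fin_f c3 by auto
        moreover have "finite {d \<in> f. reflex M d}" using fin_f by simp
        ultimately show ?thesis by (simp add: tagged_def)
      qed
      then show ?thesis by blast
    qed
    finally show ?thesis using cnt2 by (simp only:)
  qed
  ultimately have "tri_side Ou X x y z J K"
    unfolding tri_side_def DJ dM using XJK sideD(3)[OF S(1)] side_orient[OF S(1) ed d] by blast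
  then show ?thesis by blast
qed

text \<open>The corner of \<open>A\<close> at \<open>y\<close> is one of the two arcs of faces around \<open>y\<close> between the edges to \<open>x\<close> and
  \<open>z\<close>. Either the arc on the inner side of the cycle is the one in \<open>A\<close>, or it is the other one; since no
  inner angle of the cycle is reflex, the reflex angle at \<open>y\<close> then lies in \<open>A\<close>.\<close>
lemma corner_cases:
  assumes rl: "rl Ou (A + B)" and d: "distinct [x, y, z]" and e: "(x, y) \<in> DS (A + B)" "(y, z) \<in> DS (A + B)" "(z, x) \<in> DS (A + B)"
    and b: "\<And>q. q \<notin> {x, z} \<Longrightarrow> (q, y) \<in> DS A \<longleftrightarrow> (y, q) \<in> DS A"
    and c: "\<And>q. q \<in> {x, z} \<Longrightarrow> (q, y) \<in> DS A \<longleftrightarrow> (y, q) \<notin> DS A"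
  shows "(\<exists>J K. tri_side Ou (A + B) x y z J K \<and> (\<forall>q. ((q, y) \<in> DS A \<longleftrightarrow> (q, y) \<in> DS J) \<and> ((y, q) \<in> DS A \<longleftrightarrow> (y, q) \<in> DS J)))
    \<or> (\<exists>f\<in>#A. y \<in> snd f)"
proof -
  obtain J K where J: "tri_side Ou (A + B) x y z J K" using tri_side_exists[OF rl d e] by blast
  obtain M where M: "is_4ppt M" "fm M = A + B" "outer M = Ou" using rl unfolding rl_def by auto
  note D = is_4pptD[OF M(1)]
  have dM: "DS (A + B) = darts M" using DS_fm[OF M(1)] M(2) by simp
  have XJK: "A + B = J + K" and Js: "\<And>u v. (u, v) \<in> DS (A + B) \<Longrightarrow> ((u, v) \<in> DS J \<longleftrightarrow> ((v, u) \<in> DS J \<longleftrightarrow> {u, v} \<notin> cyc3 x y z))"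
    and Jr: "\<And>f. f \<in># J \<Longrightarrow> snd f \<inter> {x, y, z} = {}"
    using J unfolding tri_side_def by blast+
  have Js1: "(q, y) \<in> DS J \<longleftrightarrow> (y, q) \<in> DS J" if "q \<notin> {x, z}" "(q, y) \<in> darts M" for q
    using Js[of q y] that dM d by (auto simp: cyc3_def doubleton_eq_iff)
  have Js2: "(q, y) \<in> DS J \<longleftrightarrow> (y, q) \<notin> DS J" if "q \<in> {x, z}" "(q, y) \<in> darts M" for q
    using Js[of q y] that dM d by (auto simp: cyc3_def doubleton_eq_iff)
  \<comment> \<open>The neighbours at which \<open>A\<close> and \<open>J\<close> agree form a set
    closed under the rotation, hence all of them or none; none means complementary corners.\<close>
  let ?S = "{q \<in> nbrs M y. (q, y) \<in> DS A \<longleftrightarrow> (q, y) \<in> DS J}"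
  have cl: "rot M y w \<in> ?S" if w: "w \<in> ?S" for w
  proof -
    let ?w = "rot M y w"
    have wd: "(w, y) \<in> darts M" using w by (simp add: mem_nbrs)
    have "(y, ?w) \<in> DS A \<longleftrightarrow> (y, ?w) \<in> DS J"
      using fm_part(2)[OF M(1,2) wd] fm_part(2)[OF M(1) _ wd, of J K] M(2) XJK w by simp
    moreover have wd2: "(?w, y) \<in> darts M" using fstep_darts[OF D(2) wd] darts_sym by (metis fstep_simp)
    ultimately have "(?w, y) \<in> DS A \<longleftrightarrow> (?w, y) \<in> DS J"
      using b[of ?w] c[of ?w] Js1[of ?w] Js2[of ?w] by metis
    then show ?thesis using wd2 by (simp add: mem_nbrs)
  qed
  show ?thesis
  proof (cases "?S = {}")
    case False
    then have "?S = nbrs M y" using nbrs_closed[OF D(2), of ?S y] cl by auto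
    then have 1: "(q, y) \<in> DS A \<longleftrightarrow> (q, y) \<in> DS J" if "(q, y) \<in> darts M" for q
    proof -
      have "q \<in> ?S" using that \<open>?S = nbrs M y\<close> by (simp add: mem_nbrs)
      then show ?thesis by simp
    qed
    have sub: "DS A \<subseteq> darts M" "DS J \<subseteq> darts M" using dM XJK DS_simps(3) by (metis Un_upper1)+
    have 2: "(y, q) \<in> DS A \<longleftrightarrow> (y, q) \<in> DS J" if "(y, q) \<in> darts M" for q
      using 1 b[of q] c[of q] Js1[of q] Js2[of q] darts_sym[OF that] by metis
    have "\<forall>q. ((q, y) \<in> DS A \<longleftrightarrow> (q, y) \<in> DS J) \<and> ((y, q) \<in> DS A \<longleftrightarrow> (y, q) \<in> DS J)"
      using 1 2 sub by blast
    then show ?thesis using J by blast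
  next
    case True
    obtain f q where f: "f \<in># A + B" "y \<in> snd f" "(q, y) \<in> fst f" using rl_reflex[OF rl e(1)] by blast
    then have "f \<notin># J" using Jr by blast
    then have "f \<in># K" using f(1) XJK by (metis union_iff)
    then have "(q, y) \<in> DS K" unfolding mem_DS using f(3) by blast
    then have "(q, y) \<notin> DS J" using fm_part(1)[OF M(1), of J K] M(2) XJK by auto
    moreover have qd: "(q, y) \<in> darts M" unfolding dM[symmetric] mem_DS using f(1,3) by blast
    moreover have "q \<notin> ?S" using True by blast
    ultimately have "(q, y) \<in> DS A" by (simp add: mem_nbrs)
    then obtain g where g: "g \<in># A" "(q, y) \<in> fst g" by (auto simp: mem_DS)
    have "g = f" using g f faces_disjoint[OF D(1,2), of "fst g" "fst f"] in_fm_faces[OF M(1)] M(2) by (metis union_iff)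
    then show ?thesis using g f by blast
  qed
qed

section \<open>Ladders\<close>

lemmas TQ = Tri_def Qd_def insert_commute

lemma rc_near:
  assumes "w \<noteq> p2" "p1 \<noteq> p3" "p1 \<noteq> p4" "(p1, p3) \<notin> DS X" "A = Tri s p0 p1 p2" "B = Qd s p0 p2 p3 p4 w"
    "A' = Tri s p1 p2 p3" "B' = Qd s p1 p3 p4 p0 w" "X = R + {#A, B#}" "Y = R + {#A', B'#}"
  shows "rc 1 X Y"
  using rc_step[OF near[of w p2 p1 p3 p4 X R s p0]] assms by simp

text \<open>The primed versions are the same flips in the reflected pentagon, with
  \<open>p0, p2\<close> exchanged and \<open>p3, p4\<close> exchanged.\<close>

lemma rc_near':
  assumes "w \<noteq> p0" "p1 \<noteq> p4" "p1 \<noteq> p3" "(p1, p4) \<notin> DS X" "A = Tri s p0 p1 p2" "B = Qd s p0 p2 p3 p4 w"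
    "A' = Tri s p4 p0 p1" "B' = Qd s p1 p2 p3 p4 w" "X = R + {#A, B#}" "Y = R + {#A', B'#}"
  shows "rc 1 X Y"
  by (rule rc_near[where s = "\<not> s" and ?p0.0 = p2 and ?p1.0 = p1 and ?p2.0 = p0 and ?p3.0 = p4 and ?p4.0 = p3 and w = w
        and A = A and B = B and A' = A' and B' = B' and R = R])
    (use assms in \<open>simp_all add: TQ\<close>)

lemma rc_far:
  assumes "w \<noteq> p3" "p1 \<noteq> p4" "(p2, p4) \<notin> DS X" "A = Tri s p0 p1 p2" "B = Qd s p0 p2 p3 p4 w"
    "A' = Tri s p2 p3 p4" "B' = Qd s p2 p4 p0 p1 w" "X = R + {#A, B#}" "Y = R + {#A', B'#}"
  shows "rc 1 X Y"
  using rc_step[OF far[of w p3 p1 p4 p2 X R s p0]] assms by simp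

lemma rc_far':
  assumes "w \<noteq> p4" "p1 \<noteq> p3" "(p0, p3) \<notin> DS X" "A = Tri s p0 p1 p2" "B = Qd s p0 p2 p3 p4 w"
    "A' = Tri s p3 p4 p0" "B' = Qd s p0 p1 p2 p3 w" "X = R + {#A, B#}" "Y = R + {#A', B'#}"
  shows "rc 1 X Y"
  by (rule rc_far[where s = "\<not> s" and ?p0.0 = p2 and ?p1.0 = p1 and ?p2.0 = p0 and ?p3.0 = p4 and ?p4.0 = p3 and w = w
        and A = A and B = B and A' = A' and B' = B' and R = R])
    (use assms in \<open>simp_all add: TQ\<close>)

lemma rc_quad:
  assumes "p1 \<noteq> p3" "(p1, p3) \<notin> DS X" "A = Tri s p0 p1 p2" "B = Tri s p0 p2 p3"
    "A' = Tri s p1 p2 p3" "B' = Tri s p1 p3 p0" "X = R + {#A, B#}" "Y = R + {#A', B'#}"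
  shows "rc 1 X Y"
  using rc_step[OF quad[of p1 p3 X R s p0 p2]] assms by simp

section \<open>Ladders and the sweeps that exchange a pole\<close>

fun Lay :: "bool \<Rightarrow> 'v \<Rightarrow> 'v \<Rightarrow> 'v list \<Rightarrow> 'v tface multiset" where
  "Lay s x y (a # b # zs) = add_mset (Qd s a x b y b) (Lay s x y (b # zs))"
| "Lay s x y _ = {#}"

text \<open>A triangle with apex \<open>z\<close> filled by the vertices of the list, all of them adjacent to both poles
  \<open>x\<close> and \<open>y\<close>; the first one is next to the apex.\<close>
definition Lad :: "bool \<Rightarrow> 'v \<Rightarrow> 'v \<Rightarrow> 'v \<Rightarrow> 'v list \<Rightarrow> 'v tface multiset" where
  "Lad s x y z vs = Lay s x y (z # vs) + {#Tri s x y (last (z # vs))#}"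

lemma Lay_flip: "Lay (\<not> s) x y zs = Lay s y x zs"
  by (induction s x y zs rule: Lay.induct) (simp_all add: TQ)

lemma Lad_flip: "Lad (\<not> s) x y z vs = Lad s y x z vs"
  unfolding Lad_def Lay_flip by (simp add: TQ)

lemma Lay_append: "Lay s x y (as @ c # bs) = Lay s x y (as @ [c]) + Lay s x y (c # bs)"
proof (induction as)
  case (Cons a as) then show ?case by (cases as) auto
qed simp

lemma Lay_snoc: "Lay s x y (as @ [a, b]) = add_mset (Qd s a x b y b) (Lay s x y (as @ [a]))"
  using Lay_append[of s x y as a "[b]"] by simp

lemma Lay_DS: "DS (Lay s x y zs) \<subseteq> {x, y} \<times> set zs \<union> set zs \<times> {x, y}"
proof (induction s x y zs rule: Lay.induct)
  case (1 s x y a b zs)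
  have "fst (Qd s a x b y b) \<subseteq> {x, y} \<times> {a, b} \<union> {a, b} \<times> {x, y}"
    by (cases s) (simp_all add: fst_Qd dd_def)
  then have "DS (Lay s x y (a # b # zs)) \<subseteq> ({x, y} \<times> {a, b} \<union> {a, b} \<times> {x, y}) \<union> ({x, y} \<times> set (b # zs) \<union> set (b # zs) \<times> {x, y})"
    using 1 by (simp only: Lay.simps DS_simps) (rule Un_mono)
  also have "\<dots> \<subseteq> {x, y} \<times> set (a # b # zs) \<union> set (a # b # zs) \<times> {x, y}" by auto
  finally show ?case .
qed auto

lemma Lay_notin: "(p \<notin> {x, y} \<or> q \<notin> set zs) \<Longrightarrow> (p \<notin> set zs \<or> q \<notin> {x, y}) \<Longrightarrow> (p, q) \<notin> DS (Lay s x y zs)"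
  using Lay_DS[of s x y zs] by blast

lemma dd_iff: "(p, q) = dd s a b \<longleftrightarrow> (if s then p = a \<and> q = b else p = b \<and> q = a)" by (auto simp: dd_def)

lemmas notin = Lay_notin fst_Tri fst_Qd dd_iff

text \<open>The triangle climbs one layer per flip: the edge \<open>a q\<close> gives way to
  \<open>r b\<close>, so in every layer passed the pole \<open>q\<close> is replaced by
  \<open>r\<close>. Only the first vertex is joined to \<open>r\<close> beforehand.\<close>

lemma sweep_up:
  assumes "zs \<noteq> []" "distinct zs" "p \<noteq> q" "r \<noteq> p" "r \<noteq> q" "p \<notin> set zs" "q \<notin> set zs" "r \<notin> set zs"
    "\<And>v. v \<in> set (tl zs) \<Longrightarrow> (r, v) \<notin> DS R"
  shows "rc (length zs) (R + {#Tri s (hd zs) q r#} + Lay s p q zs) (R + Lay s p r zs + {#Tri s (last zs) q r#})"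
  using assms
proof (induction zs arbitrary: R)
  case (Cons a zs)
  show ?case
  proof (cases zs)
    case Nil then show ?thesis by simp
  next
    case (Cons b zs')
    note zs = Cons
    let ?X = "R + {#Tri s a q r#} + Lay s p q (a # b # zs')"
    let ?Y = "(R + {#Qd s a p b r b#}) + {#Tri s b q r#} + Lay s p q (b # zs')"
    have 1: "rc 1 ?X ?Y"
    proof (rule rc_near'[where s = s and ?p0.0 = q and ?p1.0 = r and ?p2.0 = a and ?p3.0 = p and ?p4.0 = b and w = b
          and R = "R + Lay s p q (b # zs')" and A = "Tri s a q r" and B = "Qd s a p b q b"
          and A' = "Tri s b q r" and B' = "Qd s a p b r b"])
      show "(r, b) \<notin> DS ?X" using Cons.prems zs by (cases s) (auto simp: notin)
      show "?X = R + Lay s p q (b # zs') + {#Tri s a q r, Qd s a p b q b#}"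
        "?Y = R + Lay s p q (b # zs') + {#Tri s b q r, Qd s a p b r b#}" by simp_all
    qed (use Cons.prems zs in \<open>auto simp: TQ\<close>)
    have "rc (length zs) ((R + {#Qd s a p b r b#}) + {#Tri s (hd zs) q r#} + Lay s p q zs)
       ((R + {#Qd s a p b r b#}) + Lay s p r zs + {#Tri s (last zs) q r#})"
      by (rule Cons.IH) (use Cons.prems zs in \<open>cases s; auto simp: notin\<close>)+
    from rc_trans[OF 1 this[unfolded zs list.sel(1)]] show ?thesis
      unfolding zs by (simp add: ac_simps)
  qed
qed simp

text \<open>The same exchange of poles, run from the last vertex to the first.\<close>

lemma sweep_down:
  assumes "zs \<noteq> []" "distinct zs" "p \<noteq> q" "r \<noteq> p" "r \<noteq> q" "p \<notin> set zs" "q \<notin> set zs" "r \<notin> set zs"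
    "\<And>v. v \<in> set (butlast zs) \<Longrightarrow> (r, v) \<notin> DS R"
  shows "rc (length zs) (R + {#Tri s q (last zs) r#} + Lay s p q zs) (R + Lay s p r zs + {#Tri s q (hd zs) r#})"
  using assms
proof (induction zs arbitrary: R rule: rev_induct)
  case (snoc b zs)
  show ?case
  proof (cases zs rule: rev_cases)
    case Nil then show ?thesis by simp
  next
    case (snoc zs' a)
    note zs = snoc
    let ?X = "R + {#Tri s q b r#} + Lay s p q (zs' @ [a, b])"
    let ?Y = "(R + {#Qd s a p b r b#}) + {#Tri s q a r#} + Lay s p q (zs' @ [a])"
    have 1: "rc 1 ?X ?Y"
    proof (rule rc_near[where s = s and ?p0.0 = b and ?p1.0 = r and ?p2.0 = q and ?p3.0 = a and ?p4.0 = p and w = b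
          and R = "R + Lay s p q (zs' @ [a])" and A = "Tri s q b r" and B = "Qd s a p b q b"
          and A' = "Tri s q a r" and B' = "Qd s a p b r b"])
      have "(r, a) \<notin> DS R" using snoc.prems(9)[of a] zs by (simp add: butlast_append)
      then show "(r, a) \<notin> DS ?X" using snoc.prems(1-8) zs by (cases s) (auto simp: notin)
      show "?X = R + Lay s p q (zs' @ [a]) + {#Tri s q b r, Qd s a p b q b#}"
        "?Y = R + Lay s p q (zs' @ [a]) + {#Tri s q a r, Qd s a p b r b#}" by (simp_all add: Lay_snoc)
    qed (use snoc.prems(1-8) zs in \<open>auto simp: TQ\<close>)
    have "rc (length zs) ((R + {#Qd s a p b r b#}) + {#Tri s q (last zs) r#} + Lay s p q zs)
       ((R + {#Qd s a p b r b#}) + Lay s p r zs + {#Tri s q (hd zs) r#})"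
    proof (rule snoc.IH)
      fix v assume "v \<in> set (butlast zs)"
      then show "(r, v) \<notin> DS (R + {#Qd s a p b r b#})"
        using snoc.prems zs by (cases s) (auto simp: notin butlast_append)
    qed (use snoc.prems zs in auto)
    then have 2: "rc (length zs) ?Y ((R + {#Qd s a p b r b#}) + Lay s p r zs + {#Tri s q (hd zs) r#})"
      unfolding zs by simp
    have "hd (zs @ [b]) = hd zs" using zs by (cases zs') auto
    with rc_trans[OF 1 2] show ?thesis unfolding zs by (simp add: Lay_snoc ac_simps)
  qed
qed simp

definition lad_ok :: "'v tface multiset \<Rightarrow> 'v \<Rightarrow> 'v \<Rightarrow> 'v \<Rightarrow> 'v list \<Rightarrow> bool" where
  "lad_ok R x y z vs \<longleftrightarrow> distinct (x # y # z # vs) \<and> (\<forall>v\<in>set vs. \<forall>u. (u, v) \<notin> DS R \<and> (v, u) \<notin> DS R)"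

text \<open>The last vertex \<open>v\<close> is swung to the side \<open>xy\<close>, and two sweeps turn the rest of the ladder around it.\<close>
lemma turn_prefix:
  assumes ok: "lad_ok R x y z (ws @ [v])" and ws: "ws \<noteq> []"
  shows "rc (2 * length ws + 4) (R + Lad s x y z (ws @ [v]))
     (R + {#Qd s x v (last ws) z v, Tri s x y v#} + Lay s z v (y # ws))"
proof -
  obtain u us where uw: "ws = u # us" using ws by (cases ws) auto
  define l where "l = last ws"
  have l: "l = last (z # ws)" "l \<in> set ws" "l \<notin> set (butlast ws)"
  proof -
    show "l = last (z # ws)" "l \<in> set ws" using ws by (simp_all add: l_def)
    have "distinct (butlast ws @ [l])" using ok ws unfolding lad_ok_def l_def by (simp add: append_butlast_last_id)
    then show "l \<notin> set (butlast ws)" by simp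
  qed
  have d: "distinct (x # y # z # v # ws)" using ok unfolding lad_ok_def by auto
  have fr: "(a, b) \<notin> DS R" if "a \<in> set ws \<or> b \<in> set ws \<or> a = v \<or> b = v" for a b
    using ok that unfolding lad_ok_def by auto
  have wsl: "ws = butlast ws @ [l]" using ws by (simp add: l_def)
  have Lyl: "Lay s x y (z # ws @ [v]) = add_mset (Qd s l x v y v) (Lay s x y (z # ws))"
    using Lay_snoc[of s x y "z # butlast ws" l v] wsl by (metis append_Cons append_assoc append_Nil)
  let ?S0 = "R + Lad s x y z (ws @ [v])"
  \<comment> \<open>\<open>v\<close> has degree two, and its edge to \<open>x\<close> is swung to
    \<open>l\<close>.\<close>
  let ?S1 = "R + Lay s x y (z # ws) + {#Tri s v y l, Qd s l x y v v#}"
  have 1: "rc 1 ?S0 ?S1"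
  proof (rule rc_far[where s = s and ?p0.0 = x and ?p1.0 = y and ?p2.0 = v and ?p3.0 = y and ?p4.0 = l and w = v
        and R = "R + Lay s x y (z # ws)" and A = "Tri s x y v" and B = "Qd s l x v y v"
        and A' = "Tri s v y l" and B' = "Qd s l x y v v"])
    show "?S1 = R + Lay s x y (z # ws) + {#Tri s v y l, Qd s l x y v v#}" by simp
    show "(v, l) \<notin> DS ?S0" unfolding Lad_def Lyl using d l fr by (cases s) (auto simp: notin)
    show "?S0 = R + Lay s x y (z # ws) + {#Tri s x y v, Qd s l x v y v#}"
      unfolding Lad_def Lyl by (simp add: ac_simps)
    show "Qd s l x v y v = Qd s x v y l v" by (rule Qd_rot)
    show "Qd s l x y v v = Qd s v l x y v" by (rule Qd_rot[symmetric])
  qed (use d l in auto)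
  \<comment> \<open>First sweep: the pole \<open>y\<close> becomes \<open>v\<close>, and the
    triangle ends up at the apex \<open>z\<close>.\<close>
  let ?S2 = "R + {#Qd s l x y v v#} + Lay s x v (z # ws) + {#Tri s y z v#}"
  have "rc (length (z # ws)) (R + {#Qd s l x y v v#} + {#Tri s y (last (z # ws)) v#} + Lay s x y (z # ws))
      (R + {#Qd s l x y v v#} + Lay s x v (z # ws) + {#Tri s y (hd (z # ws)) v#})"
  proof (rule sweep_down)
    fix a assume "a \<in> set (butlast (z # ws))"
    then have a: "a = z \<or> a \<in> set (butlast ws)" using ws by auto
    then have "a \<noteq> l" using l d by auto
    moreover have "a \<noteq> y" "a \<noteq> x" "a \<noteq> v" using a d in_set_butlastD[of a ws] by auto
    ultimately show "(v, a) \<notin> DS (R + {#Qd s l x y v v#})" using fr d by (cases s) (auto simp: notin)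
  qed (use d in auto)
  moreover have "Tri s y l v = Tri s v y l" by (simp add: TQ)
  ultimately have 2: "rc (length ws + 1) ?S1 ?S2" using l(1)[symmetric] by (simp add: ac_simps)
  \<comment> \<open>The edge \<open>v z\<close> becomes \<open>z u\<close>, which provides a
    triangle on the side \<open>z x\<close> for the second sweep.\<close>
  let ?S3 = "R + {#Qd s l x y v v, Qd s z u v y u, Tri s z x u#} + Lay s x v ws"
  have 3: "rc 1 ?S2 ?S3"
  proof (rule rc_far[where s = s and ?p0.0 = v and ?p1.0 = y and ?p2.0 = z and ?p3.0 = x and ?p4.0 = u and w = u
        and R = "R + {#Qd s l x y v v#} + Lay s x v ws" and A = "Tri s y z v" and B = "Qd s z x u v u"
        and A' = "Tri s z x u" and B' = "Qd s z u v y u"])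
    show "?S3 = R + {#Qd s l x y v v#} + Lay s x v ws + {#Tri s z x u, Qd s z u v y u#}" by (simp add: ac_simps)
    show "(z, u) \<notin> DS ?S2" using d l fr uw by (cases s) (auto simp: notin)
    show "?S2 = R + {#Qd s l x y v v#} + Lay s x v ws + {#Tri s y z v, Qd s z x u v u#}"
      unfolding uw by (simp add: ac_simps)
  qed (use d uw in \<open>auto simp: TQ\<close>)
  \<comment> \<open>Second sweep, in mirrored orientation: the pole \<open>x\<close> becomes
    \<open>z\<close>.\<close>
  let ?S4 = "R + {#Qd s l x y v v, Qd s z u v y u, Tri s z x l#} + Lay s z v ws"
  have "rc (length ws) (R + {#Qd s l x y v v, Qd s z u v y u#} + {#Tri (\<not> s) (hd ws) x z#} + Lay (\<not> s) v x ws)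
      (R + {#Qd s l x y v v, Qd s z u v y u#} + Lay (\<not> s) v z ws + {#Tri (\<not> s) (last ws) x z#})"
  proof (rule sweep_up)
    fix a assume a: "a \<in> set (tl ws)"
    then have "a \<in> set ws" "a \<noteq> u" using uw d by auto
    then show "(z, a) \<notin> DS (R + {#Qd s l x y v v, Qd s z u v y u#})" using fr d l by (cases s) (auto simp: notin)
  qed (use d ws in auto)
  moreover have "Tri (\<not> s) u x z = Tri s z x u" "Tri (\<not> s) l x z = Tri s z x l" by (simp_all add: TQ)
  ultimately have 4: "rc (length ws) ?S3 ?S4" using l_def[symmetric] uw by (simp add: Lay_flip ac_simps)
  \<comment> \<open>The edge \<open>l x\<close> becomes \<open>x v\<close>; the remaining layers now
    have poles \<open>z\<close>, \<open>v\<close> and start at \<open>y\<close>.\<close>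
  let ?S5 = "R + {#Qd s x v l z v, Tri s x y v#} + Lay s z v (y # ws)"
  have 5: "rc 1 ?S4 ?S5"
  proof (rule rc_far[where s = s and ?p0.0 = l and ?p1.0 = z and ?p2.0 = x and ?p3.0 = y and ?p4.0 = v and w = v
        and R = "R + {#Qd s z u v y u#} + Lay s z v ws" and A = "Tri s z x l" and B = "Qd s l x y v v"
        and A' = "Tri s x y v" and B' = "Qd s x v l z v"])
    show "?S4 = R + {#Qd s z u v y u#} + Lay s z v ws + {#Tri s z x l, Qd s l x y v v#}" by (simp add: ac_simps)
    have ne: "x \<noteq> y" "x \<noteq> z" "x \<noteq> v" "y \<noteq> v" "z \<noteq> v" "l \<noteq> x" "l \<noteq> v" "u \<noteq> x" "u \<noteq> v" using d l uw by auto
    have "(x, v) \<notin> DS (Lay s z v ws)" by (rule Lay_notin) (use d in auto)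
    then show "(x, v) \<notin> DS ?S4" using fr[of x v] ne by (cases s) (simp_all add: fst_Qd fst_Tri dd_def)
    show "?S5 = R + {#Qd s z u v y u#} + Lay s z v ws + {#Tri s x y v, Qd s x v l z v#}"
      unfolding uw by (simp add: TQ ac_simps)
  qed (use d l uw in \<open>auto simp: TQ\<close>)
  have "rc (1 + (length ws + 1) + 1 + length ws + 1) ?S0 ?S5"
    using rc_trans[OF rc_trans[OF rc_trans[OF rc_trans[OF 1 2] 3] 4] 5] .
  then show ?thesis unfolding l_def by (rule rc_mono) simp
qed

text \<open>The corners change roles cyclically while the order of the vertices is kept. After
  \<open>turn_prefix\<close> one more sweep exchanges the pole \<open>v\<close> for
  \<open>x\<close>, and one flip puts \<open>v\<close> back at the end. The total
  \<open>3 * length ws + 6\<close> is at most \<open>5 * (length ws + 1)\<close> for nonempty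
  \<open>ws\<close>.\<close>

lemma turn:
  assumes ok: "lad_ok R x y z vs"
  shows "rc (5 * length vs) (R + Lad s x y z vs) (R + Lad s z x y vs)"
proof (cases vs rule: rev_cases)
  case Nil then show ?thesis by (simp add: Lad_def TQ)
next
  case (snoc ws v)
  note vs = snoc
  have d: "distinct (x # y # z # v # ws)" using ok unfolding lad_ok_def vs by auto
  have fr: "(a, b) \<notin> DS R" if "a \<in> set ws \<or> b \<in> set ws \<or> a = v \<or> b = v" for a b
    using ok that unfolding lad_ok_def vs by auto
  show ?thesis
  proof (cases "ws = []")
    case True
    let ?S0 = "R + {#Qd s z x v y v, Tri s x y v#}"
    let ?S1 = "R + {#Tri s v y z, Qd s z x y v v#}"
    let ?S2 = "R + {#Qd s y z v x v, Tri s z x v#}"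
    have 1: "rc 1 ?S0 ?S1"
    proof (rule rc_far[where s = s and ?p0.0 = x and ?p1.0 = y and ?p2.0 = v and ?p3.0 = y and ?p4.0 = z and w = v and R = R
          and A = "Tri s x y v" and B = "Qd s z x v y v" and A' = "Tri s v y z" and B' = "Qd s z x y v v"])
      show "?S0 = R + {#Tri s x y v, Qd s z x v y v#}" "?S1 = R + {#Tri s v y z, Qd s z x y v v#}" by simp_all
      show "(v, z) \<notin> DS ?S0" using d fr by (cases s) (auto simp: notin)
    qed (use d in \<open>auto simp: TQ\<close>)
    have 2: "rc 1 ?S1 ?S2"
    proof (rule rc_far[where s = s and ?p0.0 = y and ?p1.0 = z and ?p2.0 = v and ?p3.0 = z and ?p4.0 = x and w = v and R = R
          and A = "Tri s v y z" and B = "Qd s z x y v v" and A' = "Tri s z x v" and B' = "Qd s y z v x v"])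
      show "?S1 = R + {#Tri s v y z, Qd s z x y v v#}" "?S2 = R + {#Tri s z x v, Qd s y z v x v#}" by simp_all
      show "(v, x) \<notin> DS ?S1" using d fr by (cases s) (auto simp: notin)
    qed (use d in \<open>auto simp: TQ\<close>)
    have "rc 5 ?S0 ?S2" by (rule rc_mono[OF rc_trans[OF 1 2]]) simp
    then show ?thesis unfolding vs True Lad_def by (simp add: ac_simps)
  next
    case False
    define l where "l = last ws"
    have l: "l \<in> set ws" using False by (simp add: l_def)
    let ?O = "R + {#Qd s x v l z v, Tri s x y v#} + Lay s z v (y # ws)"
    have 0: "rc (2 * length ws + 4) (R + Lad s x y z vs) ?O"
      using turn_prefix[OF ok[unfolded vs] False] unfolding vs l_def by simp
    let ?S6 = "R + {#Qd s x v l z v, Tri s l v x#} + Lay s z x (y # ws)"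
    have "rc (length (y # ws)) (R + {#Qd s x v l z v#} + {#Tri s (hd (y # ws)) v x#} + Lay s z v (y # ws))
       (R + {#Qd s x v l z v#} + Lay s z x (y # ws) + {#Tri s (last (y # ws)) v x#})"
    proof (rule sweep_up)
      fix a assume "a \<in> set (tl (y # ws))"
      then show "(x, a) \<notin> DS (R + {#Qd s x v l z v#})" using fr d l by (cases s) (auto simp: notin)
    qed (use d in auto)
    moreover have "Tri s y v x = Tri s x y v" by (simp add: TQ)
    ultimately have 6: "rc (length ws + 1) ?O ?S6" using False l_def[symmetric] by (simp add: ac_simps)
    let ?S7 = "R + {#Qd s l z v x v, Tri s z x v#} + Lay s z x (y # ws)"
    have 7: "rc 1 ?S6 ?S7"
    proof (rule rc_far'[where s = s and ?p0.0 = v and ?p1.0 = x and ?p2.0 = l and ?p3.0 = z and ?p4.0 = x and w = v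
          and R = "R + Lay s z x (y # ws)" and A = "Tri s l v x" and B = "Qd s x v l z v"])
      show "(v, z) \<notin> DS ?S6" using d fr l by (cases s) (auto simp: notin)
      show "?S6 = R + Lay s z x (y # ws) + {#Tri s l v x, Qd s x v l z v#}" by (simp add: ac_simps)
      show "?S7 = R + Lay s z x (y # ws) + {#Tri s z x v, Qd s l z v x v#}" by (simp add: ac_simps)
    qed (use d l in \<open>auto simp: TQ\<close>)
    have wsl: "ws = butlast ws @ [l]" using False by (simp add: l_def)
    have "Lay s z x (y # ws @ [v]) = add_mset (Qd s l z v x v) (Lay s z x (y # ws))"
      using Lay_snoc[of s z x "y # butlast ws" l v] wsl by (metis append_Cons append_assoc append_Nil)
    then have S7: "?S7 = R + Lad s z x y vs" unfolding Lad_def vs by (simp add: ac_simps)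
    have "length ws \<ge> 1" using False by (cases ws) auto
    then have "rc (5 * length vs) (R + Lad s x y z vs) ?S7"
      by (intro rc_mono[OF rc_trans[OF rc_trans[OF 0 6] 7]]) (simp add: vs)
    then show ?thesis unfolding S7 .
  qed
qed

lemma lad_ok_rest:
  assumes "lad_ok R x y z vs" "set vs' \<subseteq> set vs" "distinct (x' # y' # z' # vs')"
    "\<And>v u. v \<in> set vs' \<Longrightarrow> (u, v) \<notin> DS A \<and> (v, u) \<notin> DS A"
  shows "lad_ok (R + A) x' y' z' vs'"
  using assms unfolding lad_ok_def by (auto simp: DS_simps)

text \<open>After \<open>turn_prefix\<close> one flip makes \<open>v\<close> a corner of a smaller
  triangle holding the ladder of \<open>ws\<close>. Once that ladder is turned so that
  \<open>v\<close> is its apex, \<open>v\<close> is the first rung of a ladder with poles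
  \<open>y\<close>, \<open>z\<close>, and another turn restores the corners. With
  \<open>w = length ws\<close> the costs \<open>2 w + 4\<close>, \<open>1\<close>,
  \<open>5 w\<close> and \<open>5 (w + 1)\<close> explain the factor 12.\<close>

lemma cycle:
  assumes ok: "lad_ok R x y z (ws @ [v])"
  shows "rc (12 * length (ws @ [v])) (R + Lad s x y z (ws @ [v])) (R + Lad s x y z (v # ws))"
proof (cases "ws = []")
  case False
  have d: "distinct (x # y # z # v # ws)" using ok unfolding lad_ok_def by auto
  have fr: "(a, b) \<notin> DS R" if "a \<in> set ws \<or> b \<in> set ws \<or> a = v \<or> b = v" for a b
    using ok that unfolding lad_ok_def by auto
  define l where "l = last ws"
  have l: "l \<in> set ws" using False by (simp add: l_def)
  let ?O = "R + {#Qd s x v l z v, Tri s x y v#} + Lay s z v (y # ws)"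
  have 0: "rc (2 * length ws + 4) (R + Lad s x y z (ws @ [v])) ?O"
    using turn_prefix[OF ok False] unfolding l_def by simp
  let ?P = "(R + {#Qd s x y v z v#}) + Lad s z v y ws"
  have 1: "rc 1 ?O ?P"
  proof (rule rc_far[where s = s and ?p0.0 = x and ?p1.0 = y and ?p2.0 = v and ?p3.0 = l and ?p4.0 = z and w = v
        and R = "R + Lay s z v (y # ws)" and A = "Tri s x y v" and B = "Qd s x v l z v"
        and A' = "Tri s z v l" and B' = "Qd s x y v z v"])
    show "(v, z) \<notin> DS ?O" using d fr l by (cases s) (auto simp: notin)
    show "?O = R + Lay s z v (y # ws) + {#Tri s x y v, Qd s x v l z v#}" by (simp add: ac_simps)
    show "?P = R + Lay s z v (y # ws) + {#Tri s z v l, Qd s x y v z v#}"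
      unfolding Lad_def l_def using False by (simp add: ac_simps)
  qed (use d l in \<open>auto simp: TQ\<close>)
  let ?Q = "(R + {#Qd s x y v z v#}) + Lad s y z v ws"
  have 2: "rc (5 * length ws) ?P ?Q"
    by (rule turn, rule lad_ok_rest[OF ok]) (use d in \<open>cases s; auto simp: notin\<close>)+
  have Q: "?Q = R + Lad s y z x (v # ws)" unfolding Lad_def by (simp add: ac_simps)
  have ok2: "lad_ok R y z x (v # ws)" using ok unfolding lad_ok_def by auto
  have 3: "rc (5 * length (v # ws)) ?Q (R + Lad s x y z (v # ws))" unfolding Q by (rule turn[OF ok2])
  from rc_trans[OF rc_trans[OF rc_trans[OF 0 1] 2] 3]
  show ?thesis by (rule rc_mono) (simp)
qed simp

text \<open>The ladder fills the triangle \<open>u c a\<close>, and \<open>F\<close> lies behind its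
  side \<open>uc\<close>. Two sweeps carry the layers over to poles \<open>a\<close>,
  \<open>u'\<close>, with \<open>c\<close> in front of them; \<open>F'\<close> is \<open>F\<close>
  with its corner \<open>c\<close> replaced by the last ladder vertex. Only the first flip sees
  whether \<open>F\<close> is a triangle or a quadrilateral.\<close>

lemma advance:
  assumes ok: "lad_ok (R + {#F#}) u c a vs" and d: "distinct [a, c, u, u']" and u': "u' \<notin> set vs"
    and F: "(F = Qd s c u t u' w \<and> F' = Qd s (last (c # vs)) u t u' w \<and> w \<noteq> c) \<or>
            (F = Tri s c u u' \<and> F' = Tri s (last (c # vs)) u u')"
  shows "rc (2 * length vs + 2) (R + {#F#} + Lad s u c a vs) (R + {#F'#} + Lay s a u' (c # vs) + {#Tri s a u (last (c # vs))#})"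
proof (cases vs)
  case Nil
  have "F' = F" using F Nil by auto
  moreover have "Tri s u c a = Tri s a u c" by (simp add: TQ)
  ultimately show ?thesis using Nil by (simp add: Lad_def)
next
  case (Cons h hs)
  note vs = Cons
  define v where "v = last vs"
  have v: "v \<in> set vs" "v = last (h # hs)" "v = last (c # vs)" using vs by (auto simp: v_def)
  have dv: "distinct (u # c # a # vs)" using ok unfolding lad_ok_def by auto
  have fr: "(p, q) \<notin> DS (R + {#F#})" if "p \<in> set vs \<or> q \<in> set vs" for p q
    using ok that unfolding lad_ok_def by auto
  have frR: "(p, q) \<notin> DS R" if "p \<in> set vs \<or> q \<in> set vs" for p q using fr[OF that] by simp
  have t: "t \<notin> set vs" if "F = Qd s c u t u' w"
  proof
    assume "t \<in> set vs"
    then have "(u, t) \<notin> DS (R + {#F#})" "(t, u) \<notin> DS (R + {#F#})" using fr by auto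
    then show False using that by (cases s) (auto simp: fst_Qd dd_def)
  qed
  have F'd: "fst F' \<subseteq> {(p, q). p = v \<or> q = v \<or> (p, q) \<in> fst F}"
    using F v by (cases s) (auto simp: fst_Qd fst_Tri dd_def)
  have F'v: "(p, q) \<notin> fst F'" if "p \<in> set vs - {v} \<or> q \<in> set vs - {v}" "p \<noteq> v" "q \<noteq> v" for p q
    using F'd that fr[of p q] by auto
  have lad: "Lad s u c a vs = Lay s u c vs + {#Qd s a u h c h, Tri s u c v#}" unfolding Lad_def vs v_def by simp
  let ?S0 = "R + {#F#} + Lad s u c a vs"
  let ?S1 = "R + {#F', Qd s a u h c h#} + {#Tri s c v u'#} + Lay s u c vs"
  have vu': "(v, u') \<notin> DS ?S0" "(v, u') \<notin> DS (R + {#F#})" 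
    unfolding lad using fr[of v u'] v(1) dv u' d vs by (cases s; auto simp: notin)+
  have 1: "rc 1 ?S0 ?S1"
    using F
  proof (elim disjE conjE)
    assume f: "F = Qd s c u t u' w" "F' = Qd s (last (c # vs)) u t u' w" "w \<noteq> c"
    show ?thesis
    proof (rule rc_near'[where s = s and ?p0.0 = c and ?p1.0 = v and ?p2.0 = u and ?p3.0 = t and ?p4.0 = u' and w = w
        and R = "R + {#Qd s a u h c h#} + Lay s u c vs" and A = "Tri s u c v" and B = F and A' = "Tri s c v u'" and B' = F'])
      show "v \<noteq> t" using t[OF f(1)] v by auto
      show "v \<noteq> u'" using u' v by auto
      show "?S0 = R + {#Qd s a u h c h#} + Lay s u c vs + {#Tri s u c v, F#}" unfolding lad by (simp add: ac_simps)
    qed (use vu' f v(3) in \<open>simp_all add: TQ\<close>)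
  next
    assume f: "F = Tri s c u u'" "F' = Tri s (last (c # vs)) u u'"
    show ?thesis
    proof (rule rc_quad[where s = s and ?p0.0 = c and ?p1.0 = v and ?p2.0 = u and ?p3.0 = u'
        and R = "R + {#Qd s a u h c h#} + Lay s u c vs" and A = "Tri s u c v" and B = F and A' = F' and B' = "Tri s c v u'"])
      show "v \<noteq> u'" using u' v by auto
      show "?S0 = R + {#Qd s a u h c h#} + Lay s u c vs + {#Tri s u c v, F#}" unfolding lad by (simp add: ac_simps)
    qed (use vu' f v(3) in \<open>simp_all add: TQ\<close>)
  qed
  let ?S2 = "R + {#F', Qd s a u h c h#} + Lay s u u' vs + {#Tri s c h u'#}"
  have 2: "rc (length vs) ?S1 ?S2"
  proof -
    have "rc (length vs) (R + {#F', Qd s a u h c h#} + {#Tri s c (last vs) u'#} + Lay s u c vs)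
        (R + {#F', Qd s a u h c h#} + Lay s u u' vs + {#Tri s c (hd vs) u'#})"
    proof (rule sweep_down)
      fix p assume p: "p \<in> set (butlast vs)"
      have "butlast vs @ [v] = vs" unfolding v_def by (rule append_butlast_last_id) (simp add: vs)
      moreover have "distinct vs" using dv by simp
      ultimately have "distinct (butlast vs @ [v])" by metis
      then have pv: "p \<in> set vs" "p \<noteq> v" using p in_set_butlastD by auto
      have "(u', p) \<notin> fst F'" using F'v[of u' p] pv u' v by auto
      then show "(u', p) \<notin> DS (R + {#F', Qd s a u h c h#})"
        using frR[of u' p] pv dv d u' vs by (cases s) (auto simp: notin)
    qed (use dv d u' vs in auto)
    then show ?thesis unfolding v_def by (simp add: vs)
  qed
  let ?S3 = "R + {#F', Qd s c a h u' h#} + {#Tri s a u h#} + Lay s u u' vs"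
  have 3: "rc 1 ?S2 ?S3"
  proof (rule rc_far'[where s = s and ?p0.0 = h and ?p1.0 = u' and ?p2.0 = c and ?p3.0 = a and ?p4.0 = u and w = h
      and R = "R + {#F'#} + Lay s u u' vs" and A = "Tri s c h u'" and B = "Qd s a u h c h"
      and A' = "Tri s a u h" and B' = "Qd s c a h u' h"])
    have "(h, a) \<notin> fst F'"
    proof
      assume a: "(h, a) \<in> fst F'"
      have "(h, a) \<notin> fst F" using fr[of h a] vs by simp
      then have "h = v" using a F'd v dv by auto
      then show False using a F v dv d u' vs t by (cases s) (auto simp: fst_Qd fst_Tri dd_def)
    qed
    then show "(h, a) \<notin> DS ?S2" using frR[of h a] dv d u' vs by (cases s) (auto simp: notin)
    show "?S2 = R + {#F'#} + Lay s u u' vs + {#Tri s c h u', Qd s a u h c h#}" by (simp add: ac_simps)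
    show "?S3 = R + {#F'#} + Lay s u u' vs + {#Tri s a u h, Qd s c a h u' h#}" by (simp add: ac_simps)
  qed (use dv d u' vs in \<open>auto simp: TQ\<close>)
  let ?S4 = "R + {#F', Qd s c a h u' h#} + Lay s a u' vs + {#Tri s a u v#}"
  have 4: "rc (length vs) ?S3 ?S4"
  proof -
    have "rc (length vs) (R + {#F', Qd s c a h u' h#} + {#Tri (\<not> s) (hd vs) u a#} + Lay (\<not> s) u' u vs)
       (R + {#F', Qd s c a h u' h#} + Lay (\<not> s) u' a vs + {#Tri (\<not> s) (last vs) u a#})"
    proof (rule sweep_up)
      fix p assume p: "p \<in> set (tl vs)"
      then have p2: "p \<in> set vs" "p \<noteq> h" using vs dv by auto
      have "(a, p) \<notin> fst F'"
      proof
        assume ap: "(a, p) \<in> fst F'"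
        have "(a, p) \<notin> fst F" using fr[of a p] p2 by simp
        then have "p = v" using ap F'd v dv by auto
        then show False using ap F v dv d u' vs t p2 by (cases s) (auto simp: fst_Qd fst_Tri dd_def)
      qed
      then show "(a, p) \<notin> DS (R + {#F', Qd s c a h u' h#})"
        using frR[of a p] p2 dv d u' vs by (cases s) (auto simp: notin)
    qed (use dv d u' vs in auto)
    moreover have "Tri (\<not> s) h u a = Tri s a u h" "Tri (\<not> s) v u a = Tri s a u v" by (simp_all add: TQ)
    ultimately show ?thesis using v_def[symmetric] vs by (simp add: Lay_flip ac_simps)
  qed
  have S4: "?S4 = R + {#F'#} + Lay s a u' (c # vs) + {#Tri s a u (last (c # vs))#}"
    unfolding vs v by (simp add: ac_simps)
  have "rc (2 * length vs + 2) ?S0 ?S4" by (rule rc_mono[OF rc_trans[OF rc_trans[OF rc_trans[OF 1 2] 3] 4]]) simp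
  then show ?thesis unfolding S4 .
qed

text \<open>The vertex \<open>y'\<close> of degree two sits behind the common edge
  \<open>ab\<close>. This edge is flipped away, redrawn on the other side of \<open>y'\<close>, and
  \<open>y'\<close> is joined to \<open>a\<close> again; the redrawing is why \<open>ab\<close> must
  not occur in \<open>R\<close>.\<close>

lemma slide1:
  assumes d: "distinct [a, b, y, y', y'']" and na: "(a, b) \<notin> DS R" and fr: "\<And>u. (u, y') \<notin> DS R \<and> (y', u) \<notin> DS R"
  shows "rc 3 (R + {#Tri s a b y, Tri s b a y', Qd s y'' b y' a y'#}) (R + {#Qd s y a y' b y', Tri s a b y', Tri s b a y''#})"
proof -
  let ?S0 = "R + {#Tri s a b y, Tri s b a y', Qd s y'' b y' a y'#}"
  let ?S1 = "R + {#Tri s y a y', Tri s y y' b, Qd s y'' b y' a y'#}"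
  let ?S2 = "R + {#Tri s b a y'', Tri s y y' b, Qd s a b y' y y'#}"
  let ?S3 = "R + {#Qd s y a y' b y', Tri s a b y', Tri s b a y''#}"
  have 1: "rc 1 ?S0 ?S1"
  proof (rule rc_quad[where s = s and ?p0.0 = b and ?p1.0 = y and ?p2.0 = a and ?p3.0 = y' and R = "R + {#Qd s y'' b y' a y'#}"
        and A = "Tri s a b y" and B = "Tri s b a y'" and A' = "Tri s y a y'" and B' = "Tri s y y' b"])
    show "(y, y') \<notin> DS ?S0" using d fr by (cases s) (auto simp: notin)
  qed (use d in \<open>auto simp: TQ\<close>)
  have 2: "rc 1 ?S1 ?S2"
  proof (rule rc_far[where s = s and ?p0.0 = y' and ?p1.0 = y and ?p2.0 = a and ?p3.0 = y'' and ?p4.0 = b and w = y'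
        and R = "R + {#Tri s y y' b#}" and A = "Tri s y a y'" and B = "Qd s y'' b y' a y'" and A' = "Tri s b a y''" and B' = "Qd s a b y' y y'"])
    show "(a, b) \<notin> DS ?S1" using d na by (cases s) (auto simp: notin)
  qed (use d in \<open>auto simp: TQ\<close>)
  have 3: "rc 1 ?S2 ?S3"
  proof (rule rc_far'[where s = s and ?p0.0 = y' and ?p1.0 = b and ?p2.0 = y and ?p3.0 = a and ?p4.0 = b and w = y'
        and R = "R + {#Tri s b a y''#}" and A = "Tri s y y' b" and B = "Qd s a b y' y y'" and A' = "Tri s a b y'" and B' = "Qd s y a y' b y'"])
    show "(y', a) \<notin> DS ?S2" using d fr by (cases s) (auto simp: notin)
  qed (use d in \<open>auto simp: TQ\<close>)
  from rc_trans[OF rc_trans[OF 1 2] 3] show ?thesis by (simp add: numeral_3_eq_3)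
qed

text \<open>The last rung of the second ladder is the one next to \<open>ab\<close> and crosses
  first, so the vertices arrive in reversed order.\<close>

lemma slide:
  assumes "distinct (a # b # c # e # us @ ws)" "(a, b) \<notin> DS R"
    "\<And>u v. v \<in> set us \<union> set ws \<Longrightarrow> (u, v) \<notin> DS R \<and> (v, u) \<notin> DS R"
  shows "rc (3 * length ws) (R + Lad s a b c us + Lad s b a e ws) (R + Lad s a b c (us @ rev ws) + {#Tri s b a e#})"
  using assms
proof (induction ws arbitrary: us rule: rev_induct)
  case Nil then show ?case by (simp add: Lad_def)
next
  case (snoc v ws)
  define y where "y = last (c # us)"
  define y'' where "y'' = last (e # ws)"
  have y: "y \<in> set (c # us)" "y'' \<in> set (e # ws)" unfolding y_def y''_def by (rule last_in_set, simp)+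
  have lay1: "Lay s a b (c # us @ [v]) = add_mset (Qd s y a v b v) (Lay s a b (c # us))"
    using Lay_snoc[of s a b "butlast (c # us)" y v] append_butlast_last_id[of "c # us"] unfolding y_def[symmetric]
    by (metis append_Cons append_assoc append_Nil list.distinct(1))
  have lay2: "Lay s b a (e # ws @ [v]) = add_mset (Qd s y'' b v a v) (Lay s b a (e # ws))"
    using Lay_snoc[of s b a "butlast (e # ws)" y'' v] append_butlast_last_id[of "e # ws"] unfolding y''_def[symmetric]
    by (metis append_Cons append_assoc append_Nil list.distinct(1))
  let ?R = "R + Lay s a b (c # us) + Lay s b a (e # ws)"
  have "rc 3 (?R + {#Tri s a b y, Tri s b a v, Qd s y'' b v a v#}) (?R + {#Qd s y a v b v, Tri s a b v, Tri s b a y''#})"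
  proof (rule slide1)
    show "distinct [a, b, y, v, y'']" using snoc.prems(1) y by auto
    have "(a, b) \<notin> DS (Lay s a b (c # us))" by (rule Lay_notin) (use snoc.prems(1) in auto)
    moreover have "(a, b) \<notin> DS (Lay s b a (e # ws))" by (rule Lay_notin) (use snoc.prems(1) in auto)
    ultimately show "(a, b) \<notin> DS ?R" using snoc.prems(2) by simp
    have "(u, v) \<notin> DS (Lay s a b (c # us))" "(v, u) \<notin> DS (Lay s a b (c # us))"
      "(u, v) \<notin> DS (Lay s b a (e # ws))" "(v, u) \<notin> DS (Lay s b a (e # ws))" for u
      by (rule Lay_notin; use snoc.prems(1) in auto)+
    then show "(u, v) \<notin> DS ?R \<and> (v, u) \<notin> DS ?R" for u
      using snoc.prems(3)[of v u] by simp
  qed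
  moreover have "?R + {#Tri s a b y, Tri s b a v, Qd s y'' b v a v#} = R + Lad s a b c us + Lad s b a e (ws @ [v])"
    unfolding Lad_def lay2 y_def by (simp add: ac_simps)
  moreover have "?R + {#Qd s y a v b v, Tri s a b v, Tri s b a y''#} = R + Lad s a b c (us @ [v]) + Lad s b a e ws"
    unfolding Lad_def lay1 y''_def by (simp add: ac_simps)
  ultimately have 1: "rc 3 (R + Lad s a b c us + Lad s b a e (ws @ [v])) (R + Lad s a b c (us @ [v]) + Lad s b a e ws)" by metis
  have "rc (3 * length ws) (R + Lad s a b c (us @ [v]) + Lad s b a e ws) (R + Lad s a b c ((us @ [v]) @ rev ws) + {#Tri s b a e#})"
    by (rule snoc.IH) (use snoc.prems in auto)
  from rc_trans[OF 1 this] show ?case by simp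
qed

section \<open>Sides of triangles\<close>

lemma dd_symI: "(\<And>q. (q, v) \<in> D \<longleftrightarrow> (v, q) \<in> D) \<Longrightarrow> dd s q v \<in> D \<longleftrightarrow> dd s v q \<in> D"
  by (simp add: dd_def)

lemma symI_dd: "(dd s q v \<in> D \<longleftrightarrow> dd s v q \<in> D) \<Longrightarrow> (q, v) \<in> D \<longleftrightarrow> (v, q) \<in> D"
  by (auto simp: dd_def split: if_splits)

lemma tri_side_sym_edge:
  assumes rl: "rl Ou X" and J: "tri_side Ou X x y z J K" and c: "{q, v} \<notin> cyc3 x y z"
  shows "(q, v) \<in> DS J \<longleftrightarrow> (v, q) \<in> DS J" "(q, v) \<in> DS K \<longleftrightarrow> (v, q) \<in> DS K"
proof -
  have X: "X = J + K" and Js: "\<And>u v. (u, v) \<in> DS X \<Longrightarrow> ((u, v) \<in> DS J \<longleftrightarrow> ((v, u) \<in> DS J \<longleftrightarrow> {u, v} \<notin> cyc3 x y z))"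
    using J unfolding tri_side_def by blast+
  have 1: "(q, v) \<in> DS J \<longleftrightarrow> (v, q) \<in> DS J" if "(q, v) \<in> DS X" using Js[OF that] c by simp
  have 2: "(q, v) \<in> DS X \<longleftrightarrow> (v, q) \<in> DS X" using rl_sym[OF rl] by blast
  have 3: "DS X = DS J \<union> DS K" "DS J \<inter> DS K = {}" using X rl_disjoint[of Ou J K] rl by auto
  show "(q, v) \<in> DS J \<longleftrightarrow> (v, q) \<in> DS J" "(q, v) \<in> DS K \<longleftrightarrow> (v, q) \<in> DS K"
    using 1 2 3 by blast+
qed

lemma tri_side_sym:
  assumes "rl Ou X" "tri_side Ou X x y z J K" "v \<notin> {x, y, z}"
  shows "(q, v) \<in> DS J \<longleftrightarrow> (v, q) \<in> DS J" "(q, v) \<in> DS K \<longleftrightarrow> (v, q) \<in> DS K"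
proof -
  have "{q, v} \<notin> cyc3 x y z" using assms(3) by (auto simp: cyc3_def doubleton_eq_iff)
  then show "(q, v) \<in> DS J \<longleftrightarrow> (v, q) \<in> DS J" "(q, v) \<in> DS K \<longleftrightarrow> (v, q) \<in> DS K"
    using tri_side_sym_edge[OF assms(1,2)] by blast+
qed

lemma tri_side_cyc:
  assumes "tri_side Ou X x y z J K" "{u, v} \<in> cyc3 x y z" "(u, v) \<in> DS X"
  shows "(u, v) \<in> DS J \<longleftrightarrow> (v, u) \<notin> DS J"
  using assms unfolding tri_side_def by blast

text \<open>The boundary of \<open>J\<close> is one of two oriented triangles, and a single boundary
  dart decides which.\<close>

lemma tri_side_dd:
  assumes rl: "rl Ou X" and J: "tri_side Ou X x y z J K" and d: "distinct [x, y, z]" and i: "dd s y x \<in> DS J"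
  shows "dd s x z \<in> DS J" "dd s z y \<in> DS J" "dd s x y \<notin> DS J" "dd s z x \<notin> DS J" "dd s y z \<notin> DS J"
    "\<And>u v. {u, v} \<in> cyc3 x y z \<Longrightarrow> (u, v) \<in> DS J \<Longrightarrow> (u, v) \<in> {dd s y x, dd s x z, dd s z y}"
    "dd s x y \<in> DS K" "dd s z x \<in> DS K" "dd s y z \<in> DS K"
proof -
  have X: "X = J + K" using J unfolding tri_side_def by (rule conjunct1)
  have c: "{(u, v) \<in> DS J. {u, v} \<in> cyc3 x y z} = {(x, y), (y, z), (z, x)} \<or>
      {(u, v) \<in> DS J. {u, v} \<in> cyc3 x y z} = {(y, x), (z, y), (x, z)}"
    using J unfolding tri_side_def by (elim conjE) assumption
  have gen: "S = A \<or> S = B \<Longrightarrow> p \<in> S \<Longrightarrow> p \<notin> A \<Longrightarrow> S = B" for S A B :: "('a \<times> 'a) set" and p by blast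
  have yx: "{y, x} \<in> cyc3 x y z" by (auto simp: cyc3_def)
  have e: "{(u, v) \<in> DS J. {u, v} \<in> cyc3 x y z} = {dd s y x, dd s x z, dd s z y}"
  proof (cases s)
    case True
    then have "(y, x) \<in> {(u, v) \<in> DS J. {u, v} \<in> cyc3 x y z}" using i yx by (simp add: dd_def)
    moreover have "(y, x) \<notin> {(x, y), (y, z), (z, x)}" using d by auto
    ultimately have "{(u, v) \<in> DS J. {u, v} \<in> cyc3 x y z} = {(y, x), (z, y), (x, z)}" by (rule gen[OF c])
    then show ?thesis using True by (simp add: dd_def insert_commute)
  next
    case False
    then have "(x, y) \<in> {(u, v) \<in> DS J. {u, v} \<in> cyc3 x y z}" using i yx by (simp add: dd_def insert_commute)
    moreover have "(x, y) \<notin> {(y, x), (z, y), (x, z)}" using d by auto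
    ultimately have "{(u, v) \<in> DS J. {u, v} \<in> cyc3 x y z} = {(x, y), (y, z), (z, x)}" by (rule gen[OF disj_commute[THEN iffD1, OF c]])
    then show ?thesis using False by (simp add: dd_def insert_commute)
  qed
  have e2: "p \<in> DS J \<and> {fst p, snd p} \<in> cyc3 x y z \<longleftrightarrow> p \<in> {dd s y x, dd s x z, dd s z y}" for p
    unfolding e[symmetric] by (cases p) simp
  have fs: "{fst (dd s u v), snd (dd s u v)} = {u, v}" for u v by (simp add: dd_def insert_commute)
  show 1: "dd s x z \<in> DS J" "dd s z y \<in> DS J" using e2[of "dd s x z"] e2[of "dd s z y"] by simp_all
  have n: "dd s u v \<notin> DS J" if "{u, v} \<in> cyc3 x y z" "dd s u v \<notin> {dd s y x, dd s x z, dd s z y}" for u v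
    using e2[of "dd s u v"] that unfolding fs by blast
  show 2: "dd s x y \<notin> DS J" "dd s z x \<notin> DS J" "dd s y z \<notin> DS J"
    using n[of x y] n[of z x] n[of y z] d unfolding cyc3_def by auto
  show "\<And>u v. {u, v} \<in> cyc3 x y z \<Longrightarrow> (u, v) \<in> DS J \<Longrightarrow> (u, v) \<in> {dd s y x, dd s x z, dd s z y}"
    by (rule e2[THEN iffD1]) simp
  have "dd s x y \<in> DS X" "dd s z x \<in> DS X" "dd s y z \<in> DS X" 
    using rl_dd_sym[OF rl, of s] 1 i X by auto
  then show "dd s x y \<in> DS K" "dd s z x \<in> DS K" "dd s y z \<in> DS K" using X 2 by auto
qed

lemma face_side:
  assumes "rl Ou (J + K)" "d \<in> fst f" "d \<in> DS J" shows "f \<notin># K"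
proof
  assume "f \<in># K"
  then have "d \<in> DS K" using assms(2) unfolding mem_DS by blast
  then show False using rl_disjoint[OF assms(1)] assms(3) by blast
qed

lemma submset_side: "A \<subseteq># J + K \<Longrightarrow> (\<And>f. f \<in># A \<Longrightarrow> f \<notin># K) \<Longrightarrow> A \<subseteq># J"
  unfolding subseteq_mset_def by (metis add.right_neutral count_eq_zero_iff count_union not_in_iff zero_le)

text \<open>The part of \<open>R\<close> in \<open>K\<close> contains \<open>g\<close>, and by
  \<open>cl\<close> no edge inside \<open>R\<close> leads from it to \<open>J\<close>; connectivity
  of \<open>R\<close> then leaves nothing in \<open>J\<close>.\<close>

lemma conn_side:
  assumes rl: "rl Ou (J + K)" and g: "conn_to g R" "g \<in># K" and R: "R \<subseteq># J + K"
    and cl: "\<And>u v. (u, v) \<in> DS K \<Longrightarrow> (v, u) \<in> DS J \<Longrightarrow> (u, v) \<in> DS R \<Longrightarrow> (v, u) \<notin> DS R"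
  shows "R \<subseteq># K"
proof -
  have nJ: "f \<notin># J" if "f \<in># K" for f
  proof -
    have "f \<in># J + K" using that by simp
    then obtain d where d: "d \<in> fst f" using rl_nonempty_face[OF rl] by blast
    then have "d \<in> DS K" using that unfolding mem_DS by blast
    then show ?thesis using face_side[of Ou K J d f] rl d by (simp add: add.commute)
  qed
  let ?A = "filter_mset (\<lambda>f. f \<notin># J) R" and ?B = "filter_mset (\<lambda>f. \<not> f \<notin># J) R"
  have RAB: "R = ?A + ?B" by (rule multiset_partition)
  have gR: "g \<in># R" using g(1) unfolding conn_to_def by blast
  have "?B = {#}"
  proof (rule g(1)[unfolded conn_to_def, THEN conjunct2, rule_format, OF RAB])
    show "g \<in># ?A" using gR nJ[OF g(2)] by simp
    fix u v assume uv: "(u, v) \<in> DS ?A" "(v, u) \<in> DS R"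
    obtain f where f: "f \<in># R" "f \<notin># J" "(u, v) \<in> fst f" using uv(1) by (auto simp: mem_DS)
    have "f \<in># K" using f R by (meson mset_subset_eqD union_iff)
    then have "(u, v) \<in> DS K" "(u, v) \<in> DS R" using f by (auto simp: mem_DS)
    then have nj: "(v, u) \<notin> DS J" using cl uv(2) by blast
    obtain h where h: "h \<in># R" "(v, u) \<in> fst h" using uv(2) by (auto simp: mem_DS)
    then have "h \<notin># J" using nj unfolding mem_DS by blast
    then have "h \<in># ?A" using h by simp
    then show "(v, u) \<in> DS ?A" using h unfolding mem_DS by blast
  qed
  have "f \<notin># J" if "f \<in># R" for f
  proof
    assume "f \<in># J"
    then have "f \<in># ?B" using that by simp
    then show False unfolding \<open>?B = {#}\<close> by simp
  qed
  then show ?thesis using submset_side[of R K J] R by (simp add: add.commute)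
qed

lemma conn_to_add:
  assumes K: "conn_to g K" and gf: "g \<noteq> f" and dis: "DS K \<inter> fst f = {}" and d: "(p, q) \<in> fst f" "(q, p) \<in> DS K"
  shows "conn_to g (K + {#f#})"
  unfolding conn_to_def
proof (intro conjI allI impI)
  show "g \<in># K + {#f#}" using K unfolding conn_to_def by auto
  fix A B assume e: "K + {#f#} = A + B" and gA: "g \<in># A"
    and cl: "\<forall>u v. (u, v) \<in> DS A \<longrightarrow> (v, u) \<in> DS (K + {#f#}) \<longrightarrow> (v, u) \<in> DS A"
  have K': "B = {#}" if "K = A + B" "g \<in># A" "\<And>u v. (u, v) \<in> DS A \<Longrightarrow> (v, u) \<in> DS K \<Longrightarrow> (v, u) \<in> DS A" for A B
    using K that unfolding conn_to_def by blast
  have "f \<in># A + B" unfolding e[symmetric] by simp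
  then have "f \<in># A \<or> f \<in># B" by simp
  then show "B = {#}"
  proof
    assume "f \<in># A"
    then obtain A0 where A0: "A = add_mset f A0" by (meson mset_add)
    show ?thesis
    proof (rule K')
      show "K = A0 + B" using e A0 by simp
      show "g \<in># A0" using gA A0 gf by simp
      fix u v assume uv: "(u, v) \<in> DS A0" "(v, u) \<in> DS K"
      then have "(u, v) \<in> DS A" "(v, u) \<in> DS (K + {#f#})" using A0 by simp_all
      then have "(v, u) \<in> DS A" using cl by blast
      then show "(v, u) \<in> DS A0" using dis A0 uv(2) by auto
    qed
  next
    assume "f \<in># B"
    then obtain B0 where B0: "B = add_mset f B0" by (meson mset_add)
    have KA: "K = A + B0" using e B0 by simp
    have "B0 = {#}"
    proof (rule K'[OF KA gA])
      fix u v assume uv: "(u, v) \<in> DS A" "(v, u) \<in> DS K"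
      have "(v, u) \<in> DS (K + {#f#})" unfolding DS_simps using uv(2) by (rule UnI1)
      then show "(v, u) \<in> DS A" using cl uv(1) by blast
    qed
    then have "DS A = DS K" using KA by simp
    then have "(p, q) \<in> DS K" using cl d by auto
    then show ?thesis using dis d by blast
  qed
qed

section \<open>Regions bounded by a triangle\<close>

lemma Lay_dd: "DS (Lay s x y zs) = (\<Union>z\<in>set (butlast zs). {dd s z x, dd s y z}) \<union> (\<Union>z\<in>set (tl zs). {dd s x z, dd s z y})"
proof (induction s x y zs rule: Lay.induct)
  case (1 s x y a b zs)
  then show ?case by (simp add: fst_Qd) blast
qed auto

lemma Lad_DS: "DS (Lad s x y z vs) = (\<Union>v\<in>set vs. {dd s v x, dd s y v, dd s x v, dd s v y}) \<union> {dd s z x, dd s y z, dd s x y}"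
proof -
  define l where "l = last (z # vs)"
  have "set (butlast (z # vs) @ [l]) = set (z # vs)" unfolding l_def by (subst append_butlast_last_id) simp_all
  then have b: "insert l (set (butlast (z # vs))) = insert z (set vs)" by simp
  have "DS (Lad s x y z vs) = (\<Union>v\<in>insert l (set (butlast (z # vs))). {dd s v x, dd s y v}) \<union> (\<Union>v\<in>set vs. {dd s x v, dd s v y}) \<union> {dd s x y}"
    unfolding Lad_def l_def[symmetric] DS_simps Lay_dd fst_Tri by auto
  also have "\<dots> = (\<Union>v\<in>set vs. {dd s v x, dd s y v, dd s x v, dd s v y}) \<union> {dd s z x, dd s y z, dd s x y}"
    unfolding b by blast
  finally show ?thesis .
qed

text \<open>The ladder faces close up around each ladder vertex, so realisability alone yields the
  freshness demanded by \<open>lad_ok\<close>.\<close>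

lemma lad_fresh:
  assumes rl: "rl Ou (R + Lad s x y z vs)" and d: "distinct (x # y # z # vs)"
  shows "lad_ok R x y z vs"
  unfolding lad_ok_def
proof (intro conjI ballI allI d)
  fix v u assume v: "v \<in> set vs"
  have dis: "DS R \<inter> DS (Lad s x y z vs) = {}" using rl_disjoint rl by blast
  have rl': "rl Ou (Lad s x y z vs + R)" using rl by (simp add: add.commute)
  have nv: "v \<noteq> x" "v \<noteq> y" "v \<noteq> z" using d v by auto
  have sym: "(q, v) \<in> DS (Lad s x y z vs) \<longleftrightarrow> (v, q) \<in> DS (Lad s x y z vs)" for q
  proof (rule symI_dd[where s = s])
    show "dd s q v \<in> DS (Lad s x y z vs) \<longleftrightarrow> dd s v q \<in> DS (Lad s x y z vs)" unfolding Lad_DS using v nv by auto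
  qed
  have "dd s x v \<in> DS (Lad s x y z vs)" unfolding Lad_DS using v by auto
  then have xv: "(x, v) \<in> DS (Lad s x y z vs)" using sym[of x] by (auto simp: dd_def split: if_splits)
  show nR: "(u, v) \<notin> DS R"
    using rl_rotate[OF rl' sym xv, of u] dis by auto
  show "(v, u) \<notin> DS R" 
    using rl_rotate[OF rl' sym xv, of u] rl_sym[OF rl, of v u] sym[of u] dis by auto
qed

text \<open>Consecutive faces of the ladder share the edge from a ladder vertex to the pole
  \<open>x\<close>. It is not a boundary edge of \<open>J\<close>, so the side of the first face
  propagates.\<close>

lemma Lad_side:
  assumes rl: "rl Ou (J + K)"
  shows "Lad s x y z vs \<subseteq># J + K \<Longrightarrow> dd s z x \<in> DS J \<Longrightarrow>
    (\<And>v q. v \<in> set vs \<Longrightarrow> (q, v) \<in> DS J \<longleftrightarrow> (v, q) \<in> DS J) \<Longrightarrow> f \<in># Lad s x y z vs \<Longrightarrow> f \<notin># K"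
proof (induction vs arbitrary: z)
  case Nil
  then have "dd s z x \<in> fst f" by (simp add: Lad_def fst_Tri)
  then show ?case using face_side[OF rl] Nil by blast
next
  case (Cons v vs)
  let ?Q = "Qd s z x v y v"
  have e: "Lad s x y z (v # vs) = add_mset ?Q (Lad s x y v vs)" by (simp add: Lad_def)
  have sub: "Lad s x y v vs \<subseteq># J + K" using Cons.prems(1) unfolding e by (metis mset_subset_eq_insertD subset_mset.less_imp_le)
  have Q: "dd s z x \<in> fst ?Q" "dd s x v \<in> fst ?Q" by (simp_all add: fst_Qd)
  have QK: "?Q \<notin># K" using face_side[OF rl Q(1)] Cons.prems(2) by blast
  have "?Q \<in># J + K" using Cons.prems(1) unfolding e by (meson mset_subset_eqD union_single_eq_member)
  then have "?Q \<in># J" using QK by simp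
  then have "dd s x v \<in> DS J" using Q(2) unfolding mem_DS by blast
  then have "dd s v x \<in> DS J" using dd_symI[of v "DS J" s x] Cons.prems(3)[of v] by auto
  then show ?case using Cons.IH[OF sub] Cons.prems(3,4) QK unfolding e by auto
qed

lemma conn_to_Lay:
  assumes rl: "rl Ou (R + Lay s x y (z # zs) + B)" and R: "conn_to (outf Ou) R" and z: "dd s x z \<in> DS R"
  shows "conn_to (outf Ou) (R + Lay s x y (z # zs))"
  using assms
proof (induction zs arbitrary: R z)
  case (Cons v zs)
  let ?Q = "Qd s z x v y v"
  have e: "R + Lay s x y (z # v # zs) = (R + {#?Q#}) + Lay s x y (v # zs)" by simp
  show ?case unfolding e
  proof (rule Cons.IH)
    show "rl Ou (R + {#?Q#} + Lay s x y (v # zs) + B)" using Cons.prems(1) by simp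
    obtain p q where pq: "dd s z x = (p, q)" by fastforce
    show "conn_to (outf Ou) (R + {#?Q#})"
    proof (rule conn_to_add[OF Cons.prems(2)])
      show "outf Ou \<noteq> ?Q" using rl_outf(3)[OF Cons.prems(1)] by simp
      have "rl Ou (R + add_mset ?Q (Lay s x y (v # zs) + B))" using Cons.prems(1) by (simp add: add.assoc)
      from rl_disjoint[OF this] show "DS R \<inter> fst ?Q = {}" by auto
      show "(p, q) \<in> fst ?Q" using pq by (simp add: fst_Qd)
      show "(q, p) \<in> DS R" using pq Cons.prems(3) by (auto simp: dd_def split: if_splits)
    qed
    show "dd s x v \<in> DS (R + {#?Q#})" by (simp add: fst_Qd)
  qed
qed simp

text \<open>The region outside \<open>R\<close> has \<open>b, c, a\<close> as consecutive boundary vertices. By the last condition an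
  edge at \<open>a\<close> or \<open>b\<close> inside \<open>R\<close> is not a chord of the boundary, so no three-cycle through it meets
  the region again.\<close>
definition ear :: "('v \<times> 'v) set \<Rightarrow> bool \<Rightarrow> 'v \<Rightarrow> 'v \<Rightarrow> 'v \<Rightarrow> 'v tface multiset \<Rightarrow> bool" where
  "ear Ou s a b c R \<longleftrightarrow> distinct [a, b, c] \<and> conn_to (outf Ou) R \<and> dd s a c \<in> DS R \<and> dd s c b \<in> DS R \<and>
     (\<forall>q. q \<notin> {a, b} \<longrightarrow> ((q, c) \<in> DS R \<longleftrightarrow> (c, q) \<in> DS R)) \<and>
     (\<forall>x. ((a, x) \<in> DS R \<and> (x, a) \<in> DS R) \<or> ((b, x) \<in> DS R \<and> (x, b) \<in> DS R) \<longrightarrow> (\<forall>q. (q, x) \<in> DS R \<longleftrightarrow> (x, q) \<in> DS R))"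

lemma ear_mirror: assumes "ear Ou s a b c R" shows "ear Ou (\<not> s) b a c R"
proof -
  have ab: "{b, a} = {a, b}" by auto
  have E: "distinct [a, b, c]" "conn_to (outf Ou) R" "dd s a c \<in> DS R" "dd s c b \<in> DS R"
     "\<And>q. q \<notin> {a, b} \<Longrightarrow> ((q, c) \<in> DS R \<longleftrightarrow> (c, q) \<in> DS R)"
     "\<And>x q. ((a, x) \<in> DS R \<and> (x, a) \<in> DS R) \<or> ((b, x) \<in> DS R \<and> (x, b) \<in> DS R) \<Longrightarrow> (q, x) \<in> DS R \<longleftrightarrow> (x, q) \<in> DS R"
    using assms unfolding ear_def by blast+
  show ?thesis unfolding ear_def dd_swap ab
  proof (intro conjI allI impI)
    show "distinct [b, a, c]" using E(1) by auto
    show "(q, x) \<in> DS R \<longleftrightarrow> (x, q) \<in> DS R" if "((b, x) \<in> DS R \<and> (x, b) \<in> DS R) \<or> ((a, x) \<in> DS R \<and> (x, a) \<in> DS R)" for x q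
      using E(6)[of x q] that by argo
  qed (fact E)+
qed

text \<open>Potential of the ear argument: every turn of a ladder is followed by a flip that removes an
  edge at \<open>c\<close>, so the number of darts avoiding \<open>a\<close> and \<open>b\<close> drops.\<close>
definition psi :: "'v \<Rightarrow> 'v \<Rightarrow> 'v tface multiset \<Rightarrow> nat" where
  "psi a b I = (\<Sum>f\<in>#I. card {d \<in> fst f. fst d \<notin> {a, b} \<and> snd d \<notin> {a, b}})"

lemma psi_simps: "psi a b {#} = 0" "psi a b (add_mset f I) = psi a b {#f#} + psi a b I" "psi a b (I + I') = psi a b I + psi a b I'"
  unfolding psi_def by simp_all

lemma psi_swap: "psi a b I = psi b a I" unfolding psi_def by (simp add: insert_commute)

lemma psi_less:
  assumes "finite (fst f)" "d \<in> fst f" "d \<notin> fst g" "fst d \<notin> {a, b}" "snd d \<notin> {a, b}"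
    "\<And>d. d \<in> fst g \<Longrightarrow> fst d \<notin> {a, b} \<Longrightarrow> snd d \<notin> {a, b} \<Longrightarrow> d \<in> fst f"
  shows "psi a b {#g#} < psi a b {#f#}"
proof -
  have "{d \<in> fst g. fst d \<notin> {a, b} \<and> snd d \<notin> {a, b}} \<subset> {d \<in> fst f. fst d \<notin> {a, b} \<and> snd d \<notin> {a, b}}"
    using assms by blast
  then show ?thesis unfolding psi_def using assms(1) by (simp add: psubset_card_mono)
qed

lemma rl_finite: assumes "rl Ou X" "f \<in># X" shows "finite (fst f)"
proof -
  obtain M where M: "is_4ppt M" "fm M = X" using assms(1) unfolding rl_def by auto
  have "fst f \<in> faces M" using in_fm_faces[OF M(1), of f] M(2) assms(2) by simp
  then show ?thesis using face_finite[OF is_4pptD(1,2)[OF M(1)]] by blast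
qed

lemma rl_inner:
  assumes "rl Ou (R + I)" "conn_to (outf Ou) R" "f \<in># I" shows "f \<noteq> outf Ou"
proof
  assume "f = outf Ou"
  then have "f \<in># R" using assms(2) unfolding conn_to_def by simp
  have "f \<in># R + I" using assms(3) by simp
  then obtain d where d: "d \<in> fst f" using rl_nonempty_face[OF assms(1)] by blast
  then have "d \<in> DS R" "d \<in> DS I" using \<open>f \<in># R\<close> assms(3) unfolding mem_DS by blast+
  then show False using rl_disjoint[OF assms(1)] by blast
qed

lemma earD:
  assumes "ear Ou s a b c R"
  shows "distinct [a, b, c]" "conn_to (outf Ou) R" "dd s a c \<in> DS R" "dd s c b \<in> DS R"
    "\<And>q. q \<notin> {a, b} \<Longrightarrow> (q, c) \<in> DS R \<longleftrightarrow> (c, q) \<in> DS R"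
    "\<And>x q. (a, x) \<in> DS R \<Longrightarrow> (x, a) \<in> DS R \<Longrightarrow> (q, x) \<in> DS R \<longleftrightarrow> (x, q) \<in> DS R"
    "\<And>x q. (b, x) \<in> DS R \<Longrightarrow> (x, b) \<in> DS R \<Longrightarrow> (q, x) \<in> DS R \<longleftrightarrow> (x, q) \<in> DS R"
  using assms unfolding ear_def by blast+

text \<open>Around \<open>c\<close> the face behind \<open>uc\<close> still belongs to
  \<open>I0\<close>: the darts of \<open>R\<close> at \<open>c\<close> come in opposite pairs except
  towards \<open>a\<close> and \<open>b\<close>. The next corner \<open>u'\<close> is no ladder
  vertex, because those are fresh.\<close>

lemma ear_face:
  assumes E: "ear Ou s a b c R" and rl: "rl Ou (R + I0 + Lad s a u c vs)" and d: "distinct (a # u # c # vs)"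
    and nc: "\<And>f. f \<in># I0 \<Longrightarrow> c \<notin> snd f" and ub: "u \<noteq> b"
  shows "\<exists>F u'. F \<in># I0 \<and> u' \<notin> {a, c, u} \<union> set vs \<and> ((\<exists>t w. F = Qd s c u t u' w \<and> w \<noteq> c) \<or> F = Tri s c u u')"
proof -
  note E = earD[OF E]
  have rl': "rl Ou (R + (I0 + Lad s a u c vs))" using rl by (simp add: add.assoc)
  have dis: "DS R \<inter> DS I0 = {}" "DS R \<inter> DS (Lad s a u c vs) = {}"
    using rl_disjoint[OF rl'] by auto
  have uc: "dd s u c \<in> DS (Lad s a u c vs)" unfolding Lad_DS by simp
  then have "dd s c u \<in> DS (R + I0 + Lad s a u c vs)" using rl_dd_sym[OF rl, of s u c] by simp
  moreover have "dd s c u \<notin> DS (Lad s a u c vs)" unfolding Lad_DS using d by auto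
  moreover have "dd s c u \<notin> DS R"
  proof
    assume a: "dd s c u \<in> DS R"
    have "(u, c) \<in> DS R \<longleftrightarrow> (c, u) \<in> DS R" by (rule E(5)) (use ub d in auto)
    then have "dd s u c \<in> DS R" using a by (auto simp: dd_def split: if_splits)
    then show False using uc dis by blast
  qed
  ultimately have "dd s c u \<in> DS I0" by simp
  then obtain F where F: "F \<in># I0" "dd s c u \<in> fst F" by (auto simp: mem_DS)
  have FX: "F \<in># R + I0 + Lad s a u c vs" using F by simp
  have "F \<noteq> outf Ou" by (rule rl_inner[OF rl' E(2)]) (use F in simp)
  then have "\<exists>u'. (\<exists>t w. F = Qd s c u t u' w) \<or> F = Tri s c u u'" using rl_face[OF rl FX _ F(2)] by blast
  then obtain u' where u': "(\<exists>t w. F = Qd s c u t u' w) \<or> F = Tri s c u u'" by blast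
  have u'c: "dd s u' c \<in> fst F" using u' by (auto simp: fst_Qd fst_Tri)
  then have u'c2: "dd s u' c \<in> DS I0" using F(1) unfolding mem_DS by blast
  have "u' \<noteq> a" using u'c2 E(3) dis by blast
  moreover have "u' \<noteq> c" "u' \<noteq> u" using u' rl_Qd[OF rl] rl_Tri[OF rl] FX by (metis distinct_length_2_or_more)+
  moreover have "u' \<notin> set vs"
  proof
    assume "u' \<in> set vs"
    then have "dd s u' c \<notin> DS (R + I0)" using lad_fresh[OF rl d] unfolding lad_ok_def by (auto simp: dd_def)
    then show False using u'c2 by simp
  qed
  moreover have "w \<noteq> c" if "F = Qd s c u t u' w" for t w using nc[OF F(1)] that by simp
  ultimately show ?thesis using F(1) u' by blast
qed

text \<open>A ladder with poles \<open>a\<close>, \<open>u\<close> and apex \<open>c\<close> has been built. The next face \<open>F\<close> around \<open>c\<close> brings the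
  neighbour \<open>u'\<close> of \<open>c\<close>, and the ladder has to move from \<open>u\<close> to \<open>u'\<close>.\<close>
locale ear_state =
  fixes Ou :: "('v \<times> 'v) set" and s :: bool and a b c u u' :: 'v and R I0 Z :: "'v tface multiset"
    and vs :: "'v list" and F :: "'v tface"
  assumes E: "ear Ou s a b c R" and rl: "rl Ou (R + I0 + Lad s a u c vs)" and d: "distinct (a # u # c # vs)"
    and nc: "\<And>f. f \<in># I0 \<Longrightarrow> c \<notin> snd f" and ub: "u \<noteq> b" and I0: "I0 = add_mset F Z"
    and u': "u' \<notin> {a, c, u} \<union> set vs" and F: "(\<exists>t w. F = Qd s c u t u' w \<and> w \<noteq> c) \<or> F = Tri s c u u'"
begin

abbreviation "X \<equiv> R + I0 + Lad s a u c vs"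
abbreviation "c' \<equiv> last (c # vs)"

lemma c': "c' \<in> insert c (set vs)" by (metis last_in_set list.simps(15) list.distinct(1))

lemma dn: "distinct [a, c, u, u']" "u' \<notin> set vs" "distinct [a, c, u, b]"
  using d u' ub earD(1)[OF E] by auto

lemma fresh: "lad_ok (R + I0) a u c vs" by (rule lad_fresh[OF rl d])

lemma F_in: "F \<in># X" unfolding I0 by simp

lemma F_fresh: "v \<in> set vs \<Longrightarrow> (v, q) \<notin> fst F \<and> (q, v) \<notin> fst F"
  using fresh unfolding lad_ok_def I0 by auto

lemma Qd_d: assumes "F = Qd s c u t u' w" shows "distinct [c, u, t, u']" "w \<in> {c, u, t, u'}" "t \<notin> set vs"
proof -
  show "distinct [c, u, t, u']" "w \<in> {c, u, t, u'}" using rl_Qd[OF rl, of s c u t u' w] F_in assms by auto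
  have "dd s u t \<in> fst F" using assms by (simp add: fst_Qd)
  then show "t \<notin> set vs" using F_fresh[of t u] by (auto simp: dd_def split: if_splits)
qed

lemma disj: "DS R \<inter> DS I0 = {}" "DS R \<inter> DS (Lad s a u c vs) = {}" "DS I0 \<inter> DS (Lad s a u c vs) = {}"
  using rl_disjoint[of Ou R "I0 + Lad s a u c vs"] rl_disjoint[OF rl] rl by (auto simp: add.assoc)

lemma F_DS: "dd s c u \<in> DS I0" "dd s u' c \<in> DS I0" "dd s c u \<in> fst F" "dd s u' c \<in> fst F"
  using F unfolding I0 by (auto simp: fst_Qd fst_Tri)

lemma Lad_in: "dd s c a \<in> DS (Lad s a u c vs)" "dd s u c \<in> DS (Lad s a u c vs)" "dd s a u \<in> DS (Lad s a u c vs)"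
  unfolding Lad_DS by auto

text \<open>Two turns bring the ladder from poles \<open>a\<close>, \<open>u\<close> to poles
  \<open>u\<close>, \<open>c\<close>, the position from which \<open>advance\<close> starts; this
  makes \<open>5 + 5 + 2\<close> flips per vertex.\<close>

lemma adv:
  assumes F': "(F = Qd s c u t u' w \<and> F' = Qd s c' u t u' w \<and> w \<noteq> c) \<or> (F = Tri s c u u' \<and> F' = Tri s c' u u')"
  shows "rc (12 * length vs + 2) X (R + Z + {#F'#} + Lay s a u' (c # vs) + {#Tri s a u c'#})"
proof -
  have ok2: "lad_ok (R + I0) c a u vs" "lad_ok (R + I0) u c a vs" using fresh unfolding lad_ok_def by auto
  have t1: "rc (5 * length vs) X (R + I0 + Lad s c a u vs)" by (rule turn[OF fresh])
  have t2: "rc (5 * length vs) (R + I0 + Lad s c a u vs) (R + I0 + Lad s u c a vs)" by (rule turn[OF ok2(1)])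
  have e: "R + I0 = R + Z + {#F#}" unfolding I0 by simp
  have t3: "rc (2 * length vs + 2) (R + I0 + Lad s u c a vs) (R + Z + {#F'#} + Lay s a u' (c # vs) + {#Tri s a u c'#})"
    unfolding e by (rule advance[OF ok2(2)[unfolded e] dn(1,2) F'])
  show ?thesis by (rule rc_mono[OF rc_trans[OF rc_trans[OF t1 t2] t3]]) simp
qed

text \<open>When \<open>a\<close> and \<open>u'\<close> are not adjacent, one flip after
  \<open>adv\<close> draws this edge, and the ladder has reached \<open>u'\<close>.
  \<open>F2\<close> is \<open>F\<close> with \<open>c\<close> replaced by \<open>a\<close>, so the
  potential loses the dart on the edge \<open>cu\<close>.\<close>

lemma free_step:
  assumes na: "(a, u') \<notin> DS X"
  shows "\<exists>F2. rc (12 * length vs + 3) X (R + add_mset F2 Z + Lad s a u' c vs) \<and> psi a b {#F2#} < psi a b {#F#} \<and> c \<notin> snd F2"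
proof -
  have finF: "finite (fst F)" by (rule rl_finite[OF rl F_in])
  have na2: "(a, u') \<notin> DS R" "(a, u') \<notin> DS Z" using na I0 by auto
  have "dd s a u' = (a, u') \<or> dd s a u' = (u', a)" by (simp add: dd_def)
  then have "dd s a u' \<notin> DS X" using na rl_sym[OF rl, of u' a] by metis
  have naL: "(a, u') \<notin> DS (Lay s a u' (c # vs))" by (rule Lay_notin) (use d u' in auto)
  have naT: "(a, u') \<notin> fst (Tri s a u c')" using c' d u' by (auto simp: fst_Tri dd_def)
  have c'n: "c' \<noteq> a" "c' \<noteq> u" "c' \<noteq> u'" using c' d u' by auto
  have cub: "fst (dd s c u) \<notin> {a, b}" "snd (dd s c u) \<notin> {a, b}" using dn(3) by (auto simp: dd_def)
  from F show ?thesis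
  proof (elim disjE exE conjE)
    fix t w assume f: "F = Qd s c u t u' w" "w \<noteq> c"
    note D = Qd_d[OF f(1)]
    have at: "a \<noteq> t"
    proof
      assume "a = t"
      then have "dd s a u' \<in> fst F" using f by (simp add: fst_Qd)
      then have "dd s a u' \<in> DS X" unfolding I0 by simp
      then show False using \<open>dd s a u' \<notin> DS X\<close> by blast
    qed
    have wc': "w \<noteq> c'" using D c' u' f(2) d by auto
    let ?F' = "Qd s c' u t u' w" and ?F2 = "Qd s a u t u' w"
    let ?Y = "R + Z + {#?F'#} + Lay s a u' (c # vs) + {#Tri s a u c'#}"
    have 1: "rc (12 * length vs + 2) X ?Y" by (rule adv[of t w]) (use f in simp)
    have 2: "rc 1 ?Y (R + add_mset ?F2 Z + Lad s a u' c vs)"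
    proof (rule rc_near'[where s = s and ?p0.0 = c' and ?p1.0 = a and ?p2.0 = u and ?p3.0 = t and ?p4.0 = u' and w = w
          and R = "R + Z + Lay s a u' (c # vs)" and A = "Tri s a u c'" and B = ?F' and A' = "Tri s a u' c'" and B' = ?F2])
      have "(a, u') \<notin> fst ?F'" using at c'n dn by (auto simp: fst_Qd dd_def)
      then show "(a, u') \<notin> DS ?Y" using na2 naL naT by simp
      show "?Y = R + Z + Lay s a u' (c # vs) + {#Tri s a u c', ?F'#}" by (simp add: ac_simps)
      show "R + add_mset ?F2 Z + Lad s a u' c vs = R + Z + Lay s a u' (c # vs) + {#Tri s a u' c', ?F2#}"
        unfolding Lad_def by (simp add: ac_simps)
      show "Tri s a u c' = Tri s c' a u" "Tri s a u' c' = Tri s u' c' a" by (simp_all add: TQ)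
    qed (use wc' at u' in auto)
    have "psi a b {#?F2#} < psi a b {#F#}"
      by (rule psi_less[OF finF F_DS(3) _ cub]) (use D d in \<open>auto simp: f(1) fst_Qd dd_def split: if_splits\<close>)
    moreover have "c \<notin> snd ?F2" using f by simp
    moreover have "rc (12 * length vs + 3) X (R + add_mset ?F2 Z + Lad s a u' c vs)"
      by (rule rc_mono[OF rc_trans[OF 1 2]]) simp
    ultimately show ?thesis by blast
  next
    assume f: "F = Tri s c u u'"
    let ?F' = "Tri s c' u u'" and ?F2 = "Tri s a u u'"
    let ?Y = "R + Z + {#?F'#} + Lay s a u' (c # vs) + {#Tri s a u c'#}"
    have 1: "rc (12 * length vs + 2) X ?Y" by (rule adv) (use f in simp)
    have 2: "rc 1 ?Y (R + add_mset ?F2 Z + Lad s a u' c vs)"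
    proof (rule rc_quad[where s = s and ?p0.0 = c' and ?p1.0 = a and ?p2.0 = u and ?p3.0 = u'
          and R = "R + Z + Lay s a u' (c # vs)" and A = "Tri s a u c'" and B = ?F' and A' = ?F2 and B' = "Tri s a u' c'"])
      have "(a, u') \<notin> fst ?F'" using c'n dn by (auto simp: fst_Tri dd_def)
      then show "(a, u') \<notin> DS ?Y" using na2 naL naT by simp
      show "?Y = R + Z + Lay s a u' (c # vs) + {#Tri s a u c', ?F'#}" by (simp add: ac_simps)
      show "R + add_mset ?F2 Z + Lad s a u' c vs = R + Z + Lay s a u' (c # vs) + {#?F2, Tri s a u' c'#}"
        unfolding Lad_def by (simp add: ac_simps)
      show "Tri s a u c' = Tri s c' a u" "Tri s c' u u' = Tri s c' u u'" by (simp_all add: TQ)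
    qed (use u' in auto)
    have "psi a b {#?F2#} < psi a b {#F#}"
      by (rule psi_less[OF finF F_DS(3) _ cub]) (use dn in \<open>auto simp: f fst_Tri dd_def split: if_splits\<close>)
    moreover have "c \<notin> snd ?F2" by simp
    moreover have "rc (12 * length vs + 3) X (R + add_mset ?F2 Z + Lad s a u' c vs)"
      by (rule rc_mono[OF rc_trans[OF 1 2]]) simp
    ultimately show ?thesis by blast
  qed
qed

lemma psi_le:
  assumes "\<And>d. d \<in> DS J0 \<Longrightarrow> fst d \<noteq> b \<and> snd d \<noteq> b" "J0 \<subseteq># X"
  shows "psi a u' J0 \<le> psi a b J0"
  unfolding psi_def
proof (rule sum_mset_mono)
  fix f assume f: "f \<in># J0"
  have "finite (fst f)" by (rule rl_finite[OF rl mset_subset_eqD[OF assms(2) f]])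
  moreover have "fst e \<noteq> b \<and> snd e \<noteq> b" if "e \<in> fst f" for e using assms(1)[of e] f that unfolding mem_DS by blast
  ultimately show "card {d \<in> fst f. fst d \<notin> {a, u'} \<and> snd d \<notin> {a, u'}} \<le> card {d \<in> fst f. fst d \<notin> {a, b} \<and> snd d \<notin> {a, b}}"
    by (intro card_mono) auto
qed

lemma corner_c:
  "dd s q c \<in> DS (add_mset F (Lad s a u c vs)) \<longleftrightarrow> q = u \<or> q = u'"
  "dd s c q \<in> DS (add_mset F (Lad s a u c vs)) \<longleftrightarrow> q = a \<or> q = u"
proof -
  have "dd s q c \<in> DS (Lad s a u c vs) \<longleftrightarrow> q = u" "dd s c q \<in> DS (Lad s a u c vs) \<longleftrightarrow> q = a"
    unfolding Lad_DS using d by auto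
  moreover have "dd s q c \<in> fst F \<longleftrightarrow> q = u'" "dd s c q \<in> fst F \<longleftrightarrow> q = u"
    using F dn Qd_d by (auto simp: fst_Qd fst_Tri)
  ultimately show "dd s q c \<in> DS (add_mset F (Lad s a u c vs)) \<longleftrightarrow> q = u \<or> q = u'"
    "dd s c q \<in> DS (add_mset F (Lad s a u c vs)) \<longleftrightarrow> q = a \<or> q = u" by auto
qed

lemma Lad_snd: "f \<in># Lad s x y z ws \<Longrightarrow> snd f \<subseteq> set ws"
proof -
  have "snd f \<subseteq> set (tl zs)" if "f \<in># Lay s x y zs" for zs using that
    by (induction s x y zs rule: Lay.induct) auto
  then show "f \<in># Lad s x y z ws \<Longrightarrow> snd f \<subseteq> set ws" unfolding Lad_def by fastforce
qed

text \<open>When \<open>a\<close> and \<open>u'\<close> are adjacent, \<open>a c u'\<close> is a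
  three-cycle. \<open>F\<close> and the ladder fill a corner at \<open>c\<close> without reflex
  angle, so by \<open>corner_cases\<close> this corner is the inner one. The inside
  \<open>J0\<close> is again an ear problem, with \<open>u'\<close> in place of \<open>b\<close>,
  and \<open>P\<close> is what remains of the original one.\<close>

lemma side_step:
  assumes ad: "(a, u') \<in> DS X"
  shows "\<exists>J0 P. I0 = J0 + P \<and> F \<in># J0 \<and> tri_side Ou X a c u' (J0 + Lad s a u c vs) (R + P) \<and> ear Ou s a u' c (R + P) \<and>
    psi a u' J0 \<le> psi a b J0 \<and> (u' \<noteq> b \<longrightarrow> P \<noteq> {#})"
proof -
  note E = E[THEN earD(1)] E[THEN earD(2)] E[THEN earD(3)] E[THEN earD(4)] E[THEN earD(5)] E[THEN earD(6)] E[THEN earD(7)]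
  let ?A = "add_mset F (Lad s a u c vs)"
  have XA: "X = ?A + (R + Z)" unfolding I0 by (simp add: ac_simps)
  have dac: "distinct [a, c, u']" using dn by auto
  have "dd s c a \<in> DS X" "dd s u' c \<in> DS X" using Lad_in F_DS by auto
  then have e: "(a, c) \<in> DS X" "(c, u') \<in> DS X" "(u', a) \<in> DS X"
    using rl_sym[OF rl] ad by (auto simp: dd_def split: if_splits)
  have s1: "(q, c) \<in> DS ?A \<longleftrightarrow> (c, q) \<in> DS ?A" if "q \<notin> {a, u'}" for q
    using corner_c[of q] that by (auto simp: dd_def split: if_splits)
  have s2: "(q, c) \<in> DS ?A \<longleftrightarrow> (c, q) \<notin> DS ?A" if "q \<in> {a, u'}" for q
    using corner_c[of q] that dn by (auto simp: dd_def split: if_splits)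
  have s3: "\<not> (\<exists>f\<in>#?A. c \<in> snd f)"
  proof
    assume "\<exists>f\<in>#?A. c \<in> snd f"
    then obtain f where f: "f \<in># ?A" "c \<in> snd f" by blast
    then have "f = F \<or> f \<in># Lad s a u c vs" by auto
    then show False using f(2) nc[of F] Lad_snd[of f a u c vs] d I0 by auto
  qed
  obtain J K where J: "tri_side Ou X a c u' J K"
    and ag: "\<forall>q. ((q, c) \<in> DS ?A \<longleftrightarrow> (q, c) \<in> DS J) \<and> ((c, q) \<in> DS ?A \<longleftrightarrow> (c, q) \<in> DS J)"
    using corner_cases[OF rl[unfolded XA] dac e[unfolded XA] s1 s2] s3 unfolding XA[symmetric] by blast
  have agd: "dd s q c \<in> DS ?A \<longleftrightarrow> dd s q c \<in> DS J" "dd s c q \<in> DS ?A \<longleftrightarrow> dd s c q \<in> DS J" for q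
    unfolding dd_def using ag[rule_format, of q] by presburger+
  have XJK: "X = J + K" using J unfolding tri_side_def by (rule conjunct1)
  have ck: "conn_to (outf Ou) K" using J[unfolded tri_side_def, THEN conjunct2] by (rule conjunct1)
  have rlJ: "rl Ou (J + K)" using rl XJK by simp
  have dJK: "DS J \<inter> DS K = {}" by (rule rl_disjoint[OF rlJ])
  have ca: "dd s c a \<in> DS J" "dd s c u \<in> DS J" using agd(2) corner_c(2) by blast+
  note T = tri_side_dd[OF rl J dac ca(1)]
  have LX: "Lad s a u c vs \<subseteq># J + K" unfolding XJK[symmetric] by simp
  have "f \<notin># K" if "f \<in># Lad s a u c vs" for f
  proof (rule Lad_side[OF rlJ LX ca(1) _ that])
    fix v q assume "v \<in> set vs"
    then have "v \<notin> {a, c, u'}" using d u' by auto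
    then show "(q, v) \<in> DS J \<longleftrightarrow> (v, q) \<in> DS J" by (rule tri_side_sym(1)[OF rl J])
  qed
  then have LJ: "Lad s a u c vs \<subseteq># J" by (rule submset_side[OF LX])
  have RX: "R \<subseteq># J + K" unfolding XJK[symmetric] by (simp add: add.assoc)
  \<comment> \<open>Within \<open>R\<close> the cycle could be crossed only at \<open>a u'\<close>.
    The ear condition would then put all edges at \<open>u'\<close> into \<open>R\<close>, but
    \<open>F\<close> has a dart on \<open>u' c\<close>.\<close>
  have RK: "R \<subseteq># K"
  proof (rule conn_side[OF rlJ E(2) _ RX])
    show "outf Ou \<in># K" using ck unfolding conn_to_def by blast
    fix p q assume pq: "(p, q) \<in> DS K" "(q, p) \<in> DS J" "(p, q) \<in> DS R"
    show "(q, p) \<notin> DS R"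
    proof
      assume qp: "(q, p) \<in> DS R"
      have "{q, p} \<in> cyc3 a c u'"
        using tri_side_sym_edge(1)[OF rl J, of q p] pq dJK by blast
      then have "(q, p) \<in> {dd s c a, dd s a u', dd s u' c}" using T(6)[of q p] pq(2) by blast
      then show False
      proof (elim insertE)
        assume "(q, p) = dd s c a" then show False using qp Lad_in disj by auto
      next
        assume "(q, p) = dd s u' c" then show False using qp F_DS disj by auto
      next
        assume qe: "(q, p) = dd s a u'"
        then have au: "(a, u') \<in> DS R" "(u', a) \<in> DS R" using qp pq(3) by (auto simp: dd_def split: if_splits)
        have sy: "(q, u') \<in> DS R \<longleftrightarrow> (u', q) \<in> DS R" for q using E(6)[OF au] .
        have "rl Ou (R + (I0 + Lad s a u c vs))" using rl by (simp add: add.assoc)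
        from rl_rotate[OF this sy au(1), of c] have "(c, u') \<in> DS R" using e(2) by (simp add: add.assoc)
        then have "dd s u' c \<in> DS R" using sy[of c] by (auto simp: dd_def)
        then show False using F_DS disj by auto
      qed simp
    qed
  qed
  define J0 where "J0 = J - Lad s a u c vs"
  define P where "P = K - R"
  have JJ: "J = J0 + Lad s a u c vs" unfolding J0_def using LJ by simp
  have KK: "K = R + P" unfolding P_def using RK by simp
  have "I0 + (R + Lad s a u c vs) = (J0 + P) + (R + Lad s a u c vs)" using XJK unfolding JJ KK by (simp add: ac_simps)
  then have I0e: "I0 = J0 + P" by simp
  have "F \<notin># K" by (rule face_side[OF rlJ F_DS(3) ca(2)])
  then have "F \<notin># P" unfolding KK by simp
  then have FJ: "F \<in># J0" using I0e I0 by (metis union_iff union_single_eq_member)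
  have cyc: "{p, q} \<notin> cyc3 a c u'" if "(p, q) \<in> DS K" "(q, p) \<in> DS K" for p q
  proof
    assume c: "{p, q} \<in> cyc3 a c u'"
    have "(p, q) \<in> DS X" unfolding XJK using that by simp
    from tri_side_cyc[OF J c this] show False using that dJK by blast
  qed
  have "ear Ou s a u' c (R + P)"
    unfolding ear_def KK[symmetric]
  proof (intro conjI allI impI)
    show "distinct [a, u', c]" using dn by auto
    show "conn_to (outf Ou) K" by (rule ck)
    show "dd s a c \<in> DS K" "dd s c u' \<in> DS K" by (fact T)+
    fix q assume "q \<notin> {a, u'}"
    then have "{q, c} \<notin> cyc3 a c u'" using dn by (auto simp: cyc3_def doubleton_eq_iff)
    then show "(q, c) \<in> DS K \<longleftrightarrow> (c, q) \<in> DS K" by (rule tri_side_sym_edge(2)[OF rl J])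
  next
    fix x q assume a: "(a, x) \<in> DS K \<and> (x, a) \<in> DS K \<or> (u', x) \<in> DS K \<and> (x, u') \<in> DS K"
    have ne: "p \<noteq> q" if "(p, q) \<in> DS K" for p q using rl_neq[OF rlJ, of p q] that by simp
    from a have "x \<notin> {a, c, u'}"
    proof
      assume h: "(a, x) \<in> DS K \<and> (x, a) \<in> DS K"
      then have "{a, x} \<notin> cyc3 a c u'" "a \<noteq> x" using cyc ne by blast+
      then show ?thesis by (auto simp: cyc3_def insert_commute)
    next
      assume h: "(u', x) \<in> DS K \<and> (x, u') \<in> DS K"
      then have "{u', x} \<notin> cyc3 a c u'" "u' \<noteq> x" using cyc ne by blast+
      then show ?thesis by (auto simp: cyc3_def insert_commute)
    qed
    then show "(q, x) \<in> DS K \<longleftrightarrow> (x, q) \<in> DS K" by (rule tri_side_sym(2)[OF rl J])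
  qed
  moreover have "psi a u' J0 \<le> psi a b J0"
  proof (cases "u' = b")
    case True then show ?thesis by simp
  next
    case False
    show ?thesis
    proof (rule psi_le)
      show "J0 \<subseteq># X" using XJK JJ by simp
      \<comment> \<open>All faces at \<open>b\<close> lie outside the cycle, so ignoring darts at
        \<open>u'\<close> instead of \<open>b\<close> cannot raise the count on
        \<open>J0\<close>.\<close>
      have b: "b \<notin> {a, c, u'}" using False E(1) by auto
      note sb = tri_side_sym[OF rl J b]
      have "dd s c b \<in> DS K" using E(4) KK by simp
      then have cb: "(c, b) \<in> DS K" using sb(2)[of c] by (auto simp: dd_def split: if_splits)
      have "rl Ou (K + J)" using rlJ by (simp add: add.commute)
      note rot = rl_rotate[OF this sb(2) cb]
      have 1: "(q, b) \<notin> DS J" for q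
        using rot[of q] dJK by auto
      fix e assume "e \<in> DS J0"
      then have "e \<in> DS J" unfolding JJ by simp
      then show "fst e \<noteq> b \<and> snd e \<noteq> b" using 1 sb(1) by (cases e) auto
    qed
  qed
  moreover have "P \<noteq> {#}" if "u' \<noteq> b"
  proof
    assume "P = {#}"
    then have "dd s c u' \<in> DS R" using T KK by simp
    moreover have "(u', c) \<in> DS R \<longleftrightarrow> (c, u') \<in> DS R" by (rule E(5)) (use that dn in auto)
    ultimately have "dd s u' c \<in> DS R" by (auto simp: dd_def split: if_splits)
    then show False using F_DS disj by auto
  qed
  ultimately show ?thesis using I0e FJ J unfolding JJ KK by blast
qed

end

text \<open>An edge \<open>zx\<close> would close a three-cycle through \<open>y\<close>. As
  \<open>A\<close> has no reflex angle at \<open>y\<close>, its corner is the inner one, so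
  \<open>g\<close> lies inside although its reflex vertex is on the cycle. Flips are shown to be
  unblocked in this way.\<close>

lemma corner_free:
  assumes rl: "rl Ou (A + B)" and d: "distinct [x, y, z]"
    and i: "\<And>q. dd s q y \<in> DS A \<longleftrightarrow> q = x \<or> q \<in> S" and o: "\<And>q. dd s y q \<in> DS A \<longleftrightarrow> q = z \<or> q \<in> S"
    and S: "x \<notin> S" "z \<notin> S" and g: "g \<in># A" "dd s p y \<in> fst g" "snd g \<inter> {x, y, z} \<noteq> {}"
    and y: "\<And>f. f \<in># A \<Longrightarrow> y \<notin> snd f"
  shows "(z, x) \<notin> DS (A + B)"
proof
  assume zx: "(z, x) \<in> DS (A + B)"
  have "dd s x y \<in> DS (A + B)" "dd s y z \<in> DS (A + B)" using i[of x] o[of z] by simp_all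
  then have e: "(x, y) \<in> DS (A + B)" "(y, z) \<in> DS (A + B)" using rl_sym[OF rl] by (auto simp only: dd_def split: if_splits)
  have sw: "((q, y) \<in> DS A \<longleftrightarrow> (q = x \<or> q \<in> S)) \<and> ((y, q) \<in> DS A \<longleftrightarrow> (q = z \<or> q \<in> S)) \<or>
    ((q, y) \<in> DS A \<longleftrightarrow> (q = z \<or> q \<in> S)) \<and> ((y, q) \<in> DS A \<longleftrightarrow> (q = x \<or> q \<in> S))" for q
    using i[of q] o[of q] by (cases s) (simp_all add: dd_def)
  have s1: "(q, y) \<in> DS A \<longleftrightarrow> (y, q) \<in> DS A" if "q \<notin> {x, z}" for q using sw[of q] that by auto
  have s2: "(q, y) \<in> DS A \<longleftrightarrow> (y, q) \<notin> DS A" if "q \<in> {x, z}" for q using sw[of q] that S d by auto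
  obtain J K where J: "tri_side Ou (A + B) x y z J K"
    and ag: "\<forall>q. ((q, y) \<in> DS A \<longleftrightarrow> (q, y) \<in> DS J) \<and> ((y, q) \<in> DS A \<longleftrightarrow> (y, q) \<in> DS J)"
    using corner_cases[OF rl d e zx s1 s2] y by blast
  have XJK: "A + B = J + K" using J unfolding tri_side_def by (rule conjunct1)
  have Jr: "\<And>f. f \<in># J \<Longrightarrow> snd f \<inter> {x, y, z} = {}" using J unfolding tri_side_def by blast
  have "dd s p y \<in> DS A" using g unfolding mem_DS by blast
  then have "dd s p y \<in> DS J" unfolding dd_def using ag[rule_format, of p] by presburger
  then have "g \<notin># K" using face_side[of Ou J K, OF _ g(2)] rl XJK by simp
  then have "g \<in># J" using g(1) XJK by (metis union_iff)
  then show False using Jr g(3) by blast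
qed

lemma Lay_snoc': "zs \<noteq> [] \<Longrightarrow> Lay s x y (zs @ [b]) = add_mset (Qd s (last zs) x b y b) (Lay s x y zs)"
  using Lay_snoc[of s x y "butlast zs" "last zs" b] append_butlast_last_id[of zs]
  by (metis append_Cons append_assoc append_Nil)

text \<open>The finished layers join the outside, and their last vertex \<open>m\<close> takes over
  the role of \<open>c\<close>. Its reflex angle lies in the last layer, hence not in the remaining
  faces \<open>W\<close>.\<close>

lemma ear_next:
  assumes E: "ear Ou s a b c R" and rl: "rl Ou (R + Lay s a b (c # vs @ [m]) + W)" and d: "distinct (a # b # c # m # vs)"
    and fr: "\<And>v p. v \<in> insert m (set vs) \<Longrightarrow> (p, v) \<notin> DS R \<and> (v, p) \<notin> DS R" and nab: "dd s a b \<notin> DS R"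
  shows "ear Ou s a b m (R + Lay s a b (c # vs @ [m]))" "f \<in># W \<Longrightarrow> m \<notin> snd f"
proof -
  note E = E[THEN earD(1)] E[THEN earD(2)] E[THEN earD(3)] E[THEN earD(4)] E[THEN earD(5)] E[THEN earD(6)] E[THEN earD(7)]
  let ?L = "Lay s a b (c # vs @ [m])"
  let ?R = "R + ?L"
  have L: "DS ?L = (\<Union>z\<in>insert c (set vs). {dd s z a, dd s b z}) \<union> (\<Union>z\<in>insert m (set vs). {dd s a z, dd s z b})"
    unfolding Lay_dd by (simp add: butlast_append)
  have frd: "dd s p v \<notin> DS R \<and> dd s v p \<notin> DS R" if "v \<in> insert m (set vs)" for v p
    using fr[OF that, of p] by (simp add: dd_def)
  have neq: "dd s p p \<notin> DS ?R" for p using rl_neq[OF rl, of p p] by (auto simp: dd_def)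
  have dsym: "(dd s q x \<in> D \<longleftrightarrow> dd s x q \<in> D)" if "(q, x) \<in> D \<longleftrightarrow> (x, q) \<in> D" for q x D using that by (auto simp: dd_def)
  have Rc: "dd s q c \<in> DS R \<longleftrightarrow> dd s c q \<in> DS R" if "q \<notin> {a, b}" for q using dsym[OF E(5)[OF that]] .
  have Hv: "dd s q x \<in> DS ?R \<longleftrightarrow> dd s x q \<in> DS ?R" if "x \<in> set vs" for x q
    using frd[of x q] that d unfolding DS_simps(3) L by auto
  have Hc: "dd s q c \<in> DS ?R \<longleftrightarrow> dd s c q \<in> DS ?R" for q
  proof (cases "q \<in> {a, b}")
    case True
    then show ?thesis using E(3,4) unfolding DS_simps(3) L by auto
  next
    case False
    then show ?thesis using Rc[of q] d unfolding DS_simps(3) L by auto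
  qed
  have H: "dd s q x \<in> DS ?R \<longleftrightarrow> dd s x q \<in> DS ?R"
    if p: "p \<in> {a, b}" "dd s p x \<in> DS ?R" "dd s x p \<in> DS ?R" for p x q
  proof -
    consider "x = c" | "x \<in> set vs" | "x = m" | "x \<in> {a, b}" | "x \<notin> {a, b, c, m} \<union> set vs" by auto
    then show ?thesis
    proof cases
      case 1 then show ?thesis using Hc by simp
    next
      case 2 then show ?thesis by (rule Hv)
    next
      case 3
      then have "dd s m a \<in> DS ?L \<or> dd s b m \<in> DS ?L" using p frd[of m] by auto
      then show ?thesis unfolding L using d by auto
    next
      case 4
      then have "dd s a b \<in> DS ?R" using p neq by auto
      then have "dd s a b \<in> DS ?L" using nab by simp
      then show ?thesis unfolding L using d by auto
    next
      case 5
      then have nL: "dd s r x \<notin> DS ?L \<and> dd s x r \<notin> DS ?L" for r unfolding L by auto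
      then have "dd s p x \<in> DS R" "dd s x p \<in> DS R" using p by auto
      then have "(p, x) \<in> DS R \<and> (x, p) \<in> DS R" by (auto simp: dd_def split: if_splits)
      then have "(q, x) \<in> DS R \<longleftrightarrow> (x, q) \<in> DS R" using E(6,7) p(1) by blast
      from dsym[OF this] show ?thesis using nL by simp
    qed
  qed
  show "ear Ou s a b m ?R"
    unfolding ear_def
  proof (intro conjI allI impI)
    show "distinct [a, b, m]" using d by auto
    show "conn_to (outf Ou) ?R" by (rule conn_to_Lay[OF rl E(2,3)])
    show "dd s a m \<in> DS ?R" "dd s m b \<in> DS ?R" unfolding DS_simps(3) L by auto
    fix q assume q: "q \<notin> {a, b}"
    show "(q, m) \<in> DS ?R \<longleftrightarrow> (m, q) \<in> DS ?R"
      by (rule symI_dd[where s = s]) (use frd[of m q] q d in \<open>unfold DS_simps(3) L, auto\<close>)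
  next
    fix x q assume h: "(a, x) \<in> DS ?R \<and> (x, a) \<in> DS ?R \<or> (b, x) \<in> DS ?R \<and> (x, b) \<in> DS ?R"
    moreover have "dd s p x \<in> D \<and> dd s x p \<in> D" if "(p, x) \<in> D \<and> (x, p) \<in> D" for p D using that by (simp add: dd_def)
    ultimately obtain p where p: "p \<in> {a, b}" "dd s p x \<in> DS ?R" "dd s x p \<in> DS ?R" by blast
    show "(q, x) \<in> DS ?R \<longleftrightarrow> (x, q) \<in> DS ?R" by (rule symI_dd[where s = s]) (rule H[OF p])
  qed
  assume f: "f \<in># W"
  have "Lay s a b ((c # vs) @ [m]) = add_mset (Qd s (last (c # vs)) a m b m) (Lay s a b (c # vs))" by (rule Lay_snoc') simp
  then have "Qd s (last (c # vs)) a m b m \<in># ?R" by simp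
  from rl_reflex_unique[OF rl this f, of m] show "m \<notin> snd f" by auto
qed

context ear_state
begin

lemma psi_pos: "psi a b Z < psi a b I0"
proof -
  have "fst (dd s c u) \<notin> {a, b}" "snd (dd s c u) \<notin> {a, b}" using dn(3) by (auto simp: dd_def)
  then have "psi a b {#({}, {})#} < psi a b {#F#}"
    by (intro psi_less[OF rl_finite[OF rl F_in] F_DS(3)]) auto
  then show ?thesis unfolding I0 psi_simps(2)[of a b F Z] by simp
qed

text \<open>Here \<open>b\<close> is reached while the edge \<open>ab\<close> exists already, and
  everything left is the inside of the cycle \<open>a c b\<close>. The ladder holds the only
  triangle, so \<open>F\<close> is a quadrilateral, and its reflex vertex is no corner of the cycle,
  hence \<open>u\<close> or \<open>t\<close>. This vertex becomes a further rung \<open>m\<close>,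
  from which an empty ladder starts, mirrored if \<open>m\<close> is \<open>u\<close>.\<close>

lemma final_step:
  assumes ub': "u' = b" and J: "tri_side Ou X a c b (I0 + Lad s a u c vs) R"
  shows "\<exists>s1 a1 b1 u1 m. (s1 = s \<and> a1 = a \<and> b1 = b \<or> s1 = (\<not> s) \<and> a1 = b \<and> b1 = a) \<and>
    rc (12 * length vs + 3) X (R + Lay s a b (c # vs @ [m]) + Z + Lad s1 a1 u1 m []) \<and>
    ear Ou s1 a1 b1 m (R + Lay s a b (c # vs @ [m])) \<and> distinct [a1, u1, m] \<and> m \<notin> {a, b, c} \<union> set vs \<and>
    (\<forall>f\<in>#Z. m \<notin> snd f)"
proof -
  have sz: "size {#f \<in># I0 + Lad s a u c vs. snd f = {}#} = 1" using J unfolding tri_side_def by blast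
  have nr: "snd f \<inter> {a, c, b} = {}" if "f \<in># I0 + Lad s a u c vs" for f using J that unfolding tri_side_def by blast
  have "F \<noteq> Tri s c u u'" using sz unfolding I0 Lad_def by auto
  then obtain t w where Fq: "F = Qd s c u t b w" "w \<noteq> c" using F ub' by auto
  note D = Qd_d[OF Fq(1)[folded ub']]
  have "snd F \<inter> {a, c, b} = {}" by (rule nr) (simp add: I0)
  then have w: "w \<noteq> a" "w \<noteq> b" "w = u \<or> w = t" using Fq D(2) ub' by auto
  have dist: "distinct [a, b, c, u]" "distinct [c, u, t, b]" using dn ub' D by auto
  have bvs: "b \<notin> set vs" using dn ub' by simp
  have c'n: "c' \<noteq> a" "c' \<noteq> u" "c' \<noteq> b" "c' \<noteq> t" using c' d dist bvs D by auto
  let ?F' = "Qd s c' u t b w"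
  let ?Y = "R + Z + {#?F'#} + Lay s a b (c # vs) + {#Tri s a u c'#}"
  have 1: "rc (12 * length vs + 2) X ?Y" unfolding ub'[symmetric] by (rule adv[of t w]) (use Fq ub' in simp)
  have rlY: "rl Ou ?Y" by (rule rc_rl[OF rl 1])
  have dac: "distinct [a, c, b]" using dist by auto
  have ca: "dd s c a \<in> DS (I0 + Lad s a u c vs)" using Lad_in by simp
  note T = tri_side_dd[OF rl J dac ca]
  have rlJ: "rl Ou ((I0 + Lad s a u c vs) + R)" using rl by (simp add: ac_simps)
  have dis: "DS (I0 + Lad s a u c vs) \<inter> DS R = {}" using rl_disjoint[OF rlJ] .
  have nab: "dd s a b \<notin> DS R" using T(1) dis by blast
  have frm: "(p, m) \<notin> DS R \<and> (m, p) \<notin> DS R" if m: "m \<notin> {a, c, b}" "dd s u m \<in> fst F \<or> dd s c m \<in> fst F" for m p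
  proof -
    note sy = tri_side_sym[OF rl J m(1)]
    obtain q where "dd s q m \<in> DS (I0 + Lad s a u c vs)" using m(2) unfolding I0 by auto
    then have qm: "(q, m) \<in> DS (I0 + Lad s a u c vs)" using sy(1)[of q] by (auto simp only: dd_def split: if_splits)
    have "(p, m) \<notin> DS R" for p
      using rl_rotate[OF rlJ sy(1) qm, of p] dis by auto
    then show ?thesis using sy(2) by blast
  qed
  have frv: "(p, v) \<notin> DS R \<and> (v, p) \<notin> DS R" if "v \<in> set vs" for v p
    using fresh that unfolding lad_ok_def by simp
  have fin: "ear Ou s a b m (R + Lay s a b (c # vs @ [m]))" "\<forall>f\<in>#Z. m \<notin> snd f"
    if m: "m \<notin> {a, b, c} \<union> set vs" "dd s u m \<in> fst F \<or> dd s c m \<in> fst F" and r: "rl Ou (R + Lay s a b (c # vs @ [m]) + Z + W)" for m W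
  proof -
    have r': "rl Ou (R + Lay s a b (c # vs @ [m]) + (Z + W))" using r by (simp add: add.assoc)
    have dm: "distinct (a # b # c # m # vs)" using d bvs dist m by auto
    have fr: "(p, v) \<notin> DS R \<and> (v, p) \<notin> DS R" if "v \<in> insert m (set vs)" for v p
      using that frv[of v p] frm[of m p] m by blast
    note e = ear_next[OF E r' dm fr nab]
    show "ear Ou s a b m (R + Lay s a b (c # vs @ [m]))" by (rule e(1))
    show "\<forall>f\<in>#Z. m \<notin> snd f" using e(2) by auto
  qed
  have Ls: "Lay s a b (c # vs @ [m]) = add_mset (Qd s c' a m b m) (Lay s a b (c # vs))" for m
    using Lay_snoc'[of "c # vs" s a b m] by simp
  have bn: "a \<noteq> b" using dist by auto
  from w(3) show ?thesis
  proof
    assume wu: "w = u"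
    have Yeq: "?Y = {#?F'#} + (R + Z + Lay s a b (c # vs) + {#Tri s a u c'#})" by (simp add: ac_simps)
    \<comment> \<open>The angle of the quadrilateral at \<open>t\<close>, together with the reflex
      angle at \<open>u\<close>, rules out the edge \<open>bu\<close>.\<close>
    have nub0: "(b, u) \<notin> DS ?Y" unfolding Yeq
    proof (rule corner_free[where s = s and y = t and S = "{}" and g = ?F' and p = u])
      show "rl Ou ({#?F'#} + (R + Z + Lay s a b (c # vs) + {#Tri s a u c'#}))" using rlY unfolding Yeq .
      show "distinct [u, t, b]" using dist by auto
      show "dd s q t \<in> DS {#?F'#} \<longleftrightarrow> q = u \<or> q \<in> {}" "dd s t q \<in> DS {#?F'#} \<longleftrightarrow> q = b \<or> q \<in> {}" for q
        using c'n dist by (auto simp: fst_Qd)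
    qed (use wu dist in \<open>auto simp: fst_Qd\<close>)
    then have nub: "(u, b) \<notin> DS ?Y" using rl_sym[OF rlY, of u b] by blast
    let ?W = "R + Lay s a b (c # vs @ [u]) + Z + Lad (\<not> s) b t u []"
    have 2: "rc 1 ?Y ?W"
    proof (rule rc_far[where s = s and ?p0.0 = c' and ?p1.0 = a and ?p2.0 = u and ?p3.0 = t and ?p4.0 = b and w = u
          and R = "R + Z + Lay s a b (c # vs)" and A = "Tri s a u c'" and B = ?F' and A' = "Tri s u t b" and B' = "Qd s c' a u b u"])
      show "?Y = R + Z + Lay s a b (c # vs) + {#Tri s a u c', ?F'#}" by (simp add: ac_simps)
      have "Tri (\<not> s) b t u = Tri s u t b" by (rule Tri_flip)
      then show "?W = R + Z + Lay s a b (c # vs) + {#Tri s u t b, Qd s c' a u b u#}" unfolding Ls Lad_def by (simp add: ac_simps)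
      show "Tri s a u c' = Tri s c' a u" by (metis Tri_rot)
      show "Qd s c' a u b u = Qd s u b c' a u" by (metis Qd_rot)
    qed (use wu dist bn nub in auto)
    have 3: "rc (12 * length vs + 3) X ?W" by (rule rc_mono[OF rc_trans[OF 1 2]]) simp
    have un: "u \<notin> {a, b, c} \<union> set vs" using dist d by auto
    have uf: "dd s u u \<in> fst F \<or> dd s c u \<in> fst F" using F_DS by simp
    note fu = fin[OF un uf rc_rl[OF rl 3]]
    have "distinct [b, t, u]" using dist by auto
    then show ?thesis using 3 ear_mirror[OF fu(1)] fu(2) un by blast
  next
    assume wt: "w = t"
    have ta: "t \<noteq> a" using wt w by simp
    let ?A = "{#Tri s a u c', ?F'#}"
    have Yeq: "?Y = ?A + (R + Z + Lay s a b (c # vs))" by (simp add: ac_simps)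
    have nat0: "(t, a) \<notin> DS ?Y" unfolding Yeq
    proof (rule corner_free[where s = s and y = u and S = "{c'}" and g = ?F' and p = c'])
      show "rl Ou (?A + (R + Z + Lay s a b (c # vs)))" using rlY unfolding Yeq .
      show "distinct [a, u, t]" using dist ta by auto
      show "dd s q u \<in> DS ?A \<longleftrightarrow> q = a \<or> q \<in> {c'}" "dd s u q \<in> DS ?A \<longleftrightarrow> q = t \<or> q \<in> {c'}" for q
        using c'n dist by (auto simp: fst_Qd fst_Tri)
    qed (use wt dist c'n in \<open>auto simp: fst_Qd\<close>)
    then have nat: "(a, t) \<notin> DS ?Y" using rl_sym[OF rlY, of a t] by blast
    let ?W = "R + Lay s a b (c # vs @ [t]) + Z + Lad s a u t []"
    have 2: "rc 1 ?Y ?W"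
    proof (rule rc_near[where s = s and ?p0.0 = c' and ?p1.0 = a and ?p2.0 = u and ?p3.0 = t and ?p4.0 = b and w = t
          and R = "R + Z + Lay s a b (c # vs)" and A = "Tri s a u c'" and B = ?F' and A' = "Tri s a u t" and B' = "Qd s c' a t b t"])
      show "?Y = R + Z + Lay s a b (c # vs) + {#Tri s a u c', ?F'#}" by (simp add: ac_simps)
      show "?W = R + Z + Lay s a b (c # vs) + {#Tri s a u t, Qd s c' a t b t#}" unfolding Ls Lad_def by (simp add: ac_simps)
      show "Tri s a u c' = Tri s c' a u" by (metis Tri_rot)
      show "Qd s c' a t b t = Qd s a t b c' t" by (metis Qd_rot)
    qed (use wt dist bn nat ta in auto)
    have 3: "rc (12 * length vs + 3) X ?W" by (rule rc_mono[OF rc_trans[OF 1 2]]) simp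
    have tn: "t \<notin> {a, b, c} \<union> set vs" using dist D ta by auto
    have tf: "dd s u t \<in> fst F \<or> dd s c t \<in> fst F" using Fq by (simp add: fst_Qd)
    note ft = fin[OF tn tf rc_rl[OF rl 3]]
    have "distinct [a, u, t]" using dist ta by auto
    then show ?thesis using 3 ft tn by blast
  qed
qed

end

section \<open>The induction that builds the ladder of an ear\<close>

lemma cost_add: "i \<le> 12 * L \<Longrightarrow> l \<le> L \<Longrightarrow> p < q \<Longrightarrow> i + 12 * l * p \<le> 12 * L * (q::nat)"
proof -
  assume a: "i \<le> 12 * L" "l \<le> L" "p < q"
  have "i + 12 * l * p \<le> 12 * L + 12 * L * p" using a by (intro add_mono mult_right_mono) auto
  also have "\<dots> = 12 * L * Suc p" by simp
  also have "\<dots> \<le> 12 * L * q" using a by (intro mult_left_mono) auto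
  finally show ?thesis .
qed

text \<open>Every advance is charged to the length of the final ladder, which is legitimate since
  ladders only grow along the recursion, and is paid by a drop of \<open>psi\<close>. The size in
  the measure takes care of splits, which merely divide the potential between two parts.\<close>

theorem ear_ladder:
  assumes "ear Ou s a b c R" "rl Ou (R + I0 + Lad s a u c vs)" "distinct (a # u # c # vs)" "\<And>f. f \<in># I0 \<Longrightarrow> c \<notin> snd f"
  shows "\<exists>I' ws. rc (12 * (1 + length ws) * psi a b I0) (R + I0 + Lad s a u c vs) (R + I' + Lad s a b c ws) \<and>
    length vs \<le> length ws \<and> distinct (a # b # c # ws)"
  using assms
proof (induction "psi a b I0 + size I0" arbitrary: s a b c R I0 u vs rule: less_induct)
  case less
  note prems = less.prems
  have IH: "\<exists>I' ws. rc (12 * (1 + length ws) * psi a' b' I0') (R' + I0' + Lad s' a' u' c' vs') (R' + I' + Lad s' a' b' c' ws) \<and>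
    length vs' \<le> length ws \<and> distinct (a' # b' # c' # ws)"
    if "psi a' b' I0' + size I0' < psi a b I0 + size I0" "ear Ou s' a' b' c' R'" "rl Ou (R' + I0' + Lad s' a' u' c' vs')"
      "distinct (a' # u' # c' # vs')" "\<And>f. f \<in># I0' \<Longrightarrow> c' \<notin> snd f" for s' a' b' c' R' I0' u' vs'
    using less.hyps[OF that] by blast
  show ?case
  proof (cases "u = b")
    case True
    then show ?thesis using prems(3) by (intro exI[of _ I0] exI[of _ vs]) simp
  next
    case False
    obtain F u' where F: "F \<in># I0" "u' \<notin> {a, c, u} \<union> set vs" "(\<exists>t w. F = Qd s c u t u' w \<and> w \<noteq> c) \<or> F = Tri s c u u'"
      using ear_face[OF prems False] by blast
    obtain Z where Z: "I0 = add_mset F Z" using F(1) by (meson mset_add)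
    interpret ear_state Ou s a b c u u' R I0 Z vs F
      by unfold_locales (use prems False Z F in blast)+
    show ?thesis
    proof (cases "(a, u') \<in> DS X")
      case na: False
      obtain F2 where F2: "rc (12 * length vs + 3) X (R + add_mset F2 Z + Lad s a u' c vs)" "psi a b {#F2#} < psi a b {#F#}" "c \<notin> snd F2"
        using free_step[OF na] by blast
      have ps: "psi a b (add_mset F2 Z) < psi a b I0" using F2(2) unfolding Z psi_simps(2)[of a b F Z] psi_simps(2)[of a b F2 Z] by simp
      obtain I' ws where W: "rc (12 * (1 + length ws) * psi a b (add_mset F2 Z)) (R + add_mset F2 Z + Lad s a u' c vs) (R + I' + Lad s a b c ws)"
        "length vs \<le> length ws" "distinct (a # b # c # ws)"
      proof -
        have "\<exists>I' ws. rc (12 * (1 + length ws) * psi a b (add_mset F2 Z)) (R + add_mset F2 Z + Lad s a u' c vs) (R + I' + Lad s a b c ws) \<and>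
           length vs \<le> length ws \<and> distinct (a # b # c # ws)"
        proof (rule IH)
          show "psi a b (add_mset F2 Z) + size (add_mset F2 Z) < psi a b I0 + size I0" using ps unfolding Z by simp
          show "rl Ou (R + add_mset F2 Z + Lad s a u' c vs)" by (rule rc_rl[OF rl F2(1)])
          show "distinct (a # u' # c # vs)" using d u' by auto
          fix f assume "f \<in># add_mset F2 Z"
          then show "c \<notin> snd f" using F2(3) nc[of f] Z by auto
        qed (rule prems)
        then show ?thesis using that by blast
      qed
      have "rc (12 * length vs + 3 + 12 * (1 + length ws) * psi a b (add_mset F2 Z)) X (R + I' + Lad s a b c ws)"
        by (rule rc_trans[OF F2(1) W(1)])
      then have "rc (12 * (1 + length ws) * psi a b I0) X (R + I' + Lad s a b c ws)"
        by (rule rc_mono) (rule cost_add[OF _ _ ps], use W(2) in simp_all)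
      then show ?thesis using W by blast
    next
      case ad: True
      obtain J0 P where P: "I0 = J0 + P" "F \<in># J0" "tri_side Ou X a c u' (J0 + Lad s a u c vs) (R + P)" "ear Ou s a u' c (R + P)"
        "psi a u' J0 \<le> psi a b J0" "u' \<noteq> b \<longrightarrow> P \<noteq> {#}" using side_step[OF ad] by blast
      show ?thesis
      proof (cases "P = {#}")
        case True
        then have ub': "u' = b" "J0 = I0" using P by auto
        \<comment> \<open>Nothing lies beyond the cycle in the region: the layers up to
          \<open>m\<close> are added to the outside, and \<open>Z\<close> is a new ear problem with
          tip \<open>m\<close>.\<close>
        obtain s1 a1 b1 u1 m where S: "s1 = s \<and> a1 = a \<and> b1 = b \<or> s1 = (\<not> s) \<and> a1 = b \<and> b1 = a"
          "rc (12 * length vs + 3) X (R + Lay s a b (c # vs @ [m]) + Z + Lad s1 a1 u1 m [])"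
          "ear Ou s1 a1 b1 m (R + Lay s a b (c # vs @ [m]))" "distinct [a1, u1, m]" "m \<notin> {a, b, c} \<union> set vs" "\<forall>f\<in>#Z. m \<notin> snd f"
        proof -
          have "tri_side Ou X a c b (I0 + Lad s a u c vs) R" using P(3) True ub' by simp
          from final_step[OF ub'(1) this] show ?thesis using that by blast
        qed
        let ?R = "R + Lay s a b (c # vs @ [m])"
        have pe: "psi a1 b1 Z = psi a b Z" using S(1) psi_swap[of a b Z] by auto
        have le: "Lad s1 a1 b1 m ws = Lad s a b m ws" for ws using S(1) Lad_flip[of s b a m ws] by auto
        obtain I' ws where W: "rc (12 * (1 + length ws) * psi a1 b1 Z) (?R + Z + Lad s1 a1 u1 m []) (?R + I' + Lad s1 a1 b1 m ws)"
          "distinct (a1 # b1 # m # ws)"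
        proof -
          have "\<exists>I' ws. rc (12 * (1 + length ws) * psi a1 b1 Z) (?R + Z + Lad s1 a1 u1 m []) (?R + I' + Lad s1 a1 b1 m ws) \<and>
             length ([] :: 'a list) \<le> length ws \<and> distinct (a1 # b1 # m # ws)"
          proof (rule IH)
            show "psi a1 b1 Z + size Z < psi a b I0 + size I0" using psi_pos unfolding pe Z by simp
            show "rl Ou (?R + Z + Lad s1 a1 u1 m [])" by (rule rc_rl[OF rl S(2)])
            show "distinct (a1 # u1 # m # [])" using S(4) by simp
          qed (use S in blast)+
          then show ?thesis using that by blast
        qed
        have rf: "rl Ou (?R + I' + Lad s1 a1 b1 m ws)" by (rule rc_rl[OF rc_rl[OF rl S(2)] W(1)])
        have ok: "lad_ok (?R + I') a1 b1 m ws" by (rule lad_fresh[OF rf W(2)])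
        have "v \<notin> set ws" if v: "v \<in> set (c # vs)" for v
        proof
          assume "v \<in> set ws"
          then have "dd s v a \<notin> DS (Lay s a b (c # vs @ [m]))" using ok unfolding lad_ok_def by (auto simp: dd_def)
          moreover have "dd s v a \<in> DS (Lay s a b (c # vs @ [m]))" unfolding Lay_dd using v by (auto simp: butlast_append)
          ultimately show False by blast
        qed
        moreover have "distinct (a # b # m # ws)" using W(2) S(1) by auto
        moreover have "b \<notin> set vs" "distinct [a, b, c]" using u' ub' earD(1)[OF E] by auto
        ultimately have dw: "distinct (a # b # c # vs @ m # ws)" using d S(5) by auto
        have fe: "?R + I' + Lad s1 a1 b1 m ws = R + I' + Lad s a b c (vs @ m # ws)"
          unfolding le unfolding Lad_def using Lay_append[of s a b "c # vs" m ws] by (simp add: ac_simps)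
        have "rc (12 * length vs + 3 + 12 * (1 + length ws) * psi a b Z) X (R + I' + Lad s a b c (vs @ m # ws))"
          using rc_trans[OF S(2) W(1)] unfolding fe pe .
        then have "rc (12 * (1 + length (vs @ m # ws)) * psi a b I0) X (R + I' + Lad s a b c (vs @ m # ws))"
          by (rule rc_mono) (rule cost_add[OF _ _ psi_pos], simp_all)
        then show ?thesis using dw by (intro exI[of _ I'] exI[of _ "vs @ m # ws"]) simp
      next
        case Pn: False
        have X1: "X = R + P + J0 + Lad s a u c vs" unfolding P(1) by (simp add: ac_simps)
        have szP: "size P > 0" using Pn by (simp add: nonempty_has_size)
        \<comment> \<open>The inside of the cycle is solved first; its ladder has poles
          \<open>a\<close> and \<open>u'\<close>, and the walk around \<open>c\<close> resumes from
          there.\<close>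
        obtain J1 ws1 where W1: "rc (12 * (1 + length ws1) * psi a u' J0) (R + P + J0 + Lad s a u c vs) (R + P + J1 + Lad s a u' c ws1)"
          "length vs \<le> length ws1" "distinct (a # u' # c # ws1)"
        proof -
          have "\<exists>J1 ws1. rc (12 * (1 + length ws1) * psi a u' J0) (R + P + J0 + Lad s a u c vs) (R + P + J1 + Lad s a u' c ws1) \<and>
            length vs \<le> length ws1 \<and> distinct (a # u' # c # ws1)"
          proof (rule IH)
            show "psi a u' J0 + size J0 < psi a b I0 + size I0" using P(5) szP unfolding P(1) psi_simps(3) by simp
            show "rl Ou (R + P + J0 + Lad s a u c vs)" using rl unfolding X1 .
            fix f assume "f \<in># J0" then show "c \<notin> snd f" using nc[of f] P(1) by simp
          qed (use P(4) d in blast)+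
          then show ?thesis using that by blast
        qed
        have rl1: "rl Ou (R + P + J1 + Lad s a u' c ws1)" using rc_rl[OF rl[unfolded X1] W1(1)] .
        \<comment> \<open>The ladder fills the triangle \<open>a c u'\<close>, so together with the
          outside it has no free boundary edge, and nothing can be left.\<close>
        have "J1 = {#}"
        proof (rule rl_connected)
          let ?A = "R + P + Lad s a u' c ws1"
          show "rl Ou (?A + J1)" using rl1 by (simp add: ac_simps)
          show "?A \<noteq> {#}" unfolding Lad_def by simp
          have dac: "distinct [a, c, u']" using dn by auto
          have ca: "dd s c a \<in> DS (J0 + Lad s a u c vs)" using Lad_in by simp
          note T = tri_side_dd[OF rl P(3) dac ca]
          have La: "dd s c a \<in> DS (Lad s a u' c ws1)" "dd s a u' \<in> DS (Lad s a u' c ws1)" "dd s u' c \<in> DS (Lad s a u' c ws1)"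
            unfolding Lad_DS by auto
          fix p q assume pq: "(p, q) \<in> DS ?A"
          then consider "(p, q) \<in> DS (R + P)" | "(p, q) \<in> DS (Lad s a u' c ws1)" by auto
          then show "(q, p) \<in> DS ?A"
          proof cases
            case 1
            show ?thesis
            proof (cases "{q, p} \<in> cyc3 a c u'")
              case True
              have pX: "(p, q) \<in> DS X" using 1 unfolding X1 by auto
              have qX: "(q, p) \<in> DS X" using rl_sym[OF rl pX] .
              have "(q, p) \<in> DS (R + P) \<or> (q, p) \<in> DS (J0 + Lad s a u c vs)" using qX unfolding X1 by auto
              then show ?thesis using T(6)[OF True] La by auto
            next
              case False
              then show ?thesis using tri_side_sym_edge(2)[OF rl P(3), of q p] 1 by simp
            qed
          next
            case 2
            have "(q, p) \<in> DS (Lad s a u' c ws1) \<or> (p, q) \<in> {dd s c a, dd s a u', dd s u' c}"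
            proof -
              obtain i j where ij: "(p, q) = dd s i j" "(q, p) = dd s j i" by (cases s) (auto simp: dd_def)
              show ?thesis using 2 unfolding Lad_DS ij by auto
            qed
            moreover have "(q, p) \<in> DS (R + P)" if "(p, q) \<in> {dd s c a, dd s a u', dd s u' c}"
              using that T(7-9) by (auto simp only: dd_def prod.inject split: if_splits)
            ultimately show ?thesis by auto
          qed
        qed
        then have Y: "R + P + J1 + Lad s a u' c ws1 = R + P + Lad s a u' c ws1" by simp
        obtain I' ws where W: "rc (12 * (1 + length ws) * psi a b P) (R + P + Lad s a u' c ws1) (R + I' + Lad s a b c ws)"
          "length ws1 \<le> length ws" "distinct (a # b # c # ws)"
        proof -
          have "\<exists>I' ws. rc (12 * (1 + length ws) * psi a b P) (R + P + Lad s a u' c ws1) (R + I' + Lad s a b c ws) \<and>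
            length ws1 \<le> length ws \<and> distinct (a # b # c # ws)"
          proof (rule IH)
            have "size J0 > 0" using P(2) by (metis gr_zeroI size_eq_0_iff_empty empty_iff set_mset_empty)
            then show "psi a b P + size P < psi a b I0 + size I0" unfolding P(1) psi_simps(3) by simp
            show "rl Ou (R + P + Lad s a u' c ws1)" using rl1 unfolding Y .
            fix f assume "f \<in># P" then show "c \<notin> snd f" using nc[of f] P(1) by simp
          qed (use prems W1(3) in blast)+
          then show ?thesis using that by blast
        qed
        have r: "rc (12 * (1 + length ws1) * psi a u' J0 + 12 * (1 + length ws) * psi a b P) X (R + I' + Lad s a b c ws)"
          using rc_trans[OF W1(1)[unfolded Y] W(1)] unfolding X1 .
        have "12 * (1 + length ws1) * psi a u' J0 \<le> 12 * (1 + length ws) * psi a b J0"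
          by (rule mult_le_mono) (use W(2) P(5) in simp_all)
        then have "rc (12 * (1 + length ws) * psi a b I0) X (R + I' + Lad s a b c ws)"
          by (intro rc_mono[OF r]) (simp add: P(1) psi_simps(3) add_mult_distrib2)
        then show ?thesis using W W1(2) by (meson le_trans)
      qed
    qed
  qed
qed

section \<open>Moving a triangle\<close>

text \<open>The instance of \<open>corner_free\<close> whose corner is a single angle of the
  quadrilateral.\<close>

lemma quad_free:
  assumes rl: "rl Ou (W + {#Qd s x y z t w#})" and w: "w = x \<or> w = z"
  shows "(x, z) \<notin> DS (W + {#Qd s x y z t w#})"
proof -
  let ?Q = "Qd s x y z t w"
  have d: "distinct [x, y, z, t]" by (rule rl_Qd(1)[OF rl, of s x y z t w]) simp
  have rl': "rl Ou ({#?Q#} + W)" using rl by (simp add: add.commute)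
  have "(z, x) \<notin> DS ({#?Q#} + W)"
    by (rule corner_free[OF rl', where s = s and S = "{}" and y = y and g = ?Q and p = x])
      (use d w in \<open>auto simp: fst_Qd\<close>)
  then have "(x, z) \<notin> DS ({#?Q#} + W)" using rl_sym[OF rl', of x z] by blast
  then show ?thesis by (simp add: add.commute)
qed

text \<open>The fourth corner equals \<open>p1\<close>, so the two faces close up around
  \<open>p0\<close>. This vertex has degree two, and its reflex angle can only be the one in the
  quadrilateral.\<close>

lemma deg2:
  assumes rl: "rl Ou (W + {#Tri s p0 p1 p2, Qd s p0 p2 p3 p1 w#})"
  shows "w = p0" "(p0, p3) \<notin> DS (W + {#Tri s p0 p1 p2, Qd s p0 p2 p3 p1 w#})"
proof -
  let ?A = "{#Tri s p0 p1 p2, Qd s p0 p2 p3 p1 w#}"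
  have rl': "rl Ou (?A + W)" using rl by (simp add: add.commute)
  have d: "distinct [p0, p2, p3, p1]" by (rule rl_Qd(1)[OF rl, of s _ _ _ _ w]) simp
  have dA: "dd s q p0 \<in> DS ?A \<longleftrightarrow> q = p1 \<or> q = p2" "dd s p0 q \<in> DS ?A \<longleftrightarrow> q = p1 \<or> q = p2" for q
    using d by (auto simp: fst_Qd fst_Tri)
  have sy: "(q, p0) \<in> DS ?A \<longleftrightarrow> (p0, q) \<in> DS ?A" for q
    by (rule symI_dd[where s = s]) (use dA in blast)
  have A2: "(q, p0) \<in> DS ?A \<longleftrightarrow> q = p1 \<or> q = p2" for q using dA[of q] sy[of q] by (auto simp only: dd_def split: if_splits)
  have p1: "(p1, p0) \<in> DS ?A" using A2 by blast
  note rot = rl_rotate[OF rl' sy p1]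
  have "(p3, p0) \<notin> DS (?A + W)" using rot[of p3] A2[of p3] d by auto
  then have "(p0, p3) \<notin> DS (?A + W)" using rl_sym[OF rl', of p0 p3] by blast
  then show "(p0, p3) \<notin> DS (W + ?A)" by (simp add: add.commute)
  have "(p1, p0) \<in> DS (?A + W)" using p1 by (metis DS_simps(3) UnI1)
  then obtain f q where f: "f \<in># ?A + W" "p0 \<in> snd f" "(q, p0) \<in> fst f" using rl_reflex[OF rl'] by blast
  have "(q, p0) \<in> DS (?A + W)" using f unfolding mem_DS by blast
  then have "(q, p0) \<in> DS ?A" by (rule rot)
  then have "f \<notin># W" using face_side[of Ou ?A W "(q, p0)" f] rl' f(3) by blast
  then have "f = Tri s p0 p1 p2 \<or> f = Qd s p0 p2 p3 p1 w" using f(1) by auto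
  then show "w = p0" using f(2) by auto
qed

lemma Qd_mirror: "Qd s p0 p2 p3 p4 w = Qd (\<not> s) p2 p0 p4 p3 w" unfolding Qd_flip by (metis Qd_rot)
lemma Tri_mirror: "Tri s p0 p1 p2 = Tri (\<not> s) p2 p1 p0" unfolding Tri_flip ..

text \<open>If \<open>w\<close> is \<open>p2\<close> or \<open>p3\<close>, one flip is excluded, but
  the reflex angle at \<open>w\<close> frees the new edge of the other. Otherwise a failure needs
  both edges \<open>p1 p3\<close> and \<open>p2 p4\<close>. The cycle \<open>p1 p2 p3\<close> then
  encloses the quadrilateral with \<open>p4\<close> in its interior, so \<open>p2 p4\<close> would
  have to lie in the corner at \<open>p2\<close>, where the only inner edge is
  \<open>p2 p0\<close>.\<close>

lemma move_triangle_side: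
  assumes rl: "rl Ou (W + {#Tri s p0 p1 p2, Qd s p0 p2 p3 p4 w#})" and n: "p1 \<noteq> p3"
  shows "\<exists>T' Q'. rc 1 (W + {#Tri s p0 p1 p2, Qd s p0 p2 p3 p4 w#}) (W + {#T', Q'#}) \<and> dd s p2 p3 \<in> fst T' \<and> (\<exists>s x y z. T' = Tri s x y z)"
proof -
  let ?T = "Tri s p0 p1 p2" and ?Q = "Qd s p0 p2 p3 p4 w"
  let ?X = "W + {#?T, ?Q#}"
  have d: "distinct [p0, p2, p3, p4]" "w \<in> {p0, p2, p3, p4}" using rl_Qd[OF rl, of s p0 p2 p3 p4 w] by simp_all
  have dt: "distinct [p0, p1, p2]" by (rule rl_Tri[OF rl, of s]) simp
  show ?thesis
  proof (cases "p1 = p4")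
    case True
    have rl1: "rl Ou (W + {#Tri s p0 p1 p2, Qd s p0 p2 p3 p1 w#})" using rl True by simp
    note D = deg2[OF rl1]
    have "?T = Tri s p1 p2 p0" "?Q = Qd s p1 p0 p2 p3 w" using Qd_rot[of s p4 p0 p2 p3 w] True Tri_rot[of s p0 p1 p2] by simp_all
    then have "rc 1 ?X (W + {#Tri s p0 p2 p3, Qd s p0 p3 p1 p2 w#})"
      by (intro rc_far[where s = s and ?p0.0 = p1 and ?p1.0 = p2 and ?p2.0 = p0 and ?p3.0 = p2 and ?p4.0 = p3 and w = w and R = W
            and A = ?T and B = ?Q and A' = "Tri s p0 p2 p3" and B' = "Qd s p0 p3 p1 p2 w"])
        (use D d True in auto)
    moreover have "dd s p2 p3 \<in> fst (Tri s p0 p2 p3)" by (simp add: fst_Tri)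
    ultimately show ?thesis by blast
  next
    case n4: False
    let ?A = "{#?T, ?Q#}"
    have rl': "rl Ou (?A + W)" using rl by (simp add: add.commute)
    have ne: "?X = ?A + W" by (simp add: add.commute)
    have cin: "dd s q p2 \<in> DS ?A \<longleftrightarrow> q = p1 \<or> q \<in> {p0}" and cout: "dd s p2 q \<in> DS ?A \<longleftrightarrow> q = p3 \<or> q \<in> {p0}" for q
      using d dt by (auto simp: fst_Qd fst_Tri)
    consider (near) "w \<noteq> p2" "(p1, p3) \<notin> DS ?X" | (far) "w \<noteq> p3" "(p2, p4) \<notin> DS ?X"
    proof -
      have "w \<noteq> p2 \<and> (p1, p3) \<notin> DS ?X \<or> w \<noteq> p3 \<and> (p2, p4) \<notin> DS ?X"
      proof (rule ccontr)
        assume b: "\<not> ?thesis"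
        have f1: "(p2, p4) \<notin> DS ?X" if "w = p2"
        proof -
          have e: "?X = (W + {#?T#}) + {#Qd s p2 p3 p4 p0 w#}" using Qd_rot[of s p0 p2 p3 p4 w] by simp
          show ?thesis unfolding e by (rule quad_free[OF rl[unfolded e]]) (use that in auto)
        qed
        have f2: "(p3, p1) \<notin> DS (?A + W)" if "w = p3"
          by (rule corner_free[OF rl' _ cin cout, where g = ?Q and p = p0]) (use d dt n that in \<open>auto simp: fst_Qd\<close>)
        have f2': "(p1, p3) \<notin> DS ?X" if "w = p3" using f2[OF that] rl_sym[OF rl, of p1 p3] unfolding ne by blast
        have h: "w \<noteq> p2" "w \<noteq> p3" "(p1, p3) \<in> DS ?X" "(p2, p4) \<in> DS ?X" using b f1 f2' d(1) by auto
        have sw: "((q, p2) \<in> DS ?A \<longleftrightarrow> (q = p1 \<or> q = p0)) \<and> ((p2, q) \<in> DS ?A \<longleftrightarrow> (q = p3 \<or> q = p0)) \<or>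
          ((q, p2) \<in> DS ?A \<longleftrightarrow> (q = p3 \<or> q = p0)) \<and> ((p2, q) \<in> DS ?A \<longleftrightarrow> (q = p1 \<or> q = p0))" for q
          using cin[of q] cout[of q] by (cases s) (simp_all only: dd_def if_True if_False singleton_iff, blast+)
        have ds: "p0 \<notin> {p1, p3}" "distinct [p1, p2, p3]" using d dt n by auto
        have s1: "(q, p2) \<in> DS ?A \<longleftrightarrow> (p2, q) \<in> DS ?A" if "q \<notin> {p1, p3}" for q using sw[of q] that by blast
        have s2: "(q, p2) \<in> DS ?A \<longleftrightarrow> (p2, q) \<notin> DS ?A" if "q \<in> {p1, p3}" for q using sw[of q] that ds by auto
        have x2: "dd s p1 p2 \<in> DS (?A + W)" "dd s p2 p3 \<in> DS (?A + W)"
          unfolding DS_simps(3)[of ?A W] using cin[of p1] cout[of p3] by blast+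
        have e1: "(p1, p2) \<in> DS (?A + W)" "(p2, p3) \<in> DS (?A + W)"
          using x2 rl_sym[OF rl'] by (auto simp only: dd_def split: if_splits)
        have e2: "(p3, p1) \<in> DS (?A + W)" using h(3) rl_sym[OF rl] unfolding ne by blast
        have nr: "\<not> (\<exists>f\<in>#?A. p2 \<in> snd f)" using h(1) by auto
        obtain J K where J: "tri_side Ou (?A + W) p1 p2 p3 J K"
          and ag: "\<forall>q. ((q, p2) \<in> DS ?A \<longleftrightarrow> (q, p2) \<in> DS J) \<and> ((p2, q) \<in> DS ?A \<longleftrightarrow> (p2, q) \<in> DS J)"
          using corner_cases[OF rl' ds(2) e1 e2 s1 s2] nr by blast
        have XJK: "?A + W = J + K" using J unfolding tri_side_def by (rule conjunct1)
        have rlJ: "rl Ou (J + K)" using rl' unfolding XJK .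
        have "dd s p0 p2 \<in> DS ?A" using cin by blast
        then have "dd s p0 p2 \<in> DS J" unfolding dd_def using ag[rule_format, of p0] by presburger
        then have "?Q \<notin># K" using face_side[OF rlJ, of "dd s p0 p2" ?Q] by (simp add: fst_Qd)
        moreover have "?Q \<in># ?A + W" by simp
        ultimately have "?Q \<in># J" unfolding XJK by simp
        then have p3J: "dd s p3 p4 \<in> DS J" unfolding mem_DS by (intro bexI[of _ ?Q]) (simp_all add: fst_Qd)
        have p4: "p4 \<notin> {p1, p2, p3}" using d n4 by auto
        note sy = tri_side_sym[OF rl' J p4]
        have "(p3, p4) \<in> DS J" using p3J sy(1)[of p3] by (auto simp only: dd_def split: if_splits)
        from rl_rotate[OF rlJ sy(1) this, of p2] have "(p2, p4) \<in> DS J" using h(4) unfolding ne XJK .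
        then have "(p2, p4) \<in> DS ?A" using ag by blast
        then show False using sw[of p4] d n4 by auto
      qed
      then show ?thesis using that by blast
    qed
    then show ?thesis
    proof cases
      case near
      have "rc 1 ?X (W + {#Tri s p1 p2 p3, Qd s p1 p3 p4 p0 w#})"
        by (rule rc_near[where s = s and ?p0.0 = p0 and ?p1.0 = p1 and ?p2.0 = p2 and ?p3.0 = p3 and ?p4.0 = p4 and w = w and R = W])
          (use near n n4 in auto)
      moreover have "dd s p2 p3 \<in> fst (Tri s p1 p2 p3)" by (simp add: fst_Tri)
      ultimately show ?thesis by blast
    next
      case far
      have "rc 1 ?X (W + {#Tri s p2 p3 p4, Qd s p2 p4 p0 p1 w#})"
        by (rule rc_far[where s = s and ?p0.0 = p0 and ?p1.0 = p1 and ?p2.0 = p2 and ?p3.0 = p3 and ?p4.0 = p4 and w = w and R = W])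
          (use far n n4 in auto)
      moreover have "dd s p2 p3 \<in> fst (Tri s p2 p3 p4)" by (simp add: fst_Tri)
      ultimately show ?thesis by blast
    qed
  qed
qed

text \<open>Each diagonal of the quadrilateral is free if one of its ends is reflex, and
  \<open>w\<close> is one of the four corners; so one of two mirror-image flips works. The
  degenerate pentagons with \<open>p1\<close> equal to \<open>p3\<close> or \<open>p4\<close> are
  settled by \<open>deg2\<close>.\<close>

lemma move_triangle_far:
  assumes rl: "rl Ou (W + {#Tri s p0 p1 p2, Qd s p0 p2 p3 p4 w#})"
  shows "\<exists>T' Q'. rc 1 (W + {#Tri s p0 p1 p2, Qd s p0 p2 p3 p4 w#}) (W + {#T', Q'#}) \<and> dd s p3 p4 \<in> fst T' \<and> (\<exists>s x y z. T' = Tri s x y z)"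
proof -
  let ?T = "Tri s p0 p1 p2" and ?Q = "Qd s p0 p2 p3 p4 w"
  let ?X = "W + {#?T, ?Q#}"
  have d: "distinct [p0, p2, p3, p4]" "w \<in> {p0, p2, p3, p4}" using rl_Qd[OF rl, of s p0 p2 p3 p4 w] by simp_all
  have far: ?thesis if h: "w \<noteq> p3" "p1 \<noteq> p4" "(p2, p4) \<notin> DS ?X"
  proof -
    have "rc 1 ?X (W + {#Tri s p2 p3 p4, Qd s p2 p4 p0 p1 w#})"
      by (rule rc_far[where s = s and ?p0.0 = p0 and ?p1.0 = p1 and ?p2.0 = p2 and ?p3.0 = p3 and ?p4.0 = p4 and w = w and R = W])
        (use h in auto)
    moreover have "dd s p3 p4 \<in> fst (Tri s p2 p3 p4)" by (simp add: fst_Tri)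
    ultimately show ?thesis by blast
  qed
  have far': ?thesis if h: "w \<noteq> p4" "p1 \<noteq> p3" "(p0, p3) \<notin> DS ?X"
  proof -
    have "rc 1 ?X (W + {#Tri s p3 p4 p0, Qd s p0 p1 p2 p3 w#})"
      by (rule rc_far'[where s = s and ?p0.0 = p0 and ?p1.0 = p1 and ?p2.0 = p2 and ?p3.0 = p3 and ?p4.0 = p4 and w = w and R = W])
        (use h in auto)
    moreover have "dd s p3 p4 \<in> fst (Tri s p3 p4 p0)" by (simp add: fst_Tri)
    ultimately show ?thesis by blast
  qed
  have f1: "(p2, p4) \<notin> DS ?X" if "w = p2 \<or> w = p4"
  proof -
    have e: "?X = (W + {#?T#}) + {#Qd s p2 p3 p4 p0 w#}" using Qd_rot[of s p0 p2 p3 p4 w] by simp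
    show ?thesis unfolding e by (rule quad_free[OF rl[unfolded e]]) (use that in auto)
  qed
  have f2: "(p0, p3) \<notin> DS ?X" if "w = p0 \<or> w = p3"
  proof -
    have e: "?X = (W + {#?T#}) + {#Qd s p3 p4 p0 p2 w#}" using Qd_rot[of s p0 p2 p3 p4 w] Qd_rot[of s p2 p3 p4 p0 w] by simp
    have "(p3, p0) \<notin> DS ?X" unfolding e by (rule quad_free[OF rl[unfolded e]]) (use that in auto)
    then show ?thesis using rl_sym[OF rl] by blast
  qed
  consider "p1 = p4" | "p1 = p3" | "p1 \<noteq> p3" "p1 \<noteq> p4" by blast
  then show ?thesis
  proof cases
    case 1
    have "rl Ou (W + {#Tri s p0 p1 p2, Qd s p0 p2 p3 p1 w#})" using rl 1 by simp
    from deg2[OF this] show ?thesis by (intro far') (use 1 d in auto)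
  next
    case 2
    have "rl Ou (W + {#Tri (\<not> s) p2 p1 p0, Qd (\<not> s) p2 p0 p4 p1 w#})"
      using rl 2 unfolding Tri_mirror[of s] Qd_mirror[of s] by simp
    note D = deg2[OF this]
    have "(p2, p4) \<notin> DS ?X" using D(2) unfolding Tri_mirror[of s] Qd_mirror[of s] 2 by simp
    then show ?thesis by (intro far) (use 2 d D(1) in auto)
  next
    case 3
    then show ?thesis using far far' f1 f2 d by auto
  qed
qed

lemma move_triangle:
  assumes rl: "rl Ou (W + {#T, Q#})" and T: "T = Tri s0 x y z" and Q: "snd Q \<noteq> {}" "Q \<noteq> outf Ou"
    and sh: "(p, q) \<in> fst T" "(q, p) \<in> fst Q" and e: "(i, j) \<in> fst Q" "(j, i) \<notin> fst T"
  shows "\<exists>T' Q'. rc 1 (W + {#T, Q#}) (W + {#T', Q'#}) \<and> (i, j) \<in> fst T' \<and> (\<exists>s x y z. T' = Tri s x y z)"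
proof -
  have "T \<noteq> outf Ou" using rl_outf(2)[OF rl] T by metis
  then have "(\<exists>z. T = Tri True p q z) \<or> (\<exists>z t w. T = Qd True p q z t w)"
    by (intro rl_face[OF rl]) (use sh \<open>T \<noteq> outf Ou\<close> in \<open>simp_all add: dd_def\<close>)
  then obtain p1 where T1: "T = Tri True p q p1" using T by (metis snd_face insert_not_empty)
  have T': "T = Tri True q p1 p" using T1 Tri_rot by metis
  have "(\<exists>z. Q = Tri True q p z) \<or> (\<exists>z t w. Q = Qd True q p z t w)"
    by (intro rl_face[OF rl]) (use sh Q in \<open>simp_all add: dd_def\<close>)
  then obtain p3 p4 w where Q': "Q = Qd True q p p3 p4 w" using Q by auto
  have rl': "rl Ou (W + {#Tri True q p1 p, Qd True q p p3 p4 w#})" using rl T' Q' by simp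
  have d: "distinct [q, p, p3, p4]" by (rule rl_Qd(1)[OF rl', of True _ _ _ _ w]) simp
  have fT: "fst T = {(q, p1), (p1, p), (p, q)}" unfolding T' fst_Tri by (simp add: dd_def)
  have "(i, j) \<in> {(q, p), (p, p3), (p3, p4), (p4, q)}" using e(1) unfolding Q' fst_Qd by (simp add: dd_def)
  then consider "(i, j) = (q, p)" | "(i, j) = (p, p3)" | "(i, j) = (p3, p4)" | "(i, j) = (p4, q)" by blast
  then show ?thesis
  proof cases
    case 1 then show ?thesis using e sh by simp
  next
    case 2
    then have "p1 \<noteq> p3" using e(2) fT by auto
    from move_triangle_side[OF rl' this] show ?thesis unfolding T' Q' 2 dd_def by simp
  next
    case 3
    from move_triangle_far[OF rl'] show ?thesis unfolding T' Q' 3 dd_def by simp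
  next
    case 4
    then have "p1 \<noteq> p4" using e(2) fT by auto
    have m: "Tri True q p1 p = Tri False p p1 q" "Qd True q p p3 p4 w = Qd False p q p4 p3 w"
      using Tri_mirror[of True q p1 p] Qd_mirror[of True q p p3 p4 w] by simp_all
    have "rl Ou (W + {#Tri False p p1 q, Qd False p q p4 p3 w#})" using rl' unfolding m .
    from move_triangle_side[OF this \<open>p1 \<noteq> p4\<close>] show ?thesis unfolding T' Q' 4 m dd_def by simp
  qed
qed

section \<open>Dual paths of quadrilaterals\<close>

fun linked :: "'v tface \<Rightarrow> 'v tface list \<Rightarrow> 'v \<times> 'v \<Rightarrow> bool" where
  "linked f [] d \<longleftrightarrow> d \<in> fst f"
| "linked f (g # gs) d \<longleftrightarrow> (\<exists>p q. (p, q) \<in> fst f \<and> (q, p) \<in> fst g) \<and> linked g gs d"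

lemma move_triangle_path:
  assumes "rl Ou (W + {#T#} + mset gs)" "T = Tri s0 x y z" "\<And>g. g \<in> set gs \<Longrightarrow> snd g \<noteq> {} \<and> g \<noteq> outf Ou"
    "linked T gs (p, q)" "(q, p) \<in> DS W"
  shows "\<exists>W' T'. rc (length gs) (W + {#T#} + mset gs) (W + W' + {#T'#}) \<and> (p, q) \<in> fst T' \<and> (\<exists>s x y z. T' = Tri s x y z)"
  using assms
proof (induction gs arbitrary: W T s0 x y z)
  case Nil
  then show ?case by (intro exI[of _ "{#}"] exI[of _ T]) auto
next
  case (Cons g gs)
  obtain a b where ab: "(a, b) \<in> fst T" "(b, a) \<in> fst g" and lg: "linked g gs (p, q)" using Cons.prems(4) by auto
  have "\<exists>i j. (i, j) \<in> fst g \<and> (j, i) \<in> DS (W + mset gs) \<and> (\<forall>T'. (i, j) \<in> fst T' \<longrightarrow> linked T' gs (p, q))"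
  proof (cases gs)
    case Nil then show ?thesis using lg Cons.prems(5) by (intro exI[of _ p] exI[of _ q]) auto
  next
    case (Cons h hs)
    then obtain i j where "(i, j) \<in> fst g" "(j, i) \<in> fst h" "linked h hs (p, q)" using lg by auto
    then show ?thesis using Cons by (intro exI[of _ i] exI[of _ j]) auto
  qed
  then obtain i j where ij: "(i, j) \<in> fst g" "(j, i) \<in> DS (W + mset gs)" "\<And>T'. (i, j) \<in> fst T' \<Longrightarrow> linked T' gs (p, q)" by blast
  let ?W = "W + mset gs"
  have X: "W + {#T#} + mset (g # gs) = ?W + {#T, g#}" by simp
  have rl: "rl Ou (?W + {#T, g#})" using Cons.prems(1) unfolding X .
  have "(j, i) \<notin> fst T" using rl_disjoint[OF rl] ij(2) by auto
  then obtain T' Q' where T': "rc 1 (?W + {#T, g#}) (?W + {#T', Q'#})" "(i, j) \<in> fst T'" "\<exists>s x y z. T' = Tri s x y z"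
  proof -
    have "snd g \<noteq> {}" "g \<noteq> outf Ou" using Cons.prems(3)[of g] by simp_all
    from move_triangle[OF rl Cons.prems(2) this ab ij(1) \<open>(j, i) \<notin> fst T\<close>] show ?thesis using that by blast
  qed
  obtain s x y z where Te: "T' = Tri s x y z" using T'(3) by blast
  have e: "?W + {#T', Q'#} = (W + {#Q'#}) + {#T'#} + mset gs" by simp
  have "\<exists>W' T''. rc (length gs) ((W + {#Q'#}) + {#T'#} + mset gs) (W + {#Q'#} + W' + {#T''#}) \<and> (p, q) \<in> fst T'' \<and> (\<exists>s x y z. T'' = Tri s x y z)"
    by (rule Cons.IH[OF rc_rl[OF rl T'(1), unfolded e] Te]) (use Cons.prems ij(3) T'(2) in auto)
  then obtain W' T'' where W': "rc (length gs) ((W + {#Q'#}) + {#T'#} + mset gs) (W + {#Q'#} + W' + {#T''#})" "(p, q) \<in> fst T''" "\<exists>s x y z. T'' = Tri s x y z"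
    by blast
  have "rc (1 + length gs) (W + {#T#} + mset (g # gs)) (W + {#Q'#} + W' + {#T''#})"
    unfolding X by (rule rc_trans[OF T'(1)[unfolded e] W'(1)])
  then show ?case using W' by (intro exI[of _ "add_mset Q' W'"] exI[of _ T'']) simp
qed

text \<open>A path about to revisit a face is replaced by its tail from that face on, which keeps
  paths submultisets of the faces.\<close>

lemma linked_suffix: "linked f gs d \<Longrightarrow> g \<in> set gs \<Longrightarrow> \<exists>gs'. linked g gs' d \<and> mset (g # gs') \<subseteq># mset gs \<and> set gs' \<subseteq> set gs"
proof (induction f gs d rule: linked.induct)
  case (2 f h hs d)
  show ?case
  proof (cases "g = h")
    case True
    then have "linked g hs d" using 2 by simp
    then show ?thesis using True by (intro exI[of _ hs]) auto
  next
    case False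
    then obtain gs' where g: "linked g gs' d" "mset (g # gs') \<subseteq># mset hs" "set gs' \<subseteq> set hs" using 2 by auto
    have "mset hs \<subseteq># mset (h # hs)" by simp
    with g(2) have "mset (g # gs') \<subseteq># mset (h # hs)" by (rule subset_mset.order_trans)
    moreover have "set gs' \<subseteq> set (h # hs)" using g(3) by auto
    ultimately show ?thesis using g(1) by blast
  qed
qed simp

text \<open>A face that enters \<open>y\<close> also leaves it, and the rotation at \<open>y\<close>
  pairs the two darts.\<close>

lemma balance:
  assumes "rl Ou (A + B)" shows "card {q. dd s q y \<in> DS A} = card {q. dd s y q \<in> DS A}"
proof -
  obtain M where M: "is_4ppt M" "fm M = A + B" using assms unfolding rl_def by auto
  note D = is_4pptD[OF M(1)]
  have sub: "DS A \<subseteq> darts M" using DS_fm[OF M(1)] M(2) by auto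
  have "bij_betw (rot M y) {q. (q, y) \<in> DS A} {q. (y, q) \<in> DS A}"
    unfolding bij_betw_def
  proof (intro conjI inj_onI equalityI subsetI)
    fix p q assume "p \<in> {q. (q, y) \<in> DS A}" "q \<in> {q. (q, y) \<in> DS A}" and e: "rot M y p = rot M y q"
    then have "p \<in> nbrs M y" "q \<in> nbrs M y" using sub by (auto simp: mem_nbrs)
    then show "p = q" using D(2) e unfolding rotation_system_def by (meson inj_onD)
  next
    fix q assume "q \<in> rot M y ` {q. (q, y) \<in> DS A}"
    then obtain p where p: "(p, y) \<in> DS A" "q = rot M y p" by auto
    then show "q \<in> {q. (y, q) \<in> DS A}" using fm_part(2)[OF M, of "(p, y)"] sub by auto
  next
    fix q assume "q \<in> {q. (y, q) \<in> DS A}"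
    then have q: "(y, q) \<in> DS A" by simp
    then obtain f where f: "f \<in># A" "(y, q) \<in> fst f" unfolding mem_DS by blast
    then have ff: "fst f \<in> faces M" using in_fm_faces[OF M(1), of f] M(2) by simp
    have "(q, y) \<in> darts M" using q sub by (intro darts_sym[of y q M]) auto
    then have "q \<in> nbrs M y" by (simp add: mem_nbrs)
    moreover have "rot M y ` nbrs M y = nbrs M y"
    proof (rule endo_inj_surj)
      show "finite (nbrs M y)" 
        by (rule finite_subset[OF _ finite_imageI[OF darts_finite[OF D(1)], of fst]]) (force simp: mem_nbrs)
      show "rot M y ` nbrs M y \<subseteq> nbrs M y" "inj_on (rot M y) (nbrs M y)" using D(2) unfolding rotation_system_def by auto
    qed
    ultimately have "q \<in> rot M y ` nbrs M y" by simp
    then obtain p where p: "p \<in> nbrs M y" "rot M y p = q" by (elim imageE) simp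
    then have pd: "(p, y) \<in> darts M" by (simp add: mem_nbrs)
    then have "(p, y) \<in> DS A" using fm_part(2)[OF M pd] q p(2) by simp
    then show "q \<in> rot M y ` {q. (q, y) \<in> DS A}" using p(2) by (intro image_eqI[of q _ p]) simp_all
  qed
  then have "card {q. (q, y) \<in> DS A} = card {q. (y, q) \<in> DS A}" by (rule bij_betw_same_card)
  then show ?thesis by (cases s) (simp_all add: dd_def)
qed

section \<open>Regions bounded by a cycle\<close>

fun prs :: "'v list \<Rightarrow> ('v \<times> 'v) set" where
  "prs (x # y # zs) = insert (x, y) (prs (y # zs))"
| "prs _ = {}"

definition cyc :: "'v list \<Rightarrow> ('v \<times> 'v) set" where
  "cyc hs = insert (last hs, hd hs) (prs hs)"

lemma prs_sub: "(x, y) \<in> prs zs \<Longrightarrow> x \<in> set (butlast zs) \<and> y \<in> set (tl zs)"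
  by (induction zs rule: prs.induct) auto

lemma prs_snoc: "prs (xs @ [b, c]) = insert (b, c) (prs (xs @ [b]))"
proof (induction xs)
  case (Cons a xs) then show ?case by (cases xs) auto
qed auto

lemma prs_unique:
  "distinct zs \<Longrightarrow> (x, y) \<in> prs zs \<Longrightarrow> (x', y) \<in> prs zs \<Longrightarrow> x = x'"
  "distinct zs \<Longrightarrow> (x, y) \<in> prs zs \<Longrightarrow> (x, y') \<in> prs zs \<Longrightarrow> y = y'"
proof (induction zs rule: prs.induct)
  case (1 a b zs)
  { case 1 then show ?case using "1.IH"(1) prs_sub[of _ _ "b # zs"] by auto
  next
    case 2
    have "(a, v) \<notin> prs (b # zs)" for v using 2(1) prs_sub[of a v "b # zs"] in_set_butlastD[of a "b # zs"] by auto
    then show ?case using 2 "1.IH"(2) by auto }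
qed auto

lemma cyc_unique:
  assumes d: "distinct hs" and n: "hs \<noteq> []"
  shows "(x, y) \<in> cyc hs \<Longrightarrow> (x', y) \<in> cyc hs \<Longrightarrow> x = x'" "(x, y) \<in> cyc hs \<Longrightarrow> (x, y') \<in> cyc hs \<Longrightarrow> y = y'"
proof -
  have h: "(v, hd hs) \<notin> prs hs" for v using prs_sub[of v "hd hs" hs] d n by (cases hs) auto
  have "distinct (butlast hs @ [last hs])" using d n by simp
  then have l: "(last hs, v) \<notin> prs hs" for v using prs_sub[of "last hs" v hs] by auto
  show "(x, y) \<in> cyc hs \<Longrightarrow> (x', y) \<in> cyc hs \<Longrightarrow> x = x'" "(x, y) \<in> cyc hs \<Longrightarrow> (x, y') \<in> cyc hs \<Longrightarrow> y = y'"
    unfolding cyc_def using prs_unique[OF d] h l by blast+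
qed

lemma cyc_set: "hs \<noteq> [] \<Longrightarrow> (x, y) \<in> cyc hs \<Longrightarrow> x \<in> set hs \<and> y \<in> set hs"
  unfolding cyc_def using prs_sub[of x y hs] in_set_butlastD[of x hs] list.set_sel(2)[of hs y] by auto

lemma prs_propagate:
  assumes step: "\<And>x y z. (x, y) \<in> C \<Longrightarrow> (y, z) \<in> C \<Longrightarrow> P x y \<Longrightarrow> P y z"
  shows "prs (h # zs) \<subseteq> C \<Longrightarrow> (x, h) \<in> C \<Longrightarrow> P x h \<Longrightarrow> (u, v) \<in> prs (h # zs) \<Longrightarrow> P u v"
proof (induction zs arbitrary: h x)
  case (Cons b zs)
  then have "(h, b) \<in> C" by simp
  then have hb: "P h b" using step Cons.prems by blast
  show ?case
  proof (cases "(u, v) = (h, b)")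
    case True then show ?thesis using hb by simp
  next
    case False
    then show ?thesis using Cons.IH[of b h] Cons.prems \<open>(h, b) \<in> C\<close> hb by auto
  qed
qed simp

text \<open>The darts of \<open>R\<close> whose reversals lie outside \<open>R\<close> form the cycle \<open>hs\<close>, and an edge inside \<open>R\<close>
  is not a chord of this cycle.\<close>
definition reg :: "('v \<times> 'v) set \<Rightarrow> bool \<Rightarrow> 'v list \<Rightarrow> 'v tface multiset \<Rightarrow> bool" where
  "reg Ou s hs R \<longleftrightarrow> distinct hs \<and> 3 \<le> length hs \<and> set hs \<subseteq> snd ` Ou \<and> conn_to (outf Ou) R \<and>
    (\<forall>p q. dd s q p \<in> DS R \<and> dd s p q \<notin> DS R \<longleftrightarrow> (p, q) \<in> cyc hs) \<and>
    (\<forall>p x. dd s p x \<in> DS R \<and> dd s x p \<in> DS R \<longrightarrow>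
      (\<forall>q. dd s q x \<in> DS R \<longleftrightarrow> dd s x q \<in> DS R) \<or> (\<forall>q. dd s q p \<in> DS R \<longleftrightarrow> dd s p q \<in> DS R))"

lemma regD:
  assumes "reg Ou s hs R"
  shows "distinct hs" "3 \<le> length hs" "set hs \<subseteq> snd ` Ou" "conn_to (outf Ou) R"
    "\<And>p q. dd s q p \<in> DS R \<and> dd s p q \<notin> DS R \<longleftrightarrow> (p, q) \<in> cyc hs"
    "\<And>p x. dd s p x \<in> DS R \<Longrightarrow> dd s x p \<in> DS R \<Longrightarrow>
      (\<forall>q. dd s q x \<in> DS R \<longleftrightarrow> dd s x q \<in> DS R) \<or> (\<forall>q. dd s q p \<in> DS R \<longleftrightarrow> dd s p q \<in> DS R)"
  using assms unfolding reg_def by blast+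

abbreviation ntri :: "'v tface multiset \<Rightarrow> nat" where
  "ntri X \<equiv> size {#f \<in># X. snd f = {}#}"

text \<open>A part \<open>A\<close> of the region has as many darts into a vertex as out of it. Hence with one boundary dart
  it contains the next one, and finally the whole boundary.\<close>
lemma region_connected:
  assumes rl: "rl Ou (R + (A + B))" and reg: "reg Ou s hs R" and d: "dd s (last hs) (hd hs) \<in> DS A"
    and cl: "\<And>u v. (u, v) \<in> DS A \<Longrightarrow> (v, u) \<in> DS (A + B) \<Longrightarrow> (v, u) \<in> DS A"
  shows "B = {#}"
proof -
  note D = regD[OF reg]
  have hne: "hs \<noteq> []" using D(2) by auto
  note U = cyc_unique[OF D(1) hne]
  have dis: "DS R \<inter> DS A = {}" "DS A \<inter> DS B = {}" "DS R \<inter> DS B = {}"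
    using rl_disjoint[OF rl] rl_disjoint[of Ou "R + A" B] rl by (auto simp: add.assoc)
  have sym: "dd s v u \<in> DS R \<or> dd s v u \<in> DS A \<or> dd s v u \<in> DS B" if "dd s u v \<in> DS (R + (A + B))" for u v
    using rl_dd_sym[OF rl that] by simp
  have cl': "dd s v u \<in> DS A" if "dd s u v \<in> DS A" "dd s v u \<in> DS A \<or> dd s v u \<in> DS B" for u v
    using cl[of u v] cl[of v u] that by (auto simp: dd_def split: if_splits)
  have fin: "finite {q. dd s q y \<in> DS A}" for y
  proof -
    have "finite (DS A)" unfolding DS_def using rl_finite[OF rl] by auto
    then have "finite (fst ` DS A \<union> snd ` DS A)" by simp
    moreover have "{q. dd s q y \<in> DS A} \<subseteq> fst ` DS A \<union> snd ` DS A" by (force simp: dd_def split: if_splits)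
    ultimately show ?thesis by (rule rev_finite_subset)
  qed
  \<comment> \<open>If the boundary dart into \<open>y\<close> were in \<open>A\<close> but not the
    one out of \<open>y\<close>, reversal would embed the outgoing darts properly into the incoming
    ones, against \<open>balance\<close>.\<close>
  have step: "dd s y z \<in> DS A" if xy: "(x, y) \<in> cyc hs" and yz: "(y, z) \<in> cyc hs" and x: "dd s x y \<in> DS A" for x y z
  proof (rule ccontr)
    assume n: "dd s y z \<notin> DS A"
    have 1: "dd s y q \<in> DS A" if q: "dd s q y \<in> DS A" "q \<noteq> x" for q
    proof -
      have "dd s y q \<notin> DS R"
      proof
        assume "dd s y q \<in> DS R"
        moreover have "dd s q y \<notin> DS R" using q dis by blast
        ultimately have "(q, y) \<in> cyc hs" using D(5) by blast
        then show False using U(1)[OF xy] q by blast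
      qed
      then show ?thesis using sym[of q y] cl'[OF q(1)] q by auto
    qed
    have 2: "dd s q y \<in> DS A" if q: "dd s y q \<in> DS A" for q
    proof -
      have "dd s q y \<notin> DS R"
      proof
        assume "dd s q y \<in> DS R"
        moreover have "dd s y q \<notin> DS R" using q dis by blast
        ultimately have "(y, q) \<in> cyc hs" using D(5) by blast
        then show False using U(2)[OF yz] q n by blast
      qed
      then show ?thesis using sym[of y q] cl'[OF q] q by auto
    qed
    have "dd s y x \<in> DS R" using D(5)[of y x] xy by blast
    then have "dd s y x \<notin> DS A" using dis by blast
    then have "{q. dd s y q \<in> DS A} \<subset> {q. dd s q y \<in> DS A}" using 1 2 x by blast
    from psubset_card_mono[OF fin this] show False
      using balance[of Ou A "R + B" s y] rl by (simp add: ac_simps)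
  qed
  obtain h zs where hz: "hs = h # zs" using hne by (cases hs) auto
  have hd_l: "(last hs, h) \<in> cyc hs" "dd s (last hs) h \<in> DS A" using d hz unfolding cyc_def by auto
  have all: "dd s u v \<in> DS A" if uv: "(u, v) \<in> cyc hs" for u v
  proof (cases "(u, v) = (last hs, hd hs)")
    case True then show ?thesis using d by simp
  next
    case False
    then have uv': "(u, v) \<in> prs (h # zs)" using uv unfolding cyc_def hz[symmetric] by blast
    have "prs (h # zs) \<subseteq> cyc hs" unfolding cyc_def hz[symmetric] by blast
    from prs_propagate[of "cyc hs" "\<lambda>x y. dd s x y \<in> DS A", OF step this hd_l uv'] show ?thesis .
  qed
  show ?thesis
  proof (rule rl_connected)
    show "rl Ou ((R + A) + B)" using rl by (simp add: add.assoc)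
    have "A \<noteq> {#}" using d by auto
    then show "R + A \<noteq> {#}" by simp
    fix u v assume uv: "(u, v) \<in> DS (R + A)"
    obtain p q where pq: "(u, v) = dd s p q" "(v, u) = dd s q p" by (cases s) (auto simp: dd_def)
    have "dd s q p \<in> DS R \<or> dd s q p \<in> DS A"
    proof (cases "dd s p q \<in> DS R")
      case True
      then show ?thesis using D(5)[of p q] all[of q p] by blast
    next
      case False
      then have "dd s p q \<in> DS A" using uv pq by auto
      then show ?thesis using sym[of p q] cl' by auto
    qed
    then show "(v, u) \<in> DS (R + A)" using pq by simp
  qed
qed

lemma triangle_to_boundary:
  assumes rl: "rl Ou (R + I)" and reg: "reg Ou s hs R" and t: "ntri I > 0"
  shows "\<exists>I' T. rc (size I) (R + I) (R + I' + {#T#}) \<and> dd s (last hs) (hd hs) \<in> fst T \<and> (\<exists>s x y z. T = Tri s x y z)"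
proof -
  note D = regD[OF reg]
  define d where "d = dd s (last hs) (hd hs)"
  define d' where "d' = dd s (hd hs) (last hs)"
  have hne: "hs \<noteq> []" using D(2) by auto
  have dR: "d' \<in> DS R" "d \<notin> DS R" using D(5)[of "hd hs" "last hs"] unfolding cyc_def d_def d'_def by auto
  obtain p q where pq: "d = (p, q)" "d' = (q, p)" unfolding d_def d'_def by (cases s) (auto simp: dd_def)
  have no: "g \<noteq> outf Ou" if "g \<in># I" for g using rl_inner[OF rl D(4) that] .
  \<comment> \<open>A path in \<open>I\<close> from \<open>f\<close> to the boundary dart
    \<open>d\<close> on which all faces after \<open>f\<close> are quadrilaterals. If no triangle
    had one, the faces with such a path would be closed under crossing edges and therefore be all of
    \<open>I\<close>.\<close>
  define S where "S = (\<lambda>f. \<exists>gs. mset (f # gs) \<subseteq># I \<and> linked f gs d \<and> (\<forall>g\<in>set gs. snd g \<noteq> {}))"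
  have "\<exists>f\<in>#I. S f \<and> snd f = {}"
  proof (rule ccontr)
    assume n: "\<not> ?thesis"
    let ?A = "filter_mset S I" and ?B = "filter_mset (\<lambda>f. \<not> S f) I"
    have IAB: "I = ?A + ?B" by (rule multiset_partition)
    have "?B = {#}"
    proof (rule region_connected[OF _ reg])
      show "rl Ou (R + (?A + ?B))" using rl IAB by simp
      have "d \<in> DS (R + I)" using rl_sym[OF rl, of q p] dR pq by simp
      then obtain f where f: "f \<in># I" "d \<in> fst f" using dR by (auto simp: mem_DS)
      then have "S f" unfolding S_def by (intro exI[of _ "[]"]) simp
      then have "f \<in># ?A" using f by simp
      then show "dd s (last hs) (hd hs) \<in> DS ?A" using f(2) unfolding mem_DS d_def by blast
      fix u v assume uv: "(u, v) \<in> DS ?A" "(v, u) \<in> DS (?A + ?B)"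
      obtain f where f: "f \<in># I" "S f" "(u, v) \<in> fst f" using uv(1) by (auto simp: mem_DS)
      have "(v, u) \<in> DS I" using uv(2) IAB by metis
      then obtain g where g: "g \<in># I" "(v, u) \<in> fst g" by (auto simp: mem_DS)
      have fn: "snd f \<noteq> {}" using n f by blast
      obtain gs where gs: "mset (f # gs) \<subseteq># I" "linked f gs d" "\<forall>g\<in>set gs. snd g \<noteq> {}" using f(2) unfolding S_def by blast
      have "S g"
      proof (cases "g \<in> set (f # gs)")
        case True
        then consider "g = f" | "g \<in> set gs" by auto
        then show ?thesis
        proof cases
          case 1 then show ?thesis using f by simp
        next
          case 2
          from linked_suffix[OF gs(2) this] obtain gs' where g': "linked g gs' d" "mset (g # gs') \<subseteq># mset gs" "set gs' \<subseteq> set gs" by blast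
          have "mset gs \<subseteq># mset (f # gs)" by simp
          then have "mset (g # gs') \<subseteq># I" using g'(2) gs(1) subset_mset.order_trans by blast
          then show ?thesis unfolding S_def using g' gs(3) by blast
        qed
      next
        case False
        have "mset (g # f # gs) \<subseteq># I"
        proof (rule mset_subset_eqI)
          fix x
          show "count (mset (g # f # gs)) x \<le> count I x"
          proof (cases "x = g")
            case True
            have "count (mset (f # gs)) g = 0" using False by (simp only: count_mset_0_iff not_False_eq_True)
            then have "count (mset (g # f # gs)) x = 1" using True by simp
            moreover have "count I g \<ge> 1" using g(1) by simp
            ultimately show ?thesis using True by simp
          next
            case False
            then show ?thesis using mset_subset_eq_count[OF gs(1), of x] by simp
          qed
        qed
        moreover have "linked g (f # gs) d" using f(3) g(2) gs(2) by auto
        ultimately show ?thesis unfolding S_def using gs(3) fn by (intro exI[of _ "f # gs"]) auto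
      qed
      then have "g \<in># ?A" using g by simp
      then show "(v, u) \<in> DS ?A" using g(2) unfolding mem_DS by blast
    qed
    then have "I = ?A" using IAB by (metis add.right_neutral)
    have e0: "{#f \<in># I. snd f = {}#} = {#}"
    proof (rule ccontr)
      assume "{#f \<in># I. snd f = {}#} \<noteq> {#}"
      then obtain f where "f \<in># {#f \<in># I. snd f = {}#}" by (meson multiset_nonemptyE)
      then have f: "f \<in># I" "snd f = {}" by auto
      then have "f \<in># ?A" using \<open>I = ?A\<close> by metis
      then show False using n f by auto
    qed
    show False using t unfolding e0 by simp
  qed
  then obtain T gs where T: "T \<in># I" "snd T = {}" "mset (T # gs) \<subseteq># I" "linked T gs d" "\<forall>g\<in>set gs. snd g \<noteq> {}"
    unfolding S_def by blast
  obtain I1 where I1: "I = mset (T # gs) + I1" using T(3) by (metis subset_mset.add_diff_inverse)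
  have e: "R + I = (R + I1) + {#T#} + mset gs" unfolding I1 by (simp add: ac_simps)
  obtain x y where xy: "(x, y) \<in> fst T"
  proof -
    have "T \<in># R + I" using T(1) by simp
    from rl_nonempty_face[OF rl this] show ?thesis using that by auto
  qed
  have "(\<exists>z. T = Tri True x y z) \<or> (\<exists>z t w. T = Qd True x y z t w)"
    by (rule rl_face[OF rl]) (use T(1) no xy in \<open>simp_all add: dd_def\<close>)
  then obtain z where Tz: "T = Tri True x y z" using T(2) by auto
  have gI: "snd g \<noteq> {} \<and> g \<noteq> outf Ou" if "g \<in> set gs" for g
  proof -
    have "g \<in># I" using that unfolding I1 by simp
    then show ?thesis using T(5) that no by blast
  qed
  have "(q, p) \<in> DS (R + I1)" using dR pq by simp
  from move_triangle_path[OF rl[unfolded e] Tz gI T(4)[unfolded pq] this]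
  obtain W' T' where W: "rc (length gs) (R + I) (R + I1 + W' + {#T'#})" "(p, q) \<in> fst T'" "\<exists>s x y z. T' = Tri s x y z"
    unfolding e by blast
  have "length gs \<le> size I" unfolding I1 by simp
  then have "rc (size I) (R + I) (R + (I1 + W') + {#T'#})" using rc_mono[OF W(1)] by (simp add: add.assoc)
  then show ?thesis using W(2,3) pq(1) unfolding d_def by metis
qed

lemma ear_of_reg:
  assumes reg: "reg Ou s (a # hs @ [b, c]) R" and rl: "rl Ou (R + I)"
  shows "ear Ou s a b c R" "dd s c a \<notin> DS R" "dd s b c \<notin> DS R"
proof -
  note D = regD[OF reg]
  let ?H = "a # hs @ [b, c]"
  have ca: "(c, a) \<in> cyc ?H" and bc: "(b, c) \<in> cyc ?H"
    unfolding cyc_def using prs_snoc[of "a # hs" b c] by auto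
  note U = cyc_unique[OF D(1)]
  have 1: "dd s a c \<in> DS R" "dd s c a \<notin> DS R" "dd s c b \<in> DS R" "dd s b c \<notin> DS R"
    using D(5)[of a c] D(5)[of c b] ca bc by blast+
  then show "dd s c a \<notin> DS R" "dd s b c \<notin> DS R" by blast+
  have c: "dd s q c \<in> DS R \<longleftrightarrow> dd s c q \<in> DS R" if q: "q \<notin> {a, b}" for q
    using D(5)[of q c] D(5)[of c q] U(1)[OF _ bc, of q] U(2)[OF _ ca, of q] q by blast
  have H: "dd s q x \<in> DS R \<longleftrightarrow> dd s x q \<in> DS R" if p: "p = a \<or> p = b" "(p, x) \<in> DS R" "(x, p) \<in> DS R" for p x q
  proof -
    have "dd s p x \<in> DS R" "dd s x p \<in> DS R" using p by (simp_all add: dd_def)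
    from D(6)[OF this] show ?thesis using 1 p(1) by metis
  qed
  show "ear Ou s a b c R" unfolding ear_def
  proof (intro conjI allI impI)
    show "distinct [a, b, c]" using D(1) by auto
    show "(q, c) \<in> DS R \<longleftrightarrow> (c, q) \<in> DS R" if "q \<notin> {a, b}" for q by (rule symI_dd[where s = s]) (rule c[OF that])
    show "(q, x) \<in> DS R \<longleftrightarrow> (x, q) \<in> DS R"
      if h: "(a, x) \<in> DS R \<and> (x, a) \<in> DS R \<or> (b, x) \<in> DS R \<and> (x, b) \<in> DS R" for x q
      by (rule symI_dd[where s = s]) (use h H[of a x q] H[of b x q] in blast)
  qed (use D(4) 1 in blast)+
qed

text \<open>Boundary vertices lie on the outer face, which stays in \<open>R\<close>; hence they
  never occur among the fresh vertices of a ladder.\<close>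

lemma reg_in: assumes "reg Ou s hs R" "h \<in> set hs" shows "\<exists>q. (q, h) \<in> DS R"
proof -
  have "outf Ou \<in># R" using regD(4)[OF assms(1)] unfolding conn_to_def by blast
  then have "fst (outf Ou) \<subseteq> DS R" unfolding DS_def by blast
  then show ?thesis using regD(3)[OF assms(1)] assms(2) by force
qed

lemma conn_to_Lad:
  assumes rl: "rl Ou (R + Lad s x y z vs + B)" and R: "conn_to (outf Ou) R" and z: "dd s x z \<in> DS R"
  shows "conn_to (outf Ou) (R + Lad s x y z vs)"
proof -
  define l where "l = last (z # vs)"
  have rl': "rl Ou (R + Lay s x y (z # vs) + ({#Tri s x y l#} + B))" using rl unfolding Lad_def l_def by (simp add: add.assoc)
  have c: "conn_to (outf Ou) (R + Lay s x y (z # vs))" by (rule conn_to_Lay[OF rl' R z])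
  have rl2: "rl Ou ((R + Lay s x y (z # vs)) + ({#Tri s x y l#} + B))" using rl' by (simp add: add.assoc)
  obtain p q where pq: "dd s l x = (p, q)" by fastforce
  have l: "l = z \<or> l \<in> set vs" unfolding l_def by auto
  have "dd s x l \<in> DS (R + Lay s x y (z # vs))" unfolding DS_simps(3) Lay_dd using l z by auto
  then have "(q, p) \<in> DS (R + Lay s x y (z # vs))" using pq by (auto simp: dd_def split: if_splits)
  moreover have "(p, q) \<in> fst (Tri s x y l)" unfolding pq[symmetric] by (simp add: fst_Tri)
  moreover have "DS (R + Lay s x y (z # vs)) \<inter> fst (Tri s x y l) = {}" using rl_disjoint[OF rl2] by auto
  ultimately have "conn_to (outf Ou) (R + Lay s x y (z # vs) + {#Tri s x y l#})"
    using conn_to_add[OF c] rl_outf(2)[OF rl] by blast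
  then show ?thesis unfolding Lad_def l_def by (simp add: add.assoc)
qed

lemma Lad_cases: "dd s q p \<in> DS (Lad s a b c ws) \<longleftrightarrow> (q \<in> set ws \<and> (p = a \<or> p = b)) \<or> ((q = a \<or> q = b) \<and> p \<in> set ws) \<or> (q, p) \<in> {(c, a), (b, c), (a, b)}"
  unfolding Lad_DS by auto

text \<open>At \<open>c\<close> and at the ladder vertices the darts outside now come in opposite
  pairs, so edges at these vertices satisfy the chord condition; for all other edges it is inherited
  from \<open>R\<close>.\<close>

lemma reg_ear:
  assumes reg: "reg Ou s (a # hs @ [b, c]) R" and rl: "rl Ou (R + I + Lad s a b c ws)" and d: "distinct (a # b # c # ws)" and ne: "hs \<noteq> []"
  shows "reg Ou s (a # hs @ [b]) (R + Lad s a b c ws)"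
proof -
  note D = regD[OF reg]
  have rlR: "rl Ou (R + (I + Lad s a b c ws))" using rl by (simp add: add.assoc)
  have rl2: "rl Ou (R + Lad s a b c ws + I)" using rl by (simp add: ac_simps)
  note E = ear_of_reg[OF reg rlR]
  note E1 = earD[OF E(1)]
  let ?H = "a # hs @ [b, c]" and ?H1 = "a # hs @ [b]" and ?L = "Lad s a b c ws"
  have ok: "lad_ok (R + I) a b c ws" by (rule lad_fresh[OF rl d])
  have frd: "dd s p v \<notin> DS R \<and> dd s v p \<notin> DS R" if "v \<in> set ws" for v p
    using ok that unfolding lad_ok_def by (simp add: dd_def)
  have hull: "h \<notin> set ws" if "h \<in> set ?H" for h
  proof
    assume "h \<in> set ws"
    then have "(q, h) \<notin> DS R" for q using ok unfolding lad_ok_def by simp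
    then show False using reg_in[OF reg that] by blast
  qed
  have dis: "DS R \<inter> DS ?L = {}" using rl_disjoint[OF rlR] by auto
  have L3: "dd s c a \<in> DS ?L" "dd s b c \<in> DS ?L" "dd s a b \<in> DS ?L" unfolding Lad_DS by auto
  have cH: "cyc ?H = insert (c, a) (insert (b, c) (prs ?H1))" unfolding cyc_def using prs_snoc[of "a # hs" b c] by simp
  have cH1: "cyc ?H1 = insert (b, a) (prs ?H1)" unfolding cyc_def by simp
  obtain h hs2 where hs: "hs = h # hs2" using ne by (cases hs) auto
  have dH: "distinct ?H" by (rule D(1))
  have prs1: "u \<noteq> c \<and> v \<noteq> c \<and> (u, v) \<noteq> (a, b) \<and> v \<noteq> a \<and> u \<noteq> b" if "(u, v) \<in> prs ?H1" for u v
  proof -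
    have "(a, h) \<in> prs ?H1" using hs by simp
    then have "(a, b) \<notin> prs ?H1" using prs_unique(2)[of ?H1 a h b] dH hs by auto
    then show ?thesis using prs_sub[OF that] dH that by (auto simp: butlast_append)
  qed
  have abn: "(a, b) \<notin> cyc ?H" unfolding cH using prs1 dH by auto
  have nba: "dd s b a \<notin> DS R"
    using D(5)[of b a] abn L3(3) dis by blast
  have rR: "dd s q p \<in> DS (R + ?L) \<longleftrightarrow> dd s q p \<in> DS R \<or> (q, p) \<in> {(c, a), (b, c), (a, b)}" if "p \<notin> set ws" "q \<notin> set ws" for p q
    using that Lad_cases[of s q p a b c ws] by auto
  have wsym: "dd s q v \<in> DS (R + ?L) \<longleftrightarrow> dd s v q \<in> DS (R + ?L)" if "v \<in> set ws" for v q
    using frd[OF that, of q] that d Lad_cases[of s q v a b c ws] Lad_cases[of s v q a b c ws] by auto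
  have csym: "dd s q c \<in> DS (R + ?L) \<longleftrightarrow> dd s c q \<in> DS (R + ?L)" for q
  proof (cases "q = a \<or> q = b")
    case True then show ?thesis using E1(3,4) L3 by auto
  next
    case False
    then have "dd s q c \<in> DS R \<longleftrightarrow> dd s c q \<in> DS R" using E1(5)[of q] by (auto simp: dd_def)
    moreover have "dd s q c \<notin> DS ?L" "dd s c q \<notin> DS ?L"
      using Lad_cases[of s q c a b c ws] Lad_cases[of s c q a b c ws] False d by auto
    ultimately show ?thesis by simp
  qed
  have bd: "dd s q p \<in> DS (R + ?L) \<and> dd s p q \<notin> DS (R + ?L) \<longleftrightarrow> (p, q) \<in> cyc ?H1" for p q
  proof (cases "p \<in> set ws \<or> q \<in> set ws")
    case True
    then have "(p, q) \<notin> cyc ?H1" using cyc_set[of ?H1 p q] hull by auto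
    then show ?thesis using True wsym[of p q] wsym[of q p] by auto
  next
    case False
    have r: "dd s q p \<in> DS (R + ?L) \<longleftrightarrow> dd s q p \<in> DS R \<or> (q, p) \<in> {(c, a), (b, c), (a, b)}"
      "dd s p q \<in> DS (R + ?L) \<longleftrightarrow> dd s p q \<in> DS R \<or> (p, q) \<in> {(c, a), (b, c), (a, b)}" using rR False by auto
    consider "(q, p) = (c, a)" | "(q, p) = (b, c)" | "(q, p) = (a, b)" | "(q, p) \<notin> {(c, a), (b, c), (a, b)}" by blast
    then show ?thesis
    proof cases
      case 1 then show ?thesis using r E1(3) cyc_set[of ?H1 p q] dH by auto
    next
      case 2 then show ?thesis using r E1(4) cyc_set[of ?H1 p q] dH by auto
    next
      case 3 then show ?thesis using r nba dH unfolding cH1 by auto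
    next
      case 4
      have "dd s q p \<in> DS (R + ?L) \<and> dd s p q \<notin> DS (R + ?L) \<longleftrightarrow> (p, q) \<in> cyc ?H \<and> (p, q) \<notin> {(c, a), (b, c), (a, b)}"
        unfolding r D(5)[symmetric] using 4 by blast
      also have "\<dots> \<longleftrightarrow> (p, q) \<in> cyc ?H1" unfolding cH cH1 using prs1[of p q] 4 dH by auto
      finally show ?thesis .
    qed
  qed
  show ?thesis unfolding reg_def
  proof (intro conjI allI impI)
    show "distinct ?H1" using dH by auto
    show "3 \<le> length ?H1" using hs by simp
    show "set ?H1 \<subseteq> snd ` Ou" using D(3) by auto
    show "conn_to (outf Ou) (R + ?L)" by (rule conn_to_Lad[OF rl2 D(4) E1(3)])
    show "dd s q p \<in> DS (R + ?L) \<and> dd s p q \<notin> DS (R + ?L) \<longleftrightarrow> (p, q) \<in> cyc ?H1" for p q by (rule bd)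
    fix p x assume h: "dd s p x \<in> DS (R + ?L) \<and> dd s x p \<in> DS (R + ?L)"
    let ?S = "\<lambda>x. \<forall>q. dd s q x \<in> DS (R + ?L) \<longleftrightarrow> dd s x q \<in> DS (R + ?L)"
    show "?S x \<or> ?S p"
    proof (cases "x \<in> insert c (set ws) \<or> p \<in> insert c (set ws)")
      case True
      then show ?thesis using wsym csym by blast
    next
      case False
      then have "dd s p x \<in> DS R \<or> (p, x) = (a, b)" "dd s x p \<in> DS R \<or> (x, p) = (a, b)" using h rR[of x p] rR[of p x] by auto
      then have "dd s p x \<in> DS R" "dd s x p \<in> DS R" using nba d by auto
      from D(6)[OF this] have "\<exists>y\<in>{x, p}. \<forall>q. dd s q y \<in> DS R \<longleftrightarrow> dd s y q \<in> DS R" by blast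
      then obtain y where y: "y \<in> {x, p}" "\<And>q. dd s q y \<in> DS R \<longleftrightarrow> dd s y q \<in> DS R" by blast
      have "y \<noteq> a" "y \<noteq> b" using y(2)[of c] E1(3,4) E(2,3) by auto
      moreover have "y \<notin> insert c (set ws)" using y(1) False by auto
      ultimately have "dd s q y \<notin> DS ?L \<and> dd s y q \<notin> DS ?L" for q
        using Lad_cases[of s q y a b c ws] Lad_cases[of s y q a b c ws] by auto
      then have "?S y" using y(2) by simp
      then show ?thesis using y(1) by blast
    qed
  qed
qed

section \<open>Invariant counts and fans\<close>

lemma fl_size: "fl X Y \<Longrightarrow> size X = size Y \<and> ntri X = ntri Y"
  by (induction rule: fl.induct) simp_all

lemma rc_size: "rc n X Y \<Longrightarrow> size X = size Y \<and> ntri X = ntri Y"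
proof -
  have "(fl ^^ k) X Y \<Longrightarrow> size X = size Y \<and> ntri X = ntri Y" for k
    by (induction k arbitrary: Y) (auto dest: fl_size)
  then show "rc n X Y \<Longrightarrow> ?thesis" unfolding rc_def by blast
qed

lemma Lay_size: "size (Lay s x y (z # vs)) = length vs" "{#f \<in># Lay s x y zs. snd f = {}#} = {#}"
proof -
  show "size (Lay s x y (z # vs)) = length vs" by (induction vs arbitrary: z) auto
  show "{#f \<in># Lay s x y zs. snd f = {}#} = {#}" by (induction s x y zs rule: Lay.induct) auto
qed

lemma Lad_size: "size (Lad s x y z vs) = Suc (length vs)" "ntri (Lad s x y z vs) = 1"
  unfolding Lad_def by (simp_all add: Lay_size)

fun fan :: "bool \<Rightarrow> 'v \<Rightarrow> 'v list \<Rightarrow> 'v tface multiset" where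
  "fan s a (x # y # zs) = add_mset (Tri s a x y) (fan s a (y # zs))"
| "fan s a _ = {#}"

lemma fan_snoc: "fan s a (xs @ [b, c]) = add_mset (Tri s a b c) (fan s a (xs @ [b]))"
proof (induction xs)
  case (Cons x xs) then show ?case by (cases xs) auto
qed auto

lemma psi_bound:
  assumes rl: "rl Ou (R + I)" and c: "conn_to (outf Ou) R" and J: "J \<subseteq># I"
  shows "psi a b J \<le> 4 * size J"
proof -
  have "card {d \<in> fst f. fst d \<notin> {a, b} \<and> snd d \<notin> {a, b}} \<le> 4" if f: "f \<in># J" for f
  proof -
    have fI: "f \<in># I" using mset_subset_eqD[OF J f] .
    then have fX: "f \<in># R + I" by simp
    obtain u v where uv: "(u, v) \<in> fst f" using rl_nonempty_face[OF rl fX] by auto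
    have "(\<exists>z. f = Tri True u v z) \<or> (\<exists>z t w. f = Qd True u v z t w)"
      by (rule rl_face[OF rl fX rl_inner[OF rl c fI]]) (use uv in \<open>simp add: dd_def\<close>)
    then have "card (fst f) \<le> 4"
    proof (elim disjE exE)
      fix z assume "f = Tri True u v z"
      then show ?thesis by (simp add: fst_Tri card_insert_if)
    next
      fix z t w assume "f = Qd True u v z t w"
      then show ?thesis by (simp add: fst_Qd card_insert_if)
    qed
    moreover have "card {d \<in> fst f. fst d \<notin> {a, b} \<and> snd d \<notin> {a, b}} \<le> card (fst f)"
      by (rule card_mono[OF rl_finite[OF rl fX]]) auto
    ultimately show ?thesis by linarith
  qed
  then have "psi a b J \<le> (\<Sum>f\<in>#J. 4)" unfolding psi_def by (rule sum_mset_mono)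
  then show ?thesis by simp
qed

text \<open>All triangles of the fan are empty except the last one, which carries the ladder;
  \<open>hs\<close> lists the boundary without the apex \<open>a\<close>.\<close>

definition fan_ladder :: "bool \<Rightarrow> 'v \<Rightarrow> 'v list \<Rightarrow> 'v list \<Rightarrow> 'v tface multiset" where
  "fan_ladder s a hs vs = fan s a (butlast hs) + Lad s a (last (butlast hs)) (last hs) vs"

lemma fan_ladder_snoc: "fan_ladder s a (hs @ [b, c]) vs = fan s a (hs @ [b]) + Lad s a b c vs"
  unfolding fan_ladder_def by (simp add: butlast_append)

text \<open>A triangle brought to the edge \<open>ca\<close> is a ladder without vertices, and the
  outer face uses up the reflex angle of \<open>c\<close>. As \<open>psi\<close> is at most 4 per
  face, the ear costs a factor \<open>12 * 4 = 48\<close>; the transport raises the constant term to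
  49.\<close>

lemma cut_ear:
  assumes reg: "reg Ou s (a # hs @ [b, c]) R" and rl: "rl Ou (R + I)" and t: "ntri I + 2 = length (a # hs @ [b, c])"
  shows "\<exists>I' ws. rc (size (R + I) * (49 + 48 * length ws)) (R + I) (R + I' + Lad s a b c ws) \<and> distinct (a # b # c # ws)"
proof -
  note D = regD[OF reg]
  have "ntri I > 0" using t by simp
  have lh: "last (a # hs @ [b, c]) = c" "hd (a # hs @ [b, c]) = a" by simp_all
  from triangle_to_boundary[OF rl reg \<open>ntri I > 0\<close>, unfolded lh] obtain I0 T where
    T: "rc (size I) (R + I) (R + I0 + {#T#})" "dd s c a \<in> fst T" "\<exists>s x y z. T = Tri s x y z" by blast
  have rlT: "rl Ou (R + I0 + {#T#})" by (rule rc_rl[OF rl T(1)])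
  have "T \<noteq> outf Ou" using rl_outf(2)[OF rlT] T(3) by metis
  then have "(\<exists>z. T = Tri s c a z) \<or> (\<exists>z t w. T = Qd s c a z t w)" by (intro rl_face[OF rlT]) (use T(2) in auto)
  then obtain u where Tu: "T = Tri s c a u" using T(3) by (metis snd_face insert_not_empty)
  have e: "R + I0 + {#T#} = R + I0 + Lad s a u c []" unfolding Lad_def Tu Tri_rot[of s c a u] by simp
  have du: "distinct (a # u # c # [])" using rl_Tri[OF rlT, of s c a u] Tu by auto
  have cr: "c \<notin> snd f" if f: "f \<in># I0" for f
  proof
    assume "c \<in> snd f"
    have "rl Ou (R + (I0 + {#T#}))" using rlT by simp
    moreover have "outf Ou \<in># R" using D(4) unfolding conn_to_def by blast
    moreover have "c \<in> snd (outf Ou)" using D(3) by simp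
    ultimately show False using rl_reflex_unique[of Ou R "I0 + {#T#}" "outf Ou" f c] f \<open>c \<in> snd f\<close> by simp
  qed
  from ear_ladder[OF ear_of_reg(1)[OF reg rl] rlT[unfolded e] du cr] obtain I' ws where
    W: "rc (12 * (1 + length ws) * psi a b I0) (R + I0 + Lad s a u c []) (R + I' + Lad s a b c ws)" "distinct (a # b # c # ws)"
    by blast
  have "rl Ou (R + (I0 + {#T#}))" using rlT by simp
  from psi_bound[OF this D(4), of I0 a b] have p: "psi a b I0 \<le> 4 * size I0" by simp
  have s0: "size (R + I) = size R + size I0 + 1" using rc_size[OF T(1)] by simp
  have "12 * (1 + length ws) * psi a b I0 \<le> 12 * (1 + length ws) * (4 * size (R + I))"
    by (rule mult_left_mono) (use p s0 in simp_all)
  also have "\<dots> = size (R + I) * (48 + 48 * length ws)" by (simp add: algebra_simps)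
  finally have "size I + 12 * (1 + length ws) * psi a b I0 \<le> size (R + I) * (49 + 48 * length ws)"
    by (simp add: algebra_simps)
  then have "rc (size (R + I) * (49 + 48 * length ws)) (R + I) (R + I' + Lad s a b c ws)"
    using rc_mono[OF rc_trans[OF T(1)[unfolded e] W(1)]] by blast
  then show ?thesis using W(2) by blast
qed

lemma reg_fresh: "reg Ou s hs R \<Longrightarrow> h \<in> set hs \<Longrightarrow> lad_ok (R + B) x y z ws \<Longrightarrow> h \<notin> set ws"
  using reg_in[of Ou s hs R h] unfolding lad_ok_def by auto

text \<open>Once the ear at \<open>c\<close> is cut off, the rest is solved recursively, with its
  ladder in the adjacent triangle \<open>a b' b\<close>. That ladder is turned towards
  \<open>ab\<close> and slid into the triangle \<open>a b c\<close>. Turn and slide cost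
  \<open>5 + 3\<close> flips per vertex, and \<open>49 + 8\<close> fits into the 60 allotted to a
  boundary vertex.\<close>

theorem region_to_fan:
  assumes "reg Ou s (a # hs @ [b, c]) R" "rl Ou (R + I)" "ntri I + 2 = length (a # hs @ [b, c])"
  shows "\<exists>vs. rc (size (R + I) * (60 * length (hs @ [b, c]) + 48 * length vs)) (R + I) (R + fan_ladder s a (hs @ [b, c]) vs) \<and>
    distinct (a # (hs @ [b, c]) @ vs)"
  using assms
proof (induction hs arbitrary: b c R I rule: rev_induct)
  case Nil
  note prems = Nil
  note D = regD[OF prems(1)]
  obtain I' ws where W: "rc (size (R + I) * (49 + 48 * length ws)) (R + I) (R + I' + Lad s a b c ws)" "distinct (a # b # c # ws)"
    using cut_ear[OF prems] by blast
  have rl1: "rl Ou (R + I' + Lad s a b c ws)" by (rule rc_rl[OF prems(2) W(1)])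
  have "I' = {#}"
  proof (rule rl_connected)
    let ?A = "R + Lad s a b c ws"
    show "rl Ou (?A + I')" using rl1 by (simp add: ac_simps)
    show "?A \<noteq> {#}" unfolding Lad_def by simp
    have cy: "cyc (a # [] @ [b, c]) = {(c, a), (a, b), (b, c)}" unfolding cyc_def by auto
    fix u v assume uv: "(u, v) \<in> DS ?A"
    obtain p q where pq: "(u, v) = dd s p q" "(v, u) = dd s q p" by (cases s) (auto simp: dd_def)
    have "dd s q p \<in> DS ?A"
    proof (cases "dd s p q \<in> DS R")
      case True
      show ?thesis
      proof (cases "dd s q p \<in> DS R")
        case False
        then have "(q, p) \<in> {(c, a), (a, b), (b, c)}" using True D(5)[of p q] unfolding cy by simp
        then show ?thesis using Lad_cases[of s q p a b c ws] by auto
      qed simp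
    next
      case False
      then have l: "dd s p q \<in> DS (Lad s a b c ws)" using uv pq by auto
      show ?thesis
      proof (cases "(p, q) \<in> {(c, a), (a, b), (b, c)}")
        case True
        then have "dd s q p \<in> DS R" using D(5)[of q p] unfolding cy by simp
        then show ?thesis by simp
      next
        case False
        then show ?thesis using l Lad_cases[of s p q a b c ws] Lad_cases[of s q p a b c ws] by auto
      qed
    qed
    then show "(v, u) \<in> DS ?A" using pq by simp
  qed
  then have "R + I' + Lad s a b c ws = R + fan_ladder s a ([] @ [b, c]) ws" unfolding fan_ladder_snoc by simp
  moreover have "size (R + I) * (49 + 48 * length ws) \<le> size (R + I) * (60 * length ([] @ [b, c]) + 48 * length ws)"
    by (rule mult_left_mono) simp_all
  ultimately have "rc (size (R + I) * (60 * length ([] @ [b, c]) + 48 * length ws)) (R + I) (R + fan_ladder s a ([] @ [b, c]) ws)"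
    using rc_mono[OF W(1)] by metis
  then show ?case using W(2) by (intro exI[of _ ws]) auto
next
  case (snoc b' hs)
  note reg = snoc.prems(1) and rl = snoc.prems(2) and t = snoc.prems(3)
  note D = regD[OF reg]
  let ?S = "size (R + I)"
  obtain I' ws where W: "rc (?S * (49 + 48 * length ws)) (R + I) (R + I' + Lad s a b c ws)" "distinct (a # b # c # ws)"
    using cut_ear[OF reg rl t] by blast
  let ?L = "Lad s a b c ws"
  have rl1: "rl Ou (R + I' + ?L)" by (rule rc_rl[OF rl W(1)])
  have e1: "R + I' + ?L = (R + ?L) + I'" by (simp add: ac_simps)
  have reg1: "reg Ou s (a # hs @ [b', b]) (R + ?L)" using reg_ear[OF reg rl1 W(2)] by simp
  have rl1': "rl Ou ((R + ?L) + I')" using rl1 unfolding e1 .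
  have sz: "size ((R + ?L) + I') = ?S" "ntri ((R + ?L) + I') = ntri (R + I)" using rc_size[OF W(1)] unfolding e1 by simp_all
  \<comment> \<open>Every ear takes one triangle with it, so the count keeps matching the length of
    the boundary.\<close>
  have "ntri I' + 1 = ntri I" using sz(2) Lad_size(2)[of s a b c ws] by simp
  then have t1: "ntri I' + 2 = length (a # hs @ [b', b])" using t by simp
  from snoc.IH[OF reg1 rl1' t1] obtain us where
    U: "rc (?S * (60 * length (hs @ [b', b]) + 48 * length us)) ((R + ?L) + I') ((R + ?L) + fan_ladder s a (hs @ [b', b]) us)"
      "distinct (a # (hs @ [b', b]) @ us)" unfolding sz by blast
  let ?fan = "fan s a (hs @ [b'])"
  have e2: "(R + ?L) + fan_ladder s a (hs @ [b', b]) us = (R + ?L + ?fan) + Lad s a b' b us" unfolding fan_ladder_snoc by (simp add: ac_simps)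
  have rl2: "rl Ou ((R + ?L + ?fan) + Lad s a b' b us)" using rc_rl[OF rl1' U(1)] unfolding e2 .
  have d2: "distinct (a # b' # b # us)" using U(2) by auto
  have ok2: "lad_ok (R + ?L + ?fan) a b' b us" by (rule lad_fresh[OF rl2 d2])
  have T1: "rc (5 * length us) ((R + ?L + ?fan) + Lad s a b' b us) ((R + ?L + ?fan) + Lad s b a b' us)" by (rule turn[OF ok2])
  have rl3: "rl Ou ((R + ?L + ?fan) + Lad s b a b' us)" by (rule rc_rl[OF rl2 T1])
  have e3: "(R + ?L + ?fan) + Lad s b a b' us = (R + ?fan) + ?L + Lad s b a b' us" by (simp add: ac_simps)
  have rl3': "rl Ou ((R + ?fan + Lad s b a b' us) + ?L)" using rl3 by (simp add: ac_simps)
  have ok3: "lad_ok (R + ?fan + Lad s b a b' us) a b c ws" by (rule lad_fresh[OF rl3' W(2)])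
  have hw: "h \<notin> set ws" if "h \<in> set (a # (hs @ [b']) @ [b, c])" for h
    using reg_fresh[OF reg that, of "?fan + Lad s b a b' us" a b c ws] ok3 by (simp add: add.assoc)
  have hu: "h \<notin> set us" if "h \<in> set (a # (hs @ [b']) @ [b, c])" for h
    using reg_fresh[OF reg that, of "?L + ?fan" a b' b us] ok2 by (simp add: add.assoc)
  have wu: "set ws \<inter> set us = {}"
  proof (rule ccontr)
    assume "\<not> ?thesis"
    then obtain v where v: "v \<in> set ws" "v \<in> set us" by auto
    have "dd s v a \<in> DS ?L" using Lad_cases[of s v a a b c ws] v by simp
    moreover have "dd s v a \<notin> DS ?L" using ok2 v(2) unfolding lad_ok_def by (auto simp: dd_def)
    ultimately show False by blast
  qed
  have dh: "distinct (a # (hs @ [b']) @ [b, c])" by (rule D(1))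
  have dus: "distinct us" "distinct ws" using U(2) W(2) by auto
  have T2: "rc (3 * length us) ((R + ?fan) + ?L + Lad s b a b' us) ((R + ?fan) + Lad s a b c (ws @ rev us) + {#Tri s b a b'#})"
  proof (rule slide)
    show "distinct (a # b # c # b' # ws @ us)" using dh dus wu hw hu by auto
    have "rl Ou ((R + ?fan) + (?L + Lad s b a b' us))" using rl3 by (simp add: ac_simps)
    note dj = rl_disjoint[OF this]
    have "dd s a b \<in> DS (?L + Lad s b a b' us)" "dd s b a \<in> DS (?L + Lad s b a b' us)"
      using Lad_cases[of s a b a b c ws] Lad_cases[of s b a b a b' us] by auto
    then have "(a, b) \<in> DS (?L + Lad s b a b' us)" by (auto simp only: dd_def split: if_splits)
    then show "(a, b) \<notin> DS (R + ?fan)" using dj by blast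
    fix u v assume "v \<in> set ws \<union> set us"
    then show "(u, v) \<notin> DS (R + ?fan) \<and> (v, u) \<notin> DS (R + ?fan)"
      using ok2 ok3 unfolding lad_ok_def by auto
  qed
  have e4: "(R + ?fan) + Lad s a b c (ws @ rev us) + {#Tri s b a b'#} = R + fan_ladder s a ((hs @ [b']) @ [b, c]) (ws @ rev us)"
    unfolding fan_ladder_snoc Tri_rot[of s b a b'] using fan_snoc[of s a hs b' b] by (simp add: ac_simps)
  have lus: "length us \<le> ?S"
  proof -
    have "size ((R + ?L + ?fan) + Lad s a b' b us) = ?S" using rc_size[OF U(1)] sz(1) unfolding e2 by simp
    then show ?thesis using Lad_size(1)[of s a b' b us] by simp
  qed
  let ?n = "?S * (49 + 48 * length ws) + ?S * (60 * length (hs @ [b', b]) + 48 * length us) + 5 * length us + 3 * length us"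
  have r: "rc ?n (R + I) (R + fan_ladder s a ((hs @ [b']) @ [b, c]) (ws @ rev us))"
    using rc_trans[OF rc_trans[OF rc_trans[OF W(1)[unfolded e1] U(1)[unfolded e2]] T1[unfolded e3]] T2[unfolded e4]] .
  have "?n \<le> ?S * (60 * length ((hs @ [b']) @ [b, c]) + 48 * length (ws @ rev us))"
    using lus by (simp add: algebra_simps)
  from rc_mono[OF r this] show ?case
    using dh dus wu hw hu by (intro exI[of _ "ws @ rev us"]) auto
qed

section \<open>The normal form\<close>

text \<open>The part of a ladder behind a vertex \<open>m\<close> is itself a ladder with apex
  \<open>m\<close>, to which \<open>cycle\<close> applies.\<close>

lemma cycle_at:
  assumes ok: "lad_ok R x y z (us @ ws @ [v])"
  shows "rc (12 * length (ws @ [v])) (R + Lad s x y z (us @ ws @ [v])) (R + Lad s x y z (us @ v # ws))"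
proof (cases us rule: rev_cases)
  case Nil
  then show ?thesis using cycle[of R x y z ws v s] ok by simp
next
  case (snoc us' m)
  have e: "R + Lad s x y z (us @ ks) = (R + Lay s x y (z # us' @ [m])) + Lad s x y m ks" for ks
    unfolding Lad_def snoc using Lay_append[of s x y "z # us'" m ks] by (simp add: ac_simps)
  have d: "distinct (x # y # z # us' @ [m] @ ws @ [v])" using ok unfolding lad_ok_def snoc by auto
  have fr: "(p, w) \<notin> DS R \<and> (w, p) \<notin> DS R" if "w \<in> set (ws @ [v])" for p w
    using ok that unfolding lad_ok_def by auto
  have "lad_ok (R + Lay s x y (z # us' @ [m])) x y m (ws @ [v])"
    unfolding lad_ok_def
  proof (intro conjI ballI allI)
    show "distinct (x # y # m # ws @ [v])" using d by auto
    fix w p assume w: "w \<in> set (ws @ [v])"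
    have "w \<notin> {x, y} \<union> set (z # us' @ [m])" using d w by auto
    then have "(p, w) \<notin> DS (Lay s x y (z # us' @ [m]))" "(w, p) \<notin> DS (Lay s x y (z # us' @ [m]))"
      by (intro Lay_notin; blast)+
    then show "(p, w) \<notin> DS (R + Lay s x y (z # us' @ [m]))" "(w, p) \<notin> DS (R + Lay s x y (z # us' @ [m]))"
      using fr[OF w] by simp_all
  qed
  from cycle[OF this] show ?thesis unfolding e .
qed

lemma insort_split: "\<exists>xs ys. zs = xs @ ys \<and> insort v zs = xs @ v # ys"
proof (induction zs)
  case (Cons a zs)
  then obtain xs ys where "zs = xs @ ys" "insort v zs = xs @ v # ys" by blast
  show ?case
  proof (cases "v \<le> a")
    case True then show ?thesis by (intro exI[of _ "[]"] exI[of _ "a # zs"]) simp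
  next
    case False then show ?thesis using \<open>zs = _\<close> \<open>insort v zs = _\<close> by (intro exI[of _ "a # xs"] exI[of _ ys]) simp
  qed
qed simp

lemma lad_ok_mset: "lad_ok R x y z vs \<Longrightarrow> mset ws = mset vs \<Longrightarrow> lad_ok R x y z ws"
  unfolding lad_ok_def using mset_eq_setD[of ws vs] mset_eq_imp_distinct_iff[of ws vs] by auto

text \<open>In each round \<open>cycle_at\<close> takes the last vertex of the ladder and puts it
  into its place in the sorted prefix \<open>xs\<close>.\<close>

lemma sort_ladder:
  fixes xs :: "'v::linorder list"
  assumes "lad_ok R x y z (xs @ ys)" "sorted xs"
  shows "rc (12 * length (xs @ ys) * length ys) (R + Lad s x y z (xs @ ys)) (R + Lad s x y z (sort (xs @ ys)))"
  using assms
proof (induction ys arbitrary: xs rule: rev_induct)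
  case Nil
  then show ?case by (simp add: sorted_sort_id)
next
  case (snoc v ys)
  obtain as bs where ab: "xs = as @ bs" "insort v xs = as @ v # bs" using insort_split by blast
  have m: "mset (insort v xs @ ys) = mset (xs @ ys @ [v])" by simp
  have so: "sorted (insort v xs)" using snoc.prems(2) by (simp add: sorted_insort)
  have "lad_ok R x y z (as @ (bs @ ys) @ [v])" using snoc.prems(1) ab by simp
  note c = cycle_at[OF this]
  have "rc (12 * length (xs @ ys @ [v])) (R + Lad s x y z (xs @ ys @ [v])) (R + Lad s x y z (insort v xs @ ys))"
    unfolding ab(2) unfolding ab(1) by (rule rc_mono[of "12 * length ((bs @ ys) @ [v])"]) (use c in simp_all)
  moreover have "rc (12 * length (insort v xs @ ys) * length ys) (R + Lad s x y z (insort v xs @ ys)) (R + Lad s x y z (sort (insort v xs @ ys)))"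
    by (rule snoc.IH[OF lad_ok_mset[OF snoc.prems(1) m] so])
  ultimately have r: "rc (12 * length (xs @ ys @ [v]) + 12 * length (insort v xs @ ys) * length ys)
      (R + Lad s x y z (xs @ ys @ [v])) (R + Lad s x y z (sort (insort v xs @ ys)))"
    by (rule rc_trans)
  have "sort (insort v xs @ ys) = sort (xs @ ys @ [v])"
    by (rule properties_for_sort) (use m in simp_all)
  moreover have "12 * length (xs @ ys @ [v]) + 12 * length (insort v xs @ ys) * length ys = 12 * length (xs @ ys @ [v]) * length (ys @ [v])"
    by (simp add: algebra_simps)
  ultimately show ?case using r by metis
qed

section \<open>The outer cycle and the numbers of faces\<close>

lemma prs_nth: "prs zs = {(zs ! i, zs ! Suc i) |i. Suc i < length zs}"
proof (induction zs rule: prs.induct)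
  case (1 x y zs)
  have "(u, v) \<in> prs (x # y # zs) \<longleftrightarrow> (\<exists>i. u = (x # y # zs) ! i \<and> v = (x # y # zs) ! Suc i \<and> Suc i < length (x # y # zs))" (is "?l \<longleftrightarrow> (\<exists>i. ?P i)") for u v
  proof -
    have "(\<exists>i. ?P i) \<longleftrightarrow> ?P 0 \<or> (\<exists>i. ?P (Suc i))" by (metis not0_implies_Suc)
    then show ?thesis using 1 by simp
  qed
  then show ?case by auto
qed auto

lemma cyc_antisym:
  assumes d: "distinct hs" and l: "3 \<le> length hs" and p: "(p, q) \<in> cyc hs" "(q, p) \<in> cyc hs" shows False
proof -
  let ?n = "length hs"
  have ix: "\<exists>i<?n. u = hs ! i \<and> v = hs ! (Suc i mod ?n)" if "(u, v) \<in> cyc hs" for u v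
  proof (cases "(u, v) = (last hs, hd hs)")
    case True
    have "hs \<noteq> []" using l by auto
    then show ?thesis using True l by (intro exI[of _ "?n - 1"]) (simp add: last_conv_nth hd_conv_nth)
  next
    case False
    then have "(u, v) \<in> prs hs" using that unfolding cyc_def by blast
    then obtain i where "u = hs ! i" "v = hs ! Suc i" "Suc i < ?n" unfolding prs_nth by blast
    then show ?thesis by (intro exI[of _ i]) simp
  qed
  obtain i j where i: "i < ?n" "p = hs ! i" "q = hs ! (Suc i mod ?n)" and j: "j < ?n" "q = hs ! j" "p = hs ! (Suc j mod ?n)"
    using ix[OF p(1)] ix[OF p(2)] by blast
  have n0: "0 < ?n" using l by linarith
  have ml: "Suc k mod ?n < ?n" for k using n0 by simp
  have sm: "Suc k mod ?n = Suc k \<or> Suc k = ?n \<and> Suc k mod ?n = 0" if "k < ?n" for k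
    using that by (cases "Suc k = ?n") simp_all
  have "j = Suc i mod ?n" using nth_eq_iff_index_eq[OF d j(1) ml[of i]] i(3) j(2) by metis
  moreover have "i = Suc j mod ?n" using nth_eq_iff_index_eq[OF d i(1) ml[of j]] i(2) j(3) by metis
  ultimately show False using sm[OF i(1)] sm[OF j(1)] l by linarith
qed

text \<open>The outer boundary visits no vertex twice, because all its angles are reflex and a
  vertex has only one reflex angle. The heads of the darts in the orbit thus form a list without
  repetition.\<close>

lemma outer_list:
  assumes M: "is_4ppt M"
  shows "\<exists>hs. distinct hs \<and> cyc hs = outer M \<and> length hs = card (outer M) \<and> set hs = snd ` outer M"
proof -
  note D = is_4pptD[OF M]
  obtain d where d: "d \<in> darts M" "outer M = face M d" using D(5) unfolding faces_def by auto
  define n where "n = card (outer M)"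
  define e where "e i = (fstep M ^^ i) d" for i
  have n3: "n \<ge> 3" using D(11) n_def by simp
  have o: "outer M = e ` {..<n}" "e n = e 0"
    using face_orbit[OF D(1,2) d(1)] unfolding d(2)[symmetric] n_def[symmetric] e_def by auto
  have st: "fst (e (Suc i)) = snd (e i)" for i unfolding e_def by (simp add: fstep_def)
  have injs: "inj_on snd (outer M)" using reflex_unique[OF M] D(8) by (meson inj_onI)
  have inje: "inj_on e {..<n}" using o(1) n_def by (metis eq_card_imp_inj_on finite_lessThan card_lessThan)
  define hs where "hs = map (\<lambda>i. snd (e i)) [0..<n]"
  have dist: "distinct hs"
    unfolding hs_def distinct_map
  proof
    show "inj_on (\<lambda>i. snd (e i)) (set [0..<n])"
    proof (rule inj_onI)
      fix i j assume ij: "i \<in> set [0..<n]" "j \<in> set [0..<n]" and s: "snd (e i) = snd (e j)"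
      then have "e i \<in> outer M" "e j \<in> outer M" unfolding o(1) by auto
      then have "e i = e j" using inj_onD[OF injs s] by blast
      then show "i = j" using inj_onD[OF inje] ij by auto
    qed
  qed simp
  have len: "length hs = n" unfolding hs_def by simp
  have nth: "hs ! i = snd (e i)" if "i < n" for i using that unfolding hs_def by simp
  have "hs \<noteq> []" using len n3 by auto
  then have lh: "last hs = snd (e (n - 1))" "hd hs = snd (e 0)"
    using nth[of "n - 1"] nth[of 0] n3 len by (simp_all add: last_conv_nth hd_conv_nth)
  have "cyc hs = outer M"
  proof (intro equalityI subsetI)
    fix x assume "x \<in> cyc hs"
    then consider "x = (last hs, hd hs)" | "x \<in> prs hs" unfolding cyc_def by blast
    then show "x \<in> outer M"
    proof cases
      case 1
      have "e 0 = (snd (e (n - 1)), snd (e 0))" using st[of "n - 1"] o(2) n3 by (simp add: prod_eq_iff)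
      then show ?thesis using 1 lh o(1) n3 by auto
    next
      case 2
      then obtain i where i: "x = (hs ! i, hs ! Suc i)" "Suc i < n" unfolding prs_nth len by blast
      then have "x = e (Suc i)" using nth[of i] nth[of "Suc i"] st[of i] by (simp add: prod_eq_iff)
      then show ?thesis using i o(1) by auto
    qed
  next
    fix x assume "x \<in> outer M"
    then obtain i where i: "i < n" "x = e i" using o(1) by auto
    show "x \<in> cyc hs"
    proof (cases i)
      case 0
      have "e 0 = (snd (e (n - 1)), snd (e 0))" using st[of "n - 1"] o(2) n3 by (simp add: prod_eq_iff)
      then have "x = (last hs, hd hs)" using 0 i lh by simp
      then show ?thesis unfolding cyc_def by simp
    next
      case (Suc j)
      then have "x = (hs ! j, hs ! Suc j)" using nth[of j] nth[of "Suc j"] st[of j] i by (simp add: prod_eq_iff)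
      then have "x \<in> prs hs" unfolding prs_nth len using Suc i by blast
      then show ?thesis unfolding cyc_def by simp
    qed
  qed
  moreover have "set hs = snd ` outer M" unfolding hs_def o(1) by (auto simp: atLeast0LessThan)
  ultimately show ?thesis using dist len n_def by blast
qed

text \<open>Initially only the outer face is outside. Here \<open>s\<close> is false because its
  darts run along the cycle and not against it.\<close>

lemma reg_outer:
  assumes d: "distinct hs" and l: "3 \<le> length hs" and o: "cyc hs = Ou" "set hs = snd ` Ou"
  shows "reg Ou False hs {#outf Ou#}"
proof -
  have R: "dd False q p \<in> DS {#outf Ou#} \<longleftrightarrow> (p, q) \<in> cyc hs" for p q using o by (simp add: dd_def)
  have as: "(p, q) \<in> cyc hs \<Longrightarrow> (q, p) \<notin> cyc hs" for p q using cyc_antisym[OF d l] by blast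
  show ?thesis unfolding reg_def R
  proof (intro conjI allI impI)
    show "conn_to (outf Ou) {#outf Ou#}" unfolding conn_to_def
    proof (intro conjI allI impI)
      fix A B assume e: "{#outf Ou#} = A + B" "outf Ou \<in># A"
      then obtain A' where A': "A = add_mset (outf Ou) A'" by (meson mset_add)
      have "size {#outf Ou#} = size A + size B" unfolding e(1) by simp
      then show "B = {#}" using A' by simp
    qed simp
  qed (use d l o as in blast)+
qed

text \<open>Every vertex owns one reflex angle. With \<open>h\<close> outer darts, \<open>f\<close>
  interior faces and \<open>q\<close> interior reflex angles this gives \<open>V = h + q\<close> and
  \<open>2 E = h + 3 f + q\<close>, and Euler's formula yields \<open>f = h + q - 2\<close>. So
  there are \<open>f - q = h - 2\<close> triangles, and \<open>V = f + 2\<close>.\<close>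

lemma fm_counts:
  assumes M: "is_4ppt M"
  shows "ntri (fm M - {#outf (outer M)#}) + 2 = card (outer M)" "size (fm M) + 1 = card (verts M)"
proof -
  note D = is_4pptD[OF M]
  let ?F = "faces M" and ?Ou = "outer M"
  let ?I = "?F - {?Ou}"
  define r where "r f = card {d \<in> f. reflex M d}" for f
  have ff: "finite ?F" using finite_faces[OF D(1)] .
  have fin: "finite f" if "f \<in> ?F" for f using face_finite[OF D(1,2) that] .
  have disj: "\<forall>f\<in>?F. \<forall>g\<in>?F. f \<noteq> g \<longrightarrow> f \<inter> g = {}" using faces_disjoint[OF D(1,2)] by blast
  have fd: "finite (darts M)" by (rule darts_finite[OF D(1)])
  have E: "2 * card (edges M) = (\<Sum>f\<in>?F. card f)"
  proof -
    have fe: "finite (edges M)" using finite_edges[OF D(1)] .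
    have "card {(u, v). {u, v} \<in> edges M} = 2 * card (edges M)"
      using card_darts_of[OF fe] D(1) unfolding simple_graph_def by blast
    moreover have "{(u, v). {u, v} \<in> edges M} = \<Union>?F" using faces_Union[OF D(1,2)] unfolding darts_def by simp
    moreover have "card (\<Union>?F) = (\<Sum>f\<in>?F. card f)" by (rule card_Union_disjoint) (use disj fin in \<open>auto simp: pairwise_def disjnt_def\<close>)
    ultimately show ?thesis by simp
  qed
  have V: "card (verts M) = (\<Sum>f\<in>?F. r f)"
  proof -
    let ?R = "{d \<in> darts M. reflex M d}"
    have "bij_betw snd ?R (verts M)" unfolding bij_betw_def
    proof
      show "inj_on snd ?R" using reflex_unique[OF M] by (auto intro!: inj_onI)
      show "snd ` ?R = verts M"
      proof (intro equalityI subsetI)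
        fix v assume "v \<in> snd ` ?R" then show "v \<in> verts M" using darts_verts[OF D(1)] by auto
      next
        fix v assume "v \<in> verts M"
        then obtain d where "reflex_at M v = {d}" using D(9) by (metis card_1_singletonE)
        then have "d \<in> ?R" "snd d = v" unfolding reflex_at_def by auto
        then show "v \<in> snd ` ?R" by blast
      qed
    qed
    then have "card (verts M) = card ?R" by (simp add: bij_betw_same_card)
    also have "?R = (\<Union>f\<in>?F. {d \<in> f. reflex M d})" using faces_Union[OF D(1,2)] by blast
    also have "card \<dots> = (\<Sum>f\<in>?F. card {d \<in> f. reflex M d})"
      by (rule card_UN_disjoint) (use ff fin disj in auto)
    finally show ?thesis unfolding r_def .
  qed
  have c: "card f = 3 + r f" "r f = 0 \<or> r f = 1" if f: "f \<in> ?I" for f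
  proof -
    have "card {d \<in> f. \<not> reflex M d} = 3" using D(7)[of f] f by (simp add: convex_count_def)
    moreover have "card ({d \<in> f. \<not> reflex M d} \<union> {d \<in> f. reflex M d}) = card {d \<in> f. \<not> reflex M d} + card {d \<in> f. reflex M d}"
      by (rule card_Un_disjoint) (use fin[of f] f in auto)
    moreover have "{d \<in> f. \<not> reflex M d} \<union> {d \<in> f. reflex M d} = f" by auto
    ultimately show "card f = 3 + r f" unfolding r_def by simp
    then show "r f = 0 \<or> r f = 1" using D(10)[of f] f by auto
  qed
  have ro: "r ?Ou = card ?Ou"
  proof -
    have "{d \<in> ?Ou. reflex M d} = ?Ou" using D(8) by blast
    then show ?thesis unfolding r_def by simp
  qed
  have sF: "(\<Sum>f\<in>?F. g f) = g ?Ou + (\<Sum>f\<in>?I. g f)" for g :: "('a \<times> 'a) set \<Rightarrow> nat" by (rule sum.remove[OF ff D(5)])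
  have s3: "(\<Sum>f\<in>?I. card f) = 3 * card ?I + (\<Sum>f\<in>?I. r f)"
  proof -
    have "(\<Sum>f\<in>?I. card f) = (\<Sum>f\<in>?I. 3 + r f)" by (rule sum.cong) (use c in auto)
    then show ?thesis by (simp add: sum.distrib)
  qed
  have cF: "card ?F = Suc (card ?I)" using card_Suc_Diff1[OF ff D(5)] by simp
  have sr: "(\<Sum>f\<in>?I. r f) = card {f \<in> ?I. r f = 1}"
  proof -
    have "(\<Sum>f\<in>?I. r f) = (\<Sum>f\<in>?I. if r f = 1 then 1 else 0)" by (rule sum.cong) (use c(2) in force)+
    then show ?thesis using ff by (simp add: sum.If_cases Int_def)
  qed
  have sp: "card ?I = card {f \<in> ?I. r f = 0} + card {f \<in> ?I. r f = 1}"
  proof -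
    have "?I = {f \<in> ?I. r f = 0} \<union> {f \<in> ?I. r f = 1}" using c(2) by blast
    then have "card ?I = card ({f \<in> ?I. r f = 0} \<union> {f \<in> ?I. r f = 1})" by (rule arg_cong)
    also have "\<dots> = card {f \<in> ?I. r f = 0} + card {f \<in> ?I. r f = 1}" by (rule card_Un_disjoint) (use ff in auto)
    finally show ?thesis .
  qed
  have VF: "card (verts M) = card ?F + 1" and t: "card {f \<in> ?I. r f = 0} + 2 = card ?Ou"
    using E V sF[of card] sF[of r] s3 cF sr sp ro D(4) by linarith+
  have "size (fm M) = card ?F" unfolding fm_def by simp
  then show "size (fm M) + 1 = card (verts M)" using VF by simp
  have "fm M - {#outf ?Ou#} = image_mset (tagged M) (mset_set ?I)"
  proof -
    have "mset_set ?F = add_mset ?Ou (mset_set ?I)" by (rule mset_set.remove[OF ff D(5)])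
    then show ?thesis unfolding fm_def using outer_tag(1)[OF M] by simp
  qed
  then have "ntri (fm M - {#outf ?Ou#}) = size (filter_mset (\<lambda>f. snd (tagged M f) = {}) (mset_set ?I))"
    by (simp add: filter_mset_image_mset)
  also have "\<dots> = card {f \<in> ?I. snd (tagged M f) = {}}" using ff by simp
  also have "{f \<in> ?I. snd (tagged M f) = {}} = {f \<in> ?I. r f = 0}"
    unfolding r_def tagged_def using fin by auto
  finally show "ntri (fm M - {#outf ?Ou#}) + 2 = card ?Ou" using t by simp
qed

lemma verts_DS: assumes "is_4ppt M" shows "verts M = snd ` DS (fm M)"
proof -
  note D = is_4pptD[OF assms]
  show ?thesis unfolding DS_fm[OF assms]
  proof (intro equalityI subsetI)
    fix v assume "v \<in> snd ` darts M" then show "v \<in> verts M" using darts_verts[OF D(1)] by auto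
  next
    fix v assume "v \<in> verts M"
    then obtain d where "reflex_at M v = {d}" using D(9) by (metis card_1_singletonE)
    then have "d \<in> darts M" "snd d = v" unfolding reflex_at_def by auto
    then show "v \<in> snd ` darts M" by blast
  qed
qed

lemma fan_DS: "(p, q) \<in> DS (fan s a hs) \<Longrightarrow> p \<in> insert a (set hs) \<and> q \<in> insert a (set hs)"
proof (induction s a hs rule: fan.induct)
  case (1 s a x y zs) then show ?case by (auto simp: fst_Tri dd_def split: if_splits)
qed auto

lemma verts_fan_ladder:
  assumes "set (a # hs @ [b, c]) = snd ` Ou"
  shows "snd ` DS ({#outf Ou#} + fan_ladder s a (hs @ [b, c]) vs) = snd ` Ou \<union> set vs"
proof -
  have L: "snd ` DS (Lad s a b c vs) = {a, b, c} \<union> set vs"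
  proof (intro equalityI subsetI)
    fix v assume "v \<in> snd ` DS (Lad s a b c vs)"
    then show "v \<in> {a, b, c} \<union> set vs" unfolding Lad_DS by (auto simp: dd_def split: if_splits)
  next
    fix v assume v: "v \<in> {a, b, c} \<union> set vs"
    have "\<exists>p. dd s p v \<in> DS (Lad s a b c vs)" "\<exists>p. dd s v p \<in> DS (Lad s a b c vs)"
      unfolding Lad_DS using v by auto
    then have "\<exists>p. (p, v) \<in> DS (Lad s a b c vs)" by (cases s) (auto simp: dd_def)
    then show "v \<in> snd ` DS (Lad s a b c vs)" by force
  qed
  have "snd ` DS (fan s a (hs @ [b])) \<subseteq> set (a # hs @ [b, c])" using fan_DS[of _ _ s a "hs @ [b]"] by fastforce
  moreover have "DS ({#outf Ou#} + fan_ladder s a (hs @ [b, c]) vs) = Ou \<union> DS (fan s a (hs @ [b])) \<union> DS (Lad s a b c vs)"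
    unfolding fan_ladder_snoc by auto
  moreover have "{a, b, c} \<subseteq> snd ` Ou" using assms by auto
  ultimately show ?thesis using L assms by (auto simp: image_Un)
qed

text \<open>\<open>h\<close> counts the boundary vertices other than the apex and \<open>v\<close>
  the ladder vertices; \<open>72 = 60 + 12\<close>, for the fan and for sorting.\<close>

lemma normal_cost: "S \<le> n \<Longrightarrow> h + v \<le> n \<Longrightarrow> S * (60 * h + 48 * v) + 12 * v * v \<le> 72 * (n::nat)\<^sup>2"
proof -
  assume a: "S \<le> n" "h + v \<le> n"
  have "60 * h + 48 * v \<le> 60 * n" using a(2) by linarith
  then have 1: "S * (60 * h + 48 * v) \<le> n * (60 * n)" by (rule mult_le_mono[OF a(1)])
  have "v \<le> n" using a(2) by linarith
  then have 2: "12 * (v * v) \<le> 12 * (n * n)" by (intro mult_le_mono) simp_all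
  have "n * (60 * n) + 12 * (n * n) = 72 * n\<^sup>2" by (simp add: power2_eq_square)
  moreover have "12 * v * v = 12 * (v * v)" by simp
  ultimately show ?thesis using add_mono[OF 1 2] by metis
qed

lemma frel_mono: "frel m M N \<Longrightarrow> m \<le> n \<Longrightarrow> frel n M N"
  unfolding frel_def by (meson le_trans)

lemma normal_form:
  fixes M :: "'v::linorder cmap"
  assumes M: "is_4ppt M" and d: "distinct (a # hs @ [b, c])" and o: "cyc (a # hs @ [b, c]) = outer M" "set (a # hs @ [b, c]) = snd ` outer M"
    and l: "length (a # hs @ [b, c]) = card (outer M)"
  shows "\<exists>M'. frel (72 * (card (verts M))\<^sup>2) M M' \<and> is_4ppt M' \<and> verts M' = verts M \<and> outer M' = outer M \<and>
    fm M' = {#outf (outer M)#} + fan_ladder False a (hs @ [b, c]) (sorted_list_of_set (verts M - snd ` outer M))"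
proof -
  let ?Ou = "outer M" and ?n = "card (verts M)"
  let ?R = "{#outf ?Ou#}"
  have reg: "reg ?Ou False (a # hs @ [b, c]) ?R" by (rule reg_outer[OF d _ o]) simp
  have rlX: "rl ?Ou (fm M)" unfolding rl_def using M by blast
  define I where "I = fm M - ?R"
  have X: "fm M = ?R + I" unfolding I_def using rl_outf(1)[OF rlX] by simp
  have rl: "rl ?Ou (?R + I)" using rlX X by simp
  have t: "ntri I + 2 = length (a # hs @ [b, c])" using fm_counts(1)[OF M] l unfolding I_def by simp
  obtain vs where T: "rc (size (?R + I) * (60 * length (hs @ [b, c]) + 48 * length vs)) (?R + I) (?R + fan_ladder False a (hs @ [b, c]) vs)"
    "distinct (a # (hs @ [b, c]) @ vs)" using region_to_fan[OF reg rl t] by blast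
  have rl1: "rl ?Ou (?R + fan_ladder False a (hs @ [b, c]) vs)" by (rule rc_rl[OF rl T(1)])
  let ?fan = "fan False a (hs @ [b])"
  have e: "?R + fan_ladder False a (hs @ [b, c]) ws = (?R + ?fan) + Lad False a b c ws" for ws unfolding fan_ladder_snoc by (simp add: ac_simps)
  have d1: "distinct (a # b # c # vs)" using T(2) by auto
  have ok: "lad_ok (?R + ?fan) a b c ([] @ vs)" using lad_fresh[OF rl1[unfolded e] d1] by simp
  have S: "rc (12 * length vs * length vs) (?R + fan_ladder False a (hs @ [b, c]) vs) (?R + fan_ladder False a (hs @ [b, c]) (sort vs))"
    unfolding e using sort_ladder[OF ok, of False] by simp
  obtain M' where M': "frel (size (?R + I) * (60 * length (hs @ [b, c]) + 48 * length vs) + 12 * length vs * length vs) M M'"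
    "fm M' = ?R + fan_ladder False a (hs @ [b, c]) (sort vs)" "is_4ppt M'" "verts M' = verts M" "outer M' = outer M"
    using rc_realize[OF M rc_trans[OF T(1) S, folded X]] unfolding X by blast
  \<comment> \<open>Flips keep the vertex set, so the ladder holds exactly the interior vertices;
    once sorted, it depends only on the vertex set and the outer face.\<close>
  have "verts M = snd ` ?Ou \<union> set vs" using verts_DS[OF M'(3)] verts_fan_ladder[OF o(2)] M'(2,4) by simp
  moreover have "set vs \<inter> snd ` ?Ou = {}" using T(2) unfolding o(2)[symmetric] by auto
  ultimately have vs: "set vs = verts M - snd ` ?Ou" "verts M = set (a # (hs @ [b, c]) @ vs)" using o(2) by auto
  have sl: "sort vs = sorted_list_of_set (verts M - snd ` ?Ou)"
    unfolding vs(1)[symmetric] using d1 by (simp add: sorted_list_of_set_sort_remdups distinct_remdups_id)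
  have n: "?n = 1 + length (hs @ [b, c]) + length vs" unfolding vs(2) distinct_card[OF T(2)] by simp
  have sz: "size (?R + I) \<le> ?n" using fm_counts(2)[OF M] unfolding X by simp
  have "length (hs @ [b, c]) + length vs \<le> ?n" unfolding n by (rule add_mono) simp_all
  from normal_cost[OF sz this]
  have "size (?R + I) * (60 * length (hs @ [b, c]) + 48 * length vs) + 12 * length vs * length vs \<le> 72 * ?n\<^sup>2" .
  then have "frel (72 * ?n\<^sup>2) M M'" by (rule frel_mono[OF M'(1)])
  then show ?thesis using M'(2-5) unfolding sl by (intro exI[of _ M'] conjI)
qed

section \<open>Reversing flips\<close>

lemma del_rot_swap: "a \<noteq> b \<Longrightarrow> del_rot M a b = del_rot M b a"
  unfolding del_rot_def rot_remove_def by (intro ext) auto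

lemma insert_Diff_exchange:
  assumes "E' = insert y (E - {x})" "y \<notin> E" "x \<in> E"
  shows "E = insert x (E' - {y})" "x \<notin> E'"
  using assms by blast+

text \<open>The definition is symmetric except that the triangle lies on the first side of the
  removed edge. After the flip it may be on either side of \<open>cd\<close>, and this decides the
  order of \<open>p\<close> and \<open>q\<close>.\<close>

lemma flip_sym:
  assumes F: "flip M M'" shows "flip M' M"
proof -
  have M: "is_4ppt M" "is_4ppt M'" "verts M' = verts M" "outer M' = outer M"
    using F[unfolded flip_def, THEN conjunct1] flip_preserves[OF F] by simp_all
  obtain a b c d where ab: "(a, b) \<in> darts M" "card (face M (a, b)) = 3" "(a, b) \<notin> outer M" "(b, a) \<notin> outer M"
    and cd: "c \<noteq> d" "{c, d} \<notin> edges M" "edges M' = insert {c, d} (edges M - {{a, b}})"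
    and dr: "del_rot M' c d = del_rot M a b"
    and fa: "{f \<in> faces M'. (c, d) \<notin> f \<and> (d, c) \<notin> f} = {f \<in> faces M. (a, b) \<notin> f \<and> (b, a) \<notin> f}"
    and ca: "{card (face M' (c, d)), card (face M' (d, c))} = {3, card (face M (b, a))}"
    and re: "\<forall>x \<in> darts M - (face M (a, b) \<union> face M (b, a)). reflex M' x = reflex M x"
    using F[unfolded flip_def] by (elim conjE exE) (rule that, assumption+)
  note D = is_4pptD[OF M(1)] and D' = is_4pptD[OF M(2)]
  have nab: "a \<noteq> b" using darts_verts[OF D(1) ab(1)] by simp
  have e: "{a, b} \<in> edges M" using ab(1) by (simp add: mem_darts)
  have ne: "{c, d} \<noteq> {a, b}" using cd(2) e by auto
  have cdd: "(c, d) \<in> darts M'" "(d, c) \<in> darts M'" using cd(3) by (simp_all add: mem_darts insert_commute)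
  have nout: "(c, d) \<notin> outer M" "(d, c) \<notin> outer M"
    using faces_partition(2)[OF D(1,2,5), of "(c, d)"] faces_partition(2)[OF D(1,2,5), of "(d, c)"] cd(2)
    unfolding mem_darts insert_commute[of d c] by blast+
  have re': "\<forall>x \<in> darts M' - (face M' (c, d) \<union> face M' (d, c)). reflex M x = reflex M' x"
  proof
    fix x assume x: "x \<in> darts M' - (face M' (c, d) \<union> face M' (d, c))"
    let ?f = "face M' x"
    have f: "?f \<in> faces M'" "x \<in> ?f" using x self_in_face[of x M'] face_in_faces[of x M'] by auto
    have "(c, d) \<notin> ?f" "(d, c) \<notin> ?f"
      using x f faces_partition(1)[OF D'(1,2) f(1)] by (metis DiffD2 UnCI)+
    then have "?f \<in> {f \<in> faces M'. (c, d) \<notin> f \<and> (d, c) \<notin> f}" using f(1) by simp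
    then have g: "?f \<in> faces M" "(a, b) \<notin> ?f" "(b, a) \<notin> ?f" unfolding fa by simp_all
    have xM: "x \<in> darts M" "?f = face M x" using faces_partition[OF D(1,2) g(1) f(2)] by auto
    have ba: "(b, a) \<in> darts M" by (rule darts_sym[OF ab(1)])
    have "x \<notin> face M (a, b)" "x \<notin> face M (b, a)"
      using face_eq[OF D(1,2) ab(1), of x] face_eq[OF D(1,2) ba, of x] g(2,3) xM(2) self_in_face[of _ M] by metis+
    then show "reflex M x = reflex M' x" using re xM(1) by blast
  qed
  have edM: "edges M = insert {a, b} (edges M' - {{c, d}})" and nab': "{a, b} \<notin> edges M'"
    by (rule insert_Diff_exchange[OF cd(3,2) e])+
  have goal: "flip M' M" if h: "(p, q) = (c, d) \<or> (p, q) = (d, c)" "card (face M' (p, q)) = 3" for p q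
  proof -
    have pq: "(p, q) \<in> darts M'" "(p, q) \<notin> outer M'" "(q, p) \<notin> outer M'" "{p, q} = {c, d}"
      using h(1) cdd nout M(4) by auto
    have "face M' (p, q) \<noteq> outer M'" using pq self_in_face[of "(p, q)" M'] by metis
    moreover have "del_rot M a b = del_rot M' p q" using dr del_rot_swap[of c d M'] cd(1) h(1) by auto
    moreover have "{card (face M (a, b)), card (face M (b, a))} = {3, card (face M' (q, p))}"
      using ca ab(2) h by auto
    moreover have "{f \<in> faces M. (a, b) \<notin> f \<and> (b, a) \<notin> f} = {f \<in> faces M'. (p, q) \<notin> f \<and> (q, p) \<notin> f}"
      using fa h(1) by auto
    moreover have "\<forall>x \<in> darts M' - (face M' (p, q) \<union> face M' (q, p)). reflex M x = reflex M' x"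
      using re' h(1) by auto
    moreover have "edges M = insert {a, b} (edges M' - {{p, q}})" using edM pq(4) by simp
    ultimately show ?thesis unfolding flip_def using M pq(1-3) h(2) nab nab'
      by (intro conjI, simp_all only:) (rule exI[of _ p], rule exI[of _ q], rule exI[of _ a], rule exI[of _ b], simp only: simp_thms)
  qed
  have "card (face M' (c, d)) = 3 \<or> card (face M' (d, c)) = 3" using ca by (metis insertE insertI1 singletonD)
  then show ?thesis using goal[of c d] goal[of d c] by blast
qed

lemma relpow_flip_sym: "(flip ^^ k) M N \<Longrightarrow> (flip ^^ k) N M"
proof (induction k arbitrary: N)
  case (Suc k)
  then obtain Z where "(flip ^^ k) M Z" "flip Z N" by auto
  then show ?case using Suc.IH flip_sym relpowp_Suc_I2 by metis
qed simp

lemma frel_trans: "frel m M N \<Longrightarrow> frel n N K \<Longrightarrow> frel (m + n) M K"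
  unfolding frel_def using relpowp_trans[of _ flip] by (meson add_mono)

lemma frel_sym: "frel n M N \<Longrightarrow> frel n N M"
  unfolding frel_def using relpow_flip_sym by blast

section \<open>Recovering a map from its tagged faces\<close>

lemma face_snd_inj:
  assumes M: "is_4ppt M" and f: "f \<in> faces M" and x: "x \<in> f" "y \<in> f" "snd x = snd y"
  shows "x = y"
proof (cases "f = outer M")
  case True
  then show ?thesis using reflex_unique[OF M _ _ x(3)] is_4pptD(8)[OF M] x by blast
next
  case False
  obtain u v where u: "x = (u, v)" by fastforce
  have "rl (outer M) (fm M)" unfolding rl_def using M by blast
  moreover have "tagged M f \<in># fm M" using in_fm[OF M] f by blast
  moreover have "tagged M f \<noteq> outf (outer M)" using False by (simp add: tagged_def)
  moreover have "dd True u v \<in> fst (tagged M f)" using x u by (simp add: tagged_def dd_def)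
  ultimately have tq: "(\<exists>z. tagged M f = Tri True u v z) \<or> (\<exists>z t w. tagged M f = Qd True u v z t w)" by (rule rl_face)
  have ff: "f = fst (tagged M f)" by (simp add: tagged_def)
  from tq show ?thesis
  proof (elim disjE exE)
    fix z assume t: "tagged M f = Tri True u v z"
    have fe: "f = {(u, v), (v, z), (z, u)}" using ff unfolding t fst_Tri by (simp add: dd_def)
    have dz: "distinct [u, v, z]" using TriD(1)[OF M] in_fm[OF M] f t by metis
    have "y \<in> f" "snd y = v" using x u by simp_all
    then have "y = (u, v)" using dz unfolding fe by (cases y) auto
    then show ?thesis using u by simp
  next
    fix z t w assume q: "tagged M f = Qd True u v z t w"
    have fe: "f = {(u, v), (v, z), (z, t), (t, u)}" using ff unfolding q fst_Qd by (simp add: dd_def)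
    have dz: "distinct [u, v, z, t]" using QdD(1)[OF M] in_fm[OF M] f q by metis
    have "y \<in> f" "snd y = v" using x u by simp_all
    then have "y = (u, v)" using dz unfolding fe by (cases y) auto
    then show ?thesis using u by simp
  qed
qed

text \<open>A face visits a vertex only once, so its set of darts determines the successor of each
  dart, and its tag determines the reflex angles. Off the darts \<open>rot\<close> and
  \<open>reflex\<close> are normalised, which gives equality of the records.\<close>

lemma map_determined:
  fixes M N :: "'v cmap"
  assumes M: "is_4ppt M" and N: "is_4ppt N" and e: "fm M = fm N" "verts M = verts N" "outer M = outer N"
  shows "M = N"
proof -
  note DM = is_4pptD[OF M] and DN = is_4pptD[OF N]
  have dd: "darts M = darts N" using DS_fm[OF M] DS_fm[OF N] e(1) by simp
  have ed: "edges K = {{u, v} |u v. (u, v) \<in> darts K}" if "simple_graph K" for K :: "'v cmap"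
  proof (intro equalityI subsetI)
    fix x assume x: "x \<in> edges K"
    have sg: "\<forall>e\<in>edges K. \<exists>u v. e = {u, v} \<and> u \<noteq> v \<and> u \<in> verts K \<and> v \<in> verts K"
      using that unfolding simple_graph_def by (rule conjunct2)
    obtain u v where "x = {u, v}" using bspec[OF sg x] by blast
    moreover from this have "(u, v) \<in> darts K" using x by (simp add: mem_darts)
    ultimately show "x \<in> {{u, v} |u v. (u, v) \<in> darts K}" by blast
  next
    fix x assume "x \<in> {{u, v} |u v. (u, v) \<in> darts K}" then show "x \<in> edges K" by (auto simp: mem_darts)
  qed
  have edges: "edges M = edges N" using ed[OF DM(1)] ed[OF DN(1)] dd by simp
  have ft: "f \<in> faces N \<and> tagged N f = tagged M f" if "f \<in> faces M" for f
  proof -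
    have "tagged M f \<in># fm N" using in_fm[OF M] that e(1) by metis
    from in_fm_faces[OF N this] show ?thesis by (simp add: tagged_def)
  qed
  have fs: "fstep M d = fstep N d" and rx: "reflex M d \<longleftrightarrow> reflex N d" if d: "d \<in> darts M" for d
  proof -
    let ?f = "face M d"
    have f: "?f \<in> faces M" "d \<in> ?f" using face_in_faces[OF d] self_in_face[of d M] by auto
    have fN: "?f \<in> faces N" "tagged N ?f = tagged M ?f" using ft[OF f(1)] by auto
    have "fstep N d \<in> ?f" by (rule faces_step[OF fN(1) f(2)])
    moreover obtain p where p: "p \<in> darts M" "fstep M p = fstep N d"
    proof -
      have "fstep M ` darts M = darts M"
        by (rule endo_inj_surj[OF darts_finite[OF DM(1)]]) (use fstep_darts[OF DM(2)] fstep_inj[OF DM(2)] in \<open>auto intro: inj_on_subset\<close>)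
      moreover have "fstep N d \<in> darts M" using fstep_darts[OF DN(2)] d dd by simp
      ultimately have "fstep N d \<in> fstep M ` darts M" by simp
      then show ?thesis using that by (elim imageE) simp
    qed
    ultimately have "p \<in> ?f" using faces_step_back[OF DM(1,2) f(1) p(1)] by simp
    moreover have "snd p = snd d" using p(2) by (simp add: fstep_def)
    ultimately have "p = d" using face_snd_inj[OF M f(1) _ f(2)] by blast
    then show "fstep M d = fstep N d" using p(2) by simp
    have r: "reflex K d \<longleftrightarrow> snd d \<in> snd (tagged K ?f)" if K: "is_4ppt K" "?f \<in> faces K" for K
    proof
      assume "reflex K d" then show "snd d \<in> snd (tagged K ?f)" using f(2) by (auto simp: tagged_def)
    next
      assume "snd d \<in> snd (tagged K ?f)"
      then obtain x where x: "x \<in> ?f" "reflex K x" "snd x = snd d" by (auto simp: tagged_def)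
      then have "x = d" using face_snd_inj[OF K x(1) f(2)] by blast
      then show "reflex K d" using x by simp
    qed
    show "reflex M d \<longleftrightarrow> reflex N d" using r[OF M f(1)] r[OF N fN(1)] fN(2) by simp
  qed
  have rot: "rot M = rot N"
  proof (intro ext)
    fix v u
    show "rot M v u = rot N v u"
    proof (cases "(u, v) \<in> darts M")
      case True then show ?thesis using fs[OF True] by simp
    next
      case False
      then have "u \<notin> nbrs M v" "u \<notin> nbrs N v" using dd by (simp_all add: mem_nbrs)
      then show ?thesis using DM(2) DN(2) unfolding rotation_system_def by metis
    qed
  qed
  have refl: "reflex M = reflex N"
  proof (intro ext)
    fix d show "reflex M d = reflex N d" using rx[of d] DM(6)[of d] DN(6)[of d] dd by blast
  qed
  show ?thesis using edges rot refl e(2,3) by (intro cmap.equality) simp_all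
qed

text \<open>Both maps reach the same normal form, read off from one list of the common outer face;
  flips are reversible, so 72 doubles to 144.\<close>

lemma labeled_bound:
  fixes M N :: "'v::linorder cmap"
  assumes M: "is_4ppt M" and N: "is_4ppt N" and e: "verts M = verts N" "outer M = outer N"
  shows "frel (144 * (card (verts M))\<^sup>2) M N"
proof -
  obtain hs0 where h: "distinct hs0" "cyc hs0 = outer M" "length hs0 = card (outer M)" "set hs0 = snd ` outer M"
    using outer_list[OF M] by blast
  have l3: "3 \<le> length hs0" using is_4pptD(11)[OF M] h(3) by simp
  then obtain a hs1 where h1: "hs0 = a # hs1" "2 \<le> length hs1" by (cases hs0) auto
  obtain hs2 c where h2: "hs1 = hs2 @ [c]" "1 \<le> length hs2" using h1(2) by (cases hs1 rule: rev_cases) auto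
  obtain hs b where h3: "hs2 = hs @ [b]" using h2(2) by (cases hs2 rule: rev_cases) auto
  have hs: "hs0 = a # hs @ [b, c]" using h1 h2 h3 by simp
  note h = h[unfolded hs]
  obtain M' where M': "frel (72 * (card (verts M))\<^sup>2) M M'" "is_4ppt M'" "verts M' = verts M" "outer M' = outer M"
    "fm M' = {#outf (outer M)#} + fan_ladder False a (hs @ [b, c]) (sorted_list_of_set (verts M - snd ` outer M))"
    using normal_form[OF M h(1,2,4,3)] by blast
  obtain N' where N': "frel (72 * (card (verts N))\<^sup>2) N N'" "is_4ppt N'" "verts N' = verts N" "outer N' = outer N"
    "fm N' = {#outf (outer N)#} + fan_ladder False a (hs @ [b, c]) (sorted_list_of_set (verts N - snd ` outer N))"
    using normal_form[OF N h(1) h(2)[unfolded e] h(4)[unfolded e] h(3)[unfolded e]] by blast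
  have "M' = N'" by (rule map_determined[OF M'(2) N'(2)]) (use M' N' e in simp_all)
  then have "frel (72 * (card (verts M))\<^sup>2) M' N" using frel_sym[OF N'(1)] e(1) by simp
  from frel_trans[OF M'(1) this] show ?thesis by simp
qed

section \<open>Relabeling\<close>

text \<open>The leftover sets \<open>B - A\<close> and \<open>A - B\<close> have equal size and are
  matched as well. A permutation of the whole type is wanted because relabelling transports total
  functions through its inverse.\<close>

lemma extend_bij:
  fixes f :: "'v \<Rightarrow> 'v"
  assumes A: "finite A" "finite B" and f: "bij_betw f A B"
  shows "\<exists>\<pi>. bij \<pi> \<and> (\<forall>x\<in>A. \<pi> x = f x)"
proof -
  have "card A = card B" using f by (rule bij_betw_same_card)
  then have "card (B - A) = card (A - B)"
    using card_Diff_subset_Int[of B A] card_Diff_subset_Int[of A B] A by (simp add: Int_commute)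
  then obtain g where g: "bij_betw g (B - A) (A - B)" using finite_same_card_bij[of "B - A" "A - B"] A by auto
  define \<pi> where "\<pi> x = (if x \<in> A then f x else if x \<in> B - A then g x else x)" for x
  have 1: "bij_betw \<pi> A B" using f by (subst bij_betw_cong[of A \<pi> f]) (auto simp: \<pi>_def)
  have 2: "bij_betw \<pi> (B - A) (A - B)" using g by (subst bij_betw_cong[of "B - A" \<pi> g]) (auto simp: \<pi>_def)
  have 3: "bij_betw \<pi> (- (A \<union> B)) (- (A \<union> B))" by (subst bij_betw_cong[of _ \<pi> id]) (auto simp: \<pi>_def)
  have "bij_betw \<pi> (A \<union> (B - A) \<union> - (A \<union> B)) (B \<union> (A - B) \<union> - (A \<union> B))"
    by (intro bij_betw_combine 1 2 3) auto
  moreover have "A \<union> (B - A) \<union> - (A \<union> B) = UNIV" "B \<union> (A - B) \<union> - (A \<union> B) = UNIV" by auto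
  ultimately have "bij \<pi>" by simp
  then show ?thesis by (intro exI[of _ \<pi>]) (auto simp: \<pi>_def)
qed

definition relabel :: "('v \<Rightarrow> 'v) \<Rightarrow> 'v cmap \<Rightarrow> 'v cmap" where
  "relabel \<pi> N = \<lparr>verts = \<pi> ` verts N, edges = (\<lambda>e. \<pi> ` e) ` edges N,
     rot = (\<lambda>v u. \<pi> (rot N (inv \<pi> v) (inv \<pi> u))), outer = map_prod \<pi> \<pi> ` outer N,
     reflex = (\<lambda>d. reflex N (map_prod (inv \<pi>) (inv \<pi>) d))\<rparr>"

lemma cyc_map: "hs \<noteq> [] \<Longrightarrow> cyc (map \<pi> hs) = map_prod \<pi> \<pi> ` cyc hs"
proof -
  have "prs (map \<pi> hs) = map_prod \<pi> \<pi> ` prs hs" by (induction hs rule: prs.induct) auto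
  then show "hs \<noteq> [] \<Longrightarrow> ?thesis" unfolding cyc_def by (simp add: last_map hd_map)
qed

lemma Collect_mem_image: "{y \<in> g ` A. Q y} = g ` {x \<in> A. Q (g x)}"
  by (rule set_eqI) (simp add: image_iff, metis)

locale relabeling =
  fixes \<pi> :: "'v \<Rightarrow> 'v" and N :: "'v cmap"
  assumes bij: "bij \<pi>" and N: "is_4ppt N"
begin

abbreviation "N' \<equiv> relabel \<pi> N"
abbreviation "P \<equiv> map_prod \<pi> \<pi>"

lemmas D = is_4pptD[OF N]

lemma inj: "inj \<pi>" using bij by (rule bij_is_inj)
lemma inv_left [simp]: "inv \<pi> (\<pi> x) = x" using inj by simp
lemma inv_right [simp]: "\<pi> (inv \<pi> x) = x" using bij by (simp add: bij_is_surj surj_f_inv_f)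
lemma P_inj: "inj_on P A" using prod.inj_map[OF inj inj] inj_on_subset by blast
lemma sel [simp]: "verts N' = \<pi> ` verts N" "edges N' = (\<lambda>e. \<pi> ` e) ` edges N" "outer N' = P ` outer N"
  "rot N' (\<pi> v) (\<pi> u) = \<pi> (rot N v u)"
  by (simp_all only: relabel_def cmap.simps inv_left)
lemma sel_reflex [simp]: "reflex N' (P d) = reflex N d"
  by (cases d) (simp only: relabel_def cmap.simps map_prod_simp inv_left)

lemma ex: "\<exists>y. x = \<pi> y" using inv_right by metis

lemma darts_N': "(\<pi> u, \<pi> v) \<in> darts N' \<longleftrightarrow> (u, v) \<in> darts N"
proof -
  have "inj ((`) \<pi>)" by (rule injI) (simp only: inj_image_eq_iff[OF inj])
  from inj_image_mem_iff[OF this, of "{u, v}" "edges N"]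
  have "\<pi> ` {u, v} \<in> (\<lambda>e. \<pi> ` e) ` edges N \<longleftrightarrow> {u, v} \<in> edges N" .
  then show ?thesis unfolding mem_darts by simp
qed

lemma darts_P: "P d \<in> darts N' \<longleftrightarrow> d \<in> darts N" by (cases d) (simp add: darts_N')

lemma P_ex: "\<exists>e. d = P e"
proof -
  obtain x y where "d = (x, y)" by fastforce
  moreover obtain u v where "x = \<pi> u" "y = \<pi> v" using ex by blast
  ultimately show ?thesis by (intro exI[of _ "(u, v)"]) simp
qed

lemma darts_eq: "darts N' = P ` darts N"
  using darts_P P_ex by (metis (no_types, lifting) image_iff subsetI subset_antisym)

lemma nbrs_N': "\<pi> u \<in> nbrs N' (\<pi> v) \<longleftrightarrow> u \<in> nbrs N v" unfolding mem_nbrs darts_N' ..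

lemma fstep_N': "fstep N' (P d) = P (fstep N d)" by (cases d) simp

lemma face_N': "face N' (P d) = P ` face N d"
proof -
  have "(fstep N' ^^ k) (P d) = P ((fstep N ^^ k) d)" for k by (induction k) (simp_all add: fstep_N')
  then have "face N' (P d) = {P ((fstep N ^^ k) d) |k. True}" unfolding face_def by simp
  also have "\<dots> = P ` face N d" unfolding face_def by (simp only: simp_thms full_SetCompr_eq image_image)
  finally show ?thesis .
qed

lemma faces_N': "faces N' = (`) P ` faces N"
  unfolding faces_def darts_eq by (simp add: image_image face_N')

lemma card_P [simp]: "card (P ` A) = card A" using card_image[OF P_inj] .

lemma P_eq: "P ` A = P ` B \<longleftrightarrow> A = B" using inj_image_eq_iff[OF P_inj[of UNIV]] .

lemma relabel_4ppt: "is_4ppt N'"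
proof -
  have sg: "simple_graph N'"
    unfolding simple_graph_def
  proof (intro conjI ballI)
    show "finite (verts N')" using D(1) unfolding simple_graph_def by simp
    fix e assume "e \<in> edges N'"
    then obtain e0 where e0: "e0 \<in> edges N" "e = \<pi> ` e0" by auto
    then obtain u v where uv: "e0 = {u, v}" "u \<noteq> v" "u \<in> verts N" "v \<in> verts N" using D(1) unfolding simple_graph_def by blast
    then have "e = {\<pi> u, \<pi> v}" "\<pi> u \<noteq> \<pi> v" "\<pi> u \<in> verts N'" "\<pi> v \<in> verts N'"
      using e0(2) inj by (auto simp: inj_eq)
    then show "\<exists>u v. e = {u, v} \<and> u \<noteq> v \<and> u \<in> verts N' \<and> v \<in> verts N'" by blast
  qed
  have cg: "connected_graph N'"
    unfolding connected_graph_def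
  proof (intro ballI)
    fix u w assume "u \<in> verts N'" "w \<in> verts N'"
    then obtain x y where xy: "u = \<pi> x" "w = \<pi> y" "x \<in> verts N" "y \<in> verts N" by auto
    have "(x, y) \<in> (darts N)\<^sup>*" using D(3) xy unfolding connected_graph_def by blast
    then have "(\<pi> x, \<pi> y) \<in> (darts N')\<^sup>*"
    proof (induction rule: rtrancl_induct)
      case (step y z) then show ?case using darts_N'[of y z] by (meson rtrancl.rtrancl_into_rtrancl)
    qed simp
    then show "(u, w) \<in> (darts N')\<^sup>*" using xy by simp
  qed
  have rs: "rotation_system N'"
    unfolding rotation_system_def
  proof (intro allI conjI ballI impI)
    fix v0 :: 'v
    obtain v where v: "v0 = \<pi> v" using ex by blast
    have nb: "nbrs N' v0 = \<pi> ` nbrs N v"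
    proof (intro equalityI subsetI)
      fix x assume x: "x \<in> nbrs N' v0"
      obtain y where "x = \<pi> y" using ex by blast
      then show "x \<in> \<pi> ` nbrs N v" using x nbrs_N' v by blast
    next
      fix x assume "x \<in> \<pi> ` nbrs N v" then show "x \<in> nbrs N' v0" using nbrs_N' v by blast
    qed
    have R: "u \<in> nbrs N v \<Longrightarrow> rot N v u \<in> nbrs N v" "inj_on (rot N v) (nbrs N v)"
      "u \<in> nbrs N v \<Longrightarrow> w \<in> nbrs N v \<Longrightarrow> \<exists>k. (rot N v ^^ k) u = w" "u \<notin> nbrs N v \<Longrightarrow> rot N v u = u" for u w
      using D(2) unfolding rotation_system_def by blast+
    { fix u assume "u \<in> nbrs N' v0"
      then obtain p where p: "u = \<pi> p" "p \<in> nbrs N v" unfolding nb by auto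
      have "rot N' v0 u = \<pi> (rot N v p)" unfolding p v by simp
      then show "rot N' v0 u \<in> nbrs N' v0" unfolding nb using R(1)[OF p(2)] by blast }
    show "inj_on (rot N' v0) (nbrs N' v0)"
    proof (rule inj_onI)
      fix x y assume x: "x \<in> nbrs N' v0" "y \<in> nbrs N' v0" "rot N' v0 x = rot N' v0 y"
      then obtain p q where "x = \<pi> p" "y = \<pi> q" "p \<in> nbrs N v" "q \<in> nbrs N v" unfolding nb by auto
      then show "x = y" using x(3) R(2) inj unfolding v by (simp add: inj_eq inj_on_eq_iff)
    qed
    { fix u w assume "u \<in> nbrs N' v0" "w \<in> nbrs N' v0"
      then obtain p q where pq: "u = \<pi> p" "w = \<pi> q" "p \<in> nbrs N v" "q \<in> nbrs N v" unfolding nb by auto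
      then obtain k where "(rot N v ^^ k) p = q" using R(3) by blast
      moreover have "(rot N' v0 ^^ k) (\<pi> p) = \<pi> ((rot N v ^^ k) p)" for k unfolding v by (induction k) simp_all
      ultimately show "\<exists>k. (rot N' v0 ^^ k) u = w" using pq by auto }
    { fix u assume u: "u \<notin> nbrs N' v0"
      obtain y where y: "u = \<pi> y" using ex by blast
      then have "y \<notin> nbrs N v" using u nbrs_N' v by blast
      then show "rot N' v0 u = u" using R(4) unfolding y v by simp }
  qed
  have cv: "card (verts N') = card (verts N)" using card_image[OF inj_on_subset[OF inj]] by simp
  have ce: "card (edges N') = card (edges N)"
    using card_image[of "\<lambda>e. \<pi> ` e" "edges N"] inj by (simp add: inj_on_def inj_image_eq_iff)
  have cf: "card (faces N') = card (faces N)"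
    unfolding faces_N' using card_image[of "(`) P" "faces N"] P_eq by (simp add: inj_on_def)
  have of: "outer N' \<in> faces N'" unfolding faces_N' using D(5) by simp
  have rd: "reflex N' d \<Longrightarrow> d \<in> darts N'" for d
  proof -
    assume r: "reflex N' d"
    obtain e where e: "d = P e" using P_ex by blast
    then show "d \<in> darts N'" using r D(6)[of e] darts_P by simp
  qed
  have cc: "convex_count N' (P ` f) = convex_count N f" for f
  proof -
    have "{d \<in> P ` f. \<not> reflex N' d} = P ` {d \<in> f. \<not> reflex N' (P d)}" by (rule Collect_mem_image)
    then have "{d \<in> P ` f. \<not> reflex N' d} = P ` {d \<in> f. \<not> reflex N d}" by (simp only: sel_reflex)
    then show ?thesis unfolding convex_count_def by simp
  qed
  have ra: "card (reflex_at N' (\<pi> v)) = card (reflex_at N v)" for v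
  proof -
    have "reflex_at N' (\<pi> v) = P ` reflex_at N v"
      unfolding reflex_at_def darts_eq Collect_mem_image sel_reflex darts_P[unfolded darts_eq]
      by (simp only: Collect_mem_image sel_reflex snd_map_prod inj_eq[OF inj])
    then show ?thesis by simp
  qed
  have fo: "\<exists>g. g \<in> faces N \<and> f = P ` g \<and> g \<noteq> outer N" if "f \<in> faces N'" "f \<noteq> outer N'" for f
    using that unfolding faces_N' sel(3) by blast
  show ?thesis
    unfolding is_4ppt_def comb_pt_def plane_map_def pointed_def
  proof (intro conjI ballI allI impI sg cg rs of)
    show "int (card (verts N')) - int (card (edges N')) + int (card (faces N')) = 2" unfolding cv ce cf by (rule D(4))
    show "reflex N' d \<Longrightarrow> d \<in> darts N'" for d by (rule rd)
    show "convex_count N' f = 3" if h: "f \<in> faces N'" "f \<noteq> outer N'" for f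
    proof -
      obtain g where g: "g \<in> faces N" "f = P ` g" "g \<noteq> outer N" using fo[OF h] by blast
      show ?thesis unfolding g(2) cc by (rule D(7)[OF g(1,3)])
    qed
    show "reflex N' d" if h: "d \<in> outer N'" for d
    proof -
      obtain e where e: "d = P e" "e \<in> outer N" using h unfolding sel(3) by (elim imageE) simp
      show ?thesis unfolding e(1) sel_reflex by (rule D(8)[OF e(2)])
    qed
    show "card (reflex_at N' v) \<le> 1" "card (reflex_at N' v) = 1" if "v \<in> verts N'" for v using that ra D(9) by auto
    show "card f = 3 \<or> card f = 4" if h: "f \<in> faces N'" "f \<noteq> outer N'" for f
    proof -
      obtain g where g: "g \<in> faces N" "f = P ` g" "g \<noteq> outer N" using fo[OF h] by blast
      show ?thesis unfolding g(2) card_P by (rule D(10)[OF g(1,3)])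
    qed
    show "3 \<le> card (outer N')" using D(11) by simp
  qed
qed

lemma relabel_iso: "cmap_iso N' N"
  unfolding cmap_iso_def
proof (intro exI[of _ "inv \<pi>"] conjI)
  have i: "inv \<pi> ` \<pi> ` A = A" for A by (simp add: image_image)
  show "bij_betw (inv \<pi>) (verts N') (verts N)"
    unfolding bij_betw_def using i by (auto simp: inj_on_def)
  show "edges N = (\<lambda>e. inv \<pi> ` e) ` edges N'" by (simp add: image_image i)
  have PP: "map_prod (inv \<pi>) (inv \<pi>) (P d) = d" for d by (cases d) simp
  show "\<forall>(u, v)\<in>darts N'. rot N (inv \<pi> v) (inv \<pi> u) = inv \<pi> (rot N' v u)"
    unfolding darts_eq by auto
  show "outer N = map_prod (inv \<pi>) (inv \<pi>) ` outer N'" by (simp add: image_image PP)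
  show "\<forall>d\<in>darts N'. reflex N (map_prod (inv \<pi>) (inv \<pi>) d) = reflex N' d"
    unfolding darts_eq using PP by simp
qed

end

lemma cmap_iso_refl: "cmap_iso M M"
  unfolding cmap_iso_def by (intro exI[of _ id]) (auto simp: map_prod.id)

lemma flip_uflip: "flip M N \<Longrightarrow> uflip M N"
  unfolding uflip_def using cmap_iso_refl by blast

text \<open>The outer cycles have equal length and are matched in order. The interior vertices are
  matched arbitrarily, since the labelled bound asks only for equal vertex sets and outer
  faces.\<close>

lemma exists_relabeling:
  fixes M N :: "'v cmap"
  assumes M: "is_4ppt M" and N: "is_4ppt N" and c: "card (verts M) = card (verts N)" "card (outer_verts M) = card (outer_verts N)"
  shows "\<exists>N'. is_4ppt N' \<and> cmap_iso N' N \<and> verts N' = verts M \<and> outer N' = outer M"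
proof -
  obtain hs where h: "distinct hs" "cyc hs = outer M" "length hs = card (outer M)" "set hs = snd ` outer M" using outer_list[OF M] by blast
  obtain ks where k: "distinct ks" "cyc ks = outer N" "length ks = card (outer N)" "set ks = snd ` outer N" using outer_list[OF N] by blast
  have len: "length ks = length hs"
    using c(2) distinct_card[OF h(1)] distinct_card[OF k(1)] h(4) k(4) unfolding outer_verts_def by simp
  have fin: "finite (verts M)" "finite (verts N)" using is_4pptD(1)[OF M] is_4pptD(1)[OF N] unfolding simple_graph_def by blast+
  have sub: "set hs \<subseteq> verts M" "set ks \<subseteq> verts N"
  proof -
    have "snd ` outer K \<subseteq> verts K" if K: "is_4ppt K" for K :: "'v cmap"
      using faces_partition(2)[OF is_4pptD(1,2,5)[OF K]] darts_verts[OF is_4pptD(1)[OF K]] by force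
    then show "set hs \<subseteq> verts M" "set ks \<subseteq> verts N" using M N h(4) k(4) by simp_all
  qed
  define f where "f x = the (map_of (zip ks hs) x)" for x
  have mf: "map f ks = hs" unfolding f_def by (rule nth_equalityI) (use len k(1) in \<open>simp_all add: map_of_zip_nth\<close>)
  have bf: "bij_betw f (set ks) (set hs)"
    unfolding bij_betw_def
  proof
    show "inj_on f (set ks)" using mf h(1) by (metis distinct_map)
    show "f ` set ks = set hs" using mf by (metis set_map)
  qed
  have "card (verts N - set ks) = card (verts M - set hs)"
    using card_Diff_subset[of "set ks" "verts N"] card_Diff_subset[of "set hs" "verts M"] sub c(1) len distinct_card[OF h(1)] distinct_card[OF k(1)] by simp
  then obtain g where g: "bij_betw g (verts N - set ks) (verts M - set hs)"
    using finite_same_card_bij[of "verts N - set ks" "verts M - set hs"] fin by auto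
  define r where "r x = (if x \<in> set ks then f x else g x)" for x
  have "bij_betw r (set ks \<union> (verts N - set ks)) (set hs \<union> (verts M - set hs))"
  proof (rule bij_betw_combine)
    show "bij_betw r (set ks) (set hs)" using bf by (subst bij_betw_cong[of _ r f]) (auto simp: r_def)
    show "bij_betw r (verts N - set ks) (verts M - set hs)" using g by (subst bij_betw_cong[of _ r g]) (auto simp: r_def)
  qed auto
  moreover have "set ks \<union> (verts N - set ks) = verts N" "set hs \<union> (verts M - set hs) = verts M" using sub by auto
  ultimately have rb: "bij_betw r (verts N) (verts M)" by simp
  obtain \<pi> where p: "bij \<pi>" "\<forall>x\<in>verts N. \<pi> x = r x" using extend_bij[OF fin(2,1) rb] by blast
  interpret relabeling \<pi> N by unfold_locales (use p N in auto)
  have "\<pi> ` verts N = verts M"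
    using p(2) rb unfolding bij_betw_def by (metis image_cong)
  moreover have "map \<pi> ks = hs"
  proof -
    have "map \<pi> ks = map f ks" by (rule map_cong) (use p(2) sub(2) in \<open>auto simp: r_def\<close>)
    then show ?thesis using mf by simp
  qed
  moreover have "ks \<noteq> []" using k(3) is_4pptD(11)[OF N] by auto
  ultimately have "verts N' = verts M" "outer N' = outer M"
    using cyc_map[of ks \<pi>] k(2) h(2) by simp_all
  then show ?thesis using relabel_4ppt relabel_iso by blast
qed

lemma frel_seq: "frel n M N \<Longrightarrow> \<exists>k Ms. k \<le> n \<and> Ms 0 = M \<and> Ms k = N \<and> (\<forall>i<k. flip (Ms i) (Ms (Suc i)))"
  unfolding frel_def relpowp_fun_conv by blast

theorem theorem4:
  "\<exists>C::real. \<forall>(n::nat) (h::nat) (M::nat cmap) (N::nat cmap).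
     3 \<le> h \<and> h \<le> n \<and> is_4ppt M \<and> is_4ppt N \<and>
     card (verts M) = n \<and> card (verts N) = n \<and>
     card (outer_verts M) = h \<and> card (outer_verts N) = h \<longrightarrow>
       (\<exists>k Ms. real k \<le> C * real n ^ 2 \<and> Ms 0 = M \<and> cmap_iso (Ms k) N \<and>
           (\<forall>i<k. uflip (Ms i) (Ms (Suc i)))) \<and>
       (verts M = verts N \<and> outer M = outer N \<longrightarrow>
         (\<exists>k Ms. real k \<le> C * real n ^ 2 \<and> Ms 0 = M \<and> Ms k = N \<and>
           (\<forall>i<k. flip (Ms i) (Ms (Suc i)))))"
proof (rule exI[of _ "144::real"], intro allI impI conjI; elim conjE)
  fix n h :: nat and M N :: "nat cmap"
  assume M: "is_4ppt M" and N: "is_4ppt N" and n: "card (verts M) = n"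
  have seq: "\<exists>k Ms. real k \<le> 144 * real n ^ 2 \<and> Ms 0 = M \<and> Ms k = K \<and> (\<forall>i<k. flip (Ms i) (Ms (Suc i)))"
    if K: "is_4ppt K" "verts M = verts K" "outer M = outer K" for K
  proof -
    obtain k Ms where k: "k \<le> 144 * n\<^sup>2" "Ms 0 = M" "Ms k = K" "\<forall>i<k. flip (Ms i) (Ms (Suc i))"
      using frel_seq[OF labeled_bound[OF M K]] unfolding n by blast
    have "real k \<le> real (144 * n\<^sup>2)" using k(1) by (simp only: of_nat_le_iff)
    then have "real k \<le> 144 * real n ^ 2" by simp
    then show ?thesis using k by blast
  qed
  { assume "verts M = verts N" "outer M = outer N"
    then show "\<exists>k Ms. real k \<le> 144 * real n ^ 2 \<and> Ms 0 = M \<and> Ms k = N \<and> (\<forall>i<k. flip (Ms i) (Ms (Suc i)))"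
      by (rule seq[OF N]) }
  \<comment> \<open>A labelled flip sequence to the relabelled copy of \<open>N\<close> is also an
    unlabelled one, and it ends in a map isomorphic to \<open>N\<close>.\<close>
  { assume "card (verts N) = n" "card (outer_verts M) = h" "card (outer_verts N) = h"
    then obtain N' where N': "is_4ppt N'" "cmap_iso N' N" "verts N' = verts M" "outer N' = outer M"
      using exists_relabeling[OF M N] n by auto
    obtain k Ms where k: "real k \<le> 144 * real n ^ 2" "Ms 0 = M" "Ms k = N'" "\<forall>i<k. flip (Ms i) (Ms (Suc i))"
      using seq[OF N'(1) N'(3)[symmetric] N'(4)[symmetric]] by blast
    then show "\<exists>k Ms. real k \<le> 144 * real n ^ 2 \<and> Ms 0 = M \<and> cmap_iso (Ms k) N \<and> (\<forall>i<k. uflip (Ms i) (Ms (Suc i)))"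
      using N'(2) flip_uflip by blast }
qed

end
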